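(* Assume that conditions $\mathcal{C}_2(\boldsymbol{\gamma},\boldsymbol{\rho},\boldsymbol{A})$ and $\mathcal{J}(\boldsymbol{R})$ (stated in the context) hold with $\boldsymbol{\gamma}=\gamma\boldsymbol{1}$ and $\rho_j<0$ for all $j\in\{1,\ldots,m\}$. Suppose that $n_1\leq\cdots\leq n_m$ and that, for any $j$, as $n\to\infty$: $k_j=k_j(n)\to\infty$, $k_j/n_j\to0$, $n_1/n_j\to b_j\in(0,1]$, $k_1/k_j\to c_j\in(0,\infty)$ and $\sqrt{k_j}A_j(n_j/k_j)\to\lambda_j\in\mathbb{R}$. Let $k=\sum_{j=1}^mk_j$ and let $p=p(n)\to0$ be such that $k/(np)\to\infty$ and $\sqrt{k}/\log(k/(np))\to\infty$ as $n\to\infty$. Let $\boldsymbol{\omega}\in\mathbb{R}^m$ and random vectors $\widehat{\boldsymbol{\omega}}_n$ be such that $\widehat{\boldsymbol{\omega}}_n^\top\boldsymbol{1}=1$ and $\widehat{\boldsymbol{\omega}}_n\stackrel{\mathbb{P}}{\longrightarrow}\boldsymbol{\omega}$. Then, for any $j$, $$\frac{\sqrt{k}}{\log(k_j/(n_jp))}\left(\frac{\widehat{q}_j^\star(1-p|k_j,\widehat{\boldsymbol{\omega}}_n)}{q_j(1-p)}-1\right)=\sqrt{k}(\widehat{\gamma}_n(\boldsymbol{\omega})-\gamma)+\operatorname{o}_{\mathbb{P}}(1)\stackrel{d}{\longrightarrow}\mathcal{N}(\boldsymbol{\omega}^\top\boldsymbol{B}_{\boldsymbol{c}},\boldsymbol{\omega}^\top\mathbf{V}_{\boldsymbol{c}}\boldsymbol{\omega}).$$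 If moreover $U_j(t)/U_\ell(t)\to1$ as $t\to\infty$ for any $j\neq\ell$, then, for any $j$, $$\frac{\sqrt{k}}{\log(k/(np))}\left(\frac{\widehat{q}_n^\star(1-p|\widehat{\boldsymbol{\omega}}_n)}{q_j(1-p)}-1\right)=\sqrt{k}(\widehat{\gamma}_n(\boldsymbol{\omega})-\gamma)+\operatorname{o}_{\mathbb{P}}(1)\stackrel{d}{\longrightarrow}\mathcal{N}(\boldsymbol{\omega}^\top\boldsymbol{B}_{\boldsymbol{c}},\boldsymbol{\omega}^\top\mathbf{V}_{\boldsymbol{c}}\boldsymbol{\omega}).$$
   Context: Setting: $m$ is a fixed integer, $\boldsymbol{X}=(X_1,\ldots,X_m)^\top$ is a random vector and $\boldsymbol{X}_i=(X_{i,1},\ldots,X_{i,m})^\top$, $i\geq1$, are independent copies of $\boldsymbol{X}$. The data are the $X_{i,j}$ for $1\leq j\leq m$, $1\leq i\leq n_j=n_j(n)$, with $n=\sum_{j=1}^m n_j$ and $n_j\to\infty$ as $n\to\infty$. Each $X_j$ has a continuous distribution function $F_j$, $\overline{F}_j=1-F_j$, quantile function $q_j$ and tail quantile function $U_j(t)=\inf\{x\in\mathbb{R}:1/\overline{F}_j(x)\geq t\}$, so $q_j(1-p)=U_j(1/p)$. Condition $\mathcal{C}_2(\boldsymbol{\gamma},\boldsymbol{\rho},\boldsymbol{A})$: for every $j$, $\gamma_j>0$, $\rho_j\leq0$, $A_j$ has constant sign and converges to $0$ at infinity, and for all $x>0$, $\lim_{t\to\infty}\frac{1}{A_j(t)}\left[\frac{U_j(tx)}{U_j(t)}-x^{\gamma_j}\right]=x^{\gamma_j}\frac{x^{\rho_j}-1}{\rho_j}$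 (read as $x^{\gamma_j}\log x$ if $\rho_j=0$). Condition $\mathcal{J}(\boldsymbol{R})$: with $\overline{C}_{j,\ell}(u,v)=\mathbb{P}(\overline{F}_j(X_j)\leq u,\overline{F}_\ell(X_\ell)\leq v)$, for any $j\neq\ell$ there is a function $R_{j,\ell}$ on $[0,\infty]^2\setminus\{(\infty,\infty)\}$ such that $\lim_{s\to\infty}s\,\overline{C}_{j,\ell}(x_j/s,x_\ell/s)=R_{j,\ell}(x_j,x_\ell)$ for all $(x_j,x_\ell)$ in this set. Estimators: with $X_{1:n_j,j}\leq\cdots\leq X_{n_j:n_j,j}$ the order statistics of the $j$th sample, $\widehat{\gamma}_j(k_j)=k_j^{-1}\sum_{i=1}^{k_j}\log(X_{n_j-i+1:n_j,j}/X_{n_j-k_j:n_j,j})$, $\widehat{\gamma}_n(\boldsymbol{\omega})=\sum_{j=1}^m\omega_j\widehat{\gamma}_j(k_j)$, $$\widehat{q}_j^\star(1-p|k_j,\boldsymbol{\omega})=\left(\frac{k_j}{n_jp}\right)^{\widehat{\gamma}_n(\boldsymbol{\omega})}X_{n_j-k_j:n_j,j},\qquad \widehat{q}_n^\star(1-p|\boldsymbol{\omega})=\prod_{j=1}^m\left[\left(\frac{k_j}{n_jp}\right)^{\widehat{\gamma}_j(k_j)}X_{n_j-k_j:n_j,j}\right]^{\omega_j}.$$ Asymptotic bias and variance: $\boldsymbol{B}_{\boldsymbol{c}}=\sqrt{\sum_{i=1}^mc_i^{-1}}\left(\sqrt{c_1}\frac{\lambda_1}{1-\rho_1},\ldots,\sqrt{c_m}\frac{\lambda_m}{1-\rho_m}\right)^\top$,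 and $\mathbf{V}_{\boldsymbol{c}}$ is the symmetric matrix with $[\mathbf{V}_{\boldsymbol{c}}]_{j,j}=(\sum_{i=1}^mc_i^{-1})\gamma^2c_j$ and $[\mathbf{V}_{\boldsymbol{c}}]_{j,\ell}=(\sum_{i=1}^mc_i^{-1})\gamma^2c_jR_{j,\ell}(c_\ell/c_j,b_\ell/b_j)$ for $j<\ell$. $\boldsymbol{1}$ is the vector of ones in $\mathbb{R}^m$. *)

theory Defs
  imports "HOL-Probability.Probability"
begin

text \<open>
  Vectors indexed by 1, ..., m are functions on nat of which only the values on \<open>{1..m}\<close> matter.
  Random vectors are measurable maps into the following product space.
\<close>

abbreviation Rvec :: "nat \<Rightarrow> (nat \<Rightarrow> real) measure" where
  "Rvec m \<equiv> Pi\<^sub>M {1..m} (\<lambda>_. borel)"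

definition marginal_cdf :: "'a measure \<Rightarrow> ('a \<Rightarrow> nat \<Rightarrow> real) \<Rightarrow> nat \<Rightarrow> real \<Rightarrow> real" where
  "marginal_cdf M X j = cdf (distr M borel (\<lambda>s. X s j))"

definition survival :: "(real \<Rightarrow> real) \<Rightarrow> real \<Rightarrow> real" where
  "survival F x = 1 - F x"

definition quantile :: "(real \<Rightarrow> real) \<Rightarrow> real \<Rightarrow> real" where
  "quantile F \<tau> = Inf {x. \<tau> \<le> F x}"

text \<open>
  The first disjunct implements the convention \<open>1 / 0 = \<infinity>\<close>, whereas \<open>1 / 0 = 0\<close> on real.
  For \<open>t > 1\<close> and \<open>F\<close> a distribution function, the set is nonempty and bounded below; only
  large \<open>t\<close> are ever relevant.
\<close>

definition tail_quantile :: "(real \<Rightarrow> real) \<Rightarrow> real \<Rightarrow> real" where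
  "tail_quantile F t = Inf {x. survival F x = 0 \<or> t \<le> 1 / survival F x}"

definition cond_C2 ::
  "nat \<Rightarrow> (nat \<Rightarrow> real \<Rightarrow> real) \<Rightarrow> (nat \<Rightarrow> real) \<Rightarrow> (nat \<Rightarrow> real) \<Rightarrow> (nat \<Rightarrow> real \<Rightarrow> real) \<Rightarrow> bool" where
  "cond_C2 m U \<gamma> \<rho> A \<longleftrightarrow>
    (\<forall>j\<in>{1..m}.
      \<gamma> j > 0 \<and> \<rho> j \<le> 0 \<and>
      ((\<forall>\<^sub>F t in at_top. A j t > 0) \<or> (\<forall>\<^sub>F t in at_top. A j t < 0)) \<and>
      (A j \<longlongrightarrow> 0) at_top \<and>
      (\<forall>x>0. ((\<lambda>t. 1 / A j t * (U j (t * x) / U j t - x powr \<gamma> j)) \<longlongrightarrow>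
                x powr \<gamma> j * (if \<rho> j = 0 then ln x else (x powr \<rho> j - 1) / \<rho> j)) at_top))"

text \<open>The arguments range over \<open>[0, \<infinity>]\<close>, which is the type ennreal.\<close>

definition survival_copula ::
  "'a measure \<Rightarrow> ('a \<Rightarrow> nat \<Rightarrow> real) \<Rightarrow> nat \<Rightarrow> nat \<Rightarrow> ennreal \<Rightarrow> ennreal \<Rightarrow> real" where
  "survival_copula M X j l u v =
    measure M {s \<in> space M. ennreal (survival (marginal_cdf M X j) (X s j)) \<le> u \<and>
                            ennreal (survival (marginal_cdf M X l) (X s l)) \<le> v}"

definition cond_J ::
  "nat \<Rightarrow> 'a measure \<Rightarrow> ('a \<Rightarrow> nat \<Rightarrow> real) \<Rightarrow> (nat \<Rightarrow> nat \<Rightarrow> ennreal \<Rightarrow> ennreal \<Rightarrow> real) \<Rightarrow> bool" where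
  "cond_J m M X R \<longleftrightarrow>
    (\<forall>j\<in>{1..m}. \<forall>l\<in>{1..m}. j \<noteq> l \<longrightarrow>
      (\<forall>x y. (x, y) \<noteq> (\<infinity>, \<infinity>) \<longrightarrow>
        ((\<lambda>s. s * survival_copula M X j l (x / ennreal s) (y / ennreal s)) \<longlongrightarrow> R j l x y) at_top))"

text \<open>
  \<open>order_stat f N r\<close> is the \<open>r\<close>-th smallest among \<open>f 1, ..., f N\<close>, for \<open>1 \<le> r \<le> N\<close>.
  Below, \<open>x i j\<close> is the \<open>i\<close>-th observation in the \<open>j\<close>-th sample, \<open>N j\<close> the size of that sample
  and \<open>k j\<close> the number of top order statistics used from it.
\<close>

definition order_stat :: "(nat \<Rightarrow> real) \<Rightarrow> nat \<Rightarrow> nat \<Rightarrow> real" where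
  "order_stat f N r = sort (map f [1..<Suc N]) ! (r - 1)"

definition hill :: "(nat \<Rightarrow> real) \<Rightarrow> nat \<Rightarrow> nat \<Rightarrow> real" where
  "hill f N k = (\<Sum>i=1..k. ln (order_stat f N (N - i + 1) / order_stat f N (N - k))) / real k"

definition pooled_hill ::
  "nat \<Rightarrow> (nat \<Rightarrow> nat \<Rightarrow> real) \<Rightarrow> (nat \<Rightarrow> nat) \<Rightarrow> (nat \<Rightarrow> nat) \<Rightarrow> (nat \<Rightarrow> real) \<Rightarrow> real" where
  "pooled_hill m x N k w = (\<Sum>j=1..m. w j * hill (\<lambda>i. x i j) (N j) (k j))"

definition marginal_quantile_est ::
  "nat \<Rightarrow> (nat \<Rightarrow> nat \<Rightarrow> real) \<Rightarrow> (nat \<Rightarrow> nat) \<Rightarrow> (nat \<Rightarrow> nat) \<Rightarrow> real \<Rightarrow> (nat \<Rightarrow> real) \<Rightarrow> nat \<Rightarrow> real" where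
  "marginal_quantile_est m x N k p w j =
    (real (k j) / (real (N j) * p)) powr pooled_hill m x N k w
      * order_stat (\<lambda>i. x i j) (N j) (N j - k j)"

definition pooled_quantile_est ::
  "nat \<Rightarrow> (nat \<Rightarrow> nat \<Rightarrow> real) \<Rightarrow> (nat \<Rightarrow> nat) \<Rightarrow> (nat \<Rightarrow> nat) \<Rightarrow> real \<Rightarrow> (nat \<Rightarrow> real) \<Rightarrow> real" where
  "pooled_quantile_est m x N k p w =
    (\<Prod>j=1..m. ((real (k j) / (real (N j) * p)) powr hill (\<lambda>i. x i j) (N j) (k j)
                 * order_stat (\<lambda>i. x i j) (N j) (N j - k j)) powr w j)"

definition bias_vec ::
  "nat \<Rightarrow> (nat \<Rightarrow> real) \<Rightarrow> (nat \<Rightarrow> real) \<Rightarrow> (nat \<Rightarrow> real) \<Rightarrow> nat \<Rightarrow> real" where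
  "bias_vec m c lam \<rho> j = sqrt (\<Sum>i=1..m. inverse (c i)) * (sqrt (c j) * (lam j / (1 - \<rho> j)))"

text \<open>Entries below the diagonal are defined by symmetry from those above it.\<close>

definition var_mat ::
  "nat \<Rightarrow> real \<Rightarrow> (nat \<Rightarrow> real) \<Rightarrow> (nat \<Rightarrow> real) \<Rightarrow> (nat \<Rightarrow> nat \<Rightarrow> ennreal \<Rightarrow> ennreal \<Rightarrow> real)
    \<Rightarrow> nat \<Rightarrow> nat \<Rightarrow> real" where
  "var_mat m \<gamma> b c R j l =
    (let S = \<Sum>i=1..m. inverse (c i);
         V = (\<lambda>j l. S * \<gamma>\<^sup>2 * c j * R j l (ennreal (c l / c j)) (ennreal (b l / b j)))
     in if j = l then S * \<gamma>\<^sup>2 * c j else if j < l then V j l else V l j)"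

definition inner_vec :: "nat \<Rightarrow> (nat \<Rightarrow> real) \<Rightarrow> (nat \<Rightarrow> real) \<Rightarrow> real" where
  "inner_vec m v w = (\<Sum>j=1..m. v j * w j)"

definition quad_form :: "nat \<Rightarrow> (nat \<Rightarrow> nat \<Rightarrow> real) \<Rightarrow> (nat \<Rightarrow> real) \<Rightarrow> real" where
  "quad_form m V w = (\<Sum>j=1..m. \<Sum>l=1..m. w j * V j l * w l)"

text \<open>\<open>\<mu>\<close> is the mean and \<open>v\<close> the variance; variance 0 gives the Dirac measure at \<open>\<mu>\<close>.\<close>

definition normal_law :: "real \<Rightarrow> real \<Rightarrow> real measure" where
  "normal_law \<mu> v =
    (if v = 0 then return borel \<mu> else density lborel (\<lambda>x. ennreal (normal_density \<mu> (sqrt v) x)))"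

definition small_op :: "'a measure \<Rightarrow> (nat \<Rightarrow> 'a \<Rightarrow> real) \<Rightarrow> bool" where
  "small_op M Y \<longleftrightarrow>
    (\<forall>\<epsilon>>0. (\<lambda>n. measure M {s \<in> space M. \<bar>Y n s\<bar> > \<epsilon>}) \<longlonglongrightarrow> 0)"

definition conv_in_dist :: "'a measure \<Rightarrow> (nat \<Rightarrow> 'a \<Rightarrow> real) \<Rightarrow> real measure \<Rightarrow> bool" where
  "conv_in_dist M Y L \<longleftrightarrow> weak_conv_m (\<lambda>n. distr M borel (Y n)) L"

end

theory Submission
  imports Defs
begin

text \<open>
  With \<open>\<rho>\<^sub>j < 0\<close> the second-order condition gives \<open>ln (U\<^sub>j t) = l + \<gamma> ln t + D t\<close>
  with \<open>D\<close> of the order of the regularly varying \<open>A\<^sub>j\<close>, so that the uniform convergence theorem controls \<open>D\<close> near the intermediate level \<open>n\<^sub>j / k\<^sub>j\<close> as well as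
  in the far tail. In terms of the uniform variables \<open>1 - F\<^sub>j X\<close>, the Hill estimator becomes a mean
  logarithmic excess over a random threshold plus a bias of order \<open>A\<^sub>j (n\<^sub>j / k\<^sub>j)\<close>. Moving to the deterministic
  threshold \<open>k\<^sub>j / n\<^sub>j\<close> costs, up to a negligible term, the centred number of exceedances; what remains
  is a triangular array of independent centred scores, to which Lyapunov's theorem applies. Their
  covariances converge by a layer-cake formula and the homogeneity of the tail copula limits.
  The logarithmic error of an extrapolated quantile is the error of the pooled tail index times the logarithm
  of the extrapolation factor, which tends to infinity, plus threshold and bias errors without this factor.
\<close>

section \<open>Second-order regular variation\<close>

text \<open>Since \<open>\<rho> j < 0\<close>, the increments of
  \<open>ln (U t) - \<gamma> * ln t\<close> over unit steps of \<open>ln t\<close> are dominated by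
  a geometric series; hence a limit \<open>l\<close> exists and the bias is a deviation from an
  exact power law. Its bounds hold on a whole half-line of levels. This is essential, because
  \<open>p\<close> may lie arbitrarily far below \<open>k / N\<close>, where local uniformity says
  nothing. The threshold is random and shared by all exceedances, which destroys independence. No
  process convergence is used: counts are monotone in the level, so control at finitely many levels
  locates the threshold. Its normalised logarithm is minus the centred count up to a negligible
  error, which is why the score is a log-excess minus an indicator; this score is already centred.
  The samples have unequal lengths but share the vectors \<open>Xs i\<close>. Sums are regrouped by
  \<open>i\<close>, and the overlap \<open>min (N n j) (N n l)\<close> enters the covariances; the
  ordering of the sample sizes turns it into the asymmetric entries of \<open>var_mat\<close>. The
  estimated weights add up to 1, so \<open>\<gamma>\<close> drops out of their error, and so does
  the common scale constant in the pooled quantile.\<close>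

lemma emeasure_lborel_translate:
  fixes S :: "real set"
  assumes [measurable]: "S \<in> sets borel"
  shows "emeasure lborel {s. s - u \<in> S} = emeasure lborel S"
proof -
  have "emeasure lborel S = emeasure (distr lborel borel ((+) (- u))) S"
    by (simp add: lborel_distr_plus)
  also have "\<dots> = emeasure lborel ((+) (- u) -` S \<inter> space lborel)"
    by (rule emeasure_distr) auto
  also have "(+) (- u) -` S \<inter> space lborel = {s. s - u \<in> S}"
    by auto
  finally show ?thesis by simp
qed

text \<open>Egorov-type statement by continuity from below: the sets increase to an interval of
  length 2. The bound 3/2 is chosen so that two such sets, one of them translated by at most 1,
  cannot be disjoint inside an interval of length 3.\<close>

lemma measure_eventually_small:
  fixes g :: "nat \<Rightarrow> real \<Rightarrow> real"
  assumes meas: "\<And>n. g n \<in> borel_measurable borel"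
    and lim: "\<And>v. (\<lambda>n. g n v) \<longlonglongrightarrow> 0" and "\<delta> > 0"
  shows "\<forall>\<^sub>F n in sequentially.
    emeasure lborel {v\<in>{0..2}. \<forall>m\<ge>n. \<bar>g m v\<bar> < \<delta>} > ennreal (3/2)"
proof -
  note meas[measurable]
  define V where "V n = {v\<in>{0..2}. \<forall>m\<ge>n. \<bar>g m v\<bar> < \<delta>}" for n
  have V: "V n \<in> sets lborel" for n
    unfolding V_def by measurable
  have "incseq V"
    unfolding incseq_def V_def by auto
  have "(\<Union>n. V n) = {0..2}"
  proof (intro set_eqI iffI)
    fix v :: real assume v: "v \<in> {0..2}"
    have "\<forall>\<^sub>F m in sequentially. \<bar>g m v\<bar> < \<delta>"
      using tendstoD[OF lim[of v] \<open>\<delta> > 0\<close>] by (simp add: dist_real_def)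
    then show "v \<in> (\<Union>n. V n)"
      using v unfolding V_def eventually_sequentially by auto
  qed (auto simp: V_def)
  moreover have "(\<lambda>n. emeasure lborel (V n)) \<longlonglongrightarrow> emeasure lborel (\<Union>n. V n)"
    using V \<open>incseq V\<close> by (intro Lim_emeasure_incseq) auto
  ultimately have "(\<lambda>n. emeasure lborel (V n)) \<longlonglongrightarrow> ennreal 2"
    by simp
  then show ?thesis
    unfolding V_def[symmetric] by (rule order_tendstoD) (simp add: ennreal_less_iff)
qed

text \<open>Uniform convergence theorem for slowly varying functions in additive form
  (\<open>f\<close> is the logarithm of such a function at \<open>exp x\<close>), by the
  measure-theoretic argument. If uniformity fails along \<open>x n\<close> and \<open>u n\<close>,
  both \<open>x n\<close> and \<open>x n + u n\<close> tend to infinity, so pointwise convergence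
  holds from either base point, off small sets.\<close>

lemma uniform_convergence_theorem:
  fixes f :: "real \<Rightarrow> real"
  assumes meas: "f \<in> borel_measurable borel"
    and lim: "\<And>u. ((\<lambda>x. f (x + u) - f x) \<longlongrightarrow> 0) at_top" and "\<epsilon> > 0"
  shows "\<forall>\<^sub>F x in at_top. \<forall>u\<in>{0..1}. \<bar>f (x + u) - f x\<bar> < \<epsilon>"
proof (rule ccontr)
  note meas[measurable]
  assume "\<not> ?thesis"
  then have "\<forall>n::nat. \<exists>x\<ge>real n. \<exists>u\<in>{0..1}. \<bar>f (x + u) - f x\<bar> \<ge> \<epsilon>"
    unfolding eventually_at_top_linorder by (meson linorder_not_less)
  then obtain x u where xu: "\<And>n. x n \<ge> real n" "\<And>n. u n \<in> {0..1}"
      "\<And>n. \<bar>f (x n + u n) - f (x n)\<bar> \<ge> \<epsilon>"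
    by metis
  have x: "filterlim x at_top sequentially"
    by (rule filterlim_at_top_mono[OF filterlim_real_sequentially]) (simp add: xu)
  have xu_top: "filterlim (\<lambda>n. x n + u n) at_top sequentially"
    by (rule filterlim_at_top_mono[OF x]) (use xu(2) in auto)
  define g1 where "g1 n v = f (x n + v) - f (x n)" for n v
  define g2 where "g2 n v = f (x n + u n + v) - f (x n + u n)" for n v
  have "(\<lambda>n. g1 n v) \<longlonglongrightarrow> 0" "(\<lambda>n. g2 n v) \<longlonglongrightarrow> 0" for v
    unfolding g1_def g2_def
    using filterlim_compose[OF lim[of v] x] filterlim_compose[OF lim[of v] xu_top] by simp_all
  moreover have gm [measurable]: "g1 n \<in> borel_measurable borel" "g2 n \<in> borel_measurable borel" for n
    unfolding g1_def g2_def by measurable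
  ultimately have "\<forall>\<^sub>F n in sequentially.
      emeasure lborel {v\<in>{0..2}. \<forall>m\<ge>n. \<bar>g1 m v\<bar> < \<epsilon>/2} > ennreal (3/2) \<and>
      emeasure lborel {v\<in>{0..2}. \<forall>m\<ge>n. \<bar>g2 m v\<bar> < \<epsilon>/2} > ennreal (3/2)"
    using \<open>\<epsilon> > 0\<close> by (intro eventually_conj measure_eventually_small) auto
  then obtain n where n: "emeasure lborel {v\<in>{0..2}. \<forall>m\<ge>n. \<bar>g1 m v\<bar> < \<epsilon>/2} > ennreal (3/2)"
      "emeasure lborel {v\<in>{0..2}. \<forall>m\<ge>n. \<bar>g2 m v\<bar> < \<epsilon>/2} > ennreal (3/2)"
    by (auto simp: eventually_sequentially)
  define V where "V = {v\<in>{0..2}. \<forall>m\<ge>n. \<bar>g1 m v\<bar> < \<epsilon>/2}"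
  define W where "W = {v\<in>{0..2}. \<forall>m\<ge>n. \<bar>g2 m v\<bar> < \<epsilon>/2}"
  define W' where "W' = {s. s - u n \<in> W}"
  have [measurable]: "V \<in> sets borel" "W \<in> sets borel"
    unfolding V_def W_def by measurable
  have [measurable]: "W' \<in> sets borel"
    unfolding W'_def by measurable
  \<comment> \<open>A common point \<open>v\<close> would place \<open>f (x n + v)\<close> within
    \<open>\<epsilon>/2\<close> of both \<open>f (x n)\<close> and \<open>f (x n + u n)\<close>,
    against the choice of \<open>x n\<close> and \<open>u n\<close>. Disjointness in turn
    contradicts a total measure above 3.\<close>
  have "V \<inter> W' = {}"
  proof (rule ccontr)
    assume "V \<inter> W' \<noteq> {}"
    then obtain v where v: "v \<in> V" "v - u n \<in> W" by (auto simp: W'_def)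
    then have "\<bar>g1 n v\<bar> < \<epsilon>/2" "\<bar>g2 n (v - u n)\<bar> < \<epsilon>/2"
      by (auto simp: V_def W_def)
    then show False
      using xu(3)[of n] by (auto simp: g1_def g2_def algebra_simps abs_if split: if_splits)
  qed
  then have "emeasure lborel V + emeasure lborel W' = emeasure lborel (V \<union> W')"
    by (intro plus_emeasure) auto
  also have "\<dots> \<le> emeasure lborel {0..3::real}"
    by (intro emeasure_mono) (use xu(2)[of n] in \<open>auto simp: V_def W'_def W_def\<close>)
  also have "\<dots> = ennreal (3/2) + ennreal (3/2)"
    by (simp flip: ennreal_plus)
  finally have "emeasure lborel V + emeasure lborel W \<le> ennreal (3/2) + ennreal (3/2)"
    unfolding W'_def by (subst (asm) emeasure_lborel_translate) auto
  moreover have "ennreal (3/2) + ennreal (3/2) < emeasure lborel V + emeasure lborel W"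
    using n unfolding V_def W_def by (intro add_strict_mono) 
  ultimately show False by simp
qed

text \<open>Chaining the local bound over unit steps costs at most \<open>\<epsilon>\<close> per
  step. The linear growth in \<open>u\<close> is the additive form of a Potter bound, harmless once
  a negative index is present.\<close>

lemma uniform_convergence_theorem_global:
  fixes f :: "real \<Rightarrow> real"
  assumes meas: "f \<in> borel_measurable borel"
    and lim: "\<And>u. ((\<lambda>x. f (x + u) - f x) \<longlongrightarrow> 0) at_top" and "\<epsilon> > 0"
  shows "\<forall>\<^sub>F x in at_top. \<forall>u\<ge>0. \<bar>f (x + u) - f x\<bar> \<le> \<epsilon> * (u + 1)"
proof -
  obtain x0 where x0: "\<And>x u. x \<ge> x0 \<Longrightarrow> u \<in> {0..1} \<Longrightarrow> \<bar>f (x + u) - f x\<bar> < \<epsilon>"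
    using uniform_convergence_theorem[OF assms] unfolding eventually_at_top_linorder by blast
  have step: "\<bar>f (x + real n) - f x\<bar> \<le> \<epsilon> * real n" if "x \<ge> x0" for n x
  proof (induction n)
    case (Suc n)
    have "\<bar>f (x + real n + 1) - f (x + real n)\<bar> < \<epsilon>"
      using that by (intro x0) auto
    then show ?case using Suc by (auto simp: algebra_simps abs_if split: if_splits)
  qed simp
  have "\<bar>f (x + u) - f x\<bar> \<le> \<epsilon> * (u + 1)" if "x \<ge> x0" "u \<ge> 0" for x u
  proof -
    define n where "n = nat \<lfloor>u\<rfloor>"
    have n: "real n \<le> u" "u - real n \<in> {0..1}"
      using that by (auto simp: n_def) linarith+
    have "\<bar>f (x + real n + (u - real n)) - f (x + real n)\<bar> < \<epsilon>"
      using that n by (intro x0) auto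
    then have "\<bar>f (x + u) - f x\<bar> \<le> \<epsilon> + \<epsilon> * real n"
      using step[OF that(1), of n] by (auto simp: algebra_simps)
    also have "\<dots> \<le> \<epsilon> * (u + 1)"
      using n \<open>\<epsilon> > 0\<close> by (simp add: algebra_simps)
    finally show ?thesis .
  qed
  then show ?thesis
    unfolding eventually_at_top_linorder by blast
qed

lemma exp_minus_one_bound:
  fixes z \<epsilon> :: real
  assumes "\<bar>z\<bar> \<le> \<epsilon>"
  shows "\<bar>exp z - 1\<bar> \<le> \<epsilon> * exp \<epsilon>"
proof -
  have "\<bar>exp z - 1\<bar> \<le> \<bar>z\<bar> * exp \<bar>z\<bar>"
  proof (cases "z \<ge> 0")
    case True
    have "1 - z \<le> exp (- z)" using exp_ge_add_one_self[of "-z"] by simp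
    then have "exp z * (1 - z) \<le> exp z * exp (- z)" by (intro mult_left_mono) auto
    then show ?thesis using True by (simp add: algebra_simps flip: exp_add)
  next
    case False
    have "1 + z \<le> exp z" by simp
    moreover have "exp z \<le> 1" using False by simp
    moreover have "- z * 1 \<le> - z * exp (- z)" using False by (intro mult_left_mono) auto
    ultimately have "1 - exp z \<le> - z * exp (- z)" by linarith
    moreover have "\<bar>exp z - 1\<bar> = 1 - exp z" "\<bar>z\<bar> = - z" using False by auto
    ultimately show ?thesis by (simp only:)
  qed
  also have "\<dots> \<le> \<epsilon> * exp \<epsilon>"
    using assms by (intro mult_mono) auto
  finally show ?thesis .
qed

section \<open>Regular variation with a negative index, uniformly on a half-line\<close>

lemma filterlim_plus_const_at_top: "filterlim (\<lambda>x::real. x + u) at_top at_top"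
  by (rule filterlim_at_top_mono[of "\<lambda>x. u + x"])
     (auto intro!: filterlim_tendsto_add_at_top tendsto_const filterlim_ident)

text \<open>After removal of \<open>exp (\<rho> * x)\<close> the logarithm of \<open>D\<close> is
  slowly varying in the additive sense, so \<open>D (x + u) / D x\<close> is
  \<open>exp (\<rho> * u) * exp z\<close> with
  \<open>\<bar>z\<bar> \<le> \<epsilon> * (u + 1)\<close>. This error grows with \<open>u\<close>,
  but the decay of \<open>exp (\<rho> * u)\<close> absorbs it; hence uniformity up to infinity,
  which an index 0 would not give.\<close>

lemma regularly_varying_uniform:
  fixes D :: "real \<Rightarrow> real" and \<rho> :: real
  assumes meas: "D \<in> borel_measurable borel" and "\<rho> < 0"
    and sgn: "(\<forall>\<^sub>F x in at_top. D x > 0) \<or> (\<forall>\<^sub>F x in at_top. D x < 0)"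
    and lim: "\<And>u. ((\<lambda>x. D (x + u) / D x) \<longlongrightarrow> exp (\<rho> * u)) at_top" and "\<eta> > 0"
  shows "\<forall>\<^sub>F x in at_top. \<forall>u\<ge>0. \<bar>D (x + u) - exp (\<rho> * u) * D x\<bar> \<le> \<eta> * \<bar>D x\<bar>"
proof -
  define f where "f x = ln \<bar>D x\<bar> - \<rho> * x" for x
  have nz: "\<forall>\<^sub>F x in at_top. D x \<noteq> 0"
    using sgn by (elim disjE) (auto elim: eventually_mono)
  have nz': "\<forall>\<^sub>F x in at_top. D (x + u) \<noteq> 0" for u
    by (rule eventually_compose_filterlim[OF nz filterlim_plus_const_at_top])
  have flim: "((\<lambda>x. f (x + u) - f x) \<longlongrightarrow> 0) at_top" for u
  proof -
    have "((\<lambda>x. ln \<bar>D (x + u) / D x\<bar> - \<rho> * u) \<longlongrightarrow> ln \<bar>exp (\<rho> * u)\<bar> - \<rho> * u) at_top"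
      by (intro tendsto_intros lim) auto
    then have "((\<lambda>x. ln \<bar>D (x + u) / D x\<bar> - \<rho> * u) \<longlongrightarrow> 0) at_top" by simp
    moreover have "\<forall>\<^sub>F x in at_top. ln \<bar>D (x + u) / D x\<bar> - \<rho> * u = f (x + u) - f x"
      using nz nz'[of u]
      by eventually_elim (simp add: f_def abs_divide ln_div algebra_simps)
    ultimately show ?thesis by (rule Lim_transform_eventually)
  qed
  have fmeas: "f \<in> borel_measurable borel"
    unfolding f_def using meas by measurable
  \<comment> \<open>The bound \<open>\<bar>\<rho>\<bar>/2\<close> leaves half of the decay rate
    after absorbing \<open>\<epsilon> * u\<close>; 1 caps the constant factor at
    \<open>exp 1\<close>; the last term divides \<open>\<eta>\<close> by a bound for
    \<open>(u + 1) * exp (1 + \<rho> / 2 * u)\<close>.\<close>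
  define \<epsilon> where "\<epsilon> = min (min 1 (\<bar>\<rho>\<bar>/2)) (\<eta> / (exp 1 * (1 + 2 / \<bar>\<rho>\<bar>)))"
  have K: "exp 1 * (1 + 2 / \<bar>\<rho>\<bar>) > 0" by (simp add: add_pos_nonneg)
  have \<epsilon>: "\<epsilon> > 0" "\<epsilon> \<le> 1" "\<epsilon> \<le> \<bar>\<rho>\<bar>/2" "\<epsilon> * (exp 1 * (1 + 2 / \<bar>\<rho>\<bar>)) \<le> \<eta>"
    using \<open>\<rho> < 0\<close> \<open>\<eta> > 0\<close> K unfolding \<epsilon>_def by (auto simp: min_le_iff_disj pos_le_divide_eq[symmetric])
  have sgn': "\<forall>\<^sub>F x in at_top. \<forall>u\<ge>0. D (x + u) * D x > 0"
    using sgn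
  proof
    assume "\<forall>\<^sub>F x in at_top. D x > 0"
    then obtain x0 where "\<And>x. x \<ge> x0 \<Longrightarrow> D x > 0" unfolding eventually_at_top_linorder by blast
    then show ?thesis unfolding eventually_at_top_linorder by (intro exI[of _ x0]) auto
  next
    assume "\<forall>\<^sub>F x in at_top. D x < 0"
    then obtain x0 where "\<And>x. x \<ge> x0 \<Longrightarrow> D x < 0" unfolding eventually_at_top_linorder by blast
    then show ?thesis unfolding eventually_at_top_linorder
      by (intro exI[of _ x0]) (auto simp: mult_neg_neg)
  qed
  show ?thesis
    using uniform_convergence_theorem_global[OF fmeas flim \<open>\<epsilon> > 0\<close>] sgn'
  proof eventually_elim
    case (elim x)
    show ?case
    proof (intro allI impI)
      fix u :: real assume u: "u \<ge> 0"
      have pos: "D (x + u) * D x > 0" and fb: "\<bar>f (x + u) - f x\<bar> \<le> \<epsilon> * (u + 1)"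
        using elim u by auto
      define z where "z = f (x + u) - f x"
      have nz: "D x \<noteq> 0" "D (x + u) \<noteq> 0" using pos by auto
      have q: "D (x + u) / D x = exp (\<rho> * u) * exp z"
      proof -
        have p: "D (x + u) / D x > 0" using pos nz
          by (metis divide_less_0_iff linorder_neqE_linordered_idom mult_less_0_iff less_asym divide_eq_0_iff)
        have "z + \<rho> * u = ln \<bar>D (x + u) / D x\<bar>"
          using nz by (simp add: z_def f_def abs_divide ln_div algebra_simps)
        also have "\<bar>D (x + u) / D x\<bar> = D (x + u) / D x" using p by (rule abs_of_pos)
        finally have "z + \<rho> * u = ln (D (x + u) / D x)" .
        then have "exp (z + \<rho> * u) = D (x + u) / D x" using p by simp
        then show ?thesis by (simp add: exp_add mult.commute)
      qed
      have "\<bar>exp (\<rho> * u) * (exp z - 1)\<bar> = exp (\<rho> * u) * \<bar>exp z - 1\<bar>"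
        by (simp add: abs_mult)
      also have "\<dots> \<le> exp (\<rho> * u) * (\<epsilon> * (u + 1) * exp (\<epsilon> * (u + 1)))"
        using exp_minus_one_bound[of z "\<epsilon> * (u+1)"] fb by (intro mult_left_mono) (auto simp: z_def)
      also have "\<dots> = \<epsilon> * ((u + 1) * exp (\<rho> * u + \<epsilon> * (u + 1)))"
        by (simp add: exp_add algebra_simps)
      also have "\<dots> \<le> \<epsilon> * ((u + 1) * exp (1 + \<rho> / 2 * u))"
      proof -
        have "\<epsilon> * u \<le> \<bar>\<rho>\<bar>/2 * u" using \<epsilon> u by (intro mult_right_mono) auto
        then have "\<rho> * u + \<epsilon> * (u + 1) \<le> 1 + \<rho> / 2 * u"
          using \<epsilon> \<open>\<rho> < 0\<close> by (auto simp: algebra_simps)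
        then show ?thesis using \<epsilon> u by (intro mult_left_mono) auto
      qed
      also have "\<dots> \<le> \<epsilon> * (exp 1 * (1 + 2 / \<bar>\<rho>\<bar>))"
      proof -
        have "u + 1 \<le> (1 + 2 / \<bar>\<rho>\<bar>) * exp (\<bar>\<rho>\<bar> / 2 * u)"
        proof -
          define E where "E = exp (\<bar>\<rho>\<bar> / 2 * u)"
          have "1 + \<bar>\<rho>\<bar> / 2 * u \<le> E" unfolding E_def by (rule exp_ge_add_one_self)
          then have "2 / \<bar>\<rho>\<bar> * (1 + \<bar>\<rho>\<bar> / 2 * u) \<le> 2 / \<bar>\<rho>\<bar> * E"
            by (intro mult_left_mono) auto
          moreover have "2 / \<bar>\<rho>\<bar> * (1 + \<bar>\<rho>\<bar> / 2 * u) = 2 / \<bar>\<rho>\<bar> + u"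
            using \<open>\<rho> < 0\<close> by (simp add: field_simps)
          moreover have "2 / \<bar>\<rho>\<bar> \<ge> 0" by simp
          moreover have "E \<ge> 1" using u by (simp add: E_def)
          ultimately show ?thesis unfolding E_def[symmetric] distrib_right mult_1 by linarith
        qed
        then have "(u + 1) * exp (1 + \<rho> / 2 * u) \<le>
            (1 + 2 / \<bar>\<rho>\<bar>) * exp (\<bar>\<rho>\<bar> / 2 * u) * exp (1 + \<rho> / 2 * u)"
          by (intro mult_right_mono) auto
        also have "\<dots> = exp 1 * (1 + 2 / \<bar>\<rho>\<bar>)"
          using \<open>\<rho> < 0\<close> by (simp add: mult.assoc flip: exp_add) 
        finally show ?thesis using \<epsilon> by (intro mult_left_mono) auto
      qed
      also have "\<dots> \<le> \<eta>" by fact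
      finally have "\<bar>exp (\<rho> * u) * (exp z - 1)\<bar> * \<bar>D x\<bar> \<le> \<eta> * \<bar>D x\<bar>"
        by (intro mult_right_mono) auto
      moreover have "D (x + u) - exp (\<rho> * u) * D x = exp (\<rho> * u) * (exp z - 1) * D x"
        using q nz by (simp add: field_simps)
      ultimately show "\<bar>D (x + u) - exp (\<rho> * u) * D x\<bar> \<le> \<eta> * \<bar>D x\<bar>"
        by (simp add: abs_mult)
    qed
  qed
qed

text \<open>The increment from \<open>x + u\<close> to \<open>x + u + 1\<close> is measured once on
  the scale \<open>a x\<close> and once on the scale \<open>a (x + u)\<close>; the quotient of the
  two limits isolates the ratio of the scales. Division by \<open>h\<close> is possible because the
  limit over a unit step is nonzero.\<close>

lemma second_order_rate_regularly_varying:
  fixes G a :: "real \<Rightarrow> real"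
  assumes "\<rho> < 0" and nz: "\<forall>\<^sub>F x in at_top. a x \<noteq> 0"
    and lim: "\<And>u. ((\<lambda>x. (G (x + u) - G x) / a x) \<longlongrightarrow> (exp (\<rho> * u) - 1) / \<rho>) at_top"
  shows "((\<lambda>x. a (x + u) / a x) \<longlongrightarrow> exp (\<rho> * u)) at_top"
proof -
  define h where "h = (exp \<rho> - 1) / \<rho>"
  have h: "h \<noteq> 0" using \<open>\<rho> < 0\<close> by (simp add: h_def)
  have 1: "((\<lambda>x. (G (x + u + 1) - G (x + u)) / a (x + u)) \<longlongrightarrow> h) at_top"
    using filterlim_compose[OF lim[of 1] filterlim_plus_const_at_top[of u]] by (simp add: h_def)
  have "((\<lambda>x. (G (x + (u + 1)) - G x) / a x - (G (x + u) - G x) / a x) \<longlongrightarrow>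
      (exp (\<rho> * (u + 1)) - 1) / \<rho> - (exp (\<rho> * u) - 1) / \<rho>) at_top"
    by (intro tendsto_diff lim)
  also have "(exp (\<rho> * (u + 1)) - 1) / \<rho> - (exp (\<rho> * u) - 1) / \<rho> = exp (\<rho> * u) * h"
    unfolding h_def diff_divide_distrib[symmetric] by (simp add: exp_add algebra_simps diff_divide_distrib)
  finally have "((\<lambda>x. ((G (x + (u + 1)) - G x) / a x - (G (x + u) - G x) / a x) /
      ((G (x + u + 1) - G (x + u)) / a (x + u))) \<longlongrightarrow> exp (\<rho> * u) * h / h) at_top"
    using h 1 by (intro tendsto_divide)
  moreover have "\<forall>\<^sub>F x in at_top. ((G (x + (u + 1)) - G x) / a x - (G (x + u) - G x) / a x) /
      ((G (x + u + 1) - G (x + u)) / a (x + u)) = a (x + u) / a x"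
    using tendsto_imp_eventually_ne[OF 1 h]
  proof eventually_elim
    case (elim x)
    then have "a (x + u) \<noteq> 0" "G (x + u + 1) - G (x + u) \<noteq> 0" by auto
    then show ?case
      by (simp add: add.assoc flip: diff_divide_distrib)
  qed
  ultimately show ?thesis
    using h by (auto intro: Lim_transform_eventually)
qed


text \<open>Telescoping along \<open>x\<close>, \<open>x + 1\<close>, ...: the scale
  \<open>a\<close> contracts by \<open>\<theta>\<close> at each step, so all later increments
  together are of the order of the first one.\<close>

lemma geometric_chain_bound:
  fixes G a :: "real \<Rightarrow> real"
  assumes "0 < \<theta>" "\<theta> < 1" "0 \<le> K"
    and a: "\<And>x. x \<ge> x0 \<Longrightarrow> \<bar>a (x + 1)\<bar> \<le> \<theta> * \<bar>a x\<bar>"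
    and G: "\<And>x. x \<ge> x0 \<Longrightarrow> \<bar>G (x + 1) - G x\<bar> \<le> K * \<bar>a x\<bar>"
    and x: "x \<ge> x0"
  shows "\<bar>a (x + real n)\<bar> \<le> \<theta> ^ n * \<bar>a x\<bar>"
    and "\<bar>G (x + real n) - G x\<bar> \<le> K / (1 - \<theta>) * \<bar>a x\<bar>"
proof -
  show an: "\<bar>a (x + real n)\<bar> \<le> \<theta> ^ n * \<bar>a x\<bar>" for n
  proof (induction n)
    case (Suc n)
    have "\<bar>a (x + real n + 1)\<bar> \<le> \<theta> * \<bar>a (x + real n)\<bar>" using x by (intro a) auto
    also have "\<dots> \<le> \<theta> * (\<theta> ^ n * \<bar>a x\<bar>)" using Suc assms(1) by (intro mult_left_mono) auto
    finally show ?case by (simp add: algebra_simps)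
  qed simp
  have "\<bar>G (x + real n) - G x\<bar> \<le> K * \<bar>a x\<bar> * (\<Sum>i<n. \<theta> ^ i)"
  proof (induction n)
    case (Suc n)
    have "\<bar>G (x + real n + 1) - G (x + real n)\<bar> \<le> K * \<bar>a (x + real n)\<bar>"
      using x by (intro G) auto
    also have "\<dots> \<le> K * (\<theta> ^ n * \<bar>a x\<bar>)" using an assms(3) by (intro mult_left_mono) auto
    finally show ?case using Suc by (simp add: algebra_simps)
  qed simp
  also have "\<dots> \<le> K * \<bar>a x\<bar> * (1 / (1 - \<theta>))"
    using assms(1-3) sum_le_suminf[of "\<lambda>i. \<theta> ^ i" "{..<n}"]
    by (intro mult_left_mono) (auto simp: suminf_geometric summable_geometric)
  finally show "\<bar>G (x + real n) - G x\<bar> \<le> K / (1 - \<theta>) * \<bar>a x\<bar>" by simp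
qed

text \<open>The chain bound makes \<open>G\<close> Cauchy along an arithmetic progression, and the
  limit is the same for every starting point. As \<open>G x - l\<close> is minus the total increment
  from \<open>x\<close> to infinity, the constant \<open>1 / \<rho>\<close> is the limit of
  \<open>(exp (\<rho> * n) - 1) / \<rho>\<close> with the opposite sign.\<close>

lemma second_order_limit:
  fixes G a :: "real \<Rightarrow> real"
  assumes "\<rho> < 0" and nz: "\<forall>\<^sub>F x in at_top. a x \<noteq> 0" and a0: "(a \<longlongrightarrow> 0) at_top"
    and lim: "\<And>u. ((\<lambda>x. (G (x + u) - G x) / a x) \<longlongrightarrow> (exp (\<rho> * u) - 1) / \<rho>) at_top"
  shows "\<exists>l. ((\<lambda>x. (G x - l) / a x) \<longlongrightarrow> 1 / \<rho>) at_top"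
proof -
  \<comment> \<open>Any number strictly between \<open>exp \<rho>\<close>, the limit of
    \<open>a (x + 1) / a x\<close>, and 1 would do.\<close>
  define \<theta> where "\<theta> = exp (\<rho> / 2)"
  define K where "K = \<bar>(exp (\<rho> * 1) - 1) / \<rho>\<bar> + 1"
  have \<theta>: "0 < \<theta>" "\<theta> < 1" using \<open>\<rho> < 0\<close> by (auto simp: \<theta>_def)
  have K: "0 \<le> K" unfolding K_def by (intro add_nonneg_nonneg abs_ge_zero zero_le_one)
  have "((\<lambda>x. \<bar>a (x + 1) / a x\<bar>) \<longlongrightarrow> \<bar>exp (\<rho> * 1)\<bar>) at_top"
    by (intro tendsto_rabs second_order_rate_regularly_varying[OF assms(1,2) lim])
  moreover have "\<bar>exp (\<rho> * 1)\<bar> < \<theta>" using \<open>\<rho> < 0\<close> by (simp add: \<theta>_def)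
  ultimately have ev1: "\<forall>\<^sub>F x in at_top. \<bar>a (x + 1) / a x\<bar> < \<theta>" by (rule order_tendstoD)
  have "((\<lambda>x. \<bar>(G (x + 1) - G x) / a x\<bar>) \<longlongrightarrow> \<bar>(exp (\<rho> * 1) - 1) / \<rho>\<bar>) at_top"
    by (intro tendsto_rabs lim)
  then have ev2: "\<forall>\<^sub>F x in at_top. \<bar>(G (x + 1) - G x) / a x\<bar> < K"
    by (rule order_tendstoD) (simp only: K_def less_add_one)
  have "\<forall>\<^sub>F x in at_top. a x \<noteq> 0 \<and> \<bar>a (x + 1)\<bar> \<le> \<theta> * \<bar>a x\<bar> \<and> \<bar>G (x + 1) - G x\<bar> \<le> K * \<bar>a x\<bar>"
    using ev1 ev2 nz by eventually_elim (auto simp: abs_divide divide_less_eq)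
  then obtain x0 where x0: "\<And>x. x \<ge> x0 \<Longrightarrow> a x \<noteq> 0"
      "\<And>x. x \<ge> x0 \<Longrightarrow> \<bar>a (x + 1)\<bar> \<le> \<theta> * \<bar>a x\<bar>"
      "\<And>x. x \<ge> x0 \<Longrightarrow> \<bar>G (x + 1) - G x\<bar> \<le> K * \<bar>a x\<bar>"
    unfolding eventually_at_top_linorder by blast
  have chain: "\<bar>a (x + real n)\<bar> \<le> \<theta> ^ n * \<bar>a x\<bar>"
      "\<bar>G (x + real n) - G x\<bar> \<le> K / (1 - \<theta>) * \<bar>a x\<bar>" if "x \<ge> x0" for x n
    using geometric_chain_bound[where a = a and G = G, OF \<theta> K _ _ that] x0(2,3) by blast+
  define K' where "K' = K / (1 - \<theta>)"
  have K': "K' \<ge> 0" using K \<theta> by (simp add: K'_def)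
  have top: "filterlim (\<lambda>n. x + real n) at_top sequentially" for x
    by (rule filterlim_tendsto_add_at_top[OF tendsto_const filterlim_real_sequentially])
  have "Cauchy (\<lambda>n. G (x0 + real n))"
  proof (rule metric_CauchyI)
    fix e :: real assume "e > 0"
    have "(\<lambda>n. K' * \<bar>a (x0 + real n)\<bar>) \<longlonglongrightarrow> K' * \<bar>0\<bar>"
      by (intro tendsto_intros filterlim_compose[OF a0 top])
    then have "\<forall>\<^sub>F n in sequentially. K' * \<bar>a (x0 + real n)\<bar> < e / 2"
      using \<open>e > 0\<close> by (intro order_tendstoD) auto
    then obtain n0 where n0: "\<And>n. n \<ge> n0 \<Longrightarrow> K' * \<bar>a (x0 + real n)\<bar> < e / 2"
      unfolding eventually_sequentially by blast
    have near: "\<bar>G (x0 + real n) - G (x0 + real n0)\<bar> < e/2" if "n \<ge> n0" for n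
      using chain(2)[of "x0 + real n0" "n - n0"] n0[of n0] that
      unfolding K'_def[symmetric] by (simp add: of_nat_diff)
    have "dist (G (x0 + real n)) (G (x0 + real m)) < e" if "n \<ge> n0" "m \<ge> n0" for n m
      using near[OF that(1)] near[OF that(2)] unfolding dist_real_def by linarith
    then show "\<exists>M. \<forall>m\<ge>M. \<forall>n\<ge>M. dist (G (x0 + real m)) (G (x0 + real n)) < e" by blast
  qed
  then obtain l where l: "(\<lambda>n. G (x0 + real n)) \<longlonglongrightarrow> l"
    using Cauchy_convergent_iff convergent_def by blast
  \<comment> \<open>Shifting the starting point changes the far values of \<open>G\<close> by a
    bounded multiple of \<open>a\<close>, which tends to 0.\<close>
  have lx: "(\<lambda>n. G (x + real n)) \<longlonglongrightarrow> l" for x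
  proof -
    define u where "u = x - x0"
    have "(\<lambda>n. (G (x0 + real n + u) - G (x0 + real n)) / a (x0 + real n) * a (x0 + real n) + G (x0 + real n))
       \<longlonglongrightarrow> (exp (\<rho> * u) - 1) / \<rho> * 0 + l"
      by (intro tendsto_intros filterlim_compose[OF a0 top] l filterlim_compose[OF lim top])
    also have "(\<lambda>n. (G (x0 + real n + u) - G (x0 + real n)) / a (x0 + real n) * a (x0 + real n) + G (x0 + real n))
      = (\<lambda>n. G (x + real n))"
    proof
      fix n
      have e: "x0 + real n + u = x + real n" by (simp add: u_def)
      have "a (x0 + real n) \<noteq> 0" by (intro x0(1)) auto
      then show "(G (x0 + real n + u) - G (x0 + real n)) / a (x0 + real n) * a (x0 + real n) + G (x0 + real n)
        = G (x + real n)"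
        unfolding e by simp
    qed
    finally show ?thesis by simp
  qed
  have lG: "\<bar>G x - l\<bar> \<le> K' * \<bar>a x\<bar>" if "x \<ge> x0" for x
  proof -
    have "(\<lambda>n. \<bar>G (x + real n) - G x\<bar>) \<longlonglongrightarrow> \<bar>l - G x\<bar>" by (intro tendsto_intros lx)
    then have "\<bar>l - G x\<bar> \<le> K' * \<bar>a x\<bar>"
      by (rule LIMSEQ_le_const2) (use chain(2) that in \<open>auto simp: K'_def\<close>)
    then show ?thesis by (simp add: abs_minus_commute)
  qed
  have "((\<lambda>x. (G x - l) / a x) \<longlongrightarrow> 1 / \<rho>) at_top"
  proof (rule tendstoI)
    fix e :: real assume "e > 0"
    \<comment> \<open>One fixed \<open>n\<close> makes small both the increment beyond
      \<open>x + n\<close>, at most \<open>K' * \<theta> ^ n\<close> relative to \<open>a x\<close>,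
      and the missing term \<open>exp (\<rho> * n) / \<rho>\<close>; only then does \<open>x\<close>
      tend to infinity.\<close>
    have "(\<lambda>n. K' * \<theta> ^ n + exp (\<rho> * real n) / \<bar>\<rho>\<bar>) \<longlonglongrightarrow> K' * 0 + 0 / \<bar>\<rho>\<bar>"
    proof (intro tendsto_intros LIMSEQ_realpow_zero)
      have "(\<lambda>n. exp \<rho> ^ n) \<longlonglongrightarrow> 0" using \<open>\<rho> < 0\<close> by (intro LIMSEQ_realpow_zero) auto
      then show "(\<lambda>n. exp (\<rho> * real n)) \<longlonglongrightarrow> 0" by (simp add: exp_of_nat_mult[symmetric] mult.commute)
    qed (use \<theta> \<open>\<rho> < 0\<close> in auto)
    then have "\<forall>\<^sub>F n in sequentially. K' * \<theta> ^ n + exp (\<rho> * real n) / \<bar>\<rho>\<bar> < e / 2"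
      using \<open>e > 0\<close> by (intro order_tendstoD) auto
    then obtain n where n: "K' * \<theta> ^ n + exp (\<rho> * real n) / \<bar>\<rho>\<bar> < e / 2"
      unfolding eventually_sequentially by auto
    have "\<forall>\<^sub>F x in at_top. dist ((G (x + real n) - G x) / a x) ((exp (\<rho> * real n) - 1) / \<rho>) < e / 2"
      using \<open>e > 0\<close> by (intro tendstoD[OF lim]) auto
    then show "\<forall>\<^sub>F x in at_top. dist ((G x - l) / a x) (1 / \<rho>) < e"
      using eventually_ge_at_top[of x0]
    proof eventually_elim
      case (elim x)
      define q where "q = (G (x + real n) - G x) / a x - (exp (\<rho> * real n) - 1) / \<rho>"
      have q: "\<bar>q\<bar> < e / 2" using elim by (simp add: q_def dist_real_def)
      have "\<bar>G (x + real n) - l\<bar> \<le> K' * \<bar>a (x + real n)\<bar>" using elim by (intro lG) auto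
      also have "\<dots> \<le> K' * (\<theta> ^ n * \<bar>a x\<bar>)" using K' chain(1)[OF elim(2)] by (intro mult_left_mono) auto
      finally have r: "\<bar>(G (x + real n) - l) / a x\<bar> \<le> K' * \<theta> ^ n"
        using x0(1)[OF elim(2)] by (simp add: abs_divide divide_le_eq mult.assoc)
      have "(G x - l) / a x - 1 / \<rho> = (G (x + real n) - l) / a x - q - exp (\<rho> * real n) / \<rho>"
        unfolding q_def by (simp add: diff_divide_distrib)
      moreover have "\<bar>exp (\<rho> * real n) / \<rho>\<bar> = exp (\<rho> * real n) / \<bar>\<rho>\<bar>"
        by (simp add: abs_divide)
      ultimately have "\<bar>(G x - l) / a x - 1 / \<rho>\<bar> < e"
        using r q n by linarith
      then show ?case by (simp add: dist_real_def)
    qed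
  qed
  then show ?thesis by blast
qed

text \<open>The deviation \<open>D\<close> from the limit inherits a constant sign and regular
  variation from \<open>a\<close>, so the half-line bound applies to it. Used at the base point
  \<open>x - 1\<close>, that bound covers \<open>u \<ge> -1\<close>: a random threshold may fall on
  either side of its deterministic level.\<close>

lemma second_order_uniform:
  fixes G a :: "real \<Rightarrow> real"
  assumes "\<rho> < 0" and meas: "G \<in> borel_measurable borel"
    and sgn: "(\<forall>\<^sub>F x in at_top. a x > 0) \<or> (\<forall>\<^sub>F x in at_top. a x < 0)"
    and a0: "(a \<longlongrightarrow> 0) at_top"
    and lim: "\<And>u. ((\<lambda>x. (G (x + u) - G x) / a x) \<longlongrightarrow> (exp (\<rho> * u) - 1) / \<rho>) at_top"
  shows "\<exists>l. \<forall>\<epsilon>>0. \<forall>\<^sub>F x in at_top. \<forall>u\<ge>-1. \<bar>G (x + u) - l - exp (\<rho> * u) * a x / \<rho>\<bar> \<le> \<epsilon> * \<bar>a x\<bar>"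
proof -
  have nz: "\<forall>\<^sub>F x in at_top. a x \<noteq> 0"
    using sgn by (elim disjE) (auto elim: eventually_mono)
  obtain l where l: "((\<lambda>x. (G x - l) / a x) \<longlongrightarrow> 1 / \<rho>) at_top"
    using second_order_limit[OF \<open>\<rho> < 0\<close> nz a0 lim] by blast
  define D where "D x = G x - l" for x
  have Da: "((\<lambda>x. D x / a x) \<longlongrightarrow> 1 / \<rho>) at_top" using l by (simp add: D_def)
  note rv = second_order_rate_regularly_varying[OF \<open>\<rho> < 0\<close> nz lim]
  have neg: "\<forall>\<^sub>F x in at_top. D x / a x < 0"
    using \<open>\<rho> < 0\<close> by (intro order_tendstoD(2)[OF Da]) auto
  have Dsgn: "(\<forall>\<^sub>F x in at_top. D x > 0) \<or> (\<forall>\<^sub>F x in at_top. D x < 0)"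
    using sgn
  proof
    assume "\<forall>\<^sub>F x in at_top. a x > 0"
    with neg have "\<forall>\<^sub>F x in at_top. D x < 0" by eventually_elim (auto simp: divide_less_0_iff)
    then show ?thesis ..
  next
    assume "\<forall>\<^sub>F x in at_top. a x < 0"
    with neg have "\<forall>\<^sub>F x in at_top. D x > 0" by eventually_elim (auto simp: divide_less_0_iff)
    then show ?thesis ..
  qed
  have Da': "((\<lambda>x. D (x + u) / a x) \<longlongrightarrow> exp (\<rho> * u) / \<rho>) at_top" for u
  proof -
    have "((\<lambda>x. D (x + u) / a (x + u) * (a (x + u) / a x)) \<longlongrightarrow> 1 / \<rho> * exp (\<rho> * u)) at_top"
      by (intro tendsto_mult rv filterlim_compose[OF Da filterlim_plus_const_at_top])
    moreover have "\<forall>\<^sub>F x in at_top. D (x + u) / a (x + u) * (a (x + u) / a x) = D (x + u) / a x"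
      using eventually_compose_filterlim[OF nz filterlim_plus_const_at_top[of u]]
      by eventually_elim simp
    ultimately show ?thesis by (auto intro: Lim_transform_eventually)
  qed
  have Dlim: "((\<lambda>x. D (x + u) / D x) \<longlongrightarrow> exp (\<rho> * u)) at_top" for u
  proof -
    have "((\<lambda>x. (D (x + u) / a x) / (D x / a x)) \<longlongrightarrow> (exp (\<rho> * u) / \<rho>) / (1 / \<rho>)) at_top"
      using \<open>\<rho> < 0\<close> by (intro tendsto_divide Da Da') auto
    moreover have "\<forall>\<^sub>F x in at_top. (D (x + u) / a x) / (D x / a x) = D (x + u) / D x"
      using nz by eventually_elim simp
    ultimately show ?thesis
      using \<open>\<rho> < 0\<close> by (auto intro: Lim_transform_eventually)
  qed
  have Dmeas: "D \<in> borel_measurable borel" unfolding D_def using meas by measurable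
  have main: "\<forall>\<^sub>F x in at_top. \<forall>u\<ge>-1. \<bar>D (x + u) - exp (\<rho> * u) * a x / \<rho>\<bar> \<le> \<epsilon> * \<bar>a x\<bar>" if "\<epsilon> > 0" for \<epsilon>
  proof -
    \<comment> \<open>\<open>exp (- \<rho>) / \<bar>\<rho>\<bar>\<close> is the limit of
      \<open>\<bar>D (x - 1) / a x\<bar>\<close>, so \<open>B\<close> converts an error relative to
      \<open>D (x - 1)\<close> into one relative to \<open>a x\<close>.\<close>
    define B where "B = exp (- \<rho>) / \<bar>\<rho>\<bar> + 1"
    have B: "B > 0" by (simp add: B_def add_nonneg_pos)
    define \<eta> where "\<eta> = \<epsilon> / (2 * B)"
    have \<eta>: "\<eta> > 0" "\<eta> * B = \<epsilon> / 2" using B that by (auto simp: \<eta>_def)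
    have "((\<lambda>x. \<bar>D (x + -1) / a x\<bar>) \<longlongrightarrow> \<bar>exp (\<rho> * -1) / \<rho>\<bar>) at_top"
      by (intro tendsto_rabs Da')
    then have "\<forall>\<^sub>F x in at_top. \<bar>D (x + -1) / a x\<bar> < B"
      by (rule order_tendstoD) (simp add: B_def)
    moreover have "\<forall>\<^sub>F x in at_top. dist (D (x + -1) / a x) (exp (\<rho> * -1) / \<rho>) < \<epsilon> / 2"
      using that by (intro tendstoD[OF Da']) auto
    ultimately show ?thesis
      using eventually_compose_filterlim[OF
          regularly_varying_uniform[OF Dmeas \<open>\<rho> < 0\<close> Dsgn Dlim \<eta>(1)] filterlim_plus_const_at_top[of "-1"]] nz
    proof eventually_elim
      case (elim x)
      show ?case
      proof (intro allI impI)
        fix u :: real assume u: "u \<ge> -1"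
        have 1: "\<bar>D (x + -1 + (u + 1)) - exp (\<rho> * (u + 1)) * D (x + -1)\<bar> \<le> \<eta> * \<bar>D (x + -1)\<bar>"
          using elim(3)[rule_format, of "u + 1"] u by simp
        have "\<bar>D (x + -1)\<bar> \<le> B * \<bar>a x\<bar>"
          using elim(1,4) by (simp add: abs_divide divide_less_eq)
        then have "\<eta> * \<bar>D (x + -1)\<bar> \<le> \<eta> * (B * \<bar>a x\<bar>)" using \<eta> by (intro mult_left_mono) auto
        also have "\<dots> = \<epsilon> / 2 * \<bar>a x\<bar>" using \<eta>(2) by (simp add: mult.assoc[symmetric])
        finally have 2: "\<bar>D (x + u) - exp (\<rho> * (u + 1)) * D (x + -1)\<bar> \<le> \<epsilon> / 2 * \<bar>a x\<bar>"
          using 1 by simp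
        have "exp (\<rho> * (u + 1)) * D (x + -1) - exp (\<rho> * u) * a x / \<rho>
            = exp (\<rho> * (u + 1)) * (D (x + -1) / a x - exp (\<rho> * -1) / \<rho>) * a x"
          using elim(4) \<open>\<rho> < 0\<close> by (simp add: field_simps flip: exp_add)
        also have "\<bar>\<dots>\<bar> = exp (\<rho> * (u + 1)) * \<bar>D (x + -1) / a x - exp (\<rho> * -1) / \<rho>\<bar> * \<bar>a x\<bar>"
          by (simp add: abs_mult)
        also have "\<dots> \<le> 1 * (\<epsilon> / 2) * \<bar>a x\<bar>"
          using elim(2) u \<open>\<rho> < 0\<close> that
          by (intro mult_right_mono mult_mono) (auto simp: dist_real_def mult_nonpos_nonneg)
        finally show "\<bar>D (x + u) - exp (\<rho> * u) * a x / \<rho>\<bar> \<le> \<epsilon> * \<bar>a x\<bar>"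
          using 2 abs_triangle_ineq[of "D (x + u) - exp (\<rho> * (u + 1)) * D (x + -1)"
              "exp (\<rho> * (u + 1)) * D (x + -1) - exp (\<rho> * u) * a x / \<rho>"]
          by (simp add: field_simps)
      qed
    qed
  qed
  show ?thesis
    by (intro exI[of _ l]) (use main in \<open>auto simp: D_def\<close>)
qed

text \<open>Passage to \<open>y = ln t\<close> and
  \<open>G y = ln (U (exp y)) - \<gamma> * y\<close>. The condition on quotients becomes one on
  increments of \<open>G\<close>, because \<open>ln (1 + z)\<close> and \<open>z\<close> differ by a
  term quadratic in the relative error \<open>z\<close>, itself of the order of \<open>A\<close>.
  Monotonicity of \<open>U\<close> supplies positivity and measurability. The range
  \<open>x \<ge> 1/2\<close> comes from \<open>ln (1/2) \<ge> -1\<close>.\<close>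

lemma second_order_expansion:
  fixes U A :: "real \<Rightarrow> real"
  assumes mono: "mono_on {t0..} U" and "\<gamma> > 0" and "\<rho> < 0"
    and sgn: "(\<forall>\<^sub>F t in at_top. A t > 0) \<or> (\<forall>\<^sub>F t in at_top. A t < 0)"
    and A0: "(A \<longlongrightarrow> 0) at_top"
    and lim: "\<And>x. x > 0 \<Longrightarrow> ((\<lambda>t. 1 / A t * (U (t * x) / U t - x powr \<gamma>)) \<longlongrightarrow>
        x powr \<gamma> * ((x powr \<rho> - 1) / \<rho>)) at_top"
  shows "\<exists>l. (\<forall>\<^sub>F t in at_top. U t > 0) \<and> (\<forall>\<epsilon>>0. \<forall>\<^sub>F t in at_top. \<forall>x\<ge>1/2.
    \<bar>ln (U (t * x)) - \<gamma> * ln (t * x) - l - x powr \<rho> * A t / \<rho>\<bar> \<le> \<epsilon> * \<bar>A t\<bar>)"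
proof -
  have nz: "\<forall>\<^sub>F t in at_top. A t \<noteq> 0"
    using sgn by (elim disjE) (auto elim: eventually_mono)
  have reg: "((\<lambda>t. U (t * x) / U t) \<longlongrightarrow> x powr \<gamma>) at_top" if "x > 0" for x
  proof -
    have "((\<lambda>t. A t * (1 / A t * (U (t * x) / U t - x powr \<gamma>)) + x powr \<gamma>) \<longlongrightarrow>
       0 * (x powr \<gamma> * ((x powr \<rho> - 1) / \<rho>)) + x powr \<gamma>) at_top"
      by (intro tendsto_intros A0 lim that)
    moreover have "\<forall>\<^sub>F t in at_top. A t * (1 / A t * (U (t * x) / U t - x powr \<gamma>)) + x powr \<gamma> = U (t * x) / U t"
      using nz by eventually_elim simp
    ultimately show ?thesis by (auto intro: Lim_transform_eventually)
  qed
  \<comment> \<open>Near infinity \<open>U (t * 2) / U t\<close> exceeds 1 while \<open>U\<close> is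
    nondecreasing; a negative \<open>U t\<close> would make the quotient at most 1, and
    \<open>U t = 0\<close> would make it 0.\<close>
  have pos: "\<forall>\<^sub>F t in at_top. U t > 0"
  proof -
    have "(2::real) powr \<gamma> > 1" using \<open>\<gamma> > 0\<close> by (simp add: gr_one_powr)
    then have "\<forall>\<^sub>F t in at_top. U (t * 2) / U t > 1"
      by (intro order_tendstoD(1)[OF reg]) auto
    then show ?thesis
      using eventually_ge_at_top[of "max t0 1"]
    proof eventually_elim
      case (elim t)
      then have "U t \<le> U (t * 2)" by (intro mono_onD[OF mono]) auto
      with elim(1) show ?case
        by (cases "U t" "0 :: real" rule: linorder_cases) (auto simp: less_divide_eq)
    qed
  qed
  then obtain t1 where t1: "\<And>t. t \<ge> t1 \<Longrightarrow> U t > 0" unfolding eventually_at_top_linorder by blast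
  define y0 where "y0 = ln (max (max t0 t1) 1)"
  have y0: "exp y \<ge> t0" "exp y \<ge> t1" if "y \<ge> y0" for y
  proof -
    have "exp y0 = max (max t0 t1) 1" unfolding y0_def by (intro exp_ln) auto
    moreover have "exp y0 \<le> exp y" using that by simp
    ultimately show "exp y \<ge> t0" "exp y \<ge> t1" by linarith+
  qed
  \<comment> \<open>The argument is frozen below \<open>y0\<close>, where \<open>U\<close> need not
    be monotone or positive, so that \<open>G\<close> is measurable on the whole line.\<close>
  define G where "G y = ln (U (exp (max y y0))) - \<gamma> * y" for y
  have Gmeas: "G \<in> borel_measurable borel"
  proof -
    have "mono (\<lambda>y. ln (U (exp (max y y0))))"
    proof (rule monoI)
      fix x y :: real assume "x \<le> y"
      then have "exp (max x y0) \<le> exp (max y y0)" by simp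
      then have "U (exp (max x y0)) \<le> U (exp (max y y0))"
        using y0 by (intro mono_onD[OF mono]) auto
      moreover have "U (exp (max x y0)) > 0" using y0 by (intro t1) auto
      ultimately show "ln (U (exp (max x y0))) \<le> ln (U (exp (max y y0)))" by simp
    qed
    then have "(\<lambda>y. ln (U (exp (max y y0)))) \<in> borel_measurable borel" by (rule borel_measurable_mono)
    then show ?thesis unfolding G_def by measurable
  qed
  define a where "a y = A (exp y)" for y :: real
  have asgn: "(\<forall>\<^sub>F x in at_top. a x > 0) \<or> (\<forall>\<^sub>F x in at_top. a x < 0)"
    using sgn eventually_compose_filterlim[OF _ exp_at_top] unfolding a_def by blast
  have a0: "(a \<longlongrightarrow> 0) at_top" unfolding a_def by (rule filterlim_compose[OF A0 exp_at_top])
  have Glim: "((\<lambda>y. (G (y + u) - G y) / a y) \<longlongrightarrow> (exp (\<rho> * u) - 1) / \<rho>) at_top" for u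
  proof -
    define x where "x = exp u"
    have x: "x > 0" by (simp add: x_def)
    define z where "z t = x powr (-\<gamma>) * (U (t * x) / U t) - 1" for t
    have xg: "x powr (-\<gamma>) * x powr \<gamma> = 1" using x by (simp flip: powr_add)
    have "((\<lambda>t. x powr (-\<gamma>) * (U (t * x) / U t) - 1) \<longlongrightarrow> x powr (-\<gamma>) * x powr \<gamma> - 1) at_top"
      by (intro tendsto_intros reg x)
    then have z0: "(z \<longlongrightarrow> 0) at_top" unfolding z_def xg by simp
    have "((\<lambda>t. x powr (-\<gamma>) * (1 / A t * (U (t * x) / U t - x powr \<gamma>))) \<longlongrightarrow>
      x powr (-\<gamma>) * (x powr \<gamma> * ((x powr \<rho> - 1) / \<rho>))) at_top"
      by (intro tendsto_intros lim x)
    also have "x powr (-\<gamma>) * (x powr \<gamma> * ((x powr \<rho> - 1) / \<rho>)) = (x powr \<rho> - 1) / \<rho>"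
      using xg by (simp add: mult.assoc[symmetric])
    also have "(\<lambda>t. x powr (-\<gamma>) * (1 / A t * (U (t * x) / U t - x powr \<gamma>))) = (\<lambda>t. z t / A t)"
      unfolding z_def using xg by (auto simp: right_diff_distrib diff_divide_distrib)
    finally have zA: "((\<lambda>t. z t / A t) \<longlongrightarrow> (x powr \<rho> - 1) / \<rho>) at_top" .
    have "((\<lambda>t. ln (1 + z t) / A t) \<longlongrightarrow> (x powr \<rho> - 1) / \<rho>) at_top"
    proof (rule Lim_transform[OF zA])
      have zs: "\<forall>\<^sub>F t in at_top. \<bar>z t\<bar> < 1/2"
        using order_tendstoD(2)[OF tendsto_rabs[OF z0], of "1/2"] by simp
      have "\<forall>\<^sub>F t in at_top. norm (ln (1 + z t) / A t - z t / A t) \<le> 2 * \<bar>z t\<bar> * \<bar>z t / A t\<bar>"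
        using zs nz
      proof eventually_elim
        case (elim t)
        then have "\<bar>ln (1 + z t) - z t\<bar> \<le> 2 * (z t)\<^sup>2"
          by (intro abs_ln_one_plus_x_minus_x_bound) auto
        then have "\<bar>ln (1 + z t) - z t\<bar> / \<bar>A t\<bar> \<le> 2 * (z t)\<^sup>2 / \<bar>A t\<bar>"
          by (intro divide_right_mono) auto
        then show ?case
          by (simp add: power2_eq_square abs_mult[symmetric] flip: diff_divide_distrib abs_divide)
             (simp add: abs_divide abs_mult)
      qed
      moreover have "((\<lambda>t. 2 * \<bar>z t\<bar> * \<bar>z t / A t\<bar>) \<longlongrightarrow> 2 * \<bar>0\<bar> * \<bar>(x powr \<rho> - 1) / \<rho>\<bar>) at_top"
        by (intro tendsto_intros z0 zA)
      ultimately show "((\<lambda>t. ln (1 + z t) / A t - z t / A t) \<longlongrightarrow> 0) at_top"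
        by (auto intro: Lim_null_comparison)
    qed
    then have "((\<lambda>y. ln (1 + z (exp y)) / A (exp y)) \<longlongrightarrow> (x powr \<rho> - 1) / \<rho>) at_top"
      by (rule filterlim_compose[OF _ exp_at_top])
    moreover have "\<forall>\<^sub>F y in at_top. ln (1 + z (exp y)) / A (exp y) = (G (y + u) - G y) / a y"
      using eventually_ge_at_top[of "max y0 (y0 - u)"]
    proof eventually_elim
      case (elim y)
      then have "U (exp y) > 0" "U (exp (y + u)) > 0" using y0 by (auto intro!: t1)
      moreover have "exp y * x = exp (y + u)" by (simp add: x_def exp_add)
      ultimately have "ln (1 + z (exp y)) = ln (U (exp (y + u))) - ln (U (exp y)) - \<gamma> * u"
        by (simp add: z_def ln_mult ln_div ln_powr x_def)
      also have "\<dots> = G (y + u) - G y"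
      proof -
        have "max y y0 = y" "max (y + u) y0 = y + u" using elim by auto
        then show ?thesis by (simp add: G_def algebra_simps)
      qed
      finally show ?case by (simp add: a_def)
    qed
    ultimately show ?thesis
      by (auto intro: Lim_transform_eventually simp: x_def powr_def mult.commute)
  qed
  obtain l where l: "\<And>\<epsilon>. \<epsilon> > 0 \<Longrightarrow>
      \<forall>\<^sub>F x in at_top. \<forall>u\<ge>-1. \<bar>G (x + u) - l - exp (\<rho> * u) * a x / \<rho>\<bar> \<le> \<epsilon> * \<bar>a x\<bar>"
    using second_order_uniform[OF \<open>\<rho> < 0\<close> Gmeas asgn a0 Glim] by blast
  show ?thesis
  proof (intro exI[of _ l] conjI allI impI pos)
    fix \<epsilon> :: real assume "\<epsilon> > 0"
    show "\<forall>\<^sub>F t in at_top. \<forall>x\<ge>1/2. \<bar>ln (U (t * x)) - \<gamma> * ln (t * x) - l - x powr \<rho> * A t / \<rho>\<bar> \<le> \<epsilon> * \<bar>A t\<bar>"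
      using eventually_compose_filterlim[OF l[OF \<open>\<epsilon> > 0\<close>] ln_at_top] eventually_gt_at_top[of 0]
        eventually_ge_at_top[of "exp (y0 + 1)"]
    proof eventually_elim
      case (elim t)
      show ?case
      proof (intro allI impI)
        fix x :: real assume x: "x \<ge> 1/2"
        have "ln (1/2) \<ge> (-1::real)" using ln_2_less_1 by (simp add: ln_div)
        moreover have "ln x \<ge> ln (1/2)" using x by simp
        ultimately have u: "ln x \<ge> -1" by linarith
        have "ln t \<ge> y0 + 1" using elim(2,3) by (simp add: ln_ge_iff)
        have "G (ln t + ln x) = ln (U (t * x)) - \<gamma> * ln (t * x)"
        proof -
          have "max (ln t + ln x) y0 = ln t + ln x"
            using u \<open>ln t \<ge> y0 + 1\<close> by (intro max_absorb1) linarith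
          then show ?thesis using x elim(2) by (simp add: G_def exp_add ln_mult)
        qed
        then show "\<bar>ln (U (t * x)) - \<gamma> * ln (t * x) - l - x powr \<rho> * A t / \<rho>\<bar> \<le> \<epsilon> * \<bar>A t\<bar>"
          using elim(1)[rule_format, OF u] x elim(2) by (simp add: a_def powr_def)
      qed
    qed
  qed
qed

section \<open>Stochastic order symbols and Lyapunov's theorem\<close>

text \<open>The exceptional event avoids any measurability requirement on \<open>P\<close>.\<close>

definition nearly :: "'a measure \<Rightarrow> real \<Rightarrow> ('a \<Rightarrow> bool) \<Rightarrow> bool" where
  "nearly M \<delta> P \<longleftrightarrow> (\<exists>E\<in>sets M. measure M E \<le> \<delta> \<and> (\<forall>s\<in>space M - E. P s))"

definition whp :: "'a measure \<Rightarrow> (nat \<Rightarrow> 'a \<Rightarrow> bool) \<Rightarrow> bool" where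
  "whp M P \<longleftrightarrow> (\<forall>\<delta>>0. \<forall>\<^sub>F n in sequentially. nearly M \<delta> (P n))"

definition o_pr :: "'a measure \<Rightarrow> (nat \<Rightarrow> 'a \<Rightarrow> real) \<Rightarrow> bool" where
  "o_pr M Y \<longleftrightarrow> (\<forall>\<epsilon>>0. whp M (\<lambda>n s. \<bar>Y n s\<bar> \<le> \<epsilon>))"

definition O_pr :: "'a measure \<Rightarrow> (nat \<Rightarrow> 'a \<Rightarrow> real) \<Rightarrow> bool" where
  "O_pr M Y \<longleftrightarrow> (\<forall>\<delta>>0. \<exists>K. \<forall>\<^sub>F n in sequentially. nearly M \<delta> (\<lambda>s. \<bar>Y n s\<bar> \<le> K))"

section \<open>Calculus of the stochastic order symbols\<close>

lemma nearly_mono: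
  "nearly M \<delta> P \<Longrightarrow> (\<And>s. s \<in> space M \<Longrightarrow> P s \<Longrightarrow> Q s) \<Longrightarrow> nearly M \<delta> Q"
  unfolding nearly_def by blast

lemma (in finite_measure) nearly_conj:
  assumes "nearly M \<delta> P" "nearly M \<epsilon> Q"
  shows "nearly M (\<delta> + \<epsilon>) (\<lambda>s. P s \<and> Q s)"
proof -
  from assms obtain E E' where E: "E \<in> sets M" "measure M E \<le> \<delta>" "\<forall>s\<in>space M - E. P s"
      "E' \<in> sets M" "measure M E' \<le> \<epsilon>" "\<forall>s\<in>space M - E'. Q s"
    unfolding nearly_def by blast
  then have "measure M (E \<union> E') \<le> \<delta> + \<epsilon>"
    using measure_Un_le[of E M E'] by linarith
  with E show ?thesis
    unfolding nearly_def by (intro bexI[of _ "E \<union> E'"]) auto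
qed

lemma (in finite_measure) nearly_halves:
  "nearly M (\<delta>/2) P \<Longrightarrow> nearly M (\<delta>/2) Q \<Longrightarrow> nearly M \<delta> (\<lambda>s. P s \<and> Q s)"
  using nearly_conj[of "\<delta>/2" P "\<delta>/2" Q] by simp

lemma nearly_AE:
  assumes "AE s in M. P s" "\<delta> \<ge> 0"
  shows "nearly M \<delta> P"
proof -
  from assms(1) obtain E where "{s\<in>space M. \<not> P s} \<subseteq> E" "E \<in> null_sets M"
    unfolding eventually_ae_filter by blast
  then show ?thesis
    using assms(2) unfolding nearly_def by (intro bexI[of _ E]) (auto simp: measure_eq_0_null_sets)
qed

lemma (in finite_measure) nearly_measure_le:
  "nearly M \<delta> (\<lambda>s. \<not> P s) \<Longrightarrow> measure M {s\<in>space M. P s} \<le> \<delta>"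
proof -
  assume "nearly M \<delta> (\<lambda>s. \<not> P s)"
  then obtain E where E: "E \<in> sets M" "measure M E \<le> \<delta>" "\<forall>s\<in>space M - E. \<not> P s"
    unfolding nearly_def by blast
  then have "measure M {s\<in>space M. P s} \<le> measure M E"
    by (intro finite_measure_mono) auto
  with E show ?thesis by simp
qed

lemma whp_mono:
  assumes "whp M P" "\<forall>\<^sub>F n in sequentially. \<forall>s\<in>space M. P n s \<longrightarrow> Q n s"
  shows "whp M Q"
  unfolding whp_def
proof (intro allI impI)
  fix \<delta> :: real assume "\<delta> > 0"
  then have "\<forall>\<^sub>F n in sequentially. nearly M \<delta> (P n)" using assms(1) by (simp add: whp_def)
  then show "\<forall>\<^sub>F n in sequentially. nearly M \<delta> (Q n)"
    using assms(2) by eventually_elim (auto intro: nearly_mono)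
qed

lemma whp_mono': "whp M P \<Longrightarrow> (\<And>n s. P n s \<Longrightarrow> Q n s) \<Longrightarrow> whp M Q"
  by (rule whp_mono) auto

lemma whp_AE: "\<forall>\<^sub>F n in sequentially. AE s in M. P n s \<Longrightarrow> whp M P"
  unfolding whp_def by (intro allI impI) (auto elim!: eventually_mono intro: nearly_AE)

lemma whp_eventually: "\<forall>\<^sub>F n in sequentially. P n \<Longrightarrow> whp M (\<lambda>n s. P n)"
  by (rule whp_AE) (auto elim: eventually_mono)

lemma O_pr_cong_whp:
  assumes "finite_measure M" "O_pr M X" "whp M (\<lambda>n s. \<bar>Y n s\<bar> \<le> \<bar>X n s\<bar>)"
  shows "O_pr M Y"
  unfolding O_pr_def
proof (intro allI impI)
  interpret finite_measure M by fact
  fix \<delta> :: real assume "\<delta> > 0"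
  then obtain K where "\<forall>\<^sub>F n in sequentially. nearly M (\<delta>/2) (\<lambda>s. \<bar>X n s\<bar> \<le> K)"
    using assms(2) unfolding O_pr_def by (meson half_gt_zero)
  moreover have "\<forall>\<^sub>F n in sequentially. nearly M (\<delta>/2) (\<lambda>s. \<bar>Y n s\<bar> \<le> \<bar>X n s\<bar>)"
    using assms(3) \<open>\<delta> > 0\<close> unfolding whp_def by simp
  ultimately show "\<exists>K. \<forall>\<^sub>F n in sequentially. nearly M \<delta> (\<lambda>s. \<bar>Y n s\<bar> \<le> K)"
    by (intro exI[of _ K], eventually_elim) (rule nearly_mono[OF nearly_halves], assumption, assumption, auto)
qed

context finite_measure
begin

lemma whp_conj:
  assumes "whp M P" "whp M Q"
  shows "whp M (\<lambda>n s. P n s \<and> Q n s)"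
  unfolding whp_def
proof (intro allI impI)
  fix \<delta> :: real assume "\<delta> > 0"
  then have "\<forall>\<^sub>F n in sequentially. nearly M (\<delta>/2) (P n)"
    "\<forall>\<^sub>F n in sequentially. nearly M (\<delta>/2) (Q n)"
    using assms by (simp_all add: whp_def)
  then show "\<forall>\<^sub>F n in sequentially. nearly M \<delta> (\<lambda>s. P n s \<and> Q n s)"
    by eventually_elim (rule nearly_halves)
qed

lemma whp_ball:
  assumes "finite I" "\<And>i. i \<in> I \<Longrightarrow> whp M (P i)"
  shows "whp M (\<lambda>n s. \<forall>i\<in>I. P i n s)"
  using assms
proof (induction I rule: finite_induct)
  case empty
  then show ?case using whp_eventually[of "\<lambda>_. True" M] by simp
next
  case (insert i I)
  then have "whp M (\<lambda>n s. P i n s \<and> (\<forall>i\<in>I. P i n s))" by (intro whp_conj) auto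
  then show ?case by simp
qed

lemma o_pr_dominated:
  assumes "o_pr M X" "whp M (\<lambda>n s. \<bar>Y n s\<bar> \<le> \<bar>X n s\<bar>)"
  shows "o_pr M Y"
  unfolding o_pr_def
proof (intro allI impI)
  fix \<epsilon> :: real assume "\<epsilon> > 0"
  then have "whp M (\<lambda>n s. \<bar>X n s\<bar> \<le> \<epsilon>)" using assms(1) by (simp add: o_pr_def)
  from whp_conj[OF this assms(2)] show "whp M (\<lambda>n s. \<bar>Y n s\<bar> \<le> \<epsilon>)"
    by (rule whp_mono') auto
qed

lemma o_pr_cong: "o_pr M X \<Longrightarrow> whp M (\<lambda>n s. X n s = Y n s) \<Longrightarrow> o_pr M Y"
  by (erule o_pr_dominated) (auto elim: whp_mono')

lemma O_pr_cong: "O_pr M X \<Longrightarrow> whp M (\<lambda>n s. X n s = Y n s) \<Longrightarrow> O_pr M Y"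
  by (rule O_pr_cong_whp[OF finite_measure_axioms]) (auto elim: whp_mono')

lemma o_pr_imp_O_pr:
  assumes "o_pr M X"
  shows "O_pr M X"
  unfolding O_pr_def
proof (intro allI impI exI[of _ 1])
  fix \<delta> :: real assume "\<delta> > 0"
  have "whp M (\<lambda>n s. \<bar>X n s\<bar> \<le> 1)"
    using assms[unfolded o_pr_def, rule_format, of 1] zero_less_one by blast
  then show "\<forall>\<^sub>F n in sequentially. nearly M \<delta> (\<lambda>s. \<bar>X n s\<bar> \<le> 1)"
    unfolding whp_def using \<open>\<delta> > 0\<close> by blast
qed

text \<open>To bound \<open>Z\<close> it suffices to do so on events where a tight sequence \<open>W\<close> is bounded.\<close>

lemma o_pr_localI:
  assumes W: "O_pr M W"
    and Z: "\<And>\<epsilon> K. \<epsilon> > 0 \<Longrightarrow> whp M (\<lambda>n s. \<bar>W n s\<bar> \<le> K \<longrightarrow> \<bar>Z n s\<bar> \<le> \<epsilon>)"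
  shows "o_pr M Z"
  unfolding o_pr_def whp_def
proof (intro allI impI)
  fix \<epsilon> \<delta> :: real assume "\<epsilon> > 0" "\<delta> > 0"
  then obtain K where "\<forall>\<^sub>F n in sequentially. nearly M (\<delta>/2) (\<lambda>s. \<bar>W n s\<bar> \<le> K)"
    using W unfolding O_pr_def by (meson half_gt_zero)
  moreover have "\<forall>\<^sub>F n in sequentially. nearly M (\<delta>/2) (\<lambda>s. \<bar>W n s\<bar> \<le> K \<longrightarrow> \<bar>Z n s\<bar> \<le> \<epsilon>)"
    using Z[OF \<open>\<epsilon> > 0\<close>, of K] \<open>\<delta> > 0\<close> unfolding whp_def by simp
  ultimately show "\<forall>\<^sub>F n in sequentially. nearly M \<delta> (\<lambda>s. \<bar>Z n s\<bar> \<le> \<epsilon>)"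
    by eventually_elim (rule nearly_mono[OF nearly_halves], assumption, assumption, auto)
qed

lemma o_pr_const: "c \<longlonglongrightarrow> 0 \<Longrightarrow> o_pr M (\<lambda>n s. c n)"
  unfolding o_pr_def
proof (intro allI impI whp_eventually)
  fix \<epsilon> :: real assume "c \<longlonglongrightarrow> 0" "\<epsilon> > 0"
  then have "\<forall>\<^sub>F n in sequentially. \<bar>c n\<bar> < \<epsilon>" by (auto simp: tendsto_iff dist_real_def)
  then show "\<forall>\<^sub>F n in sequentially. \<bar>c n\<bar> \<le> \<epsilon>" by eventually_elim simp
qed

lemma O_pr_const:
  assumes "c \<longlonglongrightarrow> (l :: real)"
  shows "O_pr M (\<lambda>n s. c n)"
  unfolding O_pr_def
proof (intro allI impI exI)
  fix \<delta> :: real assume "\<delta> > 0"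
  have "\<forall>\<^sub>F n in sequentially. \<bar>c n\<bar> < \<bar>l\<bar> + 1"
    by (rule order_tendstoD(2)[OF tendsto_rabs[OF assms]]) simp
  then show "\<forall>\<^sub>F n in sequentially. nearly M \<delta> (\<lambda>s. \<bar>c n\<bar> \<le> \<bar>l\<bar> + 1)"
    by (rule eventually_mono) (use \<open>\<delta> > 0\<close> in \<open>auto intro!: nearly_AE\<close>)
qed

lemma O_pr_mult:
  assumes "O_pr M X" "O_pr M Y"
  shows "O_pr M (\<lambda>n s. X n s * Y n s)"
  unfolding O_pr_def
proof (intro allI impI)
  fix \<delta> :: real assume "\<delta> > 0"
  then obtain K L where "\<forall>\<^sub>F n in sequentially. nearly M (\<delta>/2) (\<lambda>s. \<bar>X n s\<bar> \<le> K)"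
      "\<forall>\<^sub>F n in sequentially. nearly M (\<delta>/2) (\<lambda>s. \<bar>Y n s\<bar> \<le> L)"
    using assms unfolding O_pr_def by (meson half_gt_zero)
  then have "\<forall>\<^sub>F n in sequentially. nearly M \<delta> (\<lambda>s. \<bar>X n s * Y n s\<bar> \<le> \<bar>K\<bar> * \<bar>L\<bar>)"
    by eventually_elim
       (rule nearly_mono[OF nearly_halves], assumption, assumption, auto simp: abs_mult intro!: mult_mono)
  then show "\<exists>K. \<forall>\<^sub>F n in sequentially. nearly M \<delta> (\<lambda>s. \<bar>X n s * Y n s\<bar> \<le> K)" ..
qed

lemma O_pr_add:
  assumes "O_pr M X" "O_pr M Y"
  shows "O_pr M (\<lambda>n s. X n s + Y n s)"
  unfolding O_pr_def
proof (intro allI impI)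
  fix \<delta> :: real assume "\<delta> > 0"
  then obtain K L where "\<forall>\<^sub>F n in sequentially. nearly M (\<delta>/2) (\<lambda>s. \<bar>X n s\<bar> \<le> K)"
      "\<forall>\<^sub>F n in sequentially. nearly M (\<delta>/2) (\<lambda>s. \<bar>Y n s\<bar> \<le> L)"
    using assms unfolding O_pr_def by (meson half_gt_zero)
  then have "\<forall>\<^sub>F n in sequentially. nearly M \<delta> (\<lambda>s. \<bar>X n s + Y n s\<bar> \<le> K + L)"
    by eventually_elim
       (rule nearly_mono[OF nearly_halves], assumption, assumption, auto)
  then show "\<exists>K. \<forall>\<^sub>F n in sequentially. nearly M \<delta> (\<lambda>s. \<bar>X n s + Y n s\<bar> \<le> K)" ..
qed

lemma o_pr_add:
  assumes "o_pr M X" "o_pr M Y"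
  shows "o_pr M (\<lambda>n s. X n s + Y n s)"
  unfolding o_pr_def
proof (intro allI impI)
  fix \<epsilon> :: real assume "\<epsilon> > 0"
  then have "whp M (\<lambda>n s. \<bar>X n s\<bar> \<le> \<epsilon>/2)" "whp M (\<lambda>n s. \<bar>Y n s\<bar> \<le> \<epsilon>/2)"
    using assms half_gt_zero unfolding o_pr_def by blast+
  from whp_conj[OF this] show "whp M (\<lambda>n s. \<bar>X n s + Y n s\<bar> \<le> \<epsilon>)"
    by (rule whp_mono') auto
qed

lemma o_pr_O_pr_mult:
  assumes "o_pr M X" "O_pr M Y"
  shows "o_pr M (\<lambda>n s. X n s * Y n s)"
proof (rule o_pr_localI[OF assms(2)])
  fix \<epsilon> K :: real assume "\<epsilon> > 0"
  then have "whp M (\<lambda>n s. \<bar>X n s\<bar> \<le> \<epsilon> / (\<bar>K\<bar> + 1))"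
    using assms(1) by (auto simp: o_pr_def add_nonneg_pos)
  then show "whp M (\<lambda>n s. \<bar>Y n s\<bar> \<le> K \<longrightarrow> \<bar>X n s * Y n s\<bar> \<le> \<epsilon>)"
  proof (rule whp_mono', intro impI)
    fix n s assume *: "\<bar>X n s\<bar> \<le> \<epsilon> / (\<bar>K\<bar> + 1)" "\<bar>Y n s\<bar> \<le> K"
    then have "\<bar>X n s\<bar> * \<bar>Y n s\<bar> \<le> \<epsilon> / (\<bar>K\<bar> + 1) * (\<bar>K\<bar> + 1)"
      using \<open>\<epsilon> > 0\<close> by (intro mult_mono) auto
    then show "\<bar>X n s * Y n s\<bar> \<le> \<epsilon>" by (simp add: abs_mult add_nonneg_pos)
  qed
qed

lemma o_pr_uminus: "o_pr M X \<Longrightarrow> o_pr M (\<lambda>n s. - X n s)"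
  by (simp add: o_pr_def)

lemma O_pr_uminus: "O_pr M X \<Longrightarrow> O_pr M (\<lambda>n s. - X n s)"
  by (simp add: O_pr_def)

lemma o_pr_diff: "o_pr M X \<Longrightarrow> o_pr M Y \<Longrightarrow> o_pr M (\<lambda>n s. X n s - Y n s)"
  using o_pr_add[of X "\<lambda>n s. - Y n s"] by (simp add: o_pr_uminus)

lemma O_pr_diff: "O_pr M X \<Longrightarrow> O_pr M Y \<Longrightarrow> O_pr M (\<lambda>n s. X n s - Y n s)"
  using O_pr_add[of X "\<lambda>n s. - Y n s"] by (simp add: O_pr_uminus)

lemma o_pr_zero: "o_pr M (\<lambda>n s. 0)"
  by (rule o_pr_const) simp

lemma o_pr_sum: "(\<And>i. i \<in> I \<Longrightarrow> o_pr M (X i)) \<Longrightarrow> o_pr M (\<lambda>n s. \<Sum>i\<in>I. X i n s)"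
  by (induction I rule: infinite_finite_induct) (auto intro: o_pr_add o_pr_zero)

lemma O_pr_sum: "(\<And>i. i \<in> I \<Longrightarrow> O_pr M (X i)) \<Longrightarrow> O_pr M (\<lambda>n s. \<Sum>i\<in>I. X i n s)"
  by (induction I rule: infinite_finite_induct) (auto intro: O_pr_add o_pr_imp_O_pr[OF o_pr_zero])

lemma o_pr_imp_small_op:
  assumes "o_pr M Y"
  shows "small_op M Y"
  unfolding small_op_def
proof (intro allI impI tendstoI)
  fix \<epsilon> \<delta> :: real assume "\<epsilon> > 0" "\<delta> > 0"
  then have "\<forall>\<^sub>F n in sequentially. nearly M (\<delta>/2) (\<lambda>s. \<bar>Y n s\<bar> \<le> \<epsilon>)"
    using assms by (auto simp: o_pr_def whp_def)
  then show "\<forall>\<^sub>F n in sequentially. dist (measure M {s \<in> space M. \<bar>Y n s\<bar> > \<epsilon>}) 0 < \<delta>"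
  proof eventually_elim
    case (elim n)
    then have "measure M {s \<in> space M. \<bar>Y n s\<bar> > \<epsilon>} \<le> \<delta>/2"
      by (intro nearly_measure_le) (auto simp: not_less)
    then show ?case using \<open>\<delta> > 0\<close> by simp
  qed
qed

text \<open>The exceptional event is \<open>\<bar>Y n s\<bar> > \<epsilon>\<close> itself, which
  must belong to \<open>sets M\<close>; hence measurability is required in this direction.\<close>

lemma small_op_imp_o_pr:
  assumes "small_op M Y" and [measurable]: "\<And>n. Y n \<in> borel_measurable M"
  shows "o_pr M Y"
  unfolding o_pr_def whp_def
proof (intro allI impI)
  fix \<epsilon> \<delta> :: real assume "\<epsilon> > 0" "\<delta> > 0"
  then have "\<forall>\<^sub>F n in sequentially. dist (measure M {s \<in> space M. \<bar>Y n s\<bar> > \<epsilon>}) 0 < \<delta>"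
    using assms(1) unfolding small_op_def by (intro tendstoD) auto
  then show "\<forall>\<^sub>F n in sequentially. nearly M \<delta> (\<lambda>s. \<bar>Y n s\<bar> \<le> \<epsilon>)"
  proof eventually_elim
    case (elim n)
    then show ?case
      unfolding nearly_def by (intro bexI[of _ "{s \<in> space M. \<bar>Y n s\<bar> > \<epsilon>}"]) auto
  qed
qed

end

context prob_space
begin

section \<open>Second-moment bounds and sums of independent variables\<close>

lemma nearly_second_moment:
  fixes Y :: "'a \<Rightarrow> real"
  assumes [measurable]: "Y \<in> borel_measurable M" and "integrable M (\<lambda>s. (Y s)\<^sup>2)" "\<epsilon> > 0"
    and "expectation (\<lambda>s. (Y s)\<^sup>2) \<le> \<delta> * \<epsilon>\<^sup>2"
  shows "nearly M \<delta> (\<lambda>s. \<bar>Y s\<bar> \<le> \<epsilon>)"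
  unfolding nearly_def
proof (intro bexI conjI)
  have "prob {s\<in>space M. \<epsilon> \<le> \<bar>Y s\<bar>} \<le> expectation (\<lambda>s. (Y s)\<^sup>2) / \<epsilon>\<^sup>2"
    using assms by (intro second_moment_method) auto
  also have "\<dots> \<le> \<delta>" using assms by (simp add: divide_le_eq)
  finally show "prob {s\<in>space M. \<epsilon> \<le> \<bar>Y s\<bar>} \<le> \<delta>" .
qed auto

lemma o_pr_second_moment:
  fixes Y :: "nat \<Rightarrow> 'a \<Rightarrow> real"
  assumes "\<And>n. Y n \<in> borel_measurable M" "\<And>n. integrable M (\<lambda>s. (Y n s)\<^sup>2)"
    and le: "\<forall>\<^sub>F n in sequentially. expectation (\<lambda>s. (Y n s)\<^sup>2) \<le> B n" and B: "B \<longlonglongrightarrow> 0"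
  shows "o_pr M Y"
  unfolding o_pr_def whp_def
proof (intro allI impI)
  fix \<epsilon> \<delta> :: real assume "\<epsilon> > 0" "\<delta> > 0"
  then have "\<forall>\<^sub>F n in sequentially. B n < \<delta> * \<epsilon>\<^sup>2"
    using order_tendstoD(2)[OF B, of "\<delta> * \<epsilon>\<^sup>2"] by simp
  then show "\<forall>\<^sub>F n in sequentially. nearly M \<delta> (\<lambda>s. \<bar>Y n s\<bar> \<le> \<epsilon>)"
    using le by eventually_elim (use \<open>\<epsilon> > 0\<close> assms(1,2) in \<open>intro nearly_second_moment, auto\<close>)
qed

lemma O_pr_second_moment:
  fixes Y :: "nat \<Rightarrow> 'a \<Rightarrow> real"
  assumes "\<And>n. Y n \<in> borel_measurable M" "\<And>n. integrable M (\<lambda>s. (Y n s)\<^sup>2)"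
    and le: "\<forall>\<^sub>F n in sequentially. expectation (\<lambda>s. (Y n s)\<^sup>2) \<le> B"
  shows "O_pr M Y"
  unfolding O_pr_def
proof (intro allI impI exI)
  fix \<delta> :: real assume "\<delta> > 0"
  define K where "K = sqrt ((\<bar>B\<bar> + 1) / \<delta>)"
  have K: "K > 0" "\<delta> * K\<^sup>2 = \<bar>B\<bar> + 1"
    using \<open>\<delta> > 0\<close> by (simp_all add: K_def add_nonneg_pos)
  show "\<forall>\<^sub>F n in sequentially. nearly M \<delta> (\<lambda>s. \<bar>Y n s\<bar> \<le> K)"
    using le by eventually_elim (use assms(1,2) K in \<open>intro nearly_second_moment, auto\<close>)
qed

lemma
  fixes Z :: "nat \<Rightarrow> 'a \<Rightarrow> real"
  assumes "finite I" "indep_vars (\<lambda>_. borel) Z I"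
    and "\<And>i. i \<in> I \<Longrightarrow> integrable M (\<lambda>s. (Z i s)\<^sup>2)"
    and "\<And>i. i \<in> I \<Longrightarrow> expectation (Z i) = 0"
  shows integrable_square_sum_indep: "integrable M (\<lambda>s. (\<Sum>i\<in>I. Z i s)\<^sup>2)"
    and expectation_square_sum_indep:
      "expectation (\<lambda>s. (\<Sum>i\<in>I. Z i s)\<^sup>2) = (\<Sum>i\<in>I. expectation (\<lambda>s. (Z i s)\<^sup>2))"
proof -
  have "integrable M (\<lambda>s. (\<Sum>i\<in>I. Z i s)\<^sup>2) \<and>
      expectation (\<lambda>s. (\<Sum>i\<in>I. Z i s)\<^sup>2) = (\<Sum>i\<in>I. expectation (\<lambda>s. (Z i s)\<^sup>2))"
    using assms
  proof (induction I rule: finite_induct)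
    case (insert i I)
    have ind: "indep_vars (\<lambda>_. borel) Z I"
      by (rule indep_vars_subset[OF insert.prems(1)]) auto
    have meas: "Z j \<in> borel_measurable M" if "j \<in> insert i I" for j
      using insert.prems(1) that unfolding indep_vars_def by auto
    then have [measurable]: "Z i \<in> borel_measurable M" and m2: "\<And>j. j \<in> I \<Longrightarrow> Z j \<in> borel_measurable M" by auto
    have "integrable M (\<lambda>s. (\<Sum>i\<in>I. Z i s)\<^sup>2) \<and>
        expectation (\<lambda>s. (\<Sum>i\<in>I. Z i s)\<^sup>2) = (\<Sum>i\<in>I. expectation (\<lambda>s. (Z i s)\<^sup>2))"
      by (rule insert.IH[OF ind]) (use insert.prems(2,3) in blast)+
    note IH = this[THEN conjunct1] this[THEN conjunct2]
    have int: "integrable M (Z j)" if "j \<in> insert i I" for j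
      by (rule square_integrable_imp_integrable[OF meas[OF that] insert.prems(2)[OF that]])
    have intS: "integrable M (\<lambda>s. \<Sum>i\<in>I. Z i s)"
      using int by (intro Bochner_Integration.integrable_sum) auto
    have iv: "indep_var borel (Z i) borel (\<lambda>s. \<Sum>i\<in>I. Z i s)"
      using insert by (intro indep_vars_sum) auto
    have "expectation (\<lambda>s. Z i s * (\<Sum>i\<in>I. Z i s)) = expectation (Z i) * expectation (\<lambda>s. \<Sum>i\<in>I. Z i s)"
      by (rule indep_var_lebesgue_integral[OF iv]) (use int intS in auto)
    then have c: "expectation (\<lambda>s. Z i s * (\<Sum>i\<in>I. Z i s)) = 0"
      using insert.prems(3) by simp
    have ci: "integrable M (\<lambda>s. Z i s * (\<Sum>i\<in>I. Z i s))"
      by (rule indep_var_integrable[OF iv]) (use int intS in auto)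
    have eq: "(\<Sum>i\<in>insert i I. Z i s)\<^sup>2 = (Z i s)\<^sup>2 + 2 * (Z i s * (\<Sum>i\<in>I. Z i s)) + (\<Sum>i\<in>I. Z i s)\<^sup>2" for s
      using insert.hyps by (simp add: power2_sum algebra_simps)
    show ?case
      unfolding eq using IH ci c insert.prems(2)[of i] insert.hyps by simp
  qed simp
  then show "integrable M (\<lambda>s. (\<Sum>i\<in>I. Z i s)\<^sup>2)"
    "expectation (\<lambda>s. (\<Sum>i\<in>I. Z i s)\<^sup>2) = (\<Sum>i\<in>I. expectation (\<lambda>s. (Z i s)\<^sup>2))" by auto
qed

end


section \<open>Characteristic functions of perturbed variables and of independent sums\<close>

lemma exp_minus_quadratic_bound:
  fixes y :: real
  assumes "y \<ge> 0"
  shows "\<bar>(1 - y) - exp (- y)\<bar> \<le> y\<^sup>2"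
proof -
  have "1 - y \<le> exp (- y)" using exp_ge_add_one_self[of "- y"] by simp
  moreover have "exp (- y) \<le> 1 / (1 + y)"
    using exp_ge_add_one_self[of y] assms by (simp add: exp_minus field_simps)
  moreover have "1 / (1 + y) \<le> 1 - y + y\<^sup>2"
  proof -
    have "(1 - y + y\<^sup>2) * (1 + y) = 1 + y ^ 3" by (simp add: algebra_simps power2_eq_square power3_eq_cube)
    then show ?thesis using assms by (subst pos_divide_le_eq) auto
  qed
  ultimately show ?thesis by linarith
qed

context prob_space
begin

text \<open>Quantitative Slutsky step: off the exceptional event the exponentials differ by at most
  \<open>\<bar>t\<bar> * \<epsilon>\<close>, on it trivially by 2. Limits of characteristic
  functions thus carry over between sequences whose difference is \<open>o_pr\<close>.\<close>

lemma norm_char_diff_le: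
  fixes X Y :: "'a \<Rightarrow> real"
  assumes [measurable]: "X \<in> borel_measurable M" "Y \<in> borel_measurable M"
    and near: "nearly M \<delta> (\<lambda>s. \<bar>X s - Y s\<bar> \<le> \<epsilon>)" and "\<epsilon> \<ge> 0"
  shows "cmod (char (distr M borel X) t - char (distr M borel Y) t) \<le> \<bar>t\<bar> * \<epsilon> + 2 * \<delta>"
proof -
  from near obtain E where [measurable]: "E \<in> sets M" and E: "prob E \<le> \<delta>"
      "\<And>s. s \<in> space M - E \<Longrightarrow> \<bar>X s - Y s\<bar> \<le> \<epsilon>"
    unfolding nearly_def by blast
  have int: "integrable M (\<lambda>s. iexp (t * Z s))" if [measurable]: "Z \<in> borel_measurable M" for Z
    by (rule integrable_const_bound[of _ 1]) auto
  have bnd: "cmod (iexp (t * X s) - iexp (t * Y s)) \<le> \<bar>t\<bar> * \<epsilon> + 2 * indicator E s" if "s \<in> space M" for s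
  proof (cases "s \<in> E")
    case True
    have "cmod (iexp (t * X s) - iexp (t * Y s)) \<le> cmod (iexp (t * X s)) + cmod (iexp (t * Y s))"
      by (rule norm_triangle_ineq4)
    then show ?thesis using True \<open>\<epsilon> \<ge> 0\<close> by (simp add: add_increasing)
  next
    case False
    have "iexp (t * X s) - iexp (t * Y s) = iexp (t * Y s) * (iexp (t * (X s - Y s)) - 1)"
      by (simp add: algebra_simps flip: exp_add)
    then have "cmod (iexp (t * X s) - iexp (t * Y s)) = cmod (iexp (t * (X s - Y s)) - 1)"
      by (simp add: norm_mult)
    also have "\<dots> \<le> \<bar>t * (X s - Y s)\<bar>"
      using iexp_approx1[of "t * (X s - Y s)" 0] by simp
    also have "\<dots> \<le> \<bar>t\<bar> * \<epsilon>"
      using E(2) that False by (simp add: abs_mult mult_left_mono)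
    finally show ?thesis using False by simp
  qed
  have "char (distr M borel X) t - char (distr M borel Y) t
      = (CLINT s|M. iexp (t * X s) - iexp (t * Y s))"
    unfolding char_def 
    by (subst (1 2) integral_distr)
       (auto intro!: Bochner_Integration.integral_diff[symmetric] int simp del: of_real_mult)
  also have "cmod \<dots> \<le> (LINT s|M. cmod (iexp (t * X s) - iexp (t * Y s)))"
    by (rule integral_norm_bound)
  also have "\<dots> \<le> (LINT s|M. \<bar>t\<bar> * \<epsilon> + 2 * indicator E s)"
  proof (rule integral_mono)
    show "integrable M (\<lambda>s. cmod (iexp (t * X s) - iexp (t * Y s)))"
      by (intro integrable_norm Bochner_Integration.integrable_diff int assms)
    show "integrable M (\<lambda>s. \<bar>t\<bar> * \<epsilon> + 2 * indicator E s)"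
      by (rule integrable_const_bound[of _ "\<bar>t\<bar> * \<epsilon> + 2"])
         (use \<open>\<epsilon> \<ge> 0\<close> in \<open>auto simp: indicator_def\<close>)
  qed (rule bnd)
  also have "\<dots> = \<bar>t\<bar> * \<epsilon> + 2 * prob E"
  proof -
    have "integrable M (indicat_real E)"
      by (rule integrable_const_bound[of _ 1]) auto
    then show ?thesis by (simp add: prob_space)
  qed
  finally show ?thesis using E(1) by linarith
qed

lemma char_tendsto_o_pr:
  fixes X Y :: "nat \<Rightarrow> 'a \<Rightarrow> real"
  assumes "\<And>n. X n \<in> borel_measurable M" "\<And>n. Y n \<in> borel_measurable M"
    and o: "o_pr M (\<lambda>n s. X n s - Y n s)"
    and lim: "(\<lambda>n. char (distr M borel (X n)) t) \<longlonglongrightarrow> l"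
  shows "(\<lambda>n. char (distr M borel (Y n)) t) \<longlonglongrightarrow> l"
proof (rule Lim_transform[OF lim])
  show "(\<lambda>n. char (distr M borel (Y n)) t - char (distr M borel (X n)) t) \<longlonglongrightarrow> 0"
  proof (rule tendstoI)
    fix e :: real assume "e > 0"
    define \<epsilon> where "\<epsilon> = e / (4 * (\<bar>t\<bar> + 1))"
    have "\<epsilon> > 0" "\<bar>t\<bar> * \<epsilon> \<le> e / 4"
      using \<open>e > 0\<close> by (auto simp: \<epsilon>_def field_simps add_nonneg_pos)
    have "\<forall>\<^sub>F n in sequentially. nearly M (e/8) (\<lambda>s. \<bar>X n s - Y n s\<bar> \<le> \<epsilon>)"
      using o \<open>\<epsilon> > 0\<close> \<open>e > 0\<close> unfolding o_pr_def whp_def by simp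
    then show "\<forall>\<^sub>F n in sequentially. dist (char (distr M borel (Y n)) t - char (distr M borel (X n)) t) 0 < e"
    proof eventually_elim
      case (elim n)
      have "cmod (char (distr M borel (X n)) t - char (distr M borel (Y n)) t) \<le> \<bar>t\<bar> * \<epsilon> + 2 * (e/8)"
        using assms(1,2) elim \<open>\<epsilon> > 0\<close> by (intro norm_char_diff_le) auto
      then show ?case using \<open>\<bar>t\<bar> * \<epsilon> \<le> e / 4\<close> \<open>e > 0\<close> by (simp add: norm_minus_commute dist_norm)
    qed
  qed
qed

lemma char_distr_add_const:
  fixes X :: "'a \<Rightarrow> real"
  assumes [measurable]: "X \<in> borel_measurable M"
  shows "char (distr M borel (\<lambda>s. X s + c)) t = char (distr M borel X) t * iexp (t * c)"
  unfolding char_def by (simp add: integral_distr distrib_left exp_add)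

text \<open>All factors have modulus at most 1, so the difference of the products is at most the sum
  of the differences. The third moment controls the distance of each factor to its quadratic Taylor
  polynomial, and \<open>\<beta>\<close> the distance from there to the Gaussian factor. Variances
  are not normalised, so a degenerate limit \<open>v = 0\<close> is covered.\<close>

theorem lyapunov_char_tendsto:
  fixes \<xi> :: "nat \<Rightarrow> nat \<Rightarrow> 'a \<Rightarrow> real"
  assumes fin: "\<And>n. finite (I n)" and indep: "\<And>n. indep_vars (\<lambda>_. borel) (\<xi> n) (I n)"
    and int3: "\<And>n i. i \<in> I n \<Longrightarrow> integrable M (\<lambda>s. \<bar>\<xi> n i s\<bar> ^ 3)"
    and int2: "\<And>n i. i \<in> I n \<Longrightarrow> integrable M (\<lambda>s. (\<xi> n i s)\<^sup>2)"
    and mean: "\<And>n i. i \<in> I n \<Longrightarrow> expectation (\<xi> n i) = 0"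
    and var: "(\<lambda>n. \<Sum>i\<in>I n. expectation (\<lambda>s. (\<xi> n i s)\<^sup>2)) \<longlonglongrightarrow> v"
    and third: "(\<lambda>n. \<Sum>i\<in>I n. expectation (\<lambda>s. \<bar>\<xi> n i s\<bar> ^ 3)) \<longlonglongrightarrow> 0"
    and neglig: "\<forall>\<^sub>F n in sequentially. \<forall>i\<in>I n. expectation (\<lambda>s. (\<xi> n i s)\<^sup>2) \<le> \<beta> n" and \<beta>: "\<beta> \<longlonglongrightarrow> 0"
  shows "(\<lambda>n. char (distr M borel (\<lambda>s. \<Sum>i\<in>I n. \<xi> n i s)) t) \<longlonglongrightarrow> complex_of_real (exp (- (t\<^sup>2 * v / 2)))"
proof -
  define \<sigma> where "\<sigma> n i = expectation (\<lambda>s. (\<xi> n i s)\<^sup>2)" for n i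
  define \<tau> where "\<tau> n i = expectation (\<lambda>s. \<bar>\<xi> n i s\<bar> ^ 3)" for n i
  have [simp]: "\<sigma> n i \<ge> 0" for n i by (simp add: \<sigma>_def)
  have meas: "\<xi> n i \<in> borel_measurable M" if "i \<in> I n" for n i
    using indep[of n] that unfolding indep_vars_def by auto
  define \<phi> where "\<phi> n i = char (distr M borel (\<xi> n i)) t" for n i
  define e where "e n i = complex_of_real (exp (- (t\<^sup>2 * \<sigma> n i / 2)))" for n i
  have step: "cmod (\<phi> n i - e n i) \<le> \<bar>t\<bar>^3 / 6 * \<tau> n i + t^4 / 4 * (\<beta> n * \<sigma> n i)"
    if i: "i \<in> I n" and b: "\<sigma> n i \<le> \<beta> n" for n i
  proof -
    note [measurable] = meas[OF i]
    have "cmod (\<phi> n i - (1 - t\<^sup>2 * \<sigma> n i / 2)) \<le>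
        t\<^sup>2 / 6 * expectation (\<lambda>s. min (6 * (\<xi> n i s)\<^sup>2) (\<bar>t\<bar> * \<bar>\<xi> n i s\<bar> ^ 3))"
      unfolding \<phi>_def \<sigma>_def
      using square_integrable_imp_integrable[OF meas[OF i] int2[OF i]] int2[OF i] mean[OF i]
      by (intro char_approx3') auto
    also have "\<dots> \<le> t\<^sup>2 / 6 * expectation (\<lambda>s. \<bar>t\<bar> * \<bar>\<xi> n i s\<bar> ^ 3)"
      using int3[OF i] int2[OF i] by (intro mult_left_mono integral_mono) auto
    also have "\<dots> = \<bar>t\<bar>^3 / 6 * \<tau> n i"
      by (simp add: \<tau>_def power2_eq_square power3_eq_cube)
    finally have 1: "cmod (\<phi> n i - (1 - t\<^sup>2 * \<sigma> n i / 2)) \<le> \<bar>t\<bar>^3 / 6 * \<tau> n i" .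
    have "cmod ((1 - t\<^sup>2 * \<sigma> n i / 2) - e n i) = \<bar>(1 - t\<^sup>2 * \<sigma> n i / 2) - exp (- (t\<^sup>2 * \<sigma> n i / 2))\<bar>"
    proof -
      have "(1 - t\<^sup>2 * \<sigma> n i / 2) - e n i =
          complex_of_real ((1 - t\<^sup>2 * \<sigma> n i / 2) - exp (- (t\<^sup>2 * \<sigma> n i / 2)))"
        by (simp add: e_def)
      then show ?thesis by (simp only: norm_of_real)
    qed
    also have "\<dots> \<le> (t\<^sup>2 * \<sigma> n i / 2)\<^sup>2"
      by (intro exp_minus_quadratic_bound) simp
    also have "\<dots> = t^4 / 4 * (\<sigma> n i * \<sigma> n i)"
      by (simp add: power2_eq_square power4_eq_xxxx)
    also have "\<dots> \<le> t^4 / 4 * (\<beta> n * \<sigma> n i)"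
      using b by (intro mult_left_mono mult_right_mono) auto
    finally show ?thesis
      using 1 norm_triangle_ineq[of "\<phi> n i - (1 - t\<^sup>2 * \<sigma> n i / 2)" "(1 - t\<^sup>2 * \<sigma> n i / 2) - e n i"] by simp
  qed
  have "(\<lambda>n. \<bar>t\<bar>^3 / 6 * (\<Sum>i\<in>I n. \<tau> n i) + t^4 / 4 * (\<beta> n * (\<Sum>i\<in>I n. \<sigma> n i))) \<longlonglongrightarrow>
      \<bar>t\<bar>^3 / 6 * 0 + t^4 / 4 * (0 * v)"
    unfolding \<sigma>_def \<tau>_def by (intro tendsto_intros third var \<beta>)
  then have lim0: "(\<lambda>n. \<bar>t\<bar>^3 / 6 * (\<Sum>i\<in>I n. \<tau> n i) + t^4 / 4 * (\<beta> n * (\<Sum>i\<in>I n. \<sigma> n i))) \<longlonglongrightarrow> 0"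
    by simp
  have prod_diff: "\<forall>\<^sub>F n in sequentially. cmod ((\<Prod>i\<in>I n. \<phi> n i) - (\<Prod>i\<in>I n. e n i)) \<le>
      \<bar>t\<bar>^3 / 6 * (\<Sum>i\<in>I n. \<tau> n i) + t^4 / 4 * (\<beta> n * (\<Sum>i\<in>I n. \<sigma> n i))"
    using neglig
  proof eventually_elim
    case (elim n)
    have "cmod ((\<Prod>i\<in>I n. \<phi> n i) - (\<Prod>i\<in>I n. e n i)) \<le> (\<Sum>i\<in>I n. cmod (\<phi> n i - e n i))"
    proof (rule norm_prod_diff)
      fix i assume i: "i \<in> I n"
      show "cmod (\<phi> n i) \<le> 1" unfolding \<phi>_def
        by (intro real_distribution.cmod_char_le_1 real_distribution_distr meas i)
      show "cmod (e n i) \<le> 1" unfolding e_def by simp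
    qed
    also have "\<dots> \<le> (\<Sum>i\<in>I n. \<bar>t\<bar>^3 / 6 * \<tau> n i + t^4 / 4 * (\<beta> n * \<sigma> n i))"
      using elim by (intro sum_mono step) (auto simp: \<sigma>_def)
    finally show ?case by (simp add: sum.distrib sum_distrib_left)
  qed
  have "(\<lambda>n. (\<Prod>i\<in>I n. \<phi> n i) - (\<Prod>i\<in>I n. e n i)) \<longlonglongrightarrow> 0"
    by (rule Lim_null_comparison[OF prod_diff lim0])
  moreover have "(\<Prod>i\<in>I n. \<phi> n i) = char (distr M borel (\<lambda>s. \<Sum>i\<in>I n. \<xi> n i s)) t" for n
    unfolding \<phi>_def by (rule char_distr_sum[OF indep, symmetric])
  moreover have "(\<Prod>i\<in>I n. e n i) = complex_of_real (exp (- (t\<^sup>2 * (\<Sum>i\<in>I n. \<sigma> n i) / 2)))" for n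
    unfolding e_def of_real_prod[symmetric]
    by (simp add: exp_sum[OF fin, symmetric] sum_negf sum_distrib_left sum_divide_distrib)
  moreover have "(\<lambda>n. complex_of_real (exp (- (t\<^sup>2 * (\<Sum>i\<in>I n. \<sigma> n i) / 2)))) \<longlonglongrightarrow>
      complex_of_real (exp (- (t\<^sup>2 * v / 2)))"
    unfolding \<sigma>_def by (intro tendsto_intros var) auto
  ultimately have "(\<lambda>n. char (distr M borel (\<lambda>s. \<Sum>i\<in>I n. \<xi> n i s)) t) \<longlonglongrightarrow>
      complex_of_real (exp (- (t\<^sup>2 * v / 2)))"
    by (simp only:) (rule Lim_transform)
  then show ?thesis .
qed

end

section \<open>The normal law, including its degenerate case\<close>

lemma normal_law_distr:
  assumes "v > 0"
  shows "normal_law \<mu> v = distr std_normal_distribution borel (\<lambda>x. \<mu> + sqrt v * x)"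
proof -
  interpret prob_space std_normal_distribution
    by (rule prob_space_normal_density) simp
  have "distributed std_normal_distribution lborel (\<lambda>x. x) std_normal_density"
    unfolding distributed_def by (auto simp: distr_id2)
  then have "distributed std_normal_distribution lborel (\<lambda>x. \<mu> + sqrt v * x)
      (normal_density (\<mu> + sqrt v * 0) (\<bar>sqrt v\<bar> * 1))"
    by (rule normal_density_affine) (use assms in auto)
  then have "distr std_normal_distribution lborel (\<lambda>x. \<mu> + sqrt v * x) = density lborel (normal_density \<mu> (sqrt v))"
    using assms by (simp add: distributed_def)
  moreover have "distr std_normal_distribution lborel (\<lambda>x. \<mu> + sqrt v * x) =
      distr std_normal_distribution borel (\<lambda>x. \<mu> + sqrt v * x)"
    by (rule distr_cong) auto
  ultimately show ?thesis using assms by (simp add: normal_law_def)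
qed

lemma real_distribution_normal_law:
  assumes "v \<ge> 0"
  shows "real_distribution (normal_law \<mu> v)"
proof (cases "v = 0")
  case True
  then show ?thesis
    by (simp add: normal_law_def real_distribution_def real_distribution_axioms_def prob_space_return)
next
  case False
  interpret prob_space std_normal_distribution
    by (rule prob_space_normal_density) simp
  show ?thesis
    using False assms by (subst normal_law_distr) (auto intro!: real_distribution_distr)
qed

lemma char_normal_law:
  assumes "v \<ge> 0"
  shows "char (normal_law \<mu> v) t = complex_of_real (exp (- (t\<^sup>2 * v / 2))) * iexp (t * \<mu>)"
proof (cases "v = 0")
  case True
  then show ?thesis by (simp add: normal_law_def char_def integral_return)
next
  case False
  interpret prob_space std_normal_distribution
    by (rule prob_space_normal_density) simp
  have "char (normal_law \<mu> v) t = (CLINT x|std_normal_distribution. iexp (t * (\<mu> + sqrt v * x)))"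
    using False assms by (subst normal_law_distr) (auto simp: char_def integral_distr)
  also have "\<dots> = (CLINT x|std_normal_distribution. iexp (t * \<mu>) * iexp ((t * sqrt v) * x))"
    by (simp add: distrib_left exp_add mult.assoc)
  also have "\<dots> = iexp (t * \<mu>) * char std_normal_distribution (t * sqrt v)"
    by (simp add: char_def)
  also have "char std_normal_distribution (t * sqrt v) = exp (- (t\<^sup>2 * v / 2))"
  proof -
    have "(t * sqrt v)\<^sup>2 = t\<^sup>2 * v" using assms by (simp add: power_mult_distrib)
    then show ?thesis by (simp only: char_std_normal_distribution) (simp flip: exp_of_real)
  qed
  finally show ?thesis by simp
qed

section \<open>Logarithmic excesses of uniform variables\<close>

text \<open>For a uniform \<open>x\<close>, \<open>- ln x\<close> is standard exponential and
  \<open>ln (a / x)\<close> is its excess over \<open>- ln a\<close>. Exponent 0 gives the indicator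
  of \<open>x \<le> a\<close>, so exceedance counts and log-excesses belong to one family.\<close>

definition tail_log :: "nat \<Rightarrow> real \<Rightarrow> real \<Rightarrow> real" where
  "tail_log q a x = (if x \<le> a then ln (a / x) ^ q else 0)"

lemma tail_log_measurable [measurable]:
  "(\<lambda>z. tail_log q (f z) (g z)) \<in> borel_measurable N"
  if [measurable]: "f \<in> borel_measurable N" "g \<in> borel_measurable N"
  unfolding tail_log_def by measurable

lemma tail_log_nonneg: "x \<ge> 0 \<Longrightarrow> 0 \<le> tail_log q a x"
  by (cases "x = 0") (auto simp: tail_log_def intro!: zero_le_power ln_ge_zero)

lemma tail_log_zero: "tail_log 0 a x = indicator {..a} x"
  by (simp add: tail_log_def indicator_def)

text \<open>Layer-cake formula by the fundamental theorem of calculus: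
  \<open>ln (a * u / x) ^ Suc q\<close> vanishes at \<open>u = x / a\<close> and has derivative
  \<open>Suc q * ln (a * u / x) ^ q / u\<close>. The exponent drops by one at the price of scaling
  the threshold.\<close>

lemma tail_log_layers:
  assumes "x > 0" "a > 0"
  shows "(\<integral>\<^sup>+u. ennreal (real (Suc q) * tail_log q (a * u) x / u) * indicator {0<..1} u \<partial>lborel)
    = ennreal (tail_log (Suc q) a x)"
proof -
  have cond: "x \<le> a * u \<longleftrightarrow> x / a \<le> u" for u using assms by (simp add: field_simps)
  have "x / a > 0" using assms by simp
  then have pos: "x / a \<le> u \<Longrightarrow> u > 0" for u by linarith
  have eq: "ennreal (real (Suc q) * tail_log q (a * u) x / u) * indicator {0<..1} u =
      ennreal (real (Suc q) * ln (a * u / x) ^ q / u) * indicator {x/a..1} u" for u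
    using cond[of u] pos[of u] by (auto simp: tail_log_def indicator_def)
  show ?thesis
  proof (cases "x \<le> a")
    case True
    have "(\<integral>\<^sup>+u. ennreal (real (Suc q) * ln (a * u / x) ^ q / u) * indicator {x/a..1} u \<partial>lborel)
      = ennreal (ln (a * 1 / x) ^ Suc q - ln (a * (x/a) / x) ^ Suc q)"
    proof (rule nn_integral_FTC_Icc)
      fix u assume "u \<in> {x / a..1}"
      then have "x / a \<le> u" "u \<le> 1" by auto
      moreover have "x / a > 0" using assms by simp
      ultimately have u: "u > 0" "a * u / x \<ge> 1" using assms by (linarith, simp add: field_simps)
      show "((\<lambda>u. ln (a * u / x) ^ Suc q) has_real_derivative real (Suc q) * ln (a * u / x) ^ q / u) (at u)"
      proof -
        have "((\<lambda>u. ln (a * u / x)) has_real_derivative 1 / u) (at u)"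
          using u assms by (auto intro!: derivative_eq_intros simp: field_simps)
        from DERIV_power[OF this, of "Suc q"] show ?thesis by (simp add: algebra_simps)
      qed
      show "0 \<le> real (Suc q) * ln (a * u / x) ^ q / u"
        using u by auto
    qed (use assms True in auto)
    then show ?thesis
      unfolding eq using True assms by (simp add: tail_log_def)
  next
    case False
    then have "x / a > 1" using assms by simp
    then show ?thesis unfolding eq using False by (simp add: tail_log_def)
  qed
qed

text \<open>Both thresholds are scaled by the same \<open>u\<close>, and the product rule splits the
  derivative into the two mixed terms. At the lower limit \<open>max (x / a) (y / b)\<close> one of
  the logarithms is 0. Scaling both at once is what later lets the homogeneity of the tail copula
  act.\<close>

lemma tail_log_product_layers:
  assumes "x > 0" "a > 0" "y > 0" "b > 0"
  shows "(\<integral>\<^sup>+u. ennreal ((tail_log 0 (a * u) x * tail_log 1 (b * u) y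
        + tail_log 1 (a * u) x * tail_log 0 (b * u) y) / u) * indicator {0<..1} u \<partial>lborel)
    = ennreal (tail_log 1 a x * tail_log 1 b y)"
proof -
  define l where "l = max (x / a) (y / b)"
  have l: "l > 0" using assms by (simp add: l_def less_max_iff_disj)
  have cond: "x \<le> a * u \<longleftrightarrow> x / a \<le> u" "y \<le> b * u \<longleftrightarrow> y / b \<le> u" for u
    using assms by (simp_all add: field_simps)
  have eq: "ennreal ((tail_log 0 (a * u) x * tail_log 1 (b * u) y
        + tail_log 1 (a * u) x * tail_log 0 (b * u) y) / u) * indicator {0<..1} u =
      ennreal ((ln (a * u / x) + ln (b * u / y)) / u) * indicator {l..1} u" for u
    using cond[of u] l by (auto simp: tail_log_def indicator_def l_def add.commute)
  show ?thesis
  proof (cases "l \<le> 1")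
    case True
    have "(\<integral>\<^sup>+u. ennreal ((ln (a * u / x) + ln (b * u / y)) / u) * indicator {l..1} u \<partial>lborel)
      = ennreal (ln (a * 1 / x) * ln (b * 1 / y) - ln (a * l / x) * ln (b * l / y))"
    proof (rule nn_integral_FTC_Icc[where F = "\<lambda>u. ln (a * u / x) * ln (b * u / y)"])
      fix u assume "u \<in> {l..1}"
      then have u: "l \<le> u" "u \<le> 1" by auto
      have u0: "u > 0" using l u by simp
      have u1: "a * u / x \<ge> 1" "b * u / y \<ge> 1"
        using cond[of u] u assms by (auto simp: l_def field_simps)
      show "((\<lambda>u. ln (a * u / x) * ln (b * u / y)) has_real_derivative
          (ln (a * u / x) + ln (b * u / y)) / u) (at u)"
        using u0 assms by (auto intro!: derivative_eq_intros simp: field_simps)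
      show "0 \<le> (ln (a * u / x) + ln (b * u / y)) / u"
        using u0 u1 by auto
    qed (use True in auto)
    also have "ln (a * l / x) * ln (b * l / y) = 0"
      using assms by (auto simp: l_def max_def)
    finally show ?thesis
      unfolding eq using True assms by (simp add: tail_log_def l_def)
  next
    case False
    then have "x > a \<or> y > b" using assms by (auto simp: l_def)
    then show ?thesis unfolding eq using False by (auto simp: tail_log_def)
  qed
qed

lemma power_deficit_layers:
  assumes "x > 0" "a > 0" "r > 0"
  shows "(\<integral>\<^sup>+u. ennreal (r * u powr (r - 1) * indicator {..a * u} x) * indicator {0<..1} u \<partial>lborel)
    = ennreal ((1 - (x / a) powr r) * indicator {..a} x)"
proof -
  have cond: "x \<le> a * u \<longleftrightarrow> x / a \<le> u" for u using assms by (simp add: field_simps)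
  have "x / a > 0" using assms by simp
  then have pos: "x / a \<le> u \<Longrightarrow> u > 0" for u by linarith
  have eq: "ennreal (r * u powr (r - 1) * indicator {..a * u} x) * indicator {0<..1} u =
      ennreal (r * u powr (r - 1)) * indicator {x/a..1} u" for u
    using cond[of u] pos[of u] by (auto simp: indicator_def)
  show ?thesis
  proof (cases "x \<le> a")
    case True
    have "(\<integral>\<^sup>+u. ennreal (r * u powr (r - 1)) * indicator {x/a..1} u \<partial>lborel)
      = ennreal (1 powr r - (x/a) powr r)"
    proof (rule nn_integral_FTC_Icc)
      fix u assume "u \<in> {x / a..1}"
      then have "x / a \<le> u" "u \<le> 1" by auto
      moreover have "x / a > 0" using assms by simp
      ultimately have u: "u > 0" by linarith
      show "((\<lambda>u. u powr r) has_real_derivative r * u powr (r - 1)) (at u)"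
        using u by (rule has_real_derivative_powr)
    qed (use assms True in auto)
    then show ?thesis
      unfolding eq using True assms by simp
  next
    case False
    then have "x / a > 1" using assms by simp
    then show ?thesis unfolding eq using False by simp
  qed
qed

lemma nn_integral_powr_unit:
  fixes r :: real
  assumes "r > 0"
  shows "(\<integral>\<^sup>+u. ennreal (r * u powr r) * indicator {0<..1} u \<partial>lborel) = ennreal (r / (r + 1))"
proof -
  have "((\<lambda>u. r * u powr r) has_integral r * (1 powr (r + 1) / (r + 1))) {0..1}"
    by (intro has_integral_mult_right has_integral_powr_from_0) (use assms in auto)
  then have hi: "((\<lambda>u. r * u powr r) has_integral r / (r + 1)) {0..1}" by simp
  have "(\<integral>\<^sup>+u. ennreal (r * u powr r) * indicator {0<..1} u \<partial>lborel)
     = (\<integral>\<^sup>+u. ennreal (if u \<in> {0..1} then r * u powr r else 0) \<partial>lborel)"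
    by (intro nn_integral_cong) (use assms in \<open>auto simp: indicator_def not_less\<close>)
  also have "\<dots> = ennreal (r / (r + 1))"
  proof (rule nn_integral_has_integral_lborel)
    show "((\<lambda>u. if u \<in> {0..1} then r * u powr r else 0) has_integral r / (r + 1)) UNIV"
      using hi by (simp only: has_integral_restrict_UNIV)
  qed (use assms in auto)
  finally show ?thesis .
qed

context prob_space
begin

text \<open>Continuity makes \<open>F\<close> take every value in the open unit interval, but not
  injectively. With \<open>F x = 1 - u\<close> the event contains \<open>X > x\<close>; flat
  stretches of \<open>F\<close> may make it strictly larger, so the upper bound goes through every
  \<open>v > u\<close>.\<close>

lemma survival_uniform:
  fixes X :: "'a \<Rightarrow> real"
  assumes [measurable]: "X \<in> borel_measurable M"
    and F: "F = cdf (distr M borel X)" and cont: "continuous_on UNIV F"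
    and u: "0 \<le> u" "u \<le> 1"
  shows "prob {s\<in>space M. survival F (X s) \<le> u} = u"
proof -
  interpret D: real_distribution "distr M borel X" by (rule real_distribution_distr) simp
  have Fprob: "F x = prob {s\<in>space M. X s \<le> x}" for x
    unfolding F cdf_def by (subst measure_distr) (auto intro!: arg_cong[where f = prob])
  have [measurable]: "F \<in> borel_measurable borel"
    by (rule borel_measurable_mono) (auto simp: F mono_def D.cdf_nondecreasing)
  have mono: "x \<le> y \<Longrightarrow> F x \<le> F y" for x y by (simp add: F D.cdf_nondecreasing)
  have ivt: "\<exists>x. F x = v" if "0 < v" "v < 1" for v
  proof -
    have "\<forall>\<^sub>F x in at_bot. F x < v" "\<forall>\<^sub>F x in at_top. v < F x"
      unfolding F using that
      by (auto intro: order_tendstoD[OF D.cdf_lim_at_bot] order_tendstoD[OF D.cdf_lim_at_top_prob])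
    then obtain a b where ab: "\<And>x. x \<le> a \<Longrightarrow> F x < v" "\<And>x. x \<ge> b \<Longrightarrow> v < F x"
      unfolding eventually_at_bot_linorder eventually_at_top_linorder by blast
    have "\<exists>x\<ge>min a b. x \<le> b \<and> F x = v"
      using ab(1)[of "min a b"] ab(2)[of b] cont
      by (intro IVT') (auto intro: continuous_on_subset)
    then show ?thesis by blast
  qed
  have tail: "prob {s\<in>space M. X s > x} = 1 - F x" for x
  proof -
    have "{s\<in>space M. X s > x} = space M - {s\<in>space M. X s \<le> x}" by auto
    then show ?thesis by (simp add: prob_compl Fprob)
  qed
  have lower: "u \<le> prob {s\<in>space M. survival F (X s) \<le> u}" if u': "0 < u" "u < 1"
  proof -
    obtain x where x: "F x = 1 - u" using ivt[of "1 - u"] u' by auto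
    have "survival F (X s) \<le> u" if "X s > x" for s
      using mono[of x "X s"] that x by (simp add: survival_def)
    then have "1 - F x \<le> prob {s\<in>space M. survival F (X s) \<le> u}"
      unfolding tail[symmetric] by (intro finite_measure_mono) (auto simp: survival_def)
    then show ?thesis using x by simp
  qed
  have upper: "prob {s\<in>space M. survival F (X s) \<le> u} \<le> v" if v: "u < v" "v < 1" for v
  proof -
    obtain x where x: "F x = 1 - v" using ivt[of "1 - v"] v u by auto
    have "X s > x" if "survival F (X s) \<le> u" for s
    proof (rule ccontr)
      assume "\<not> X s > x"
      then have "F (X s) \<le> F x" by (intro mono) simp
      then show False using that x \<open>u < v\<close> by (simp add: survival_def)
    qed
    then have "prob {s\<in>space M. survival F (X s) \<le> u} \<le> 1 - F x"
      unfolding tail[symmetric] by (intro finite_measure_mono) (auto simp: survival_def)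
    then show ?thesis using x by simp
  qed
  show ?thesis
  proof (cases "u = 1")
    case True
    have "F x \<ge> 0" for x by (simp add: Fprob)
    then show ?thesis using True by (simp add: survival_def prob_space)
  next
    case False
    then have "u < 1" using u by simp
    then have "prob {s\<in>space M. survival F (X s) \<le> u} \<le> u"
      using upper by (intro dense_ge_bounded[of u 1]) auto
    moreover have "u \<le> prob {s\<in>space M. survival F (X s) \<le> u}"
      using lower \<open>u < 1\<close> u by (cases "u = 0") auto
    ultimately show ?thesis by simp
  qed
qed

end

locale uniform_rv = prob_space +
  fixes V :: "'a \<Rightarrow> real"
  assumes V_measurable [measurable]: "V \<in> borel_measurable M"
    and V_nonneg: "V s \<ge> 0"
    and V_uniform: "0 \<le> u \<Longrightarrow> u \<le> 1 \<Longrightarrow> prob {s\<in>space M. V s \<le> u} = u"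
begin

lemma V_pos: "AE s in M. V s > 0"
proof -
  have "prob {s\<in>space M. V s \<le> 0} = 0" using V_uniform[of 0] by simp
  then have "AE s in M. \<not> V s \<le> 0"
    by (subst (asm) prob_eq_0) (auto simp: not_le)
  then show ?thesis by eventually_elim simp
qed

lemma emeasure_V_le: "0 \<le> u \<Longrightarrow> u \<le> 1 \<Longrightarrow> emeasure M {s\<in>space M. V s \<le> u} = ennreal u"
  by (simp add: emeasure_eq_measure V_uniform)

text \<open>Conditionally on \<open>V \<le> a\<close> the log-excess is standard exponential, whence
  the factorials. The induction uses the layer formula; the factor \<open>u\<close> from the scaled
  threshold cancels the \<open>1 / u\<close> of the layers.\<close>

lemma nn_integral_tail_log:
  assumes "0 < a" "a \<le> 1"
  shows "(\<integral>\<^sup>+s. ennreal (tail_log q a (V s)) \<partial>M) = ennreal (fact q * a)"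
  using assms
proof (induction q arbitrary: a)
  case 0
  have "(\<integral>\<^sup>+s. ennreal (tail_log 0 a (V s)) \<partial>M) = (\<integral>\<^sup>+s. indicator {s\<in>space M. V s \<le> a} s \<partial>M)"
    by (intro nn_integral_cong) (auto simp: tail_log_def indicator_def)
  then show ?case using 0 by (simp add: emeasure_V_le)
next
  case (Suc q)
  interpret P: pair_sigma_finite M lborel ..
  have "(\<integral>\<^sup>+s. ennreal (tail_log (Suc q) a (V s)) \<partial>M) =
      (\<integral>\<^sup>+s. (\<integral>\<^sup>+u. ennreal (real (Suc q) * tail_log q (a * u) (V s) / u) * indicator {0<..1} u \<partial>lborel) \<partial>M)"
    using V_pos Suc.prems
    by (intro nn_integral_cong_AE) (auto elim!: eventually_mono simp: tail_log_layers simp del: of_nat_Suc)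
  also have "\<dots> = (\<integral>\<^sup>+u. (\<integral>\<^sup>+s. ennreal (real (Suc q) * tail_log q (a * u) (V s) / u) * indicator {0<..1} u \<partial>M) \<partial>lborel)"
    by (rule P.Fubini'[symmetric]) measurable
  also have "\<dots> = (\<integral>\<^sup>+u. ennreal (fact (Suc q) * a) * indicator {0<..1::real} u \<partial>lborel)"
  proof (intro nn_integral_cong)
    fix u :: real
    show "(\<integral>\<^sup>+s. ennreal (real (Suc q) * tail_log q (a * u) (V s) / u) * indicator {0<..1} u \<partial>M) =
        ennreal (fact (Suc q) * a) * indicator {0<..1} u"
    proof (cases "u \<in> {0<..1}")
      case True
      have "(\<integral>\<^sup>+s. ennreal (real (Suc q) * tail_log q (a * u) (V s) / u) * indicator {0<..1} u \<partial>M) =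
          (\<integral>\<^sup>+s. ennreal (real (Suc q) / u) * ennreal (tail_log q (a * u) (V s)) \<partial>M)"
        using True V_nonneg
        by (intro nn_integral_cong) (auto simp: ennreal_mult[symmetric] tail_log_nonneg simp del: of_nat_Suc)
      also have "\<dots> = ennreal (real (Suc q) / u) * ennreal (fact q * (a * u))"
        using True Suc.prems by (subst nn_integral_cmult) (auto simp: Suc.IH mult_le_one)
      also have "\<dots> = ennreal (fact (Suc q) * a)"
        proof -
          have "real (Suc q) / u * (fact q * (a * u)) = fact (Suc q) * a"
            using True by (simp add: field_simps)
          then show ?thesis
            using True Suc.prems by (subst ennreal_mult[symmetric]) (auto simp del: of_nat_Suc)
        qed
      finally show ?thesis using True by simp
    qed simp
  qed
  also have "\<dots> = ennreal (fact (Suc q) * a)"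
    by (subst nn_integral_cmult) auto
  finally show ?case .
qed

lemma integrable_tail_log [simp]:
  assumes "0 < a" "a \<le> 1"
  shows "integrable M (\<lambda>s. tail_log q a (V s))"
  using assms V_nonneg
  by (intro integrableI_nonneg) (auto simp: tail_log_nonneg nn_integral_tail_log)

lemma expectation_tail_log:
  assumes "0 < a" "a \<le> 1"
  shows "expectation (\<lambda>s. tail_log q a (V s)) = fact q * a"
  using assms V_nonneg
  by (intro integral_eq_nn_integral[THEN trans]) (auto simp: tail_log_nonneg nn_integral_tail_log)

text \<open>With \<open>r = - \<rho>\<close> the factor \<open>1 / (r + 1)\<close> becomes the
  \<open>1 / (1 - \<rho>)\<close> of the asymptotic bias. The complement
  \<open>1 - (V / a) powr r\<close> is integrated instead, because it vanishes at the threshold and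
  so has a layer formula.\<close>

lemma expectation_power_deficit:
  assumes "0 < a" "a \<le> 1" "r > 0"
  shows "integrable M (\<lambda>s. (V s / a) powr r * indicator {..a} (V s))"
    and "expectation (\<lambda>s. (V s / a) powr r * indicator {..a} (V s)) = a / (r + 1)"
proof -
  interpret P: pair_sigma_finite M lborel ..
  have bnd: "(V s / a) powr r * indicator {..a} (V s) \<le> 1" for s
    using V_nonneg[of s] assms powr_mono2[of r "V s / a" 1] by (auto simp: indicator_def)
  show int: "integrable M (\<lambda>s. (V s / a) powr r * indicator {..a} (V s))"
    by (rule integrable_const_bound[of _ 1]) (use bnd in auto)
  have nn: "(\<integral>\<^sup>+s. ennreal ((1 - (V s / a) powr r) * indicator {..a} (V s)) \<partial>M) = ennreal (a * (r / (r + 1)))"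
  proof -
    have "(\<integral>\<^sup>+s. ennreal ((1 - (V s / a) powr r) * indicator {..a} (V s)) \<partial>M) =
      (\<integral>\<^sup>+s. (\<integral>\<^sup>+u. ennreal (r * u powr (r - 1) * indicator {..a * u} (V s)) * indicator {0<..1} u \<partial>lborel) \<partial>M)"
      using V_pos assms
      by (intro nn_integral_cong_AE) (auto elim!: eventually_mono simp: power_deficit_layers)
    also have "\<dots> = (\<integral>\<^sup>+u. (\<integral>\<^sup>+s. ennreal (r * u powr (r - 1) * indicator {..a * u} (V s)) * indicator {0<..1} u \<partial>M) \<partial>lborel)"
    proof (rule P.Fubini'[symmetric])
      have "(\<lambda>(s, u). ennreal (r * u powr (r - 1) * (if V s \<le> a * u then 1 else 0)) * indicator {0<..1} u)
          \<in> borel_measurable (M \<Otimes>\<^sub>M lborel)" by measurable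
      then show "(\<lambda>(s, u). ennreal (r * u powr (r - 1) * indicator {..a * u} (V s)) * indicator {0<..1} u)
          \<in> borel_measurable (M \<Otimes>\<^sub>M lborel)" by (simp add: indicator_def of_bool_def)
    qed
    also have "\<dots> = (\<integral>\<^sup>+u. ennreal a * (ennreal (r * u powr r) * indicator {0<..1} u) \<partial>lborel)"
    proof (intro nn_integral_cong)
      fix u :: real
      show "(\<integral>\<^sup>+s. ennreal (r * u powr (r - 1) * indicator {..a * u} (V s)) * indicator {0<..1} u \<partial>M) =
          ennreal a * (ennreal (r * u powr r) * indicator {0<..1} u)"
      proof (cases "u \<in> {0<..1}")
        case True
        have "(\<integral>\<^sup>+s. ennreal (r * u powr (r - 1) * indicator {..a * u} (V s)) * indicator {0<..1} u \<partial>M) =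
            (\<integral>\<^sup>+s. ennreal (r * u powr (r - 1)) * ennreal (tail_log 0 (a * u) (V s)) \<partial>M)"
          using True assms
          by (intro nn_integral_cong) (auto simp: tail_log_def indicator_def)
        also have "\<dots> = ennreal (r * u powr (r - 1)) * ennreal (a * u)"
          using True assms by (subst nn_integral_cmult) (auto simp: nn_integral_tail_log mult_le_one)
        also have "\<dots> = ennreal (a * (r * u powr r))"
          using True assms by (subst ennreal_mult[symmetric]) (auto simp: powr_diff)
        finally show ?thesis using True assms by (simp add: ennreal_mult)
      qed simp
    qed
    also have "\<dots> = ennreal a * ennreal (r / (r + 1))"
      by (subst nn_integral_cmult) (auto simp: nn_integral_powr_unit assms)
    finally show ?thesis using assms by (simp add: ennreal_mult[symmetric])
  qed
  have "expectation (\<lambda>s. (1 - (V s / a) powr r) * indicator {..a} (V s)) = a * (r / (r + 1))"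
  proof (subst integral_eq_nn_integral)
    show "AE s in M. 0 \<le> (1 - (V s / a) powr r) * indicator {..a} (V s)"
    proof (rule AE_I2)
      fix s
      show "0 \<le> (1 - (V s / a) powr r) * indicator {..a} (V s)"
        using bnd[of s] by (cases "V s \<le> a") auto
    qed
  qed (use assms nn in auto)
  moreover have "expectation (\<lambda>s. (1 - (V s / a) powr r) * indicator {..a} (V s)) =
      expectation (\<lambda>s. tail_log 0 a (V s) - (V s / a) powr r * indicator {..a} (V s))"
    by (simp add: tail_log_zero algebra_simps)
  moreover have "\<dots> = a - expectation (\<lambda>s. (V s / a) powr r * indicator {..a} (V s))"
    using assms int by (subst Bochner_Integration.integral_diff) (auto simp: expectation_tail_log)
  ultimately have "expectation (\<lambda>s. (V s / a) powr r * indicator {..a} (V s)) = a - a * (r / (r + 1))"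
    by linarith
  also have "\<dots> = a / (r + 1)"
    using assms by (simp add: field_simps)
  finally show "expectation (\<lambda>s. (V s / a) powr r * indicator {..a} (V s)) = a / (r + 1)" .
qed

end


section \<open>Tail dependence of a pair of uniform variables\<close>

locale uniform_pair = prob_space M + V: uniform_rv M V + W: uniform_rv M W
  for M :: "'a measure" and V W :: "'a \<Rightarrow> real"
begin

text \<open>For the survival transforms of two margins this is \<open>survival_copula\<close> at
  real arguments.\<close>

definition joint :: "real \<Rightarrow> real \<Rightarrow> real" where
  "joint x y = prob {s\<in>space M. V s \<le> x \<and> W s \<le> y}"

lemma joint_nonneg: "0 \<le> joint x y"
  by (simp add: joint_def)

lemma joint_le:
  assumes "0 \<le> x" "x \<le> 1" "0 \<le> y" "y \<le> 1"
  shows "joint x y \<le> x" "joint x y \<le> y"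
proof -
  have "joint x y \<le> prob {s\<in>space M. V s \<le> x}" "joint x y \<le> prob {s\<in>space M. W s \<le> y}"
    unfolding joint_def by (auto intro!: finite_measure_mono)
  then show "joint x y \<le> x" "joint x y \<le> y"
    using assms V.V_uniform W.V_uniform by auto
qed

lemma joint_mono: "x \<le> x' \<Longrightarrow> y \<le> y' \<Longrightarrow> joint x y \<le> joint x' y'"
  unfolding joint_def by (auto intro!: finite_measure_mono)

lemma joint_measurable [measurable]:
  assumes [measurable]: "f \<in> borel_measurable borel" "g \<in> borel_measurable borel"
  shows "(\<lambda>w. joint (f w) (g w)) \<in> borel_measurable (borel :: real measure)"
proof -
  have "(\<lambda>w. emeasure M {s\<in>space M. V s \<le> f w \<and> W s \<le> g w}) \<in> borel_measurable (borel :: real measure)"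
    by measurable
  then show ?thesis
    unfolding joint_def measure_def by measurable
qed

text \<open>Uniform margins make the joint tail 1-Lipschitz in each argument. The pointwise tail
  copula limit can therefore be used at converging arguments as well.\<close>

lemma joint_lipschitz:
  assumes "0 \<le> x" "x \<le> 1" "0 \<le> y" "y \<le> 1" "0 \<le> x'" "x' \<le> 1" "0 \<le> y'" "y' \<le> 1"
  shows "\<bar>joint x y - joint x' y'\<bar> \<le> \<bar>x - x'\<bar> + \<bar>y - y'\<bar>"
proof -
  have fst_step: "joint x2 y \<le> joint x1 y + (x2 - x1)" if "x1 \<le> x2" "0 \<le> x1" "x2 \<le> 1" for x1 x2 y
  proof -
    have "joint x2 y \<le> prob ({s\<in>space M. V s \<le> x1 \<and> W s \<le> y} \<union> ({s\<in>space M. V s \<le> x2} - {s\<in>space M. V s \<le> x1}))"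
      unfolding joint_def by (intro finite_measure_mono) auto
    also have "\<dots> \<le> joint x1 y + prob ({s\<in>space M. V s \<le> x2} - {s\<in>space M. V s \<le> x1})"
      unfolding joint_def by (intro measure_Un_le) auto
    also have "prob ({s\<in>space M. V s \<le> x2} - {s\<in>space M. V s \<le> x1}) = x2 - x1"
      using that V.V_uniform by (subst finite_measure_Diff) auto
    finally show ?thesis by simp
  qed
  have snd_step: "joint x y2 \<le> joint x y1 + (y2 - y1)" if "y1 \<le> y2" "0 \<le> y1" "y2 \<le> 1" for y1 y2 x
  proof -
    have "joint x y2 \<le> prob ({s\<in>space M. V s \<le> x \<and> W s \<le> y1} \<union> ({s\<in>space M. W s \<le> y2} - {s\<in>space M. W s \<le> y1}))"
      unfolding joint_def by (intro finite_measure_mono) auto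
    also have "\<dots> \<le> joint x y1 + prob ({s\<in>space M. W s \<le> y2} - {s\<in>space M. W s \<le> y1})"
      unfolding joint_def by (intro measure_Un_le) auto
    also have "prob ({s\<in>space M. W s \<le> y2} - {s\<in>space M. W s \<le> y1}) = y2 - y1"
      using that W.V_uniform by (subst finite_measure_Diff) auto
    finally show ?thesis by simp
  qed
  have 1: "\<bar>joint x y - joint x' y\<bar> \<le> \<bar>x - x'\<bar>"
    using fst_step[of x x' y] fst_step[of x' x y] joint_mono[of x x' y y] joint_mono[of x' x y y] assms
    by (cases "x \<le> x'") auto
  have 2: "\<bar>joint x' y - joint x' y'\<bar> \<le> \<bar>y - y'\<bar>"
    using snd_step[of y y' x'] snd_step[of y' y x'] joint_mono[of x' x' y y'] joint_mono[of x' x' y' y] assms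
    by (cases "y \<le> y'") auto
  show ?thesis using 1 2 by linarith
qed

text \<open>Layering in \<open>W\<close> alone turns the mixed moment into an integral of joint tail
  probabilities, the quantities on which the dependence condition gives information.\<close>

lemma nn_integral_joint_cross:
  assumes "0 < a" "a \<le> 1" "0 < b" "b \<le> 1"
  shows "(\<integral>\<^sup>+s. ennreal (tail_log 0 a (V s) * tail_log 1 b (W s)) \<partial>M) =
    (\<integral>\<^sup>+w. ennreal (joint a (b * w) / w) * indicator {0<..1} w \<partial>lborel)"
proof -
  interpret P: pair_sigma_finite M lborel ..
  have "(\<integral>\<^sup>+s. ennreal (tail_log 0 a (V s) * tail_log 1 b (W s)) \<partial>M) =
     (\<integral>\<^sup>+s. (\<integral>\<^sup>+w. ennreal (tail_log 0 a (V s)) *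
        (ennreal (real (Suc 0) * tail_log 0 (b * w) (W s) / w) * indicator {0<..1} w) \<partial>lborel) \<partial>M)"
  proof (rule nn_integral_cong_AE)
    show "AE s in M. ennreal (tail_log 0 a (V s) * tail_log 1 b (W s)) =
      (\<integral>\<^sup>+w. ennreal (tail_log 0 a (V s)) *
        (ennreal (real (Suc 0) * tail_log 0 (b * w) (W s) / w) * indicator {0<..1} w) \<partial>lborel)"
      using W.V_pos
    proof eventually_elim
      case (elim s)
      then show ?case
        using assms V.V_nonneg W.V_nonneg
        by (subst nn_integral_cmult) (auto simp: tail_log_layers[where q = 0, simplified] ennreal_mult tail_log_nonneg)
    qed
  qed
  also have "\<dots> = (\<integral>\<^sup>+w. (\<integral>\<^sup>+s. ennreal (tail_log 0 a (V s)) *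
        (ennreal (real (Suc 0) * tail_log 0 (b * w) (W s) / w) * indicator {0<..1} w) \<partial>M) \<partial>lborel)"
    by (rule P.Fubini'[symmetric]) measurable
  also have "\<dots> = (\<integral>\<^sup>+w. ennreal (joint a (b * w) / w) * indicator {0<..1} w \<partial>lborel)"
  proof (intro nn_integral_cong)
    fix w :: real
    show "(\<integral>\<^sup>+s. ennreal (tail_log 0 a (V s)) *
        (ennreal (real (Suc 0) * tail_log 0 (b * w) (W s) / w) * indicator {0<..1} w) \<partial>M) =
        ennreal (joint a (b * w) / w) * indicator {0<..1} w"
    proof (cases "w \<in> {0<..1}")
      case True
      have "(\<integral>\<^sup>+s. ennreal (tail_log 0 a (V s)) *
          (ennreal (real (Suc 0) * tail_log 0 (b * w) (W s) / w) * indicator {0<..1} w) \<partial>M) =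
        (\<integral>\<^sup>+s. ennreal (1 / w) * indicator {s\<in>space M. V s \<le> a \<and> W s \<le> b * w} s \<partial>M)"
        using True by (intro nn_integral_cong) (auto simp: tail_log_def indicator_def)
      also have "\<dots> = ennreal (1 / w) * ennreal (joint a (b * w))"
        by (subst nn_integral_cmult) (auto simp: joint_def emeasure_eq_measure)
      also have "\<dots> = ennreal (joint a (b * w) / w)"
        using True by (subst ennreal_mult[symmetric]) (auto simp: joint_nonneg)
      finally show ?thesis using True by simp
    qed simp
  qed
  finally show ?thesis .
qed

lemma nn_integral_product:
  assumes "0 < a" "0 < b"
  shows "(\<integral>\<^sup>+s. ennreal (tail_log 1 a (V s) * tail_log 1 b (W s)) \<partial>M) =
    (\<integral>\<^sup>+u. ((\<integral>\<^sup>+s. ennreal (tail_log 0 (a * u) (V s) * tail_log 1 (b * u) (W s)) \<partial>M) +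
      (\<integral>\<^sup>+s. ennreal (tail_log 1 (a * u) (V s) * tail_log 0 (b * u) (W s)) \<partial>M)) * ennreal (1 / u) * indicator {0<..1} u \<partial>lborel)"
proof -
  interpret P: pair_sigma_finite M lborel ..
  have "(\<integral>\<^sup>+s. ennreal (tail_log 1 a (V s) * tail_log 1 b (W s)) \<partial>M) =
     (\<integral>\<^sup>+s. (\<integral>\<^sup>+u. ennreal ((tail_log 0 (a * u) (V s) * tail_log 1 (b * u) (W s)
        + tail_log 1 (a * u) (V s) * tail_log 0 (b * u) (W s)) / u) * indicator {0<..1} u \<partial>lborel) \<partial>M)"
  proof (rule nn_integral_cong_AE)
    show "AE s in M. ennreal (tail_log 1 a (V s) * tail_log 1 b (W s)) =
      (\<integral>\<^sup>+u. ennreal ((tail_log 0 (a * u) (V s) * tail_log 1 (b * u) (W s)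
        + tail_log 1 (a * u) (V s) * tail_log 0 (b * u) (W s)) / u) * indicator {0<..1} u \<partial>lborel)"
      using W.V_pos V.V_pos by eventually_elim (simp only: tail_log_product_layers assms)
  qed
  also have "\<dots> = (\<integral>\<^sup>+u. (\<integral>\<^sup>+s. ennreal ((tail_log 0 (a * u) (V s) * tail_log 1 (b * u) (W s)
        + tail_log 1 (a * u) (V s) * tail_log 0 (b * u) (W s)) / u) * indicator {0<..1} u \<partial>M) \<partial>lborel)"
    by (rule P.Fubini'[symmetric]) measurable
  also have "\<dots> = (\<integral>\<^sup>+u. ((\<integral>\<^sup>+s. ennreal (tail_log 0 (a * u) (V s) * tail_log 1 (b * u) (W s)) \<partial>M) +
      (\<integral>\<^sup>+s. ennreal (tail_log 1 (a * u) (V s) * tail_log 0 (b * u) (W s)) \<partial>M)) * ennreal (1 / u) * indicator {0<..1} u \<partial>lborel)"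
  proof (intro nn_integral_cong)
    fix u :: real
    show "(\<integral>\<^sup>+s. ennreal ((tail_log 0 (a * u) (V s) * tail_log 1 (b * u) (W s)
        + tail_log 1 (a * u) (V s) * tail_log 0 (b * u) (W s)) / u) * indicator {0<..1} u \<partial>M) =
      ((\<integral>\<^sup>+s. ennreal (tail_log 0 (a * u) (V s) * tail_log 1 (b * u) (W s)) \<partial>M) +
      (\<integral>\<^sup>+s. ennreal (tail_log 1 (a * u) (V s) * tail_log 0 (b * u) (W s)) \<partial>M)) * ennreal (1 / u) * indicator {0<..1} u"
    proof (cases "u \<in> {0<..1}")
      case True
      have "ennreal ((p + q) / u) = (ennreal p + ennreal q) * ennreal (1 / u)" if "p \<ge> 0" "q \<ge> 0" for p q
        using True that by (simp add: ennreal_mult[symmetric] flip: ennreal_plus)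
      then have "(\<integral>\<^sup>+s. ennreal ((tail_log 0 (a * u) (V s) * tail_log 1 (b * u) (W s)
        + tail_log 1 (a * u) (V s) * tail_log 0 (b * u) (W s)) / u) \<partial>M) =
        (\<integral>\<^sup>+s. (ennreal (tail_log 0 (a * u) (V s) * tail_log 1 (b * u) (W s))
        + ennreal (tail_log 1 (a * u) (V s) * tail_log 0 (b * u) (W s))) * ennreal (1 / u) \<partial>M)"
        using V.V_nonneg W.V_nonneg by (intro nn_integral_cong) (simp add: tail_log_nonneg)
      also have "\<dots> = ((\<integral>\<^sup>+s. ennreal (tail_log 0 (a * u) (V s) * tail_log 1 (b * u) (W s)) \<partial>M) +
      (\<integral>\<^sup>+s. ennreal (tail_log 1 (a * u) (V s) * tail_log 0 (b * u) (W s)) \<partial>M)) * ennreal (1 / u)"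
        by (simp add: nn_integral_multc nn_integral_add)
      finally show ?thesis using True by simp
    qed simp
  qed
  finally show ?thesis .
qed

end

lemma uniform_pair_swap: "uniform_pair M V W \<Longrightarrow> uniform_pair M W V"
  by (simp add: uniform_pair_def)

lemma tail_log_square: "(tail_log q a x)\<^sup>2 = tail_log (2 * q) a x"
  by (simp add: tail_log_def power_mult mult.commute)

context uniform_pair
begin

lemma integrable_tail_log_product:
  assumes "0 < a" "a \<le> 1" "0 < b" "b \<le> 1"
  shows "integrable M (\<lambda>s. tail_log p a (V s) * tail_log q b (W s))"
proof (rule Bochner_Integration.integrable_bound)
  show "integrable M (\<lambda>s. tail_log (2 * p) a (V s) + tail_log (2 * q) b (W s))"
    using assms by auto
  have "\<bar>x * y\<bar> \<le> \<bar>x\<^sup>2 + y\<^sup>2\<bar>" for x y :: real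
  proof -
    have "2 * \<bar>x\<bar> * \<bar>y\<bar> \<le> x\<^sup>2 + y\<^sup>2" using sum_squares_bound[of "\<bar>x\<bar>" "\<bar>y\<bar>"] by simp
    moreover have "0 \<le> \<bar>x\<bar> * \<bar>y\<bar>" by simp
    ultimately have "\<bar>x\<bar> * \<bar>y\<bar> \<le> x\<^sup>2 + y\<^sup>2" by linarith
    then show ?thesis by (simp add: abs_mult)
  qed
  then show "AE s in M. norm (tail_log p a (V s) * tail_log q b (W s))
      \<le> norm (tail_log (2 * p) a (V s) + tail_log (2 * q) b (W s))"
    by (simp flip: tail_log_square)
qed measurable

lemma scaled_expectation_tail_log_product:
  assumes "0 < a" "a \<le> 1" "0 < b" "b \<le> 1" "s \<ge> 0"
  shows "ennreal (s * expectation (\<lambda>w. tail_log p a (V w) * tail_log q b (W w)))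
    = ennreal s * (\<integral>\<^sup>+w. ennreal (tail_log p a (V w) * tail_log q b (W w)) \<partial>M)"
proof -
  have nn: "0 \<le> tail_log p a (V w) * tail_log q b (W w)" for w
    by (intro mult_nonneg_nonneg tail_log_nonneg V.V_nonneg W.V_nonneg)
  then have "0 \<le> expectation (\<lambda>w. tail_log p a (V w) * tail_log q b (W w))"
    by (intro integral_nonneg_AE) auto
  then show ?thesis
    using nn_integral_eq_integral[OF integrable_tail_log_product[OF assms(1-4)]] nn assms(5)
    by (simp add: ennreal_mult)
qed

text \<open>The scaled mixed moment at the thresholds \<open>a * u\<close> and \<open>b * u\<close>,
  divided by \<open>u\<close>: one of the two layers of the product of log-excesses. The other layer
  arises by exchanging \<open>V\<close> and \<open>W\<close>; at \<open>u = 1\<close> the scaled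
  mixed moment itself is recovered.\<close>

definition cross_density :: "real \<Rightarrow> real \<Rightarrow> real \<Rightarrow> real \<Rightarrow> ennreal" where
  "cross_density s a b u =
    ennreal s * (\<integral>\<^sup>+w. ennreal (tail_log 0 (a * u) (V w) * tail_log 1 (b * u) (W w)) \<partial>M) * ennreal (1 / u)"

lemma cross_density_measurable [measurable]: "cross_density s a b \<in> borel_measurable borel"
proof -
  have "(\<lambda>u::real. ennreal s * (\<integral>\<^sup>+w. ennreal (tail_log 0 (a * u) (V w) * tail_log 1 (b * u) (W w)) \<partial>M)
      * ennreal (1 / u)) \<in> borel_measurable borel"
    by measurable
  then show ?thesis unfolding cross_density_def[abs_def] .
qed

lemma cross_density_eq:
  assumes "0 < a" "a \<le> 1" "0 < b" "b \<le> 1" "s \<ge> 0" "0 < u" "u \<le> 1"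
  shows "cross_density s a b u =
    (\<integral>\<^sup>+w. ennreal (s * joint (a * u) (b * (u * w)) / (w * u)) * indicator {0<..1} w \<partial>lborel)"
proof -
  have "(\<integral>\<^sup>+w. ennreal (tail_log 0 (a * u) (V w) * tail_log 1 (b * u) (W w)) \<partial>M) =
     (\<integral>\<^sup>+w. ennreal (joint (a * u) (b * u * w) / w) * indicator {0<..1} w \<partial>lborel)"
    using assms by (intro nn_integral_joint_cross) (auto simp: mult_le_one)
  then have "cross_density s a b u =
    (\<integral>\<^sup>+w. ennreal s * (ennreal (joint (a * u) (b * u * w) / w) * indicator {0<..1} w) * ennreal (1 / u) \<partial>lborel)"
    unfolding cross_density_def by (simp add: nn_integral_cmult nn_integral_multc)
  also have "\<dots> = (\<integral>\<^sup>+w. ennreal (s * joint (a * u) (b * (u * w)) / (w * u)) * indicator {0<..1} w \<partial>lborel)"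
  proof (intro nn_integral_cong)
    fix w :: real
    show "ennreal s * (ennreal (joint (a * u) (b * u * w) / w) * indicator {0<..1} w) * ennreal (1 / u)
      = ennreal (s * joint (a * u) (b * (u * w)) / (w * u)) * indicator {0<..1} w"
      using assms joint_nonneg[of "a * u" "b * u * w"]
      by (cases "w \<in> {0<..1}") (auto simp: ennreal_mult[symmetric] mult.assoc)
  qed
  finally show ?thesis .
qed

text \<open>Bounding the joint tail by its second margin \<open>b * u * w\<close> cancels the
  denominator \<open>w * u\<close>. The resulting constant dominates the integral over
  \<open>u\<close>.\<close>

lemma cross_density_le:
  assumes "0 < a" "a \<le> 1" "0 < b" "b \<le> 1" "s \<ge> 0" "0 < u" "u \<le> 1" "s * b \<le> K"
  shows "cross_density s a b u \<le> ennreal K"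
proof -
  have "cross_density s a b u \<le> (\<integral>\<^sup>+w. ennreal K * indicator {0<..1::real} w \<partial>lborel)"
    unfolding cross_density_eq[OF assms(1-7)]
  proof (intro nn_integral_mono)
    fix w :: real
    show "ennreal (s * joint (a * u) (b * (u * w)) / (w * u)) * indicator {0<..1} w \<le> ennreal K * indicator {0<..1} w"
    proof (cases "w \<in> {0<..1}")
      case True
      have "s * joint (a * u) (b * (u * w)) \<le> s * (b * (u * w))"
        using assms True by (intro mult_left_mono joint_le) (auto simp: mult_le_one)
      also have "\<dots> = (s * b) * (w * u)" by simp
      also have "\<dots> \<le> K * (w * u)"
        using assms True by (intro mult_right_mono) auto
      finally have "s * joint (a * u) (b * (u * w)) / (w * u) \<le> K"
        using assms True by (subst pos_divide_le_eq) auto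
      then show ?thesis using True by (simp add: ennreal_leI)
    qed simp
  qed
  also have "\<dots> = ennreal K" by (subst nn_integral_cmult) auto
  finally show ?thesis .
qed

text \<open>By homogeneity \<open>r u (u * w) / (w * u) = r 1 w / w\<close>, so the limit does not
  depend on \<open>u\<close>.\<close>

lemma cross_density_tendsto:
  assumes ab: "\<And>n. 0 < a n" "\<And>n. a n \<le> 1" "\<And>n. 0 < b n" "\<And>n. b n \<le> 1" "\<And>n. 0 \<le> s n"
    and K: "\<And>n. s n * b n \<le> K"
    and r: "\<And>x y. 0 < x \<Longrightarrow> x \<le> 1 \<Longrightarrow> 0 < y \<Longrightarrow> y \<le> 1 \<Longrightarrow>
      (\<lambda>n. s n * joint (a n * x) (b n * y)) \<longlonglongrightarrow> r x y"
    and hom: "\<And>u w. 0 < u \<Longrightarrow> u \<le> 1 \<Longrightarrow> 0 < w \<Longrightarrow> w \<le> 1 \<Longrightarrow> r u (u * w) = u * r 1 w"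
    and u: "0 < u" "u \<le> 1"
  shows "(\<lambda>n. cross_density (s n) (a n) (b n) u) \<longlonglongrightarrow>
    (\<integral>\<^sup>+w. ennreal (r 1 w / w) * indicator {0<..1} w \<partial>lborel)"
proof -
  let ?r = "\<lambda>w. if w \<in> {0<..1} then r 1 w / w else 0"
  \<comment> \<open>No regularity of \<open>r\<close> is assumed; it is measurable as a pointwise
    limit of measurable functions.\<close>
  have rm: "?r \<in> borel_measurable borel"
  proof (rule borel_measurable_LIMSEQ_real)
    fix w :: real
    show "(\<lambda>n. (s n * joint (a n * 1) (b n * w) / w) * indicator {0<..1} w) \<longlonglongrightarrow> ?r w"
      using r[of 1 w] by (cases "w \<in> {0<..1}") (auto intro!: tendsto_divide)
  qed measurable
  have "(\<lambda>n. cross_density (s n) (a n) (b n) u) \<longlonglongrightarrow> (\<integral>\<^sup>+w. ennreal (?r w) \<partial>lborel)"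
    unfolding cross_density_eq[OF ab u]
  proof (rule nn_integral_dominated_convergence[where w = "\<lambda>w. ennreal K * indicator {0<..1} w"])
    have "K \<ge> 0" using K[of 0] ab(5)[of 0] ab(3)[of 0] by (meson dual_order.trans less_imp_le mult_nonneg_nonneg)
    show "AE w in lborel. ennreal (s n * joint (a n * u) (b n * (u * w)) / (w * u)) * indicator {0<..1} w
        \<le> ennreal K * indicator {0<..1} w" for n
    proof (rule AE_I2)
      fix w :: real
      show "ennreal (s n * joint (a n * u) (b n * (u * w)) / (w * u)) * indicator {0<..1} w
        \<le> ennreal K * indicator {0<..1} w"
      proof (cases "w \<in> {0<..1}")
        case True
        have "s n * joint (a n * u) (b n * (u * w)) \<le> s n * (b n * (u * w))"
          using ab u True by (intro mult_left_mono joint_le) (auto simp: mult_le_one less_imp_le)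
        also have "\<dots> = (s n * b n) * (w * u)" by simp
        also have "\<dots> \<le> K * (w * u)"
          using K u True by (intro mult_right_mono) auto
        finally have "s n * joint (a n * u) (b n * (u * w)) / (w * u) \<le> K"
          using u True by (subst pos_divide_le_eq) auto
        then show ?thesis using True by (simp add: ennreal_leI)
      qed simp
    qed
    show "(\<integral>\<^sup>+w. ennreal K * indicator {0<..1::real} w \<partial>lborel) < \<infinity>"
      by (subst nn_integral_cmult) auto
    show "AE w in lborel. (\<lambda>n. ennreal (s n * joint (a n * u) (b n * (u * w)) / (w * u)) * indicator {0<..1} w)
        \<longlonglongrightarrow> ennreal (?r w)"
    proof (rule AE_I2)
      fix w :: real
      show "(\<lambda>n. ennreal (s n * joint (a n * u) (b n * (u * w)) / (w * u)) * indicator {0<..1} w)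
        \<longlonglongrightarrow> ennreal (?r w)"
      proof (cases "w \<in> {0<..1}")
        case True
        have "(\<lambda>n. s n * joint (a n * u) (b n * (u * w)) / (w * u)) \<longlonglongrightarrow> r u (u * w) / (w * u)"
          using True u by (intro tendsto_divide r tendsto_const) (auto simp: mult_le_one)
        also have "r u (u * w) / (w * u) = ?r w" using hom[of u w] True u by simp
        finally show ?thesis using True by (simp add: tendsto_ennrealI)
      qed auto
    qed
  qed (use rm in measurable)
  also have "(\<integral>\<^sup>+w. ennreal (?r w) \<partial>lborel) = (\<integral>\<^sup>+w. ennreal (r 1 w / w) * indicator {0<..1} w \<partial>lborel)"
    by (intro nn_integral_cong) auto
  finally show ?thesis .
qed

end

lemma tendsto_enn2real_of_scaled:
  assumes "(\<lambda>n. ennreal (f n)) \<longlonglongrightarrow> l" "l < \<top>" "\<And>n. f n \<ge> 0"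
  shows "f \<longlonglongrightarrow> enn2real l"
proof -
  have "(\<lambda>n. enn2real (ennreal (f n))) \<longlonglongrightarrow> enn2real l"
    using assms by (intro tendsto_enn2real) auto
  then show ?thesis using assms(3) by simp
qed

text \<open>
  The limits of the cross terms cancel: by homogeneity of \<open>r\<close>, the product of the two logarithmic
  excesses has expectation asymptotically equal to the sum of both mixed expectations.
\<close>

lemma (in uniform_pair) excess_covariance_tendsto:
  assumes ab: "\<And>n. 0 < a n" "\<And>n. a n \<le> 1" "\<And>n. 0 < b n" "\<And>n. b n \<le> 1" "\<And>n. 0 \<le> s n"
    and K: "\<And>n. s n * a n \<le> K" "\<And>n. s n * b n \<le> K"
    and r: "\<And>x y. 0 < x \<Longrightarrow> x \<le> 1 \<Longrightarrow> 0 < y \<Longrightarrow> y \<le> 1 \<Longrightarrow>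
      (\<lambda>n. s n * joint (a n * x) (b n * y)) \<longlonglongrightarrow> r x y"
    and hom: "\<And>x y c. 0 < x \<Longrightarrow> x \<le> 1 \<Longrightarrow> 0 < y \<Longrightarrow> y \<le> 1 \<Longrightarrow> 0 < c \<Longrightarrow> c \<le> 1 \<Longrightarrow> r (c * x) (c * y) = c * r x y"
  shows "(\<lambda>n. s n * expectation (\<lambda>w. (tail_log 1 (a n) (V w) - tail_log 0 (a n) (V w)) *
      (tail_log 1 (b n) (W w) - tail_log 0 (b n) (W w)))) \<longlonglongrightarrow> r 1 1"
proof -
  interpret S: uniform_pair M W V
    by (rule uniform_pair_swap) (rule uniform_pair_axioms)
  have swap: "S.joint x y = joint y x" for x y
    unfolding joint_def S.joint_def by (auto intro!: arg_cong[where f = prob])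
  have K0: "K \<ge> 0" using K(1)[of 0] ab(5)[of 0] ab(1)[of 0] by (meson dual_order.trans less_imp_le mult_nonneg_nonneg)
  define \<psi> where "\<psi> = (\<integral>\<^sup>+w. ennreal (r 1 w / w) * indicator {0<..1} w \<partial>lborel)"
  define \<psi>' where "\<psi>' = (\<integral>\<^sup>+w. ennreal (r w 1 / w) * indicator {0<..1} w \<partial>lborel)"
  have c1: "(\<lambda>n. cross_density (s n) (a n) (b n) u) \<longlonglongrightarrow> \<psi>" if "0 < u" "u \<le> 1" for u
    unfolding \<psi>_def using hom[of 1 _] 
    by (intro cross_density_tendsto[where K = K] ab K r that) (use hom[of 1] in force)+
  have c2: "(\<lambda>n. S.cross_density (s n) (b n) (a n) u) \<longlonglongrightarrow> \<psi>'" if "0 < u" "u \<le> 1" for u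
    unfolding \<psi>'_def
  proof (intro S.cross_density_tendsto[where K = K and r = "\<lambda>x y. r y x"] ab K that)
    show "(\<lambda>n. s n * S.joint (b n * x) (a n * y)) \<longlonglongrightarrow> r y x"
      if "0 < x" "x \<le> 1" "0 < y" "y \<le> 1" for x y
      unfolding swap using that by (intro r)
    show "r (u * w) u = u * r w 1" if "0 < u" "u \<le> 1" "0 < w" "w \<le> 1" for u w
      using hom[of w 1 u] that by simp
  qed
  have b1: "cross_density (s n) (a n) (b n) u \<le> ennreal K" if "0 < u" "u \<le> 1" for n u
    by (intro cross_density_le ab K that)
  have b2: "S.cross_density (s n) (b n) (a n) u \<le> ennreal K" if "0 < u" "u \<le> 1" for n u
    by (intro S.cross_density_le ab K that)
  have fin: "\<psi> < \<top>" "\<psi>' < \<top>"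
    using LIMSEQ_le_const2[OF c1[of 1], of "ennreal K"] LIMSEQ_le_const2[OF c2[of 1], of "ennreal K"] b1 b2
    by (auto simp: le_less_trans)
  define E where "E p q n = expectation (\<lambda>w. tail_log p (a n) (V w) * tail_log q (b n) (W w))" for p q n
  have E0: "E p q n \<ge> 0" for p q n
    unfolding E_def by (intro integral_nonneg_AE AE_I2 mult_nonneg_nonneg tail_log_nonneg V.V_nonneg W.V_nonneg)
  have sE: "ennreal (s n * E p q n) = ennreal (s n) * (\<integral>\<^sup>+w. ennreal (tail_log p (a n) (V w) * tail_log q (b n) (W w)) \<partial>M)" for p q n
    unfolding E_def by (intro scaled_expectation_tail_log_product ab)
  have "(\<lambda>n. ennreal (s n * E 0 1 n)) \<longlonglongrightarrow> \<psi>"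
    using c1[of 1] unfolding sE cross_density_def by simp
  then have l1: "(\<lambda>n. s n * E 0 1 n) \<longlonglongrightarrow> enn2real \<psi>"
    using fin E0 ab by (intro tendsto_enn2real_of_scaled) auto
  have "(\<lambda>n. ennreal (s n * E 1 0 n)) \<longlonglongrightarrow> \<psi>'"
    using c2[of 1] unfolding sE S.cross_density_def by (simp add: mult.commute)
  then have l2: "(\<lambda>n. s n * E 1 0 n) \<longlonglongrightarrow> enn2real \<psi>'"
    using fin E0 ab by (intro tendsto_enn2real_of_scaled) auto
  \<comment> \<open>The two layers converge to the constants \<open>\<psi>\<close> and
    \<open>\<psi>'\<close>, and integrating constants over the unit interval changes
    nothing.\<close>
  have "(\<lambda>n. ennreal (s n * E 1 1 n)) \<longlonglongrightarrow> \<psi> + \<psi>'"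
  proof -
    have eq: "ennreal (s n * E 1 1 n) = (\<integral>\<^sup>+u. (cross_density (s n) (a n) (b n) u
        + S.cross_density (s n) (b n) (a n) u) * indicator {0<..1} u \<partial>lborel)" for n
    proof -
      have "ennreal (s n * E 1 1 n) = (\<integral>\<^sup>+u. ennreal (s n) *
        (((\<integral>\<^sup>+w. ennreal (tail_log 0 (a n * u) (V w) * tail_log 1 (b n * u) (W w)) \<partial>M) +
        (\<integral>\<^sup>+w. ennreal (tail_log 1 (a n * u) (V w) * tail_log 0 (b n * u) (W w)) \<partial>M)) * ennreal (1 / u) * indicator {0<..1} u) \<partial>lborel)"
        unfolding sE by (subst nn_integral_product) (use ab in \<open>auto simp: nn_integral_cmult\<close>)
      also have "\<dots> = (\<integral>\<^sup>+u. (cross_density (s n) (a n) (b n) u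
        + S.cross_density (s n) (b n) (a n) u) * indicator {0<..1} u \<partial>lborel)"
        unfolding cross_density_def S.cross_density_def
        by (intro nn_integral_cong) (simp add: distrib_left distrib_right mult_ac)
      finally show ?thesis .
    qed
    have "(\<lambda>n. ennreal (s n * E 1 1 n)) \<longlonglongrightarrow> (\<integral>\<^sup>+u. (\<psi> + \<psi>') * indicator {0<..1::real} u \<partial>lborel)"
      unfolding eq
    proof (rule nn_integral_dominated_convergence[where w = "\<lambda>u. (ennreal K + ennreal K) * indicator {0<..1} u"])
      show "AE u in lborel. (cross_density (s n) (a n) (b n) u + S.cross_density (s n) (b n) (a n) u) * indicator {0<..1} u
         \<le> (ennreal K + ennreal K) * indicator {0<..1} u" for n
        using b1[of _ n] b2[of _ n] by (intro AE_I2) (auto simp: indicator_def intro!: add_mono)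
      show "(\<integral>\<^sup>+u. (ennreal K + ennreal K) * indicator {0<..1::real} u \<partial>lborel) < \<infinity>"
        by (subst nn_integral_cmult) (auto simp flip: ennreal_plus)
      show "AE u in lborel. (\<lambda>n. (cross_density (s n) (a n) (b n) u + S.cross_density (s n) (b n) (a n) u) * indicator {0<..1} u)
        \<longlonglongrightarrow> (\<psi> + \<psi>') * indicator {0<..1} u"
        using c1 c2 by (intro AE_I2) (auto simp: indicator_def intro!: tendsto_add)
    qed measurable
    then show ?thesis by (simp add: nn_integral_cmult)
  qed
  then have l3: "(\<lambda>n. s n * E 1 1 n) \<longlonglongrightarrow> enn2real (\<psi> + \<psi>')"
    using fin E0 ab by (intro tendsto_enn2real_of_scaled) auto
  have E00: "E 0 0 n = joint (a n) (b n)" for n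
  proof -
    have "E 0 0 n = expectation (indicator {w\<in>space M. V w \<le> a n \<and> W w \<le> b n})"
      unfolding E_def by (intro Bochner_Integration.integral_cong) (auto simp: tail_log_def indicator_def)
    then show ?thesis by (simp add: joint_def)
  qed
  have l4: "(\<lambda>n. s n * E 0 0 n) \<longlonglongrightarrow> r 1 1"
    unfolding E00 using r[of 1 1] by simp
  have "(\<lambda>n. s n * E 1 1 n - s n * E 1 0 n - s n * E 0 1 n + s n * E 0 0 n) \<longlonglongrightarrow>
      enn2real (\<psi> + \<psi>') - enn2real \<psi>' - enn2real \<psi> + r 1 1"
    by (intro tendsto_intros l1 l2 l3 l4)
  also have "enn2real (\<psi> + \<psi>') - enn2real \<psi>' - enn2real \<psi> + r 1 1 = r 1 1"
    using fin by (simp add: enn2real_plus)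
  also have "(\<lambda>n. s n * E 1 1 n - s n * E 1 0 n - s n * E 0 1 n + s n * E 0 0 n) =
     (\<lambda>n. s n * expectation (\<lambda>w. (tail_log 1 (a n) (V w) - tail_log 0 (a n) (V w)) *
      (tail_log 1 (b n) (W w) - tail_log 0 (b n) (W w))))"
  proof
    fix n
    have int: "integrable M (\<lambda>w. tail_log p (a n) (V w) * tail_log q (b n) (W w))" for p q
      by (intro integrable_tail_log_product ab)
    have "expectation (\<lambda>w. (tail_log 1 (a n) (V w) - tail_log 0 (a n) (V w)) *
        (tail_log 1 (b n) (W w) - tail_log 0 (b n) (W w))) = E 1 1 n - E 1 0 n - E 0 1 n + E 0 0 n"
      unfolding E_def left_diff_distrib right_diff_distrib using int by (simp del: One_nat_def)
    then show "s n * E 1 1 n - s n * E 1 0 n - s n * E 0 1 n + s n * E 0 0 n =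
      s n * expectation (\<lambda>w. (tail_log 1 (a n) (V w) - tail_log 0 (a n) (V w)) *
        (tail_log 1 (b n) (W w) - tail_log 0 (b n) (W w)))"
      by (simp only:) (simp add: algebra_simps)
  qed
  finally show ?thesis .
qed


text \<open>The expected product of two scores behaves like the bare joint tail probability at the
  same thresholds. The scale \<open>s\<close> and the limits of \<open>s n * a n\<close> and
  \<open>s n * b n\<close> stay free, to be matched later with the arguments of \<open>R\<close> in
  the covariance matrix.\<close>

lemma (in uniform_pair) copula_covariance_tendsto:
  assumes J: "\<And>x y. 0 < x \<Longrightarrow> 0 < y \<Longrightarrow> ((\<lambda>s. s * joint (x / s) (y / s)) \<longlongrightarrow> R x y) at_top"
    and s: "filterlim s at_top sequentially"
    and sa: "(\<lambda>n. s n * a n) \<longlonglongrightarrow> \<alpha>" "\<alpha> > 0" and sb: "(\<lambda>n. s n * b n) \<longlonglongrightarrow> \<beta>" "\<beta> > 0"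
  shows "(\<lambda>n. s n * expectation (\<lambda>w. (tail_log 1 (a n) (V w) - tail_log 0 (a n) (V w)) *
      (tail_log 1 (b n) (W w) - tail_log 0 (b n) (W w)))) \<longlonglongrightarrow> R \<alpha> \<beta>"
proof -
  \<comment> \<open>Homogeneity of degree one follows from the limit itself, by replacing
    \<open>s\<close> with \<open>s / c\<close>.\<close>
  have hom: "R (c * x) (c * y) = c * R x y" if "0 < x" "0 < y" "0 < c" for x y c
  proof (rule tendsto_unique[OF trivial_limit_at_top_linorder J])
    have "filterlim (\<lambda>s. s / c) at_top at_top"
      using \<open>c > 0\<close> by (simp add: divide_inverse filterlim_at_top_mult_tendsto_pos[OF tendsto_const _ filterlim_ident])
    from filterlim_compose[OF J[OF that(1,2)] this]
    have "((\<lambda>s. c * (s / c * joint (x / (s / c)) (y / (s / c)))) \<longlongrightarrow> c * R x y) at_top"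
      by (rule tendsto_mult_left)
    then show "((\<lambda>s. s * joint (c * x / s) (c * y / s)) \<longlongrightarrow> c * R x y) at_top"
      using \<open>c > 0\<close> by (simp add: mult.commute)
  qed (use that in auto)
  have s0: "(\<lambda>n. inverse (s n)) \<longlonglongrightarrow> 0"
    by (rule tendsto_inverse_0_at_top[OF s])
  have ev0: "\<forall>\<^sub>F n in sequentially. s n > 0"
    using s by (simp add: filterlim_at_top_dense)
  have small: "\<forall>\<^sub>F n in sequentially. 0 < c n \<and> c n < 1 \<and> s n * c n \<le> z + 1"
    if "(\<lambda>n. s n * c n) \<longlonglongrightarrow> z" "z > 0" for c and z :: real
  proof -
    have "(\<lambda>n. (s n * c n) * inverse (s n)) \<longlonglongrightarrow> z * 0" by (intro tendsto_mult that s0)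
    then have "\<forall>\<^sub>F n in sequentially. (s n * c n) * inverse (s n) < 1"
      by (intro order_tendstoD) auto
    then show ?thesis
      using order_tendstoD(1)[OF that] order_tendstoD(2)[OF that(1) less_add_one] ev0
    proof eventually_elim
      case (elim n)
      then have "s n * c n * inverse (s n) = c n" by simp
      with elim show ?case by (auto simp: zero_less_mult_iff)
    qed
  qed
  \<comment> \<open>The Lipschitz bound replaces \<open>a n * x\<close> by
    \<open>\<alpha> * x / s n\<close>, at a cost that stays small after multiplication by
    \<open>s n\<close>.\<close>
  have conv: "(\<lambda>n. s n * joint (a n * x) (b n * y)) \<longlonglongrightarrow> R (\<alpha> * x) (\<beta> * y)"
    if x: "0 < x" "x \<le> 1" and y: "0 < y" "y \<le> 1" for x y
  proof -
    have base: "(\<lambda>n. s n * joint (\<alpha> * x / s n) (\<beta> * y / s n)) \<longlonglongrightarrow> R (\<alpha> * x) (\<beta> * y)"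
      using sa sb x y by (intro filterlim_compose[OF J s]) auto
    have "\<forall>\<^sub>F n in sequentially. norm (s n * joint (a n * x) (b n * y) - s n * joint (\<alpha> * x / s n) (\<beta> * y / s n))
        \<le> \<bar>s n * a n - \<alpha>\<bar> + \<bar>s n * b n - \<beta>\<bar>"
      using small[OF sa] small[OF sb] ev0 filterlim_at_top_dense[THEN iffD1, OF s, rule_format, of "\<alpha> * x"]
        filterlim_at_top_dense[THEN iffD1, OF s, rule_format, of "\<beta> * y"]
    proof eventually_elim
      case (elim n)
      have "\<bar>joint (a n * x) (b n * y) - joint (\<alpha> * x / s n) (\<beta> * y / s n)\<bar> \<le>
          \<bar>a n * x - \<alpha> * x / s n\<bar> + \<bar>b n * y - \<beta> * y / s n\<bar>"
        using elim x y sa(2) sb(2) by (intro joint_lipschitz) (auto simp: mult_le_one)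
      then have "s n * \<bar>joint (a n * x) (b n * y) - joint (\<alpha> * x / s n) (\<beta> * y / s n)\<bar> \<le>
          s n * (\<bar>a n * x - \<alpha> * x / s n\<bar> + \<bar>b n * y - \<beta> * y / s n\<bar>)"
        using elim by (intro mult_left_mono) auto
      also have "\<dots> = \<bar>s n * (a n * x - \<alpha> * x / s n)\<bar> + \<bar>s n * (b n * y - \<beta> * y / s n)\<bar>"
        using elim by (simp add: abs_mult distrib_left)
      also have "s n * (a n * x - \<alpha> * x / s n) = (s n * a n - \<alpha>) * x"
        using elim by (simp add: field_simps)
      also have "s n * (b n * y - \<beta> * y / s n) = (s n * b n - \<beta>) * y"
        using elim by (simp add: field_simps)
      also have "\<bar>(s n * a n - \<alpha>) * x\<bar> + \<bar>(s n * b n - \<beta>) * y\<bar> \<le> \<bar>s n * a n - \<alpha>\<bar> * 1 + \<bar>s n * b n - \<beta>\<bar> * 1"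
        unfolding abs_mult using x y by (intro add_mono mult_left_mono) auto
      finally show ?case
        using elim by (simp add: abs_mult flip: right_diff_distrib)
    qed
    moreover have "(\<lambda>n. \<bar>s n * a n - \<alpha>\<bar> + \<bar>s n * b n - \<beta>\<bar>) \<longlonglongrightarrow> \<bar>\<alpha> - \<alpha>\<bar> + \<bar>\<beta> - \<beta>\<bar>"
      by (intro tendsto_intros sa sb)
    ultimately show ?thesis
      by (intro Lim_transform[OF base]) (auto intro: Lim_null_comparison)
  qed
  have "\<forall>\<^sub>F n in sequentially. (0 < a n \<and> a n < 1 \<and> s n * a n \<le> \<alpha> + 1) \<and> (0 < b n \<and> b n < 1 \<and> s n * b n \<le> \<beta> + 1) \<and> s n > 0"
    by (intro eventually_conj small sa sb ev0)
  \<comment> \<open>The bounds on \<open>a\<close>, \<open>b\<close> and \<open>s\<close> hold only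
    from some \<open>n0\<close> on but are required at all indices, so the sequences are shifted by
    \<open>n0\<close>.\<close>
  then obtain n0 where n0: "\<And>n. n \<ge> n0 \<Longrightarrow> (0 < a n \<and> a n < 1 \<and> s n * a n \<le> \<alpha> + 1) \<and> (0 < b n \<and> b n < 1 \<and> s n * b n \<le> \<beta> + 1) \<and> s n > 0"
    unfolding eventually_sequentially by blast
  have "(\<lambda>n. s (n + n0) * expectation (\<lambda>w. (tail_log 1 (a (n + n0)) (V w) - tail_log 0 (a (n + n0)) (V w)) *
      (tail_log 1 (b (n + n0)) (W w) - tail_log 0 (b (n + n0)) (W w)))) \<longlonglongrightarrow> R (\<alpha> * 1) (\<beta> * 1)"
  proof (rule excess_covariance_tendsto[where K = "max (\<alpha> + 1) (\<beta> + 1)" and r = "\<lambda>x y. R (\<alpha> * x) (\<beta> * y)"])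
    fix n
    have "n + n0 \<ge> n0" by simp
    from n0[OF this] show "0 < a (n + n0)" "a (n + n0) \<le> 1" "0 < b (n + n0)" "b (n + n0) \<le> 1"
        "0 \<le> s (n + n0)" "s (n + n0) * a (n + n0) \<le> max (\<alpha> + 1) (\<beta> + 1)"
        "s (n + n0) * b (n + n0) \<le> max (\<alpha> + 1) (\<beta> + 1)" by auto
  next
    fix x y :: real assume "0 < x" "x \<le> 1" "0 < y" "y \<le> 1"
    from LIMSEQ_ignore_initial_segment[OF conv[OF this], of n0]
    show "(\<lambda>n. s (n + n0) * joint (a (n + n0) * x) (b (n + n0) * y)) \<longlonglongrightarrow> R (\<alpha> * x) (\<beta> * y)" .
  next
    fix x y c :: real assume "0 < x" "x \<le> 1" "0 < y" "y \<le> 1" "0 < c" "c \<le> 1"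
    then show "R (\<alpha> * (c * x)) (\<beta> * (c * y)) = c * R (\<alpha> * x) (\<beta> * y)"
      using hom[of "\<alpha> * x" "\<beta> * y" c] sa(2) sb(2) by (simp add: mult.left_commute)
  qed
  then show ?thesis unfolding mult_1_right by (rule LIMSEQ_offset)
qed

section \<open>Comparison of log-excess sums over two thresholds\<close>

lemma tail_log_one_eq: "x > 0 \<Longrightarrow> a > 0 \<Longrightarrow> tail_log 1 a x = (if x \<le> a then ln a - ln x else 0)"
  by (simp add: tail_log_def ln_div)

text \<open>As a function of \<open>ln t\<close>, the sum of log-excesses below \<open>t\<close> is
  convex, with slope the number of points up to \<open>t\<close>. Between \<open>a\<close> and
  \<open>\<tau>\<close> this slope lies between the count at \<open>a\<close> and, up to ties at
  \<open>\<tau>\<close>, the number \<open>k\<close>. Replacing it by \<open>k\<close> costs at most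
  the difference of these two times the log-distance.\<close>

lemma threshold_change:
  fixes v :: "nat \<Rightarrow> real"
  assumes "finite I" "\<And>i. i \<in> I \<Longrightarrow> v i > 0" "a > 0" "\<tau> > 0"
    and less: "card {i\<in>I. v i < \<tau>} \<le> k" and le: "k \<le> card {i\<in>I. v i \<le> \<tau>}"
  shows "\<bar>(\<Sum>i\<in>I. tail_log 1 \<tau> (v i)) - (\<Sum>i\<in>I. tail_log 1 a (v i)) - real k * ln (\<tau> / a)\<bar>
    \<le> \<bar>real (card {i\<in>I. v i \<le> a}) - real k\<bar> * \<bar>ln (\<tau> / a)\<bar>"
proof -
  define S where "S t = (\<Sum>i\<in>I. tail_log 1 t (v i))" for t
  have count: "real (card {i\<in>I. P i}) * c = (\<Sum>i\<in>I. if P i then c else 0)" for P and c :: real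
    using assms(1) by (simp add: sum.If_cases Int_def)
  have ln: "ln (\<tau> / a) = ln \<tau> - ln a" using assms by (simp add: ln_div)
  show ?thesis
  proof (cases "a \<le> \<tau>")
    case True
    have l: "ln (\<tau> / a) \<ge> 0" using True assms by simp
    have "real (card {i\<in>I. v i \<le> a}) * ln (\<tau> / a) \<le> S \<tau> - S a"
      unfolding count S_def sum_subtractf[symmetric]
      using True assms by (intro sum_mono) (auto simp: tail_log_one_eq ln simp del: One_nat_def)
    moreover have "S \<tau> - S a \<le> real (card {i\<in>I. v i < \<tau>}) * ln (\<tau> / a)"
      unfolding count S_def sum_subtractf[symmetric]
      using True assms by (intro sum_mono) (auto simp: tail_log_one_eq ln simp del: One_nat_def)
    moreover have "real (card {i\<in>I. v i < \<tau>}) * ln (\<tau> / a) \<le> real k * ln (\<tau> / a)"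
      using less l by (intro mult_right_mono) auto
    moreover have "(real k - real (card {i\<in>I. v i \<le> a})) * ln (\<tau> / a)
        \<le> \<bar>real (card {i\<in>I. v i \<le> a}) - real k\<bar> * \<bar>ln (\<tau> / a)\<bar>"
      using l by (intro mult_mono) auto
    ultimately show ?thesis by (simp add: S_def left_diff_distrib abs_le_iff)
  next
    case False
    have l: "ln (a / \<tau>) \<ge> 0" using False assms by simp
    have ln': "ln (\<tau> / a) = - ln (a / \<tau>)" using assms by (simp add: ln_div)
    have lna: "ln (a / \<tau>) = ln a - ln \<tau>" using assms by (simp add: ln_div)
    have "real (card {i\<in>I. v i \<le> \<tau>}) * ln (a / \<tau>) \<le> S a - S \<tau>"
      unfolding count S_def sum_subtractf[symmetric]
      using False assms by (intro sum_mono) (auto simp: tail_log_one_eq lna simp del: One_nat_def)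
    moreover have "S a - S \<tau> \<le> real (card {i\<in>I. v i \<le> a}) * ln (a / \<tau>)"
      unfolding count S_def sum_subtractf[symmetric]
      using False assms by (intro sum_mono) (auto simp: tail_log_one_eq lna simp del: One_nat_def)
    moreover have "real k * ln (a / \<tau>) \<le> real (card {i\<in>I. v i \<le> \<tau>}) * ln (a / \<tau>)"
      using le l by (intro mult_right_mono) auto
    moreover have "(real (card {i\<in>I. v i \<le> a}) - real k) * ln (a / \<tau>)
        \<le> \<bar>real (card {i\<in>I. v i \<le> a}) - real k\<bar> * \<bar>ln (a / \<tau>)\<bar>"
      using l by (intro mult_mono) auto
    ultimately show ?thesis unfolding ln' by (simp add: S_def left_diff_distrib abs_le_iff)
  qed
qed

section \<open>Random thresholds\<close>

locale uniform_sample = prob_space M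
  for M :: "'a measure" +
  fixes V :: "nat \<Rightarrow> 'a \<Rightarrow> real" and N k :: "nat \<Rightarrow> nat"
  assumes V_unif: "\<And>i. i \<ge> 1 \<Longrightarrow> uniform_rv M (V i)"
    and V_indep: "indep_vars (\<lambda>_. borel) V {1..}"
    and N_top: "filterlim N at_top sequentially"
    and k_top: "filterlim k at_top sequentially"
    and k_N: "(\<lambda>n. real (k n) / real (N n)) \<longlonglongrightarrow> 0"
begin

definition a :: "nat \<Rightarrow> real" where
  "a n = real (k n) / real (N n)"

definition counting :: "nat \<Rightarrow> 'a \<Rightarrow> real" where
  "counting n s = ((\<Sum>i=1..N n. tail_log 0 (a n) (V i s)) - real (k n)) / sqrt (real (k n))"

text \<open>The indicator subtracted from each log-excess is the effect of the random threshold,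
  which is tied to the number of exceedances of \<open>a n\<close>. For
  \<open>0 < a n \<le> 1\<close> every term has mean 0 and variance \<open>a n\<close>, so no
  further centring appears.\<close>

definition excess :: "nat \<Rightarrow> 'a \<Rightarrow> real" where
  "excess n s = (\<Sum>i=1..N n. tail_log 1 (a n) (V i s) - tail_log 0 (a n) (V i s)) / sqrt (real (k n))"

lemma V_measurable [measurable]: "i \<ge> 1 \<Longrightarrow> V i \<in> borel_measurable M"
  using uniform_rv.V_measurable[OF V_unif] .

lemma k_pos: "\<forall>\<^sub>F n in sequentially. k n > 0"
  using filterlim_at_top[THEN iffD1, OF k_top, rule_format, of 1] by eventually_elim simp

lemma N_pos: "\<forall>\<^sub>F n in sequentially. N n > 0"
  using filterlim_at_top[THEN iffD1, OF N_top, rule_format, of 1] by eventually_elim simp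

lemma a_tendsto: "a \<longlonglongrightarrow> 0"
  using k_N by (simp add: a_def[abs_def])

lemma a_pos: "\<forall>\<^sub>F n in sequentially. a n > 0"
  using k_pos N_pos by eventually_elim (simp add: a_def)

lemma a_less: "c > 0 \<Longrightarrow> \<forall>\<^sub>F n in sequentially. a n < c"
  using order_tendstoD(2)[OF a_tendsto] .

lemma a_N: "\<forall>\<^sub>F n in sequentially. real (N n) * a n = real (k n)"
  using N_pos by eventually_elim (simp add: a_def)

lemma sqrt_k_top: "filterlim (\<lambda>n. sqrt (real (k n))) at_top sequentially"
  by (intro filterlim_compose[OF sqrt_at_top] filterlim_compose[OF filterlim_real_sequentially] k_top)

lemma inverse_sqrt_k: "(\<lambda>n. 1 / sqrt (real (k n))) \<longlonglongrightarrow> 0"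
  using tendsto_inverse_0_at_top[OF sqrt_k_top] by (simp add: inverse_eq_divide)

lemma
  assumes [measurable]: "g \<in> borel_measurable borel"
    and int: "\<And>i. i \<ge> 1 \<Longrightarrow> integrable M (\<lambda>s. (g (V i s))\<^sup>2)"
    and mean: "\<And>i. i \<ge> 1 \<Longrightarrow> expectation (\<lambda>s. g (V i s)) = \<mu>"
    and le: "\<And>i. i \<ge> 1 \<Longrightarrow> expectation (\<lambda>s. (g (V i s))\<^sup>2) \<le> C"
  shows integrable_centered_sum_square:
      "integrable M (\<lambda>s. ((\<Sum>i=1..n. g (V i s)) - real n * \<mu>)\<^sup>2)"
    and expectation_centered_sum_square:
      "expectation (\<lambda>s. ((\<Sum>i=1..n. g (V i s)) - real n * \<mu>)\<^sup>2) \<le> real n * C"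
proof -
  define Z where "Z i s = g (V i s) - \<mu>" for i s
  have eq: "(\<Sum>i=1..n. g (V i s)) - real n * \<mu> = (\<Sum>i=1..n. Z i s)" for s
    by (simp add: Z_def sum_subtractf)
  have indep: "indep_vars (\<lambda>_. borel) Z {1..n}"
    unfolding Z_def by (rule indep_vars_compose2[OF indep_vars_subset[OF V_indep]]) auto
  have int1: "integrable M (\<lambda>s. g (V i s))" if "i \<ge> 1" for i
    using that by (intro square_integrable_imp_integrable[OF _ int]) auto
  have Z2: "integrable M (\<lambda>s. (Z i s)\<^sup>2)" "expectation (\<lambda>s. (Z i s)\<^sup>2) \<le> C" "expectation (Z i) = 0" if "i \<ge> 1" for i
  proof -
    note I = int[OF that] int1[OF that]
    have e: "(Z i s)\<^sup>2 = (g (V i s))\<^sup>2 - 2 * \<mu> * g (V i s) + \<mu>\<^sup>2" for s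
      by (simp add: Z_def power2_diff)
    show "integrable M (\<lambda>s. (Z i s)\<^sup>2)" unfolding e using I by auto
    have "expectation (\<lambda>s. (Z i s)\<^sup>2) = expectation (\<lambda>s. (g (V i s))\<^sup>2) - 2 * \<mu> * \<mu> + \<mu>\<^sup>2"
      unfolding e using I mean[OF that] by (simp add: prob_space)
    also have "\<dots> = expectation (\<lambda>s. (g (V i s))\<^sup>2) - \<mu>\<^sup>2" by (simp add: power2_eq_square)
    also have "\<dots> \<le> C" using le[OF that] zero_le_power2[of \<mu>] by linarith
    finally show "expectation (\<lambda>s. (Z i s)\<^sup>2) \<le> C" .
    show "expectation (Z i) = 0" unfolding Z_def using I mean[OF that] by (simp add: prob_space)
  qed
  show "integrable M (\<lambda>s. ((\<Sum>i=1..n. g (V i s)) - real n * \<mu>)\<^sup>2)"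
    unfolding eq by (rule integrable_square_sum_indep[OF _ indep]) (use Z2 in auto)
  have "expectation (\<lambda>s. (\<Sum>i=1..n. Z i s)\<^sup>2) = (\<Sum>i=1..n. expectation (\<lambda>s. (Z i s)\<^sup>2))"
    by (rule expectation_square_sum_indep[OF _ indep]) (use Z2 in auto)
  also have "\<dots> \<le> (\<Sum>i=1..n. C)" using Z2 by (intro sum_mono) auto
  finally show "expectation (\<lambda>s. ((\<Sum>i=1..n. g (V i s)) - real n * \<mu>)\<^sup>2) \<le> real n * C"
    unfolding eq by simp
qed

lemma centered_sum_nearly:
  assumes g: "\<And>n. g n \<in> borel_measurable borel"
    and int: "\<forall>\<^sub>F n in sequentially. \<forall>i\<ge>1. integrable M (\<lambda>s. (g n (V i s))\<^sup>2)
      \<and> expectation (\<lambda>s. g n (V i s)) = \<mu> n \<and> expectation (\<lambda>s. (g n (V i s))\<^sup>2) \<le> C n"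
  shows "B \<longlonglongrightarrow> 0 \<Longrightarrow> \<forall>\<^sub>F n in sequentially. real (N n) * C n / (c n)\<^sup>2 \<le> B n \<Longrightarrow>
      o_pr M (\<lambda>n s. ((\<Sum>i=1..N n. g n (V i s)) - real (N n) * \<mu> n) / c n)"
    and "\<forall>\<^sub>F n in sequentially. real (N n) * C n / (c n)\<^sup>2 \<le> K \<Longrightarrow>
      O_pr M (\<lambda>n s. ((\<Sum>i=1..N n. g n (V i s)) - real (N n) * \<mu> n) / c n)"
proof -
  define Y where "Y n s = ((\<Sum>i=1..N n. g n (V i s)) - real (N n) * \<mu> n) / c n" for n s
  define G where "G n \<longleftrightarrow> (\<forall>i\<ge>1. integrable M (\<lambda>s. (g n (V i s))\<^sup>2)
      \<and> expectation (\<lambda>s. g n (V i s)) = \<mu> n \<and> expectation (\<lambda>s. (g n (V i s))\<^sup>2) \<le> C n)" for n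
  \<comment> \<open>\<open>Y'\<close> is set to 0 at the finitely many indices where the moment
    hypotheses fail, so that square integrability holds for every \<open>n\<close>.\<close>
  define Y' where "Y' n s = (if G n then Y n s else 0)" for n s
  note g[measurable]
  have Y: "whp M (\<lambda>n s. Y' n s = Y n s)"
    using int by (intro whp_mono[OF whp_eventually[of G]]) (auto simp: G_def Y'_def)
  have meas: "Y' n \<in> borel_measurable M" for n
    unfolding Y'_def Y_def by measurable
  have sq: "integrable M (\<lambda>s. (Y n s)\<^sup>2)" "expectation (\<lambda>s. (Y n s)\<^sup>2) \<le> real (N n) * C n / (c n)\<^sup>2" if "G n" for n
  proof -
    note i = integrable_centered_sum_square[OF g, of n "\<mu> n" "C n" "N n"]
      and e = expectation_centered_sum_square[OF g, of n "\<mu> n" "C n" "N n"]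
    have "integrable M (\<lambda>s. ((\<Sum>i=1..N n. g n (V i s)) - real (N n) * \<mu> n)\<^sup>2)"
      using that by (intro i) (auto simp: G_def)
    then show "integrable M (\<lambda>s. (Y n s)\<^sup>2)" by (simp add: Y_def power_divide)
    have "expectation (\<lambda>s. ((\<Sum>i=1..N n. g n (V i s)) - real (N n) * \<mu> n)\<^sup>2) \<le> real (N n) * C n"
      using that by (intro e) (auto simp: G_def)
    then show "expectation (\<lambda>s. (Y n s)\<^sup>2) \<le> real (N n) * C n / (c n)\<^sup>2"
      by (simp add: Y_def power_divide divide_right_mono)
  qed
  have int': "integrable M (\<lambda>s. (Y' n s)\<^sup>2)" for n using sq by (cases "G n") (auto simp: Y'_def)
  show "o_pr M (\<lambda>n s. ((\<Sum>i=1..N n. g n (V i s)) - real (N n) * \<mu> n) / c n)"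
    if B: "B \<longlonglongrightarrow> 0" "\<forall>\<^sub>F n in sequentially. real (N n) * C n / (c n)\<^sup>2 \<le> B n"
  proof -
    have "\<forall>\<^sub>F n in sequentially. expectation (\<lambda>s. (Y' n s)\<^sup>2) \<le> B n"
      using B(2) int unfolding G_def[symmetric]
      by eventually_elim (auto simp: Y'_def intro: order_trans[OF sq(2)])
    from o_pr_cong[OF o_pr_second_moment[OF meas int' this B(1)] Y] show ?thesis
      by (simp add: Y_def[abs_def])
  qed
  show "O_pr M (\<lambda>n s. ((\<Sum>i=1..N n. g n (V i s)) - real (N n) * \<mu> n) / c n)"
    if B: "\<forall>\<^sub>F n in sequentially. real (N n) * C n / (c n)\<^sup>2 \<le> K"
  proof -
    have "\<forall>\<^sub>F n in sequentially. expectation (\<lambda>s. (Y' n s)\<^sup>2) \<le> K"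
      using B int unfolding G_def[symmetric]
      by eventually_elim (auto simp: Y'_def intro: order_trans[OF sq(2)])
    from O_pr_cong[OF O_pr_second_moment[OF meas int' this] Y] show ?thesis
      by (simp add: Y_def[abs_def])
  qed
qed

lemma moments:
  assumes "i \<ge> 1" "0 < b" "b \<le> 1"
  shows "integrable M (\<lambda>s. tail_log q b (V i s))" "expectation (\<lambda>s. tail_log q b (V i s)) = fact q * b"
  using assms uniform_rv.integrable_tail_log[OF V_unif] uniform_rv.expectation_tail_log[OF V_unif] by auto

lemma a_unit: "\<forall>\<^sub>F n in sequentially. 0 < a n \<and> a n \<le> 1"
  using a_pos a_less[of 1] by (auto elim: eventually_elim2)

lemma counting_O_pr: "O_pr M counting"
proof -
  have "O_pr M (\<lambda>n s. ((\<Sum>i=1..N n. tail_log 0 (a n) (V i s)) - real (N n) * a n) / sqrt (real (k n)))"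
  proof (rule centered_sum_nearly(2)[where C = a and K = 1])
    show "\<forall>\<^sub>F n in sequentially. \<forall>i\<ge>1. integrable M (\<lambda>s. (tail_log 0 (a n) (V i s))\<^sup>2)
      \<and> expectation (\<lambda>s. tail_log 0 (a n) (V i s)) = a n \<and> expectation (\<lambda>s. (tail_log 0 (a n) (V i s))\<^sup>2) \<le> a n"
      using a_unit by eventually_elim (auto simp: tail_log_square moments)
    show "\<forall>\<^sub>F n in sequentially. real (N n) * a n / (sqrt (real (k n)))\<^sup>2 \<le> 1"
      using a_N k_pos by eventually_elim simp
  qed simp
  then show ?thesis
    by (rule O_pr_cong) (intro whp_mono[OF whp_eventually[OF a_N]], auto simp: counting_def)
qed

lemma excess_square: "(tail_log 1 b x - tail_log 0 b x)\<^sup>2 = tail_log 2 b x - 2 * tail_log 1 b x + tail_log 0 b x"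
  by (simp add: tail_log_def power2_diff)

text \<open>The second moment is \<open>2 * b - 2 * b + b\<close>, from the factorial moments of
  orders 2, 1 and 0.\<close>

lemma excess_moments:
  assumes "i \<ge> 1" "0 < b" "b \<le> 1"
  shows "integrable M (\<lambda>s. (tail_log 1 b (V i s) - tail_log 0 b (V i s))\<^sup>2)"
    and "expectation (\<lambda>s. tail_log 1 b (V i s) - tail_log 0 b (V i s)) = 0"
    and "expectation (\<lambda>s. (tail_log 1 b (V i s) - tail_log 0 b (V i s))\<^sup>2) = b"
  unfolding excess_square using moments[OF assms] by (simp_all add: numeral_2_eq_2)

lemma excess_O_pr: "O_pr M excess"
proof -
  have "O_pr M (\<lambda>n s. ((\<Sum>i=1..N n. tail_log 1 (a n) (V i s) - tail_log 0 (a n) (V i s)) - real (N n) * 0) / sqrt (real (k n)))"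
  proof (rule centered_sum_nearly(2)[where C = a and K = 1])
    show "\<forall>\<^sub>F n in sequentially. \<forall>i\<ge>1. integrable M (\<lambda>s. (tail_log 1 (a n) (V i s) - tail_log 0 (a n) (V i s))\<^sup>2)
      \<and> expectation (\<lambda>s. tail_log 1 (a n) (V i s) - tail_log 0 (a n) (V i s)) = 0
      \<and> expectation (\<lambda>s. (tail_log 1 (a n) (V i s) - tail_log 0 (a n) (V i s))\<^sup>2) \<le> a n"
      using a_unit by eventually_elim (simp add: excess_moments del: One_nat_def)
    show "\<forall>\<^sub>F n in sequentially. real (N n) * a n / (sqrt (real (k n)))\<^sup>2 \<le> 1"
      using a_N k_pos by eventually_elim simp
  qed simp
  then show ?thesis by (simp add: excess_def[abs_def])
qed

end

section \<open>Bahadur-type representation of the random threshold\<close>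

context uniform_sample
begin

text \<open>Levels are parametrised on the logarithmic scale of the fluctuations of the threshold:
  comparing \<open>\<tau>\<close> with \<open>shifted x n\<close> will be the same as comparing
  \<open>log_ratio\<close> with \<open>x\<close>.\<close>

definition shifted :: "real \<Rightarrow> nat \<Rightarrow> real" where
  "shifted x n = a n * exp (x / sqrt (real (k n)))"

lemma sqrt_k_exp_minus_one: "(\<lambda>n. sqrt (real (k n)) * (exp (x / sqrt (real (k n))) - 1)) \<longlonglongrightarrow> x"
proof -
  have "((\<lambda>h. exp (x * h)) has_real_derivative x) (at 0)"
    by (auto intro!: derivative_eq_intros)
  then have "((\<lambda>h. (exp (x * h) - 1) / h) \<longlongrightarrow> x) (at 0)"
    by (simp add: has_field_derivative_iff)
  moreover have "filterlim (\<lambda>n. 1 / sqrt (real (k n))) (at 0) sequentially"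
    using inverse_sqrt_k k_pos by (auto simp: filterlim_at elim: eventually_mono)
  ultimately have "(\<lambda>n. (exp (x * (1 / sqrt (real (k n)))) - 1) / (1 / sqrt (real (k n)))) \<longlonglongrightarrow> x"
    by (rule filterlim_compose)
  then show ?thesis by (simp add: mult.commute)
qed

lemma exp_over_sqrt_k: "(\<lambda>n. exp (x / sqrt (real (k n)))) \<longlonglongrightarrow> 1"
proof -
  have "(\<lambda>n. exp (x * (1 / sqrt (real (k n))))) \<longlonglongrightarrow> exp (x * 0)"
    by (intro tendsto_intros inverse_sqrt_k)
  then show ?thesis by simp
qed

lemma shifted_unit: "\<forall>\<^sub>F n in sequentially. 0 < shifted x n \<and> shifted x n \<le> 1"
proof -
  have "(\<lambda>n. a n * exp (x / sqrt (real (k n)))) \<longlonglongrightarrow> 0 * 1"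
    by (intro tendsto_mult a_tendsto exp_over_sqrt_k)
  then have "\<forall>\<^sub>F n in sequentially. shifted x n < 1"
    unfolding shifted_def by (intro order_tendstoD) auto
  then show ?thesis using a_pos by eventually_elim (simp add: shifted_def)
qed

text \<open>For fixed \<open>x\<close> the normalised variance of the increment is at most
  \<open>\<bar>exp (x / sqrt k) - 1\<bar>\<close>, which tends to 0, while its normalised mean tends
  to \<open>x\<close>. Uniformity in \<open>x\<close> is not claimed; monotonicity of counts will
  take its place.\<close>

lemma count_increment:
  "o_pr M (\<lambda>n s. ((\<Sum>i=1..N n. tail_log 0 (shifted x n) (V i s)) - (\<Sum>i=1..N n. tail_log 0 (a n) (V i s))) / sqrt (real (k n)) - x)"
proof -
  have "o_pr M (\<lambda>n s. ((\<Sum>i=1..N n. tail_log 0 (shifted x n) (V i s) - tail_log 0 (a n) (V i s))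
      - real (N n) * (shifted x n - a n)) / sqrt (real (k n)))"
  proof (rule centered_sum_nearly(1)[where C = "\<lambda>n. \<bar>shifted x n - a n\<bar>" and B = "\<lambda>n. \<bar>exp (x / sqrt (real (k n))) - 1\<bar>"])
    show "\<forall>\<^sub>F n in sequentially. \<forall>i\<ge>1. integrable M (\<lambda>s. (tail_log 0 (shifted x n) (V i s) - tail_log 0 (a n) (V i s))\<^sup>2)
      \<and> expectation (\<lambda>s. tail_log 0 (shifted x n) (V i s) - tail_log 0 (a n) (V i s)) = shifted x n - a n
      \<and> expectation (\<lambda>s. (tail_log 0 (shifted x n) (V i s) - tail_log 0 (a n) (V i s))\<^sup>2) \<le> \<bar>shifted x n - a n\<bar>"
      using a_unit shifted_unit[of x]
    proof eventually_elim
      case (elim n)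
      \<comment> \<open>The two indicators are nested, so their difference never changes sign and
        equals its square up to that sign.\<close>
      have sq: "(tail_log 0 (shifted x n) v - tail_log 0 (a n) v)\<^sup>2 =
          (if a n \<le> shifted x n then 1 else -1) * (tail_log 0 (shifted x n) v - tail_log 0 (a n) v)" for v
        by (auto simp: tail_log_def)
      show ?case
        unfolding sq using elim moments[of _ "a n" 0] moments[of _ "shifted x n" 0] by auto
    qed
    have "(\<lambda>n. \<bar>exp (x / sqrt (real (k n))) - 1\<bar>) \<longlonglongrightarrow> \<bar>1 - 1\<bar>"
      by (intro tendsto_intros exp_over_sqrt_k)
    then show "(\<lambda>n. \<bar>exp (x / sqrt (real (k n))) - 1\<bar>) \<longlonglongrightarrow> 0" by simp
    show "\<forall>\<^sub>F n in sequentially. real (N n) * \<bar>shifted x n - a n\<bar> / (sqrt (real (k n)))\<^sup>2 \<le> \<bar>exp (x / sqrt (real (k n))) - 1\<bar>"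
      using a_N a_pos k_pos
    proof eventually_elim
      case (elim n)
      have "shifted x n - a n = a n * (exp (x / sqrt (real (k n))) - 1)"
        by (simp add: shifted_def algebra_simps)
      then have "real (N n) * \<bar>shifted x n - a n\<bar> = (real (N n) * a n) * \<bar>exp (x / sqrt (real (k n))) - 1\<bar>"
        using elim by (simp add: abs_mult)
      then show ?case using elim by simp
    qed
  qed simp
  moreover have "o_pr M (\<lambda>n s. real (N n) * (shifted x n - a n) / sqrt (real (k n)) - x)"
  proof (rule o_pr_const)
    have "(\<lambda>n. sqrt (real (k n)) * (exp (x / sqrt (real (k n))) - 1) - x) \<longlonglongrightarrow> x - x"
      by (intro tendsto_intros sqrt_k_exp_minus_one)
    moreover have "\<forall>\<^sub>F n in sequentially. sqrt (real (k n)) * (exp (x / sqrt (real (k n))) - 1) - x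
        = real (N n) * (shifted x n - a n) / sqrt (real (k n)) - x"
      using a_N k_pos
    proof eventually_elim
      case (elim n)
      have "real (N n) * (shifted x n - a n) = (real (N n) * a n) * (exp (x / sqrt (real (k n))) - 1)"
        by (simp add: shifted_def algebra_simps)
      then show ?case using elim by (simp add: real_div_sqrt mult.commute flip: times_divide_eq_left)
    qed
    ultimately show "(\<lambda>n. real (N n) * (shifted x n - a n) / sqrt (real (k n)) - x) \<longlonglongrightarrow> 0"
      by (auto intro: Lim_transform_eventually)
  qed
  ultimately have "o_pr M (\<lambda>n s. ((\<Sum>i=1..N n. tail_log 0 (shifted x n) (V i s) - tail_log 0 (a n) (V i s))
      - real (N n) * (shifted x n - a n)) / sqrt (real (k n)) + (real (N n) * (shifted x n - a n) / sqrt (real (k n)) - x))"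
    by (rule o_pr_add)
  then show ?thesis
    by (rule o_pr_cong)
       (intro whp_AE always_eventually allI AE_I2, simp add: sum_subtractf diff_divide_distrib)
qed

end

text \<open>Together the two counts say that \<open>\<tau>\<close> is the \<open>(k + 1)\<close>-st
  smallest of the \<open>V i\<close>, in a form insensitive to ties. It corresponds to the order
  statistic of rank \<open>N - k\<close> of the observations.\<close>

locale uniform_sample_threshold = uniform_sample M V N k for M :: "'a measure" and V N k +
  fixes \<tau> :: "nat \<Rightarrow> 'a \<Rightarrow> real"
  assumes \<tau>: "\<forall>\<^sub>F n in sequentially. AE s in M. \<tau> n s > 0 \<and>
    card {i\<in>{1..N n}. V i s < \<tau> n s} \<le> k n \<and> k n < card {i\<in>{1..N n}. V i s \<le> \<tau> n s}"
begin

definition log_ratio :: "nat \<Rightarrow> 'a \<Rightarrow> real" where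
  "log_ratio n s = sqrt (real (k n)) * ln (\<tau> n s / a n)"

definition regular :: "nat \<Rightarrow> 'a \<Rightarrow> bool" where
  "regular n s \<longleftrightarrow> k n > 0 \<and> 0 < a n \<and> a n \<le> 1 \<and> real (N n) * a n = real (k n) \<and> \<tau> n s > 0 \<and>
    card {i\<in>{1..N n}. V i s < \<tau> n s} \<le> k n \<and> k n < card {i\<in>{1..N n}. V i s \<le> \<tau> n s} \<and> (\<forall>i\<ge>1. V i s > 0)"

lemma regular: "whp M regular"
proof (rule whp_AE)
  have pos: "AE s in M. \<forall>i\<in>{1..}. V i s > 0"
    by (subst AE_ball_countable) (auto intro: uniform_rv.V_pos[OF V_unif])
  show "\<forall>\<^sub>F n in sequentially. AE s in M. regular n s"
    using \<tau> k_pos a_unit a_N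
  proof eventually_elim
    case (elim n)
    from elim(1) pos show ?case
      by eventually_elim (use elim(2-4) in \<open>simp add: regular_def\<close>)
  qed
qed

lemma card_eq_sum_tail_log: "real (card {i\<in>{1..n}. V i s \<le> u}) = (\<Sum>i=1..n. tail_log 0 u (V i s))"
  by (simp add: tail_log_def sum.If_cases Int_def)

text \<open>The threshold is at most \<open>shifted x n\<close> exactly when more than
  \<open>k n\<close> points are. By the increment expansion this means roughly
  \<open>counting + x > 0\<close>, so \<open>log_ratio\<close> must be close to
  \<open>- counting\<close>. Counts are monotone in the level, so finitely many grid points of
  spacing \<open>\<eta>\<close> suffice once \<open>counting\<close> is bounded.\<close>

lemma threshold_bahadur: "o_pr M (\<lambda>n s. log_ratio n s + counting n s)"
proof (rule o_pr_localI[OF counting_O_pr])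
  fix \<epsilon> K :: real assume "\<epsilon> > 0"
  define \<eta> where "\<eta> = \<epsilon> / 2"
  have \<eta>: "\<eta> > 0" using \<open>\<epsilon> > 0\<close> by (simp add: \<eta>_def)
  \<comment> \<open>The floor \<open>z\<close> of \<open>- counting / \<eta>\<close> satisfies
    \<open>\<bar>z\<bar> \<le> J - 2\<close>, which leaves room for the grid points
    \<open>z + 2\<close> and \<open>z - 1\<close>.\<close>
  define J where "J = \<lceil>K / \<eta>\<rceil> + 3"
  define \<Delta> where "\<Delta> x n s = ((\<Sum>i=1..N n. tail_log 0 (shifted x n) (V i s)) - (\<Sum>i=1..N n. tail_log 0 (a n) (V i s))) / sqrt (real (k n)) - x" for x n s
  have "whp M (\<lambda>n s. \<forall>j\<in>{-J..J}. \<bar>\<Delta> (\<eta> * of_int j) n s\<bar> \<le> \<eta> / 2)"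
  proof (rule whp_ball)
    fix j
    have "o_pr M (\<Delta> (\<eta> * of_int j))" unfolding \<Delta>_def by (rule count_increment)
    then show "whp M (\<lambda>n s. \<bar>\<Delta> (\<eta> * of_int j) n s\<bar> \<le> \<eta> / 2)"
      using half_gt_zero[OF \<eta>] unfolding o_pr_def by blast
  qed simp
  from whp_conj[OF this regular]
  show "whp M (\<lambda>n s. \<bar>counting n s\<bar> \<le> K \<longrightarrow> \<bar>log_ratio n s + counting n s\<bar> \<le> \<epsilon>)"
  proof (rule whp_mono', elim conjE, intro impI)
    fix n s
    assume \<Delta>: "\<forall>j\<in>{-J..J}. \<bar>\<Delta> (\<eta> * of_int j) n s\<bar> \<le> \<eta> / 2" and reg: "regular n s"
      and Z: "\<bar>counting n s\<bar> \<le> K"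
    have k0: "sqrt (real (k n)) > 0" using reg by (simp add: regular_def)
    have cnt: "(real (card {i\<in>{1..N n}. V i s \<le> shifted x n}) - real (k n)) / sqrt (real (k n))
        = counting n s + x + \<Delta> x n s" for x
      unfolding card_eq_sum_tail_log counting_def \<Delta>_def by (simp add: diff_divide_distrib)
    have above: "\<tau> n s \<le> shifted x n \<longleftrightarrow> log_ratio n s \<le> x" for x
    proof -
      have "\<tau> n s \<le> shifted x n \<longleftrightarrow> \<tau> n s / a n \<le> exp (x / sqrt (real (k n)))"
        using reg by (simp add: shifted_def regular_def pos_divide_le_eq mult.commute)
      also have "\<dots> \<longleftrightarrow> ln (\<tau> n s / a n) \<le> x / sqrt (real (k n))"
        using reg by (subst ln_le_cancel_iff[symmetric]) (auto simp: regular_def)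
      also have "\<dots> \<longleftrightarrow> log_ratio n s \<le> x"
        using k0 by (simp add: log_ratio_def pos_le_divide_eq mult.commute)
      finally show ?thesis .
    qed
    have upper: "counting n s + x + \<Delta> x n s > 0" if "log_ratio n s \<le> x" for x
    proof -
      have "card {i\<in>{1..N n}. V i s \<le> \<tau> n s} \<le> card {i\<in>{1..N n}. V i s \<le> shifted x n}"
        using that above[of x] by (intro card_mono) auto
      then have "k n < card {i\<in>{1..N n}. V i s \<le> shifted x n}" using reg by (simp add: regular_def)
      then show ?thesis unfolding cnt[symmetric] using k0 by simp
    qed
    have lower: "counting n s + x + \<Delta> x n s \<le> 0" if "\<not> log_ratio n s \<le> x" for x
    proof -
      have "card {i\<in>{1..N n}. V i s \<le> shifted x n} \<le> card {i\<in>{1..N n}. V i s < \<tau> n s}"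
        using that above[of x] by (intro card_mono) auto
      then have "card {i\<in>{1..N n}. V i s \<le> shifted x n} \<le> k n" using reg by (simp add: regular_def)
      then show ?thesis unfolding cnt[symmetric] using k0 by (simp add: divide_nonpos_pos)
    qed
    define z where "z = \<lfloor>- counting n s / \<eta>\<rfloor>"
    have z: "\<eta> * of_int z \<le> - counting n s" "- counting n s < \<eta> * of_int z + \<eta>"
      using floor_correct[of "- counting n s / \<eta>"] \<eta> unfolding z_def[symmetric]
      by (auto simp: field_simps)
    have "\<bar>- counting n s / \<eta>\<bar> \<le> K / \<eta>" using Z \<eta> by (simp add: divide_right_mono)
    then have zJ: "\<bar>z\<bar> \<le> J - 2"
      unfolding z_def J_def by linarith
    \<comment> \<open>Two grid steps up and one step down outweigh an increment error of
      \<open>\<eta> / 2\<close>. The resulting window puts \<open>log_ratio + counting\<close>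
      within \<open>2 * \<eta> = \<epsilon>\<close>.\<close>
    have arith: "c + (w + 2 * \<eta>) + d > 0" "c + (w - \<eta>) + d \<le> 0"
      if "w \<le> - c" "- c < w + \<eta>" "\<bar>d\<bar> \<le> \<eta> / 2" for c w d
      using that \<eta> by linarith+
    have "\<bar>\<Delta> (\<eta> * of_int (z + 2)) n s\<bar> \<le> \<eta> / 2" "\<bar>\<Delta> (\<eta> * of_int (z - 1)) n s\<bar> \<le> \<eta> / 2"
    proof -
      have "z + 2 \<in> {-J..J}" "z - 1 \<in> {-J..J}" using zJ by auto
      then show "\<bar>\<Delta> (\<eta> * of_int (z + 2)) n s\<bar> \<le> \<eta> / 2" "\<bar>\<Delta> (\<eta> * of_int (z - 1)) n s\<bar> \<le> \<eta> / 2"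
        using \<Delta> by blast+
    qed
    moreover have e: "\<eta> * of_int (z + 2) = \<eta> * of_int z + 2 * \<eta>" "\<eta> * of_int (z - 1) = \<eta> * of_int z - \<eta>"
      by (simp_all add: algebra_simps)
    ultimately have "counting n s + \<eta> * of_int (z + 2) + \<Delta> (\<eta> * of_int (z + 2)) n s > 0"
        "counting n s + \<eta> * of_int (z - 1) + \<Delta> (\<eta> * of_int (z - 1)) n s \<le> 0"
      unfolding e using z arith by blast+
    then have "log_ratio n s \<le> \<eta> * of_int (z + 2)" "\<not> log_ratio n s \<le> \<eta> * of_int (z - 1)"
      using lower[of "\<eta> * of_int (z + 2)"] upper[of "\<eta> * of_int (z - 1)"] by (meson not_le)+
    then show "\<bar>log_ratio n s + counting n s\<bar> \<le> \<epsilon>"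
      using z unfolding e by (simp add: \<eta>_def)
  qed
qed

lemma log_ratio_O_pr: "O_pr M log_ratio"
proof -
  have "O_pr M (\<lambda>n s. (log_ratio n s + counting n s) - counting n s)"
    by (intro O_pr_diff o_pr_imp_O_pr threshold_bahadur counting_O_pr)
  then show ?thesis by simp
qed

text \<open>Moving from \<open>\<tau>\<close> to \<open>a n\<close> produces
  \<open>k n * ln (\<tau> / a n)\<close> up to an error which, normalised, is at most a product of
  two tight factors divided by \<open>sqrt k\<close>. The normalised main term is
  \<open>log_ratio\<close>, hence nearly \<open>- counting\<close>; this replaces the fixed centring
  \<open>k n\<close> by the number of exceedances of \<open>a n\<close>.\<close>

lemma log_excess_expansion:
  "o_pr M (\<lambda>n s. ((\<Sum>i=1..N n. tail_log 1 (\<tau> n s) (V i s)) - real (k n)) / sqrt (real (k n)) - excess n s)"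
proof -
  define Y where "Y n s = ((\<Sum>i=1..N n. tail_log 1 (\<tau> n s) (V i s)) - (\<Sum>i=1..N n. tail_log 1 (a n) (V i s))
      - real (k n) * ln (\<tau> n s / a n)) / sqrt (real (k n))" for n s
  have "o_pr M (\<lambda>n s. (1 / sqrt (real (k n))) * (counting n s * log_ratio n s))"
    by (intro o_pr_O_pr_mult o_pr_const inverse_sqrt_k O_pr_mult counting_O_pr log_ratio_O_pr)
  then have "o_pr M Y"
  proof (rule o_pr_dominated, intro whp_mono'[OF regular])
    fix n s assume reg: "regular n s"
    then have k0: "sqrt (real (k n)) > 0" by (simp add: regular_def)
    have "\<bar>Y n s\<bar> \<le> (\<bar>real (card {i\<in>{1..N n}. V i s \<le> a n}) - real (k n)\<bar> * \<bar>ln (\<tau> n s / a n)\<bar>) / sqrt (real (k n))"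
      unfolding Y_def abs_divide using reg k0
      by (simp only: abs_of_pos[OF k0], intro divide_right_mono threshold_change) (auto simp: regular_def)
    also have "\<dots> = \<bar>1 / sqrt (real (k n)) * (counting n s * log_ratio n s)\<bar>"
      unfolding card_eq_sum_tail_log counting_def log_ratio_def using k0 by (simp add: abs_mult abs_divide)
    finally show "\<bar>Y n s\<bar> \<le> \<bar>1 / sqrt (real (k n)) * (counting n s * log_ratio n s)\<bar>" .
  qed
  then have "o_pr M (\<lambda>n s. Y n s + (log_ratio n s + counting n s))"
    by (intro o_pr_add threshold_bahadur)
  then show ?thesis
  proof (rule o_pr_cong, intro whp_mono'[OF regular])
    fix n s assume "regular n s"
    then have k0: "sqrt (real (k n)) > 0" by (simp add: regular_def)
    have "log_ratio n s = real (k n) * ln (\<tau> n s / a n) / sqrt (real (k n))"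
      using k0 by (simp add: log_ratio_def real_div_sqrt flip: times_divide_eq_left)
    then show "Y n s + (log_ratio n s + counting n s) =
      ((\<Sum>i=1..N n. tail_log 1 (\<tau> n s) (V i s)) - real (k n)) / sqrt (real (k n)) - excess n s"
      by (simp add: Y_def counting_def excess_def sum_subtractf diff_divide_distrib)
  qed
qed

end

section \<open>Second-order bias over the random threshold\<close>

context uniform_sample_threshold
begin

lemma ratio_tendsto: "o_pr M (\<lambda>n s. \<tau> n s / a n - 1)"
proof (rule o_pr_localI[OF log_ratio_O_pr])
  fix \<epsilon> K :: real assume "\<epsilon> > 0"
  have "(\<lambda>n. \<bar>K\<bar> * (1 / sqrt (real (k n))) * exp (\<bar>K\<bar> * (1 / sqrt (real (k n))))) \<longlonglongrightarrow> \<bar>K\<bar> * 0 * exp (\<bar>K\<bar> * 0)"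
    by (intro tendsto_intros inverse_sqrt_k)
  then have "\<forall>\<^sub>F n in sequentially. \<bar>K\<bar> * (1 / sqrt (real (k n))) * exp (\<bar>K\<bar> * (1 / sqrt (real (k n)))) < \<epsilon>"
    using \<open>\<epsilon> > 0\<close> by (intro order_tendstoD) auto
  from whp_conj[OF regular whp_eventually[OF this]]
  show "whp M (\<lambda>n s. \<bar>log_ratio n s\<bar> \<le> K \<longrightarrow> \<bar>\<tau> n s / a n - 1\<bar> \<le> \<epsilon>)"
  proof (rule whp_mono', elim conjE, intro impI)
    fix n s assume reg: "regular n s" and le: "\<bar>log_ratio n s\<bar> \<le> K"
      and small: "\<bar>K\<bar> * (1 / sqrt (real (k n))) * exp (\<bar>K\<bar> * (1 / sqrt (real (k n)))) < \<epsilon>"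
    have k0: "sqrt (real (k n)) > 0" using reg by (simp add: regular_def)
    have "ln (\<tau> n s / a n) = log_ratio n s * (1 / sqrt (real (k n)))"
      using k0 by (simp add: log_ratio_def)
    then have "\<bar>ln (\<tau> n s / a n)\<bar> = \<bar>log_ratio n s\<bar> * (1 / sqrt (real (k n)))"
      using k0 by (simp add: abs_mult)
    also have "\<dots> \<le> \<bar>K\<bar> * (1 / sqrt (real (k n)))" using le k0 by (intro mult_right_mono) auto
    finally have "\<bar>exp (ln (\<tau> n s / a n)) - 1\<bar> \<le> \<bar>K\<bar> * (1 / sqrt (real (k n))) * exp (\<bar>K\<bar> * (1 / sqrt (real (k n))))"
      by (rule exp_minus_one_bound)
    moreover have "exp (ln (\<tau> n s / a n)) = \<tau> n s / a n" using reg by (simp add: regular_def)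
    ultimately show "\<bar>\<tau> n s / a n - 1\<bar> \<le> \<epsilon>" using small by simp
  qed
qed

text \<open>The factor 2 is the reciprocal of the lower bound 1/2 on \<open>x\<close> in the
  second-order expansion, which therefore applies at the level of the threshold.\<close>

lemma \<tau>_le: "whp M (\<lambda>n s. \<tau> n s \<le> 2 * a n)"
proof -
  have "whp M (\<lambda>n s. \<bar>\<tau> n s / a n - 1\<bar> \<le> 1)" using ratio_tendsto unfolding o_pr_def by (meson zero_less_one)
  from whp_conj[OF this regular] show ?thesis
  proof (rule whp_mono', elim conjE)
    fix n s assume "\<bar>\<tau> n s / a n - 1\<bar> \<le> 1" "regular n s"
    then have "\<tau> n s / a n \<le> 2" "a n > 0" by (auto simp: regular_def abs_le_iff)
    then show "\<tau> n s \<le> 2 * a n" by (simp add: pos_divide_le_eq)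
  qed
qed

lemma ratio_powr_tendsto: "o_pr M (\<lambda>n s. (\<tau> n s / a n) powr r - 1)"
  unfolding o_pr_def
proof (intro allI impI)
  fix \<epsilon> :: real assume "\<epsilon> > 0"
  have "((\<lambda>x. x powr r) \<longlongrightarrow> 1 powr r) (at 1)"
    by (intro tendsto_intros) auto
  then have "isCont (\<lambda>x. x powr r) 1" by (simp add: isCont_def)
  then obtain \<delta> where \<delta>: "\<delta> > 0" "\<And>x. \<bar>x - 1\<bar> < \<delta> \<Longrightarrow> \<bar>x powr r - 1\<bar> < \<epsilon>"
    using \<open>\<epsilon> > 0\<close> unfolding continuous_at_eps_delta dist_real_def by (metis powr_one_eq_one)
  have "whp M (\<lambda>n s. \<bar>\<tau> n s / a n - 1\<bar> \<le> \<delta> / 2)"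
    using ratio_tendsto half_gt_zero[OF \<delta>(1)] unfolding o_pr_def by blast
  then show "whp M (\<lambda>n s. \<bar>(\<tau> n s / a n) powr r - 1\<bar> \<le> \<epsilon>)"
    by (rule whp_mono') (use \<delta> in \<open>force intro: less_imp_le\<close>)
qed

text \<open>Shape of the empirical bias: by the second-order expansion, the deviations at
  \<open>V i\<close> and at the threshold are nearly proportional to these powers, with
  \<open>r = - \<rho>\<close>.\<close>

definition power_deficit :: "real \<Rightarrow> nat \<Rightarrow> 'a \<Rightarrow> real" where
  "power_deficit r n s = (\<Sum>i\<in>{i\<in>{1..N n}. V i s < \<tau> n s}. (V i s / a n) powr r - (\<tau> n s / a n) powr r) / real (k n)"

text \<open>At the deterministic threshold this is a law of large numbers with mean
  \<open>a n / (r + 1) - a n\<close> per term. Passing to \<open>\<tau>\<close> is cheap: in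
  \<open>z = (V i s / a n) powr r\<close> both summands have the form \<open>min (z - c) 0\<close>,
  which is 1-Lipschitz in \<open>c\<close> and vanishes beyond the respective threshold.\<close>

lemma power_deficit_tendsto:
  assumes "r > 0"
  shows "o_pr M (\<lambda>n s. power_deficit r n s - (1 / (r + 1) - 1))"
proof -
  define g where "g n v = ((max 0 v / a n) powr r - 1) * indicator {..a n} v" for n v
  define Qa where "Qa n s = (\<Sum>i=1..N n. g n (V i s)) / real (k n)" for n s
  have [measurable]: "g n \<in> borel_measurable borel" for n
    unfolding g_def by measurable
  have gV: "g n (V i s) = (V i s / a n) powr r * indicator {..a n} (V i s) - tail_log 0 (a n) (V i s)" if "i \<ge> 1" for n i s
    using uniform_rv.V_nonneg[OF V_unif[OF that], of s] by (simp add: g_def tail_log_zero left_diff_distrib max_absorb2)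
  have "o_pr M (\<lambda>n s. ((\<Sum>i=1..N n. g n (V i s)) - real (N n) * (a n / (r + 1) - a n)) / real (k n))"
  proof (rule centered_sum_nearly(1)[where C = a and B = "\<lambda>n. (1 / sqrt (real (k n)))\<^sup>2"])
    show "\<forall>\<^sub>F n in sequentially. \<forall>i\<ge>1. integrable M (\<lambda>s. (g n (V i s))\<^sup>2)
      \<and> expectation (\<lambda>s. g n (V i s)) = a n / (r + 1) - a n \<and> expectation (\<lambda>s. (g n (V i s))\<^sup>2) \<le> a n"
      using a_unit
    proof eventually_elim
      case (elim n)
      show ?case
      proof (intro allI impI)
        fix i :: nat assume i: "i \<ge> 1"
        interpret V: uniform_rv M "V i" by (rule V_unif[OF i])
        have le: "(g n (V i s))\<^sup>2 \<le> tail_log 0 (a n) (V i s)" for s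
        proof (cases "V i s \<le> a n")
          case True
          then have "(V i s / a n) powr r \<le> 1 powr r"
            using elim V.V_nonneg[of s] \<open>r > 0\<close> by (intro powr_mono2) auto
          then have "\<bar>(V i s / a n) powr r - 1\<bar> \<le> 1" by (auto simp: abs_le_iff)
          then have "((V i s / a n) powr r - 1)\<^sup>2 \<le> 1" using abs_square_le_1 by blast
          then show ?thesis using True V.V_nonneg[of s] by (simp add: g_def tail_log_def max_absorb2)
        qed (simp add: g_def tail_log_def)
        have int: "integrable M (\<lambda>s. (g n (V i s))\<^sup>2)"
        proof (rule Bochner_Integration.integrable_bound)
          show "integrable M (\<lambda>s. tail_log 0 (a n) (V i s))"
            using elim i by (intro moments) auto
          show "AE s in M. norm ((g n (V i s))\<^sup>2) \<le> norm (tail_log 0 (a n) (V i s))"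
            using le by (intro AE_I2) (auto intro: order_trans[OF _ abs_ge_self])
        qed measurable
        moreover have "expectation (\<lambda>s. g n (V i s)) = a n / (r + 1) - a n"
          unfolding gV[OF i] using elim \<open>r > 0\<close> V.expectation_power_deficit[of "a n" r] moments[OF i, of "a n" 0]
          by (subst Bochner_Integration.integral_diff) auto
        moreover have "expectation (\<lambda>s. (g n (V i s))\<^sup>2) \<le> expectation (\<lambda>s. tail_log 0 (a n) (V i s))"
          using le int moments(1)[OF i, of "a n" 0] elim by (intro integral_mono) auto
        ultimately show "integrable M (\<lambda>s. (g n (V i s))\<^sup>2)
          \<and> expectation (\<lambda>s. g n (V i s)) = a n / (r + 1) - a n \<and> expectation (\<lambda>s. (g n (V i s))\<^sup>2) \<le> a n"
          using moments(2)[OF i, of "a n" 0] elim by auto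
      qed
    qed
    have "(\<lambda>n. (1 / sqrt (real (k n)))\<^sup>2) \<longlonglongrightarrow> 0\<^sup>2" by (intro tendsto_intros inverse_sqrt_k)
    then show "(\<lambda>n. (1 / sqrt (real (k n)))\<^sup>2) \<longlonglongrightarrow> 0" by simp
    show "\<forall>\<^sub>F n in sequentially. real (N n) * a n / (real (k n))\<^sup>2 \<le> (1 / sqrt (real (k n)))\<^sup>2"
      using a_N k_pos by eventually_elim (simp add: power_divide power2_eq_square)
  qed simp
  moreover have "whp M (\<lambda>n s. ((\<Sum>i=1..N n. g n (V i s)) - real (N n) * (a n / (r + 1) - a n)) / real (k n)
      = Qa n s - (1 / (r + 1) - 1))"
  proof (rule whp_mono'[OF regular])
    fix n s assume "regular n s"
    then have "real (N n) * (a n / (r + 1) - a n) = real (k n) * (1 / (r + 1) - 1)" "real (k n) > 0"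
      by (auto simp: regular_def right_diff_distrib)
    then show "((\<Sum>i=1..N n. g n (V i s)) - real (N n) * (a n / (r + 1) - a n)) / real (k n)
      = Qa n s - (1 / (r + 1) - 1)"
      by (simp add: Qa_def diff_divide_distrib)
  qed
  ultimately have Qa: "o_pr M (\<lambda>n s. Qa n s - (1 / (r + 1) - 1))" by (rule o_pr_cong)
  \<comment> \<open>This factor is \<open>k n\<close> plus the number of \<open>V i\<close> up to
    \<open>a n\<close>, divided by \<open>k n\<close>: a bound for the relative number of terms in
    which the two summands can differ.\<close>
  have "O_pr M (\<lambda>n s. 2 + counting n s * (1 / sqrt (real (k n))))"
    by (intro O_pr_add O_pr_const[OF tendsto_const] O_pr_mult counting_O_pr O_pr_const[OF inverse_sqrt_k])
  then have "o_pr M (\<lambda>n s. ((\<tau> n s / a n) powr r - 1) * (2 + counting n s * (1 / sqrt (real (k n)))))"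
    by (intro o_pr_O_pr_mult ratio_powr_tendsto)
  then have "o_pr M (\<lambda>n s. power_deficit r n s - Qa n s)"
  proof (rule o_pr_dominated, intro whp_mono'[OF regular])
    fix n s assume reg: "regular n s"
    then have k0: "sqrt (real (k n)) > 0" "real (k n) > 0" "a n > 0" "\<tau> n s > 0" by (auto simp: regular_def)
    define y where "y = (\<tau> n s / a n) powr r"
    define f where "f v = (if v < \<tau> n s then (v / a n) powr r - y else 0)" for v
    have bound: "\<bar>f (V i s) - g n (V i s)\<bar> \<le>
        \<bar>y - 1\<bar> * ((if V i s < \<tau> n s then 1 else 0) + tail_log 0 (a n) (V i s))" if i: "i \<ge> 1" for i
    proof -
      define z where "z = (V i s / a n) powr r"
      have V0: "V i s > 0" using reg i by (simp add: regular_def)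
      have 1: "V i s < \<tau> n s \<longleftrightarrow> z < y" 
      proof -
        have "V i s / a n < \<tau> n s / a n \<longleftrightarrow> (V i s / a n) powr r < (\<tau> n s / a n) powr r"
        proof -
          have "0 \<le> V i s / a n" "0 \<le> \<tau> n s / a n" using k0 V0 by simp_all
          then show ?thesis
            using powr_less_mono2[of r "V i s / a n" "\<tau> n s / a n"] \<open>r > 0\<close>
              powr_mono2[of r "\<tau> n s / a n" "V i s / a n"] by linarith
        qed
        then show ?thesis unfolding z_def y_def using k0 by (simp add: divide_less_cancel)
      qed
      have 2: "V i s \<le> a n \<longleftrightarrow> z \<le> 1"
      proof -
        have "V i s / a n \<le> 1 \<longleftrightarrow> (V i s / a n) powr r \<le> 1"
        proof -
          have "0 \<le> V i s / a n" using k0 V0 by simp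
          then show ?thesis
            using powr_less_mono2[of r 1 "V i s / a n"] powr_mono2[of r "V i s / a n" 1] \<open>r > 0\<close>
            unfolding powr_one_eq_one by linarith
        qed
        then show ?thesis unfolding z_def using k0 by (simp add: divide_le_eq)
      qed
      have "f (V i s) = (if z < y then z - y else 0)" unfolding f_def 1 z_def ..
      moreover have "g n (V i s) = (if z \<le> 1 then z - 1 else 0)"
        using V0 2 by (simp add: g_def z_def indicator_def max_absorb2)
      ultimately show ?thesis
        using 1 2 by (auto simp: tail_log_def abs_minus_commute[of 1 y])
    qed
    have "power_deficit r n s = (\<Sum>i=1..N n. f (V i s)) / real (k n)"
      unfolding power_deficit_def f_def y_def by (simp add: sum.If_cases Int_def)
    then have "\<bar>power_deficit r n s - Qa n s\<bar> = \<bar>\<Sum>i=1..N n. f (V i s) - g n (V i s)\<bar> / real (k n)"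
      using k0 by (simp add: Qa_def sum_subtractf flip: diff_divide_distrib)
    also have "\<dots> \<le> (\<Sum>i=1..N n. \<bar>y - 1\<bar> * ((if V i s < \<tau> n s then 1 else 0) + tail_log 0 (a n) (V i s))) / real (k n)"
      using k0 bound by (intro divide_right_mono order_trans[OF sum_abs] sum_mono) auto
    also have "\<dots> = \<bar>y - 1\<bar> * (real (card {i\<in>{1..N n}. V i s < \<tau> n s}) + (\<Sum>i=1..N n. tail_log 0 (a n) (V i s))) / real (k n)"
      by (simp add: sum_distrib_left[symmetric] sum.distrib sum.If_cases Int_def)
    also have "\<dots> \<le> \<bar>y - 1\<bar> * (real (k n) + (\<Sum>i=1..N n. tail_log 0 (a n) (V i s))) / real (k n)"
      using reg k0 by (intro divide_right_mono mult_left_mono) (auto simp: regular_def)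
    also have "\<dots> = \<bar>y - 1\<bar> * (2 + counting n s * (1 / sqrt (real (k n))))"
      using k0 by (simp add: counting_def field_simps)
    also have "\<dots> \<le> \<bar>((\<tau> n s / a n) powr r - 1) * (2 + counting n s * (1 / sqrt (real (k n))))\<bar>"
      unfolding y_def[symmetric] abs_mult by (intro mult_left_mono) auto
    finally show "\<bar>power_deficit r n s - Qa n s\<bar> \<le> \<bar>((\<tau> n s / a n) powr r - 1) * (2 + counting n s * (1 / sqrt (real (k n))))\<bar>" .
  qed
  from o_pr_add[OF this Qa] show ?thesis by (simp add: algebra_simps)
qed

end

text \<open>
  \<open>D\<close> is the relative bias of a tail quantile function at a level of order \<open>1 / \<tau>\<close>, in the form
  provided by the uniform second-order expansion.
\<close>

locale second_order_sample = uniform_sample_threshold M V N k \<tau> for M :: "'a measure" and V N k \<tau> +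
  fixes D A :: "real \<Rightarrow> real" and \<rho> lam :: real
  assumes \<rho>: "\<rho> < 0"
    and D: "\<And>\<epsilon>. \<epsilon> > 0 \<Longrightarrow> \<forall>\<^sub>F t in at_top. \<forall>x\<ge>1/2. \<bar>D (t * x) - x powr \<rho> * A t / \<rho>\<bar> \<le> \<epsilon> * \<bar>A t\<bar>"
    and lam: "(\<lambda>n. sqrt (real (k n)) * A (real (N n) / real (k n))) \<longlonglongrightarrow> lam"
begin

definition bias :: "nat \<Rightarrow> real" where
  "bias n = sqrt (real (k n)) * A (real (N n) / real (k n))"

lemma bias_tendsto: "bias \<longlonglongrightarrow> lam"
  using lam by (simp add: bias_def[abs_def])

lemma bias_bounded: "\<forall>\<^sub>F n in sequentially. \<bar>bias n\<bar> \<le> \<bar>lam\<bar> + 1"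
  using order_tendstoD(2)[OF tendsto_rabs[OF bias_tendsto] less_add_one] by eventually_elim simp

lemma inverse_a_top: "filterlim (\<lambda>n. 1 / a n) at_top sequentially"
  using filterlim_inverse_at_top[OF a_tendsto a_pos] by (simp add: inverse_eq_divide)

lemma D_expansion:
  assumes "\<epsilon> > 0"
  shows "\<forall>\<^sub>F n in sequentially. \<forall>v. 0 < v \<and> v \<le> 2 * a n \<longrightarrow>
    \<bar>sqrt (real (k n)) * D (1 / v) - (v / a n) powr (- \<rho>) * bias n / \<rho>\<bar> \<le> \<epsilon>"
proof -
  \<comment> \<open>Errors relative to \<open>A\<close> become errors relative to
    \<open>bias\<close>, which is eventually at most \<open>\<bar>lam\<bar> + 1\<close>.\<close>
  define e where "e = \<epsilon> / (\<bar>lam\<bar> + 1)"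
  have e: "e > 0" using assms by (simp add: e_def add_nonneg_pos)
  show ?thesis
    using eventually_compose_filterlim[OF D[OF e] inverse_a_top] a_pos bias_bounded
  proof eventually_elim
    case (elim n)
    show ?case
    proof (intro allI impI, elim conjE)
      fix v assume v: "0 < v" "v \<le> 2 * a n"
      have "a n / v \<ge> 1/2" using v by (simp add: field_simps)
      from elim(1)[rule_format, OF this]
      have "\<bar>D (1 / v) - (a n / v) powr \<rho> * A (1 / a n) / \<rho>\<bar> \<le> e * \<bar>A (1 / a n)\<bar>"
        using elim(2) by simp
      also have "(a n / v) powr \<rho> = (v / a n) powr (- \<rho>)"
        using v elim(2) by (simp add: powr_minus_divide powr_divide)
      also have "A (1 / a n) = A (real (N n) / real (k n))" by (simp add: a_def)
      finally have "sqrt (real (k n)) * \<bar>D (1 / v) - (v / a n) powr (- \<rho>) * A (real (N n) / real (k n)) / \<rho>\<bar>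
          \<le> sqrt (real (k n)) * (e * \<bar>A (real (N n) / real (k n))\<bar>)"
        by (intro mult_left_mono) auto
      also have "sqrt (real (k n)) * \<bar>D (1 / v) - (v / a n) powr (- \<rho>) * A (real (N n) / real (k n)) / \<rho>\<bar>
          = \<bar>sqrt (real (k n)) * (D (1 / v) - (v / a n) powr (- \<rho>) * A (real (N n) / real (k n)) / \<rho>)\<bar>"
        by (simp add: abs_mult)
      also have "sqrt (real (k n)) * (D (1 / v) - (v / a n) powr (- \<rho>) * A (real (N n) / real (k n)) / \<rho>)
          = sqrt (real (k n)) * D (1 / v) - (v / a n) powr (- \<rho>) * bias n / \<rho>"
        by (simp add: bias_def right_diff_distrib)
      also have "sqrt (real (k n)) * (e * \<bar>A (real (N n) / real (k n))\<bar>) = e * \<bar>bias n\<bar>"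
        by (simp add: bias_def abs_mult)
      also have "\<dots> \<le> e * (\<bar>lam\<bar> + 1)" using elim(3) e by (intro mult_left_mono) auto
      also have "\<dots> = \<epsilon>" by (simp add: e_def add_nonneg_pos)
      finally show "\<bar>sqrt (real (k n)) * D (1 / v) - (v / a n) powr (- \<rho>) * bias n / \<rho>\<bar> \<le> \<epsilon>" .
    qed
  qed
qed

text \<open>The bound reaches down to arbitrarily small \<open>v\<close>, so it covers the extreme
  level as well as the threshold.\<close>

lemma D_bounded: "\<exists>C. \<forall>\<^sub>F n in sequentially. \<forall>v. 0 < v \<and> v \<le> 2 * a n \<longrightarrow> \<bar>sqrt (real (k n)) * D (1 / v)\<bar> \<le> C"
proof (intro exI)
  show "\<forall>\<^sub>F n in sequentially. \<forall>v. 0 < v \<and> v \<le> 2 * a n \<longrightarrow>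
    \<bar>sqrt (real (k n)) * D (1 / v)\<bar> \<le> 1 + 2 powr (- \<rho>) * ((\<bar>lam\<bar> + 1) / \<bar>\<rho>\<bar>)"
    using D_expansion[OF zero_less_one] a_pos bias_bounded
  proof eventually_elim
    case (elim n)
    show ?case
    proof (intro allI impI, elim conjE)
      fix v assume v: "0 < v" "v \<le> 2 * a n"
      have "\<bar>(v / a n) powr (- \<rho>) * bias n / \<rho>\<bar> = (v / a n) powr (- \<rho>) * (\<bar>bias n\<bar> / \<bar>\<rho>\<bar>)"
        by (simp add: abs_mult abs_divide)
      also have "\<dots> \<le> 2 powr (- \<rho>) * ((\<bar>lam\<bar> + 1) / \<bar>\<rho>\<bar>)"
        using v elim \<rho> by (intro mult_mono powr_mono2 divide_right_mono divide_nonneg_nonneg abs_ge_zero) (auto simp: pos_divide_le_eq)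
      finally have "\<bar>(v / a n) powr (- \<rho>) * bias n / \<rho>\<bar> \<le> 2 powr (- \<rho>) * ((\<bar>lam\<bar> + 1) / \<bar>\<rho>\<bar>)" .
      then show "\<bar>sqrt (real (k n)) * D (1 / v)\<bar> \<le> 1 + 2 powr (- \<rho>) * ((\<bar>lam\<bar> + 1) / \<bar>\<rho>\<bar>)"
        using elim(1)[rule_format, OF conjI, OF v] by linarith
    qed
  qed
qed

lemma D_threshold_O_pr: "O_pr M (\<lambda>n s. sqrt (real (k n)) * D (1 / \<tau> n s))"
proof -
  obtain C where C: "\<forall>\<^sub>F n in sequentially. \<forall>v. 0 < v \<and> v \<le> 2 * a n \<longrightarrow> \<bar>sqrt (real (k n)) * D (1 / v)\<bar> \<le> C"
    using D_bounded by blast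
  have "whp M (\<lambda>n s. \<bar>sqrt (real (k n)) * D (1 / \<tau> n s)\<bar> \<le> \<bar>C\<bar>)"
  proof (rule whp_mono')
    show "whp M (\<lambda>n s. (regular n s \<and> \<tau> n s \<le> 2 * a n) \<and>
        (\<forall>v. 0 < v \<and> v \<le> 2 * a n \<longrightarrow> \<bar>sqrt (real (k n)) * D (1 / v)\<bar> \<le> C))"
      by (intro whp_conj regular \<tau>_le whp_eventually[OF C])
  next
    fix n s
    assume *: "(regular n s \<and> \<tau> n s \<le> 2 * a n) \<and>
        (\<forall>v. 0 < v \<and> v \<le> 2 * a n \<longrightarrow> \<bar>sqrt (real (k n)) * D (1 / v)\<bar> \<le> C)"
    then have "\<bar>sqrt (real (k n)) * D (1 / \<tau> n s)\<bar> \<le> C" by (auto simp: regular_def)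
    then show "\<bar>sqrt (real (k n)) * D (1 / \<tau> n s)\<bar> \<le> \<bar>C\<bar>" by linarith
  qed
  then show ?thesis
    by (rule O_pr_cong_whp[OF finite_measure_axioms O_pr_const[OF tendsto_const]])
qed

text \<open>Inserting the expansion leaves \<open>power_deficit * bias / \<rho>\<close>, with limit
  \<open>(1 / (1 - \<rho>) - 1) * lam / \<rho> = lam / (1 - \<rho>)\<close>. At most
  \<open>k n\<close> terms, each with an error of at most \<open>\<epsilon> / sqrt k\<close>, are
  divided by \<open>sqrt k\<close>, so the total error stays within
  \<open>\<epsilon>\<close>.\<close>

lemma bias_sum:
  "o_pr M (\<lambda>n s. (\<Sum>i\<in>{i\<in>{1..N n}. V i s < \<tau> n s}. D (1 / V i s) - D (1 / \<tau> n s)) / sqrt (real (k n)) - lam / (1 - \<rho>))"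
proof -
  define r where "r = - \<rho>"
  have r: "r > 0" using \<rho> by (simp add: r_def)
  define S where "S n s = (\<Sum>i\<in>{i\<in>{1..N n}. V i s < \<tau> n s}. D (1 / V i s) - D (1 / \<tau> n s)) / sqrt (real (k n))" for n s
  have 1: "o_pr M (\<lambda>n s. S n s - power_deficit r n s * (bias n / \<rho>))"
    unfolding o_pr_def
  proof (intro allI impI)
    fix \<epsilon> :: real assume "\<epsilon> > 0"
    then have "\<epsilon> / 2 > 0" by simp
    have "whp M (\<lambda>n s. (regular n s \<and> \<tau> n s \<le> 2 * a n) \<and> (\<forall>v. 0 < v \<and> v \<le> 2 * a n \<longrightarrow>
      \<bar>sqrt (real (k n)) * D (1 / v) - (v / a n) powr (- \<rho>) * bias n / \<rho>\<bar> \<le> \<epsilon> / 2))"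
      by (intro whp_conj regular \<tau>_le whp_eventually[OF D_expansion[OF \<open>\<epsilon> / 2 > 0\<close>]])
    then show "whp M (\<lambda>n s. \<bar>S n s - power_deficit r n s * (bias n / \<rho>)\<bar> \<le> \<epsilon>)"
    proof (rule whp_mono', elim conjE)
      fix n s
      assume reg: "regular n s" and t: "\<tau> n s \<le> 2 * a n"
        and ex: "\<forall>v. 0 < v \<and> v \<le> 2 * a n \<longrightarrow> \<bar>sqrt (real (k n)) * D (1 / v) - (v / a n) powr (- \<rho>) * bias n / \<rho>\<bar> \<le> \<epsilon> / 2"
      have k0: "sqrt (real (k n)) > 0" "real (k n) > 0" using reg by (auto simp: regular_def)
      define I where "I = {i\<in>{1..N n}. V i s < \<tau> n s}"
      define E where "E v = sqrt (real (k n)) * D (1 / v) - (v / a n) powr r * (bias n / \<rho>)" for v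
      have E: "\<bar>E v\<bar> \<le> \<epsilon> / 2" if "0 < v" "v \<le> 2 * a n" for v
        using ex[rule_format, of v] that by (simp add: E_def r_def)
      have cI: "real (card I) \<le> real (k n)" using reg by (simp add: regular_def I_def)
      have "S n s - power_deficit r n s * (bias n / \<rho>) =
        (\<Sum>i\<in>I. sqrt (real (k n)) * (D (1 / V i s) - D (1 / \<tau> n s))) / real (k n)
        - (\<Sum>i\<in>I. ((V i s / a n) powr r - (\<tau> n s / a n) powr r) * (bias n / \<rho>)) / real (k n)"
      proof -
        have "x / sqrt (real (k n)) = sqrt (real (k n)) * x / real (k n)" for x
          using k0 by (simp add: field_simps)
        then show ?thesis
          unfolding S_def power_deficit_def I_def[symmetric]
            sum_distrib_left[symmetric] sum_distrib_right[symmetric] by simp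
      qed
      also have "\<dots> = (\<Sum>i\<in>I. E (V i s) - E (\<tau> n s)) / real (k n)"
        unfolding diff_divide_distrib[symmetric] sum_subtractf[symmetric]
        by (intro arg_cong[where f = "\<lambda>z. z / real (k n)"] sum.cong) (auto simp: E_def algebra_simps)
      also have "\<bar>\<dots>\<bar> \<le> (\<Sum>i\<in>I. \<epsilon>) / real (k n)"
      proof -
        have "\<bar>E (V i s) - E (\<tau> n s)\<bar> \<le> \<epsilon>" if "i \<in> I" for i
          using E[of "V i s"] E[of "\<tau> n s"] that reg t by (auto simp: I_def regular_def)
        then have "\<bar>\<Sum>i\<in>I. E (V i s) - E (\<tau> n s)\<bar> \<le> (\<Sum>i\<in>I. \<epsilon>)"
          by (intro order_trans[OF sum_abs] sum_mono) auto
        then show ?thesis using k0 by (simp add: abs_divide divide_right_mono)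
      qed
      also have "\<dots> \<le> \<epsilon>"
        using cI k0 \<open>\<epsilon> > 0\<close> by (simp add: pos_divide_le_eq mult_right_mono)
      finally show "\<bar>S n s - power_deficit r n s * (bias n / \<rho>)\<bar> \<le> \<epsilon>" .
    qed
  qed
  have "o_pr M (\<lambda>n s. (power_deficit r n s - (1 / (r + 1) - 1)) * (bias n / \<rho>))"
    using \<rho> by (intro o_pr_O_pr_mult power_deficit_tendsto r O_pr_const[OF tendsto_divide[OF bias_tendsto tendsto_const]]) auto
  moreover have "o_pr M (\<lambda>n s. (1 / (r + 1) - 1) * (bias n / \<rho>) - lam / (1 - \<rho>))"
  proof (rule o_pr_const)
    have "(\<lambda>n. (1 / (r + 1) - 1) * (bias n / \<rho>) - lam / (1 - \<rho>)) \<longlonglongrightarrow> (1 / (r + 1) - 1) * (lam / \<rho>) - lam / (1 - \<rho>)"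
      using \<rho> by (intro tendsto_intros bias_tendsto) auto
    also have "(1 / (r + 1) - 1) * (lam / \<rho>) - lam / (1 - \<rho>) = 0"
      using \<rho> by (simp add: r_def field_simps)
    finally show "(\<lambda>n. (1 / (r + 1) - 1) * (bias n / \<rho>) - lam / (1 - \<rho>)) \<longlonglongrightarrow> 0" .
  qed
  ultimately have "o_pr M (\<lambda>n s. (S n s - power_deficit r n s * (bias n / \<rho>)) +
      ((power_deficit r n s - (1 / (r + 1) - 1)) * (bias n / \<rho>) + ((1 / (r + 1) - 1) * (bias n / \<rho>) - lam / (1 - \<rho>))))"
    by (intro o_pr_add 1)
  then show ?thesis
    by (rule o_pr_cong)
       (intro whp_AE always_eventually allI AE_I2, simp add: S_def algebra_simps diff_divide_distrib)
qed

end

section \<open>The Hill estimator of one sample\<close>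

text \<open>Beyond its length a list has an unspecified value that depends only on the overshoot.
  Out-of-range order statistics are therefore constant in the data, hence measurable.\<close>

lemma nth_beyond: "length xs \<le> j \<Longrightarrow> xs ! j = [] ! (j - length xs)"
proof (induction xs arbitrary: j)
  case (Cons x xs)
  then show ?case by (cases j) auto
qed simp

lemma card_eq_card_sorted:
  "card {i\<in>{1..N}. P (f i)} = card {j. j < N \<and> P (sort (map f [1..<Suc N]) ! j)}"
proof -
  have "card {j. j < N \<and> P (sort (map f [1..<Suc N]) ! j)} = length (filter P (sort (map f [1..<Suc N])))"
    by (simp add: length_filter_conv_card)
  also have "\<dots> = size (filter_mset P (mset (map f [1..<Suc N])))"
    by (metis mset_filter mset_sort size_mset)
  also have "\<dots> = length (filter P (map f [1..<Suc N]))"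
    by (metis mset_filter size_mset)
  also have "\<dots> = length (filter (\<lambda>i. P (f i)) [1..<Suc N])"
    by (simp add: filter_map comp_def)
  also have "\<dots> = card {i\<in>{1..N}. P (f i)}"
    by (subst distinct_card[symmetric]) (auto intro!: arg_cong[where f = card])
  finally show ?thesis by simp
qed

lemma sum_eq_sum_sorted:
  fixes h :: "real \<Rightarrow> real"
  shows "(\<Sum>i=1..N. h (f i)) = (\<Sum>j<N. h (sort (map f [1..<Suc N]) ! j))"
proof -
  have "(\<Sum>i=1..N. h (f i)) = sum_list (map (\<lambda>i. h (f i)) [1..<Suc N])"
    by (subst sum_list_distinct_conv_sum_set) (auto simp: atLeastLessThanSuc_atLeastAtMost simp del: upt_Suc)
  also have "\<dots> = sum_mset (mset (map h (map f [1..<Suc N])))"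
    by (simp only: sum_mset_sum_list map_map comp_def)
  also have "\<dots> = sum_mset (mset (map h (sort (map f [1..<Suc N]))))"
    by (simp only: mset_map mset_sort)
  also have "\<dots> = sum_list (map h (sort (map f [1..<Suc N])))"
    by (simp only: sum_mset_sum_list)
  also have "\<dots> = (\<Sum>j<N. h (sort (map f [1..<Suc N]) ! j))"
    by (subst sum_list_sum_nth) (auto simp: atLeast0LessThan simp del: upt_Suc)
  finally show ?thesis .
qed

text \<open>Within range, being at most \<open>c\<close> means that more than \<open>r - 1\<close>
  observations are, and this count is a sum of indicators.\<close>

lemma order_stat_measurable:
  assumes meas: "\<And>i. i \<in> {1..N} \<Longrightarrow> (\<lambda>s. X s i) \<in> borel_measurable M"
  shows "(\<lambda>s. order_stat (X s) N r) \<in> borel_measurable M"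
proof (cases "r - 1 < N")
  case False
  have "order_stat (X s) N r = [] ! (r - 1 - N)" for s
    using nth_beyond[of "sort (map (X s) [1..<Suc N])" "r - 1"] False
    by (simp add: order_stat_def not_less del: upt_Suc One_nat_def)
  then show ?thesis by simp
next
  case True
  have iff: "order_stat (X s) N r \<le> c \<longleftrightarrow> r - 1 < card {i\<in>{1..N}. X s i \<le> c}" for s c
  proof -
    let ?ys = "sort (map (X s) [1..<Suc N])"
    have sorted: "?ys ! i \<le> ?ys ! j" if "i \<le> j" "j < N" for i j
      using that by (intro sorted_nth_mono) auto
    show ?thesis
      unfolding card_eq_card_sorted[where f = "X s" and P = "\<lambda>x. x \<le> c"] order_stat_def
    proof
      assume "?ys ! (r - 1) \<le> c"
      then have "{..r - 1} \<subseteq> {j. j < N \<and> ?ys ! j \<le> c}"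
        using True sorted[of _ "r - 1"] by (auto intro: order_trans)
      from card_mono[OF _ this] show "r - 1 < card {j. j < N \<and> ?ys ! j \<le> c}" by simp
    next
      assume *: "r - 1 < card {j. j < N \<and> ?ys ! j \<le> c}"
      show "?ys ! (r - 1) \<le> c"
      proof (rule ccontr)
        assume "\<not> ?ys ! (r - 1) \<le> c"
        then have "\<not> r - 1 \<le> j" if "j < N" "?ys ! j \<le> c" for j
          using sorted[of "r - 1" j] that by linarith
        then have "{j. j < N \<and> ?ys ! j \<le> c} \<subseteq> {..<r - 1}"
          by (auto simp: not_le)
        from card_mono[OF _ this] show False using * by simp
      qed
    qed
  qed
  show ?thesis
  proof (rule borel_measurable_iff_le[THEN iffD2], intro allI)
    fix c
    have "{s\<in>space M. order_stat (X s) N r \<le> c} = {s\<in>space M. real (r - 1) < (\<Sum>i\<in>{1..N}. indicator {..c} (X s i))}"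
    proof -
      have "real (card {i\<in>{1..N}. X s i \<le> c}) = (\<Sum>i\<in>{1..N}. indicator {..c} (X s i))" for s
        by (simp add: indicator_def sum.If_cases Int_def of_bool_def)
      from this[symmetric] show ?thesis unfolding iff by (simp only: of_nat_less_iff)
    qed
    moreover have "(\<lambda>s. \<Sum>i\<in>{1..N}. indicator {..c} (X s i) :: real) \<in> borel_measurable M"
      using meas by (intro borel_measurable_sum measurable_compose[OF _ borel_measurable_indicator]) auto
    ultimately show "{s\<in>space M. order_stat (X s) N r \<le> c} \<in> sets M" by simp
  qed
qed

text \<open>In the sorted list, indexed from 0, the threshold sits at \<open>N - k - 1\<close>, so
  only the \<open>k\<close> later entries can exceed it. The Hill sum runs over all of these, but
  entries tied with the threshold contribute \<open>ln 1 = 0\<close>; it may be taken over strict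
  exceedances even when there are ties.\<close>

lemma
  assumes "0 < k" "k < N"
  shows order_stat_card_greater: "card {i\<in>{1..N}. f i > order_stat f N (N - k)} \<le> k"
    and order_stat_card_ge: "k < card {i\<in>{1..N}. f i \<ge> order_stat f N (N - k)}"
    and order_stat_mem: "\<exists>i\<in>{1..N}. order_stat f N (N - k) = f i"
    and hill_eq: "order_stat f N (N - k) \<noteq> 0 \<Longrightarrow> hill f N k =
      (\<Sum>i\<in>{i\<in>{1..N}. f i > order_stat f N (N - k)}. ln (f i / order_stat f N (N - k))) / real k"
proof -
  let ?ys = "sort (map f [1..<Suc N])"
  define \<theta> where "\<theta> = order_stat f N (N - k)"
  have \<theta>: "\<theta> = ?ys ! (N - k - 1)" by (simp add: \<theta>_def order_stat_def)
  have len: "length ?ys = N" by simp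
  have sorted: "?ys ! i \<le> ?ys ! j" if "i \<le> j" "j < N" for i j
    using that by (intro sorted_nth_mono) auto
  have gt: "{j. j < N \<and> ?ys ! j > \<theta>} \<subseteq> {N - k..<N}"
  proof
    fix j assume j: "j \<in> {j. j < N \<and> ?ys ! j > \<theta>}"
    have "\<not> j \<le> N - k - 1" using sorted[of j "N - k - 1"] j assms unfolding \<theta> by auto
    then show "j \<in> {N - k..<N}" using j by auto
  qed
  have ge: "\<theta> \<le> ?ys ! j" if "j \<in> {N - k - 1..<N}" for j
    using sorted[of "N - k - 1" j] that unfolding \<theta> by auto
  show "card {i\<in>{1..N}. f i > order_stat f N (N - k)} \<le> k"
    unfolding card_eq_card_sorted \<theta>_def[symmetric] using card_mono[OF _ gt] assms by simp
  have "{N - k - 1..<N} \<subseteq> {j. j < N \<and> ?ys ! j \<ge> \<theta>}" using ge by auto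
  from card_mono[OF _ this] show "k < card {i\<in>{1..N}. f i \<ge> order_stat f N (N - k)}"
    unfolding card_eq_card_sorted \<theta>_def[symmetric] using assms by simp
  have "\<theta> \<in> set ?ys" unfolding \<theta> using assms len by (intro nth_mem) simp
  then show "\<exists>i\<in>{1..N}. order_stat f N (N - k) = f i" unfolding \<theta>_def[symmetric] by auto
  assume nz: "order_stat f N (N - k) \<noteq> 0"
  define h where "h x = (if x > \<theta> then ln (x / \<theta>) else 0)" for x
  have "(\<Sum>i=1..k. ln (order_stat f N (N - i + 1) / \<theta>)) = (\<Sum>j\<in>{N - k..<N}. ln (?ys ! j / \<theta>))"
    using assms by (intro sum.reindex_bij_witness[where i = "\<lambda>j. N - j" and j = "\<lambda>i. N - i"])
      (auto simp: order_stat_def)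
  also have "\<dots> = (\<Sum>j\<in>{N - k..<N}. h (?ys ! j))"
  proof (rule sum.cong[OF refl])
    fix j assume "j \<in> {N - k..<N}"
    then have "?ys ! j \<ge> \<theta>" by (intro ge) auto
    then show "ln (?ys ! j / \<theta>) = h (?ys ! j)"
      using nz unfolding h_def \<theta>_def[symmetric] by (cases "?ys ! j = \<theta>") (simp_all add: less_le)
  qed
  also have "\<dots> = (\<Sum>j<N. h (?ys ! j))"
    using gt assms by (intro sum.mono_neutral_left) (auto simp: h_def)
  also have "\<dots> = (\<Sum>i=1..N. h (f i))" by (rule sum_eq_sum_sorted[symmetric])
  also have "\<dots> = (\<Sum>i\<in>{i\<in>{1..N}. f i > \<theta>}. ln (f i / \<theta>))"
    unfolding h_def by (simp add: sum.If_cases Int_def)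
  finally show "hill f N k = (\<Sum>i\<in>{i\<in>{1..N}. f i > order_stat f N (N - k)}. ln (f i / order_stat f N (N - k))) / real k"
    unfolding hill_def \<theta>_def[symmetric] by simp
qed

section \<open>Tail quantile functions of a continuous distribution\<close>

lemma tail_quantile_eq:
  assumes "t > 0" "\<And>x. F x \<le> 1"
  shows "tail_quantile F t = Inf {x. survival F x \<le> 1 / t}"
proof -
  have "survival F x = 0 \<or> t \<le> 1 / survival F x \<longleftrightarrow> survival F x \<le> 1 / t" for x
    using assms(1) assms(2)[of x] by (cases "survival F x = 0") (auto simp: survival_def field_simps)
  then show ?thesis by (simp add: tail_quantile_def)
qed

lemma quantile_eq_tail_quantile:
  assumes "p > 0" "\<And>x. F x \<le> 1"
  shows "quantile F (1 - p) = tail_quantile F (1 / p)"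
  using assms by (subst tail_quantile_eq) (auto simp: quantile_def survival_def algebra_simps)

locale continuous_cdf =
  fixes F :: "real \<Rightarrow> real" and P :: "real measure"
  assumes P: "real_distribution P" and F: "F = cdf P" and cont: "continuous_on UNIV F"
begin

sublocale P: real_distribution P by (rule P)

lemma F_mono: "x \<le> y \<Longrightarrow> F x \<le> F y"
  by (simp add: F P.cdf_nondecreasing)

lemma F_le_1: "F x \<le> 1"
  by (simp add: F P.cdf_bounded_prob)

lemma survival_nonneg: "0 \<le> survival F x"
  using F_le_1[of x] by (simp add: survival_def)

text \<open>For levels from 2 on, \<open>1 - 1 / t\<close> lies strictly inside the unit interval,
  so the sets are nonempty and bounded below and their infima are comparable. Any bound above 1
  would serve.\<close>

lemma tail_quantile_mono: "mono_on {2..} (tail_quantile F)"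
proof (rule mono_onI)
  fix s t :: real assume st: "s \<in> {2..}" "t \<in> {2..}" "s \<le> t"
  have "\<forall>\<^sub>F x in at_top. F x > 1 - 1 / t"
    unfolding F using st by (intro order_tendstoD[OF P.cdf_lim_at_top_prob]) auto
  then obtain x where "F x > 1 - 1 / t" by (auto simp: eventually_at_top_linorder)
  then have ne: "{x. survival F x \<le> 1 / t} \<noteq> {}"
    by (auto simp: survival_def intro!: exI[of _ x])
  have "\<forall>\<^sub>F x in at_bot. F x < 1 - 1 / s"
    unfolding F using st by (intro order_tendstoD[OF P.cdf_lim_at_bot]) (auto simp: divide_less_eq)
  then obtain b where b: "\<And>x. x \<le> b \<Longrightarrow> F x < 1 - 1 / s" by (auto simp: eventually_at_bot_linorder)
  have "bdd_below {x. survival F x \<le> 1 / s}"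
  proof (rule bdd_belowI)
    fix x assume "x \<in> {x. survival F x \<le> 1 / s}"
    then show "b \<le> x" using b[of x] by (cases "x \<le> b") (auto simp: survival_def)
  qed
  moreover have "1 / t \<le> 1 / s" using st by (intro divide_left_mono) auto
  then have "{x. survival F x \<le> 1 / t} \<subseteq> {x. survival F x \<le> 1 / s}" by auto
  ultimately show "tail_quantile F s \<le> tail_quantile F t"
    using st ne F_le_1 by (simp add: tail_quantile_eq cInf_superset_mono)
qed

lemma uniform_rv_survival:
  assumes "prob_space M" and X: "X \<in> borel_measurable M" and PX: "P = distr M borel X"
  shows "uniform_rv M (\<lambda>s. survival F (X s))"
proof -
  interpret M: prob_space M by fact
  have [measurable]: "F \<in> borel_measurable borel"
    by (rule borel_measurable_mono) (simp add: mono_def F_mono)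
  note X[measurable]
  show ?thesis
  proof
    show "(\<lambda>s. survival F (X s)) \<in> borel_measurable M" unfolding survival_def by measurable
    show "0 \<le> survival F (X s)" for s by (rule survival_nonneg)
    show "M.prob {s \<in> space M. survival F (X s) \<le> u} = u" if "0 \<le> u" "u \<le> 1" for u
      using that cont by (intro M.survival_uniform X) (simp_all add: F PX)
  qed
qed

text \<open>On a flat piece of \<open>F\<close> the generalised inverse returns the left end, so
  equality holds only almost surely. For each \<open>q\<close> the event that
  \<open>F X > F q\<close> is contained in \<open>X > q\<close> and has the same probability, so
  \<open>X\<close> almost never exceeds \<open>q\<close> with the same value of \<open>F\<close>;
  rational \<open>q\<close> suffice.\<close>

lemma tail_quantile_survival:
  assumes "prob_space M" and X[measurable]: "X \<in> borel_measurable M" and PX: "P = distr M borel X"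
  shows "AE s in M. tail_quantile F (1 / survival F (X s)) = X s"
proof -
  interpret U: uniform_rv M "\<lambda>s. survival F (X s)"
    using assms by (rule uniform_rv_survival)
  have [measurable]: "F \<in> borel_measurable borel"
    by (rule borel_measurable_mono) (simp add: mono_def F_mono)
  have null: "AE s in M. \<not> (X s > q \<and> F (X s) = F q)" for q
  proof -
    define v where "v = survival F q"
    have v: "0 \<le> v" "v \<le> 1"
      using survival_nonneg by (auto simp: v_def survival_def F P.cdf_nonneg)
    have "v \<le> U.prob {s\<in>space M. survival F (X s) < v}"
    proof (cases "v = 0")
      case False
      show ?thesis
      proof (rule dense_le_bounded[of 0])
        fix u assume u: "0 < u" "u < v"
        then have "u = U.prob {s\<in>space M. survival F (X s) \<le> u}" using v by (simp add: U.V_uniform)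
        also have "\<dots> \<le> U.prob {s\<in>space M. survival F (X s) < v}"
          using u by (intro U.finite_measure_mono) auto
        finally show "u \<le> U.prob {s\<in>space M. survival F (X s) < v}" .
      qed (use False v in simp)
    qed simp
    moreover have "U.prob {s\<in>space M. X s > q} = v"
    proof -
      have "U.prob {s\<in>space M. X s \<le> q} = F q"
        unfolding F PX cdf_def by (subst measure_distr) (auto intro!: arg_cong[where f = U.prob])
      moreover have "{s\<in>space M. X s > q} = space M - {s\<in>space M. X s \<le> q}" by auto
      ultimately show ?thesis by (simp add: U.prob_compl v_def survival_def)
    qed
    moreover have "{s\<in>space M. survival F (X s) < v} \<subseteq> {s\<in>space M. X s > q}"
      using F_mono by (auto simp: v_def survival_def not_le[symmetric])
    ultimately have "U.prob ({s\<in>space M. X s > q} - {s\<in>space M. survival F (X s) < v}) \<le> 0"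
      by (subst U.finite_measure_Diff) (auto simp: survival_def)
    then have "U.prob ({s\<in>space M. X s > q} - {s\<in>space M. survival F (X s) < v}) = 0"
      by (simp add: measure_le_0_iff)
    then have "AE s in M. s \<notin> {s\<in>space M. X s > q} - {s\<in>space M. survival F (X s) < v}"
      by (subst (asm) U.prob_eq_0) (auto simp: survival_def)
    then show ?thesis
      using AE_space by eventually_elim (auto simp: v_def survival_def)
  qed
  have "AE s in M. \<forall>q\<in>\<rat>. \<not> (X s > q \<and> F (X s) = F q)"
    by (subst AE_ball_countable) (use null countable_rat in auto)
  then show ?thesis
    using U.V_pos
  proof eventually_elim
    case (elim s)
    have "Inf {x. survival F x \<le> survival F (X s)} = X s"
    proof (rule cInf_eq_minimum)
      fix x assume "x \<in> {x. survival F x \<le> survival F (X s)}"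
      then have le: "F (X s) \<le> F x" by (simp add: survival_def)
      show "X s \<le> x"
      proof (rule ccontr)
        assume "\<not> X s \<le> x"
        then obtain q where q: "q \<in> \<rat>" "x < q" "q < X s" using Rats_dense_in_real[of x "X s"] by auto
        then have "F (X s) = F q" using le F_mono[of x q] F_mono[of q "X s"] by auto
        then show False using elim(1) q by blast
      qed
    qed simp
    then show ?case using elim(2) F_le_1 by (subst tail_quantile_eq) auto
  qed
qed

end


section \<open>Logarithmic expansions in one continuous sample\<close>

lemma eventually_intermediate:
  fixes N k :: "nat \<Rightarrow> nat"
  assumes "filterlim k at_top sequentially" "filterlim N at_top sequentially"
    "(\<lambda>n. real (k n) / real (N n)) \<longlonglongrightarrow> 0"
  shows "\<forall>\<^sub>F n in sequentially. 0 < k n \<and> k n < N n"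
  using filterlim_at_top[THEN iffD1, OF assms(1), rule_format, of 1]
    filterlim_at_top[THEN iffD1, OF assms(2), rule_format, of 1]
    order_tendstoD(2)[OF assms(3) zero_less_one]
  by eventually_elim (auto simp: divide_less_eq)

locale hill_sample = prob_space M + continuous_cdf F P
  for M :: "'a measure" and F :: "real \<Rightarrow> real" and P :: "real measure" +
  fixes X :: "nat \<Rightarrow> 'a \<Rightarrow> real" and N k :: "nat \<Rightarrow> nat" and A :: "real \<Rightarrow> real" and \<gamma> \<rho> lam l :: real
  assumes X_meas: "\<And>i. i \<ge> 1 \<Longrightarrow> X i \<in> borel_measurable M"
    and X_distr: "\<And>i. i \<ge> 1 \<Longrightarrow> distr M borel (X i) = P"
    and X_indep: "indep_vars (\<lambda>_. borel) X {1..}"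
    and N_top: "filterlim N at_top sequentially"
    and k_top: "filterlim k at_top sequentially"
    and k_N: "(\<lambda>n. real (k n) / real (N n)) \<longlonglongrightarrow> 0"
    and \<rho>_neg: "\<rho> < 0"
    and U_pos: "\<forall>\<^sub>F t in at_top. tail_quantile F t > 0"
    and expansion: "\<And>\<epsilon>. \<epsilon> > 0 \<Longrightarrow> \<forall>\<^sub>F t in at_top. \<forall>x\<ge>1/2.
      \<bar>ln (tail_quantile F (t * x)) - \<gamma> * ln (t * x) - l - x powr \<rho> * A t / \<rho>\<bar> \<le> \<epsilon> * \<bar>A t\<bar>"
    and lam: "(\<lambda>n. sqrt (real (k n)) * A (real (N n) / real (k n))) \<longlonglongrightarrow> lam"
begin

definition V :: "nat \<Rightarrow> 'a \<Rightarrow> real" where "V i s = survival F (X i s)"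
definition \<theta> :: "nat \<Rightarrow> 'a \<Rightarrow> real" where "\<theta> n s = order_stat (\<lambda>i. X i s) (N n) (N n - k n)"
text \<open>Logarithmic deviation from the power law \<open>exp l * t powr \<gamma>\<close>.\<close>

definition D :: "real \<Rightarrow> real" where "D t = ln (tail_quantile F t) - \<gamma> * ln t - l"

lemma V_uniform: "i \<ge> 1 \<Longrightarrow> uniform_rv M (V i)"
  unfolding V_def using X_meas X_distr by (intro uniform_rv_survival prob_space_axioms) auto

lemma X_eq: "AE s in M. \<forall>i\<in>{1..}. V i s > 0 \<and> tail_quantile F (1 / V i s) = X i s"
proof (subst AE_ball_countable)
  show "\<forall>i\<in>{1..}. AE s in M. V i s > 0 \<and> tail_quantile F (1 / V i s) = X i s"
  proof
    fix i :: nat assume "i \<in> {1..}"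
    then have i: "i \<ge> 1" by simp
    have "AE s in M. tail_quantile F (1 / V i s) = X i s"
      unfolding V_def using X_meas[OF i] X_distr[OF i] by (intro tail_quantile_survival prob_space_axioms) auto
    with uniform_rv.V_pos[OF V_uniform[OF i]]
    show "AE s in M. V i s > 0 \<and> tail_quantile F (1 / V i s) = X i s" by eventually_elim simp
  qed
qed simp

text \<open>On the event that \<open>tail_quantile F\<close> inverts the survival transform at all
  observations, these decrease strictly in the \<open>V i\<close>, so order statistics of
  \<open>X\<close> translate into counts for \<open>V\<close>. Equal values of \<open>V\<close>
  force equal observations, which settles strictness.\<close>

lemma threshold_facts:
  assumes X: "\<forall>i\<in>{1..}. V i s > 0 \<and> tail_quantile F (1 / V i s) = X i s" and k: "0 < k n" "k n < N n"
  shows "survival F (\<theta> n s) > 0" "tail_quantile F (1 / survival F (\<theta> n s)) = \<theta> n s"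
    and "i \<ge> 1 \<Longrightarrow> \<theta> n s < X i s \<longleftrightarrow> V i s < survival F (\<theta> n s)"
    and "card {i\<in>{1..N n}. V i s < survival F (\<theta> n s)} \<le> k n"
    and "k n < card {i\<in>{1..N n}. V i s \<le> survival F (\<theta> n s)}"
proof -
  obtain i0 where i0: "i0 \<in> {1..N n}" "\<theta> n s = X i0 s"
    using order_stat_mem[OF k, of "\<lambda>i. X i s"] by (auto simp: \<theta>_def)
  show 1: "survival F (\<theta> n s) > 0" "tail_quantile F (1 / survival F (\<theta> n s)) = \<theta> n s"
    using X i0 by (auto simp: V_def)
  have iff: "\<theta> n s < X i s \<longleftrightarrow> V i s < survival F (\<theta> n s)" if "i \<ge> 1" for i
  proof
    assume "V i s < survival F (\<theta> n s)"
    then have "F (\<theta> n s) < F (X i s)" by (simp add: V_def survival_def)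
    then show "\<theta> n s < X i s" using F_mono[of "X i s" "\<theta> n s"] by linarith
  next
    assume *: "\<theta> n s < X i s"
    then have "V i s \<le> survival F (\<theta> n s)" using F_mono[of "\<theta> n s" "X i s"] by (simp add: V_def survival_def)
    moreover have "V i s \<noteq> survival F (\<theta> n s)" using X that 1(2) * by force
    ultimately show "V i s < survival F (\<theta> n s)" by simp
  qed
  then show "i \<ge> 1 \<Longrightarrow> \<theta> n s < X i s \<longleftrightarrow> V i s < survival F (\<theta> n s)" .
  have "{i\<in>{1..N n}. V i s < survival F (\<theta> n s)} = {i\<in>{1..N n}. X i s > \<theta> n s}"
    using iff by auto
  then show "card {i\<in>{1..N n}. V i s < survival F (\<theta> n s)} \<le> k n"
    using order_stat_card_greater[OF k, of "\<lambda>i. X i s"] by (simp add: \<theta>_def)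
  have "{i\<in>{1..N n}. X i s \<ge> \<theta> n s} \<subseteq> {i\<in>{1..N n}. V i s \<le> survival F (\<theta> n s)}"
    using F_mono by (auto simp: V_def survival_def)
  from card_mono[OF _ this] show "k n < card {i\<in>{1..N n}. V i s \<le> survival F (\<theta> n s)}"
    using order_stat_card_ge[OF k, of "\<lambda>i. X i s"] by (simp add: \<theta>_def)
qed

lemma intermediate: "\<forall>\<^sub>F n in sequentially. 0 < k n \<and> k n < N n"
  by (rule eventually_intermediate[OF k_top N_top k_N])

sublocale S: second_order_sample M V N k "\<lambda>n s. survival F (\<theta> n s)" D A \<rho> lam
proof (intro second_order_sample.intro uniform_sample_threshold.intro uniform_sample.intro
    uniform_sample_axioms.intro uniform_sample_threshold_axioms.intro second_order_sample_axioms.intro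
    prob_space_axioms)
  show "uniform_rv M (V i)" if "i \<ge> 1" for i using that by (rule V_uniform)
  have [measurable]: "F \<in> borel_measurable borel"
    by (rule borel_measurable_mono) (simp add: mono_def F_mono)
  show "indep_vars (\<lambda>_. borel) V {1..}"
    unfolding V_def survival_def by (rule indep_vars_compose2[OF X_indep]) auto
  show "\<forall>\<^sub>F n in sequentially. AE s in M. survival F (\<theta> n s) > 0 \<and>
    card {i\<in>{1..N n}. V i s < survival F (\<theta> n s)} \<le> k n \<and> k n < card {i\<in>{1..N n}. V i s \<le> survival F (\<theta> n s)}"
    using intermediate
  proof eventually_elim
    case (elim n)
    from X_eq show ?case
      by eventually_elim (use threshold_facts elim in blast)
  qed
  show "\<forall>\<^sub>F t in at_top. \<forall>x\<ge>1/2. \<bar>D (t * x) - x powr \<rho> * A t / \<rho>\<bar> \<le> \<epsilon> * \<bar>A t\<bar>" if "\<epsilon> > 0" for \<epsilon>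
    using expansion[OF that] by (simp add: D_def diff_diff_eq algebra_simps)
qed (use N_top k_top k_N \<rho>_neg lam in auto)

lemma tail_quantile_pos_small: "\<forall>\<^sub>F n in sequentially. \<forall>v. 0 < v \<and> v \<le> 2 * S.a n \<longrightarrow> tail_quantile F (1 / v) > 0"
proof -
  obtain t0 where t0: "\<And>t. t \<ge> t0 \<Longrightarrow> tail_quantile F t > 0"
    using U_pos unfolding eventually_at_top_linorder by blast
  have "\<forall>\<^sub>F n in sequentially. S.a n < 1 / (2 * (\<bar>t0\<bar> + 1))"
    by (rule S.a_less) (simp add: add_nonneg_pos)
  then show ?thesis
  proof eventually_elim
    case (elim n)
    show ?case
    proof (intro allI impI, elim conjE)
      fix v assume v: "0 < v" "v \<le> 2 * S.a n"
      have "v * (\<bar>t0\<bar> + 1) \<le> (2 * S.a n) * (\<bar>t0\<bar> + 1)"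
        using v by (intro mult_right_mono) auto
      also have "\<dots> \<le> 1" using elim by (simp add: field_simps)
      finally have "\<bar>t0\<bar> + 1 \<le> 1 / v" using v by (simp add: pos_le_divide_eq mult.commute)
      then show "tail_quantile F (1 / v) > 0" by (intro t0) linarith
    qed
  qed
qed

text \<open>Everything is expressed through \<open>V\<close>:
  \<open>ln X = l - \<gamma> * ln V + D (1 / V)\<close>, so each log-spacing splits into
  \<open>\<gamma>\<close> times a uniform log-excess and a difference of deviations, while
  \<open>l\<close> cancels. Positivity is only known from the threshold upwards, and only there are
  logarithms taken.\<close>

lemma threshold_expansion:
  "whp M (\<lambda>n s. S.regular n s \<and> \<theta> n s > 0 \<and> ln (\<theta> n s) = l - \<gamma> * ln (survival F (\<theta> n s)) + D (1 / survival F (\<theta> n s)) \<and>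
    hill (\<lambda>i. X i s) (N n) (k n) = (\<gamma> * (\<Sum>i=1..N n. tail_log 1 (survival F (\<theta> n s)) (V i s)) +
      (\<Sum>i\<in>{i\<in>{1..N n}. V i s < survival F (\<theta> n s)}. D (1 / V i s) - D (1 / survival F (\<theta> n s)))) / real (k n))"
proof (rule whp_mono')
  have 1: "whp M (\<lambda>n s. \<forall>i\<in>{1..}. V i s > 0 \<and> tail_quantile F (1 / V i s) = X i s)"
    using X_eq by (intro whp_AE) simp
  show "whp M (\<lambda>n s. (\<forall>i\<in>{1..}. V i s > 0 \<and> tail_quantile F (1 / V i s) = X i s) \<and> (0 < k n \<and> k n < N n) \<and>
      (\<forall>v. 0 < v \<and> v \<le> 2 * S.a n \<longrightarrow> tail_quantile F (1 / v) > 0) \<and> survival F (\<theta> n s) \<le> 2 * S.a n \<and> S.regular n s)"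
    by (intro whp_conj 1 whp_eventually intermediate tail_quantile_pos_small S.\<tau>_le S.regular)
next
  fix n s
  assume *: "(\<forall>i\<in>{1..}. V i s > 0 \<and> tail_quantile F (1 / V i s) = X i s) \<and> (0 < k n \<and> k n < N n) \<and>
      (\<forall>v. 0 < v \<and> v \<le> 2 * S.a n \<longrightarrow> tail_quantile F (1 / v) > 0) \<and> survival F (\<theta> n s) \<le> 2 * S.a n \<and> S.regular n s"
  define \<tau> where "\<tau> = survival F (\<theta> n s)"
  have X: "\<forall>i\<in>{1..}. V i s > 0 \<and> tail_quantile F (1 / V i s) = X i s" and k: "0 < k n" "k n < N n"
    and pos: "\<And>v. 0 < v \<Longrightarrow> v \<le> 2 * S.a n \<Longrightarrow> tail_quantile F (1 / v) > 0"
    and le: "\<tau> \<le> 2 * S.a n" and reg: "S.regular n s"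
    using * by (auto simp: \<tau>_def)
  note T = threshold_facts[OF X k, folded \<tau>_def]
  have \<theta>_pos: "\<theta> n s > 0" using pos[OF T(1) le] T(2) by simp
  have lnU: "ln (tail_quantile F (1 / v)) = l - \<gamma> * ln v + D (1 / v)" if "v > 0" for v
    using that by (simp add: D_def ln_div)
  have ln\<theta>: "ln (\<theta> n s) = l - \<gamma> * ln \<tau> + D (1 / \<tau>)" using lnU[OF T(1)] T(2) by simp
  have "hill (\<lambda>i. X i s) (N n) (k n) =
      (\<Sum>i\<in>{i\<in>{1..N n}. X i s > \<theta> n s}. ln (X i s / \<theta> n s)) / real (k n)"
    using hill_eq[OF k, of "\<lambda>i. X i s"] \<theta>_pos by (simp add: \<theta>_def)
  also have "(\<Sum>i\<in>{i\<in>{1..N n}. X i s > \<theta> n s}. ln (X i s / \<theta> n s)) =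
      (\<Sum>i\<in>{i\<in>{1..N n}. V i s < \<tau>}. \<gamma> * tail_log 1 \<tau> (V i s) + (D (1 / V i s) - D (1 / \<tau>)))"
  proof (rule sum.cong)
    show "{i\<in>{1..N n}. X i s > \<theta> n s} = {i\<in>{1..N n}. V i s < \<tau>}" using T(3) by auto
    fix i assume "i \<in> {i\<in>{1..N n}. V i s < \<tau>}"
    then have i: "i \<ge> 1" "V i s < \<tau>" by auto
    have V: "V i s > 0" "tail_quantile F (1 / V i s) = X i s" using X i by auto
    have "X i s > 0" using pos[of "V i s"] V i le by auto
    then have "ln (X i s / \<theta> n s) = ln (X i s) - ln (\<theta> n s)" using \<theta>_pos by (simp add: ln_div)
    also have "\<dots> = \<gamma> * (ln \<tau> - ln (V i s)) + (D (1 / V i s) - D (1 / \<tau>))"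
      using lnU[OF V(1)] V(2) ln\<theta> by (simp add: algebra_simps)
    also have "ln \<tau> - ln (V i s) = tail_log 1 \<tau> (V i s)"
      using i V T(1) tail_log_one_eq[of "V i s" \<tau>] by simp
    finally show "ln (X i s / \<theta> n s) = \<gamma> * tail_log 1 \<tau> (V i s) + (D (1 / V i s) - D (1 / \<tau>))" .
  qed
  also have "\<dots> = \<gamma> * (\<Sum>i\<in>{i\<in>{1..N n}. V i s < \<tau>}. tail_log 1 \<tau> (V i s)) +
      (\<Sum>i\<in>{i\<in>{1..N n}. V i s < \<tau>}. D (1 / V i s) - D (1 / \<tau>))"
    by (simp add: sum.distrib sum_distrib_left)
  also have "(\<Sum>i\<in>{i\<in>{1..N n}. V i s < \<tau>}. tail_log 1 \<tau> (V i s)) = (\<Sum>i=1..N n. tail_log 1 \<tau> (V i s))"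
    using T(1) by (intro sum.mono_neutral_left) (auto simp: tail_log_def less_le)
  finally show "S.regular n s \<and> \<theta> n s > 0 \<and> ln (\<theta> n s) = l - \<gamma> * ln (survival F (\<theta> n s)) + D (1 / survival F (\<theta> n s)) \<and>
    hill (\<lambda>i. X i s) (N n) (k n) = (\<gamma> * (\<Sum>i=1..N n. tail_log 1 (survival F (\<theta> n s)) (V i s)) +
      (\<Sum>i\<in>{i\<in>{1..N n}. V i s < survival F (\<theta> n s)}. D (1 / V i s) - D (1 / survival F (\<theta> n s)))) / real (k n)"
    unfolding \<tau>_def[symmetric] using reg \<theta>_pos ln\<theta> by simp
qed

theorem hill_expansion:
  "o_pr M (\<lambda>n s. sqrt (real (k n)) * (hill (\<lambda>i. X i s) (N n) (k n) - \<gamma>) - (\<gamma> * S.excess n s + lam / (1 - \<rho>)))"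
proof -
  have "o_pr M (\<lambda>n s. (((\<Sum>i=1..N n. tail_log 1 (survival F (\<theta> n s)) (V i s)) - real (k n)) / sqrt (real (k n)) - S.excess n s) * \<gamma> +
     ((\<Sum>i\<in>{i\<in>{1..N n}. V i s < survival F (\<theta> n s)}. D (1 / V i s) - D (1 / survival F (\<theta> n s))) / sqrt (real (k n)) - lam / (1 - \<rho>)))"
    by (intro o_pr_add S.bias_sum o_pr_O_pr_mult S.log_excess_expansion O_pr_const[OF tendsto_const])
  then show ?thesis
  proof (rule o_pr_cong, intro whp_mono'[OF threshold_expansion], elim conjE)
    fix n s
    assume reg: "S.regular n s" and h: "hill (\<lambda>i. X i s) (N n) (k n) = (\<gamma> * (\<Sum>i=1..N n. tail_log 1 (survival F (\<theta> n s)) (V i s)) +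
      (\<Sum>i\<in>{i\<in>{1..N n}. V i s < survival F (\<theta> n s)}. D (1 / V i s) - D (1 / survival F (\<theta> n s)))) / real (k n)"
    have k0: "real (k n) > 0" using reg by (simp add: S.regular_def)
    have e: "sqrt (real (k n)) * ((\<gamma> * x + y) / real (k n) - \<gamma>) = \<gamma> * ((x - real (k n)) / sqrt (real (k n))) + y / sqrt (real (k n))" for x y
    proof -
      define w where "w = sqrt (real (k n))"
      have "w > 0" "real (k n) = w * w" using k0 by (simp_all add: w_def)
      then show ?thesis unfolding w_def[symmetric] by (simp add: field_simps)
    qed
    show "(((\<Sum>i=1..N n. tail_log 1 (survival F (\<theta> n s)) (V i s)) - real (k n)) / sqrt (real (k n)) - S.excess n s) * \<gamma> +
     ((\<Sum>i\<in>{i\<in>{1..N n}. V i s < survival F (\<theta> n s)}. D (1 / V i s) - D (1 / survival F (\<theta> n s))) / sqrt (real (k n)) - lam / (1 - \<rho>))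
      = sqrt (real (k n)) * (hill (\<lambda>i. X i s) (N n) (k n) - \<gamma>) - (\<gamma> * S.excess n s + lam / (1 - \<rho>))"
      unfolding h e by (simp add: algebra_simps)
  qed
qed

lemma hill_O_pr: "O_pr M (\<lambda>n s. sqrt (real (k n)) * (hill (\<lambda>i. X i s) (N n) (k n) - \<gamma>))"
proof -
  have "O_pr M (\<lambda>n s. (sqrt (real (k n)) * (hill (\<lambda>i. X i s) (N n) (k n) - \<gamma>) - (\<gamma> * S.excess n s + lam / (1 - \<rho>)))
     + (\<gamma> * S.excess n s + lam / (1 - \<rho>)))"
    by (intro O_pr_add O_pr_mult o_pr_imp_O_pr[OF hill_expansion] S.excess_O_pr O_pr_const[OF tendsto_const])
  then show ?thesis by simp
qed

text \<open>The log-threshold fluctuates by the order \<open>1 / sqrt k\<close> around the power law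
  at the level \<open>S.a n\<close>. Next to a tail index error of that order multiplied by a
  divergent logarithm, this is negligible.\<close>

lemma threshold_O_pr: "O_pr M (\<lambda>n s. sqrt (real (k n)) * (ln (\<theta> n s) - l + \<gamma> * ln (S.a n)))"
proof -
  have "O_pr M (\<lambda>n s. (- \<gamma>) * S.log_ratio n s + sqrt (real (k n)) * D (1 / survival F (\<theta> n s)))"
    by (intro O_pr_add O_pr_mult S.D_threshold_O_pr S.log_ratio_O_pr O_pr_const[OF tendsto_const])
  then show ?thesis
  proof (rule O_pr_cong, intro whp_mono'[OF threshold_expansion], elim conjE)
    fix n s
    assume reg: "S.regular n s" and t: "ln (\<theta> n s) = l - \<gamma> * ln (survival F (\<theta> n s)) + D (1 / survival F (\<theta> n s))"
    have "ln (survival F (\<theta> n s) / S.a n) = ln (survival F (\<theta> n s)) - ln (S.a n)"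
      using reg by (simp add: S.regular_def ln_div)
    show "- \<gamma> * S.log_ratio n s + sqrt (real (k n)) * D (1 / survival F (\<theta> n s)) =
        sqrt (real (k n)) * (ln (\<theta> n s) - l + \<gamma> * ln (S.a n))"
      unfolding t S.log_ratio_def \<open>ln (survival F (\<theta> n s) / S.a n) = ln (survival F (\<theta> n s)) - ln (S.a n)\<close>
      by (simp add: algebra_simps)
  qed
qed

text \<open>The level may be of smaller order than \<open>S.a n\<close>: the deviation
  \<open>D\<close> is bounded uniformly over all smaller levels.\<close>

lemma extreme_quantile_bounded:
  assumes p: "\<forall>\<^sub>F n in sequentially. 0 < p n \<and> p n \<le> 2 * S.a n"
  shows "O_pr M (\<lambda>n s. sqrt (real (k n)) * (ln (tail_quantile F (1 / p n)) - l + \<gamma> * ln (p n)))"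
    and "\<forall>\<^sub>F n in sequentially. tail_quantile F (1 / p n) > 0"
proof -
  obtain C where C: "\<forall>\<^sub>F n in sequentially. \<forall>v. 0 < v \<and> v \<le> 2 * S.a n \<longrightarrow> \<bar>sqrt (real (k n)) * D (1 / v)\<bar> \<le> C"
    using S.D_bounded by blast
  have "\<forall>\<^sub>F n in sequentially. \<bar>sqrt (real (k n)) * (ln (tail_quantile F (1 / p n)) - l + \<gamma> * ln (p n))\<bar> \<le> \<bar>C\<bar>"
    using C p
  proof eventually_elim
    case (elim n)
    have "ln (tail_quantile F (1 / p n)) - l + \<gamma> * ln (p n) = D (1 / p n)"
      using elim(2) by (simp add: D_def ln_div)
    then show ?case using elim(1)[rule_format, OF elim(2)] by simp
  qed
  then show "O_pr M (\<lambda>n s. sqrt (real (k n)) * (ln (tail_quantile F (1 / p n)) - l + \<gamma> * ln (p n)))"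
    by (intro O_pr_cong_whp[OF finite_measure_axioms O_pr_const[OF tendsto_const[of "\<bar>C\<bar>"]]] whp_eventually) simp
  show "\<forall>\<^sub>F n in sequentially. tail_quantile F (1 / p n) > 0"
    using tail_quantile_pos_small p by eventually_elim blast
qed

text \<open>Restated in terms of the data alone, without the derived variables of the sample, so
  that it applies to several dependent samples side by side.\<close>

lemma hill_expansion_explicit:
  "o_pr M (\<lambda>n s. sqrt (real (k n)) * (hill (\<lambda>i. X i s) (N n) (k n) - \<gamma>) -
    (\<gamma> * ((\<Sum>i=1..N n. tail_log 1 (real (k n) / real (N n)) (survival F (X i s))
        - tail_log 0 (real (k n) / real (N n)) (survival F (X i s))) / sqrt (real (k n))) + lam / (1 - \<rho>)))"
  using hill_expansion unfolding S.excess_def S.a_def V_def .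

lemma threshold_O_pr_explicit:
  "O_pr M (\<lambda>n s. sqrt (real (k n)) * (ln (order_stat (\<lambda>i. X i s) (N n) (N n - k n)) - l
    + \<gamma> * ln (real (k n) / real (N n))))"
  using threshold_O_pr unfolding S.a_def \<theta>_def .

lemma extreme_quantile_bounded_explicit:
  assumes "\<forall>\<^sub>F n in sequentially. 0 < p n \<and> p n \<le> real (k n) / real (N n)"
  shows "O_pr M (\<lambda>n s. sqrt (real (k n)) * (ln (tail_quantile F (1 / p n)) - l + \<gamma> * ln (p n)))"
    and "\<forall>\<^sub>F n in sequentially. tail_quantile F (1 / p n) > 0"
proof -
  have "\<forall>\<^sub>F n in sequentially. 0 < p n \<and> p n \<le> 2 * S.a n"
    using assms by eventually_elim (auto simp: S.a_def)
  then show "O_pr M (\<lambda>n s. sqrt (real (k n)) * (ln (tail_quantile F (1 / p n)) - l + \<gamma> * ln (p n)))"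
    "\<forall>\<^sub>F n in sequentially. tail_quantile F (1 / p n) > 0"
    by (rule extreme_quantile_bounded)+
qed

lemma threshold_pos: "whp M (\<lambda>n s. order_stat (\<lambda>i. X i s) (N n) (N n - k n) > 0)"
  using threshold_expansion by (rule whp_mono') (simp add: \<theta>_def)

end

section \<open>The pooled estimators\<close>

lemma abs_sum_power_le:
  fixes x :: "nat \<Rightarrow> real"
  assumes "m \<ge> 1"
  shows "\<bar>\<Sum>j=1..m. x j\<bar> ^ q \<le> real m ^ q * (\<Sum>j=1..m. \<bar>x j\<bar> ^ q)"
proof -
  define B where "B = Max ((\<lambda>j. \<bar>x j\<bar>) ` {1..m})"
  have fin: "finite ((\<lambda>j. \<bar>x j\<bar>) ` {1..m})" "(\<lambda>j. \<bar>x j\<bar>) ` {1..m} \<noteq> {}" using assms by auto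
  then have "B \<in> (\<lambda>j. \<bar>x j\<bar>) ` {1..m}" unfolding B_def by (rule Max_in)
  then obtain j where j: "j \<in> {1..m}" "B = \<bar>x j\<bar>" by blast
  have "\<bar>\<Sum>j=1..m. x j\<bar> \<le> (\<Sum>j=1..m. B)"
    using fin by (intro order_trans[OF sum_abs] sum_mono) (auto simp: B_def)
  then have "\<bar>\<Sum>j=1..m. x j\<bar> ^ q \<le> (real m * B) ^ q" by (intro power_mono) auto
  also have "\<dots> = real m ^ q * \<bar>x j\<bar> ^ q" by (simp add: power_mult_distrib j)
  also have "\<dots> \<le> real m ^ q * (\<Sum>j=1..m. \<bar>x j\<bar> ^ q)"
    using j by (intro mult_left_mono member_le_sum) auto
  finally show ?thesis .
qed

lemma (in uniform_rv) score_third_moment: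
  assumes "0 < a" "a \<le> 1"
  shows "integrable M (\<lambda>s. \<bar>tail_log 1 a (V s) - tail_log 0 a (V s)\<bar> ^ 3)"
    and "expectation (\<lambda>s. \<bar>tail_log 1 a (V s) - tail_log 0 a (V s)\<bar> ^ 3) \<le> 28 * a"
proof -
  have cube: "\<bar>z - 1\<bar> ^ 3 \<le> 4 * z ^ 3 + 4" if "z \<ge> 0" for z :: real
  proof -
    have "\<bar>z - 1\<bar> ^ 3 \<le> (z + 1) ^ 3" using that by (intro power_mono) auto
    also have "(z + 1) ^ 3 = 4 * z ^ 3 + 4 - 3 * ((z + 1) * (z - 1)\<^sup>2)"
      by (simp add: power2_eq_square power3_eq_cube algebra_simps)
    also have "\<dots> \<le> 4 * z ^ 3 + 4" using that by simp
    finally show ?thesis .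
  qed
  have bound: "\<bar>tail_log 1 a (V s) - tail_log 0 a (V s)\<bar> ^ 3 \<le> 4 * tail_log 3 a (V s) + 4 * tail_log 0 a (V s)" for s
    using cube[of "tail_log 1 a (V s)"] tail_log_nonneg[OF V_nonneg[of s], of 1 a]
    by (cases "V s \<le> a") (auto simp: tail_log_def)
  show int: "integrable M (\<lambda>s. \<bar>tail_log 1 a (V s) - tail_log 0 a (V s)\<bar> ^ 3)"
  proof (rule Bochner_Integration.integrable_bound)
    show "integrable M (\<lambda>s. 4 * tail_log 3 a (V s) + 4 * tail_log 0 a (V s))" using assms by auto
    show "AE s in M. norm (\<bar>tail_log 1 a (V s) - tail_log 0 a (V s)\<bar> ^ 3) \<le> norm (4 * tail_log 3 a (V s) + 4 * tail_log 0 a (V s))"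
      using bound by (intro AE_I2) (auto intro: order_trans[OF _ abs_ge_self])
  qed measurable
  have "expectation (\<lambda>s. \<bar>tail_log 1 a (V s) - tail_log 0 a (V s)\<bar> ^ 3) \<le>
      expectation (\<lambda>s. 4 * tail_log 3 a (V s) + 4 * tail_log 0 a (V s))"
    using assms bound int by (intro integral_mono) auto
  \<comment> \<open>28 is \<open>4 * fact 3 + 4 * fact 0\<close>, from the bound
    \<open>\<bar>z - 1\<bar> ^ 3 \<le> 4 * z ^ 3 + 4\<close>.\<close>
  also have "\<dots> = 28 * a" using assms by (simp add: expectation_tail_log fact_numeral)
  finally show "expectation (\<lambda>s. \<bar>tail_log 1 a (V s) - tail_log 0 a (V s)\<bar> ^ 3) \<le> 28 * a" .
qed

text \<open>Delta method for the exponential. As \<open>r / d\<close> tends to infinity and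
  \<open>r / d * Z\<close> is tight, \<open>Z\<close> tends to 0 in probability, and the quadratic
  remainder is \<open>d / r\<close> times the square of a tight sequence.\<close>

lemma (in finite_measure) o_pr_ratio_of_log:
  assumes log: "o_pr M (\<lambda>n s. r n / d n * Z n s - T n s)" and T: "O_pr M T"
    and pos: "\<forall>\<^sub>F n in sequentially. r n > 0 \<and> d n > 0" and rd: "filterlim (\<lambda>n. r n / d n) at_top sequentially"
    and Q: "whp M (\<lambda>n s. Q n s = r n / d n * (exp (Z n s) - 1))"
  shows "o_pr M (\<lambda>n s. Q n s - T n s)"
proof -
  have dr: "(\<lambda>n. d n / r n) \<longlonglongrightarrow> 0"
    using tendsto_inverse_0_at_top[OF rd] by (simp add: inverse_eq_divide)
  have "O_pr M (\<lambda>n s. (r n / d n * Z n s - T n s) + T n s)"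
    by (intro O_pr_add o_pr_imp_O_pr log T)
  then have Y: "O_pr M (\<lambda>n s. r n / d n * Z n s)" by simp
  have "o_pr M (\<lambda>n s. d n / r n * (r n / d n * Z n s))"
    by (intro o_pr_O_pr_mult o_pr_const dr Y)
  then have "whp M (\<lambda>n s. \<bar>d n / r n * (r n / d n * Z n s)\<bar> \<le> 1)"
    unfolding o_pr_def using zero_less_one by blast
  from whp_conj[OF this whp_eventually[OF pos]] have Z1: "whp M (\<lambda>n s. \<bar>Z n s\<bar> \<le> 1 \<and> r n > 0 \<and> d n > 0)"
  proof (rule whp_mono', elim conjE)
    fix n s assume *: "\<bar>d n / r n * (r n / d n * Z n s)\<bar> \<le> 1" "r n > 0" "d n > 0"
    then have "d n / r n * (r n / d n * Z n s) = Z n s" by simp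
    then show "\<bar>Z n s\<bar> \<le> 1 \<and> r n > 0 \<and> d n > 0" using * by simp
  qed
  have "o_pr M (\<lambda>n s. d n / r n * ((r n / d n * Z n s) * (r n / d n * Z n s)))"
    by (intro o_pr_O_pr_mult o_pr_const dr O_pr_mult Y)
  then have "o_pr M (\<lambda>n s. Q n s - r n / d n * Z n s)"
  proof (rule o_pr_dominated, intro whp_mono'[OF whp_conj[OF Q Z1]], elim conjE)
    fix n s assume q: "Q n s = r n / d n * (exp (Z n s) - 1)" and z: "\<bar>Z n s\<bar> \<le> 1" "r n > 0" "d n > 0"
    have "\<bar>exp (Z n s) - 1 - Z n s\<bar> \<le> (Z n s)\<^sup>2"
    proof (cases "Z n s \<ge> 0")
      case True
      have "exp (Z n s) \<le> 1 + Z n s + (Z n s)\<^sup>2" using exp_bound[of "Z n s"] z True by simp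
      then show ?thesis
        using exp_ge_add_one_self[of "Z n s"] zero_le_power2[of "Z n s"] by (intro abs_leI) linarith+
    next
      case False
      then show ?thesis using exp_minus_quadratic_bound[of "- Z n s"] by (simp add: abs_minus_commute algebra_simps)
    qed
    then have "r n / d n * \<bar>exp (Z n s) - 1 - Z n s\<bar> \<le> r n / d n * (Z n s)\<^sup>2"
      using z by (intro mult_left_mono) auto
    also have "\<dots> = d n / r n * ((r n / d n * Z n s) * (r n / d n * Z n s))"
      using z by (simp add: power2_eq_square)
    finally have "r n / d n * \<bar>exp (Z n s) - 1 - Z n s\<bar> \<le> \<bar>d n / r n * ((r n / d n * Z n s) * (r n / d n * Z n s))\<bar>"
      by linarith
    moreover have "\<bar>Q n s - r n / d n * Z n s\<bar> = r n / d n * \<bar>exp (Z n s) - 1 - Z n s\<bar>"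
    proof -
      have "Q n s - r n / d n * Z n s = r n / d n * (exp (Z n s) - 1 - Z n s)"
        unfolding q by (simp add: algebra_simps add_divide_distrib)
      then show ?thesis using z by (simp only: abs_mult) simp
    qed
    ultimately show "\<bar>Q n s - r n / d n * Z n s\<bar> \<le> \<bar>d n / r n * ((r n / d n * Z n s) * (r n / d n * Z n s))\<bar>"
      by simp
  qed
  from o_pr_add[OF this log] show ?thesis by simp
qed

section \<open>Dependent samples of unequal length: covariances of the scores\<close>

locale pooled_tail_setting = prob_space M
  for M :: "'a measure" +
  fixes m :: nat
    and X :: "'a \<Rightarrow> nat \<Rightarrow> real"
    and Xs :: "nat \<Rightarrow> 'a \<Rightarrow> nat \<Rightarrow> real"
    and N k :: "nat \<Rightarrow> nat \<Rightarrow> nat"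
    and F U A :: "nat \<Rightarrow> real \<Rightarrow> real"
    and R :: "nat \<Rightarrow> nat \<Rightarrow> ennreal \<Rightarrow> ennreal \<Rightarrow> real"
    and \<gamma> :: real
    and \<rho> b c lam :: "nat \<Rightarrow> real"
    and ktot :: "nat \<Rightarrow> nat"
  assumes m: "m \<ge> 1"
    and X: "X \<in> measurable M (Rvec m)"
    and Xs_indep: "indep_vars (\<lambda>_. Rvec m) Xs {1..}"
    and Xs_copies: "\<And>i. i \<ge> 1 \<Longrightarrow> distr M (Rvec m) (Xs i) = distr M (Rvec m) X"
    and F_def: "F = marginal_cdf M X"
    and U_def: "U = (\<lambda>j. tail_quantile (F j))"
    and F_cont: "\<And>j. j \<in> {1..m} \<Longrightarrow> continuous_on UNIV (F j)"
    and N_sum: "\<And>n. (\<Sum>j=1..m. N n j) = n"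
    and N_inf: "\<And>j. j \<in> {1..m} \<Longrightarrow> filterlim (\<lambda>n. N n j) at_top sequentially"
    and C2: "cond_C2 m U (\<lambda>_. \<gamma>) \<rho> A"
    and J: "cond_J m M X R"
    and \<rho>_neg: "\<And>j. j \<in> {1..m} \<Longrightarrow> \<rho> j < 0"
    and N_mono: "\<And>n j l. 1 \<le> j \<Longrightarrow> j \<le> l \<Longrightarrow> l \<le> m \<Longrightarrow> N n j \<le> N n l"
    and k_inf: "\<And>j. j \<in> {1..m} \<Longrightarrow> filterlim (\<lambda>n. k n j) at_top sequentially"
    and k_intermediate: "\<And>j. j \<in> {1..m} \<Longrightarrow> (\<lambda>n. real (k n j) / real (N n j)) \<longlonglongrightarrow> 0"
    and b_range: "\<And>j. j \<in> {1..m} \<Longrightarrow> 0 < b j \<and> b j \<le> 1"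
    and b_lim: "\<And>j. j \<in> {1..m} \<Longrightarrow> (\<lambda>n. real (N n 1) / real (N n j)) \<longlonglongrightarrow> b j"
    and c_range: "\<And>j. j \<in> {1..m} \<Longrightarrow> 0 < c j"
    and c_lim: "\<And>j. j \<in> {1..m} \<Longrightarrow> (\<lambda>n. real (k n 1) / real (k n j)) \<longlonglongrightarrow> c j"
    and lam_lim: "\<And>j. j \<in> {1..m} \<Longrightarrow>
      (\<lambda>n. sqrt (real (k n j)) * A j (real (N n j) / real (k n j))) \<longlonglongrightarrow> lam j"
    and ktot_def: "ktot = (\<lambda>n. \<Sum>j=1..m. k n j)"
begin

lemma component_measurable:
  "j \<in> {1..m} \<Longrightarrow> f \<in> measurable M (Rvec m) \<Longrightarrow> (\<lambda>s. f s j) \<in> borel_measurable M"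
  by (rule measurable_compose[OF _ measurable_component_singleton]) auto

lemma Xs_measurable: "i \<ge> 1 \<Longrightarrow> Xs i \<in> measurable M (Rvec m)"
  using Xs_indep unfolding indep_vars_def by auto

lemma Xs_component: "i \<ge> 1 \<Longrightarrow> j \<in> {1..m} \<Longrightarrow> (\<lambda>s. Xs i s j) \<in> borel_measurable M"
  by (intro component_measurable Xs_measurable)

lemma distr_component:
  assumes "i \<ge> 1" "j \<in> {1..m}"
  shows "distr M borel (\<lambda>s. Xs i s j) = distr M borel (\<lambda>s. X s j)"
proof -
  have c: "(\<lambda>x. x j) \<in> measurable (Rvec m) borel"
    using assms(2) by (rule measurable_component_singleton)
  have "distr M borel (\<lambda>s. Xs i s j) = distr (distr M (Rvec m) (Xs i)) borel (\<lambda>x. x j)"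
    using c Xs_measurable[OF assms(1)] by (subst distr_distr) (auto simp: comp_def)
  also have "\<dots> = distr M borel (\<lambda>s. X s j)"
    using c X unfolding Xs_copies[OF assms(1)] by (subst distr_distr) (auto simp: comp_def)
  finally show ?thesis .
qed

lemma \<gamma>_pos: "\<gamma> > 0"
  using C2 m unfolding cond_C2_def by auto

lemma cdf_component: "j \<in> {1..m} \<Longrightarrow> continuous_cdf (F j) (distr M borel (\<lambda>s. X s j))"
  unfolding continuous_cdf_def using F_cont component_measurable[OF _ X]
  by (auto simp: F_def marginal_cdf_def intro!: real_distribution_distr)

lemma hill_sample_exists:
  assumes j: "j \<in> {1..m}"
  shows "\<exists>l. hill_sample M (F j) (distr M borel (\<lambda>s. X s j)) (\<lambda>i s. Xs i s j)
    (\<lambda>n. N n j) (\<lambda>n. k n j) (A j) \<gamma> (\<rho> j) (lam j) l"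
proof -
  interpret C: continuous_cdf "F j" "distr M borel (\<lambda>s. X s j)" by (rule cdf_component[OF j])
  note C2j = C2[unfolded cond_C2_def U_def, rule_format, OF j]
  have nz: "\<not> \<rho> j = 0" using \<rho>_neg[OF j] by simp
  have c2: "(\<forall>\<^sub>F t in at_top. A j t > 0) \<or> (\<forall>\<^sub>F t in at_top. A j t < 0)" "(A j \<longlongrightarrow> 0) at_top"
    and lim: "\<And>x. x > 0 \<Longrightarrow> ((\<lambda>t. 1 / A j t * (tail_quantile (F j) (t * x) / tail_quantile (F j) t - x powr \<gamma>)) \<longlongrightarrow>
                x powr \<gamma> * ((x powr \<rho> j - 1) / \<rho> j)) at_top"
    using C2j unfolding if_not_P[OF nz] by blast+
  from second_order_expansion[OF C.tail_quantile_mono \<gamma>_pos \<rho>_neg[OF j] c2 lim]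
  obtain l where l: "\<forall>\<^sub>F t in at_top. tail_quantile (F j) t > 0"
      "\<And>\<epsilon>. \<epsilon> > 0 \<Longrightarrow> \<forall>\<^sub>F t in at_top. \<forall>x\<ge>1/2.
      \<bar>ln (tail_quantile (F j) (t * x)) - \<gamma> * ln (t * x) - l - x powr \<rho> j * A j t / \<rho> j\<bar> \<le> \<epsilon> * \<bar>A j t\<bar>"
    by blast
  have c: "(\<lambda>x. x j) \<in> measurable (Rvec m) borel"
    using j by (rule measurable_component_singleton)
  have "indep_vars (\<lambda>_. borel) (\<lambda>i s. Xs i s j) {1..}"
    by (rule indep_vars_compose2[OF Xs_indep]) (use c in auto)
  then show ?thesis
    by (intro exI[of _ l] hill_sample.intro hill_sample_axioms.intro prob_space_axioms C.continuous_cdf_axioms)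
       (use l j Xs_component distr_component N_inf k_inf k_intermediate \<rho>_neg lam_lim in auto)
qed

text \<open>Logarithm of the scale constant of \<open>U j\<close>, that is, the limit of
  \<open>ln (U j t) - \<gamma> * ln t\<close>.\<close>

definition ell :: "nat \<Rightarrow> real" where
  "ell j = (SOME l. hill_sample M (F j) (distr M borel (\<lambda>s. X s j)) (\<lambda>i s. Xs i s j)
    (\<lambda>n. N n j) (\<lambda>n. k n j) (A j) \<gamma> (\<rho> j) (lam j) l)"

lemma hill_sample: "j \<in> {1..m} \<Longrightarrow> hill_sample M (F j) (distr M borel (\<lambda>s. X s j)) (\<lambda>i s. Xs i s j)
    (\<lambda>n. N n j) (\<lambda>n. k n j) (A j) \<gamma> (\<rho> j) (lam j) (ell j)"
  unfolding ell_def by (rule someI_ex[OF hill_sample_exists])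

definition a :: "nat \<Rightarrow> nat \<Rightarrow> real" where
  "a n j = real (k n j) / real (N n j)"

text \<open>\<open>S * c j\<close> is the limit of \<open>ktot n / k n j\<close>, which converts
  individual rates into the pooled one.\<close>

definition S :: real where
  "S = (\<Sum>i=1..m. inverse (c i))"

lemma k_pos: "j \<in> {1..m} \<Longrightarrow> \<forall>\<^sub>F n in sequentially. 0 < k n j \<and> k n j < N n j"
  using eventually_intermediate[OF k_inf N_inf k_intermediate] .

lemma all_k_pos: "\<forall>\<^sub>F n in sequentially. \<forall>j\<in>{1..m}. 0 < k n j \<and> k n j < N n j"
  by (intro eventually_ball_finite ballI k_pos) auto

lemma S_pos: "S > 0"
  unfolding S_def using m c_range by (intro sum_pos) auto

lemma k_ratio:
  assumes "i \<in> {1..m}" "j \<in> {1..m}"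
  shows "(\<lambda>n. real (k n i) / real (k n j)) \<longlonglongrightarrow> c j * inverse (c i)"
proof -
  have "(\<lambda>n. (real (k n 1) / real (k n j)) * inverse (real (k n 1) / real (k n i))) \<longlonglongrightarrow> c j * inverse (c i)"
    using assms c_range[OF assms(1)] by (intro tendsto_intros c_lim) auto
  moreover have "\<forall>\<^sub>F n in sequentially. (real (k n 1) / real (k n j)) * inverse (real (k n 1) / real (k n i)) = real (k n i) / real (k n j)"
    using all_k_pos
  proof eventually_elim
    case (elim n)
    then have "k n 1 > 0" using m by auto
    then show ?case by simp
  qed
  ultimately show ?thesis by (rule Lim_transform_eventually)
qed

lemma ktot_ratio:
  assumes "j \<in> {1..m}"
  shows "(\<lambda>n. real (ktot n) / real (k n j)) \<longlonglongrightarrow> S * c j"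
proof -
  have "(\<lambda>n. \<Sum>i=1..m. real (k n i) / real (k n j)) \<longlonglongrightarrow> (\<Sum>i=1..m. c j * inverse (c i))"
    using assms by (intro tendsto_sum k_ratio) auto
  then show ?thesis
    by (simp add: ktot_def S_def sum_divide_distrib sum_distrib_left mult.commute[of _ "c j"])
qed

lemma N_ratio:
  assumes "i \<in> {1..m}" "j \<in> {1..m}"
  shows "(\<lambda>n. real (N n i) / real (N n j)) \<longlonglongrightarrow> b j / b i"
proof -
  have "(\<lambda>n. (real (N n 1) / real (N n j)) / (real (N n 1) / real (N n i))) \<longlonglongrightarrow> b j / b i"
    using assms b_range[OF assms(1)] by (intro tendsto_intros b_lim) auto
  moreover have "\<forall>\<^sub>F n in sequentially. (real (N n 1) / real (N n j)) / (real (N n 1) / real (N n i)) = real (N n i) / real (N n j)"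
    using all_k_pos
  proof eventually_elim
    case (elim n)
    then have "k n 1 < N n 1" using m by auto
    then have "N n 1 > 0" by simp
    then show ?case by simp
  qed
  ultimately show ?thesis by (rule Lim_transform_eventually)
qed

definition score :: "nat \<Rightarrow> nat \<Rightarrow> (nat \<Rightarrow> real) \<Rightarrow> real" where
  "score n j x = tail_log 1 (a n j) (survival (F j) (x j)) - tail_log 0 (a n j) (survival (F j) (x j))"

lemma F_measurable: "j \<in> {1..m} \<Longrightarrow> F j \<in> borel_measurable borel"
  by (rule borel_measurable_mono) (simp add: mono_def continuous_cdf.F_mono[OF cdf_component])

lemma score_measurable: "j \<in> {1..m} \<Longrightarrow> score n j \<in> borel_measurable (Rvec m)"
proof -
  assume j: "j \<in> {1..m}"
  note [measurable] = F_measurable[OF j] measurable_component_singleton[OF j, of "\<lambda>_. borel"]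
  show ?thesis unfolding score_def survival_def by measurable
qed

lemma V_uniform: "j \<in> {1..m} \<Longrightarrow> uniform_rv M (\<lambda>s. survival (F j) (X s j))"
  by (rule continuous_cdf.uniform_rv_survival[OF cdf_component])
     (auto intro: prob_space_axioms component_measurable[OF _ X])

lemma pair: "j \<in> {1..m} \<Longrightarrow> l \<in> {1..m} \<Longrightarrow>
    uniform_pair M (\<lambda>s. survival (F j) (X s j)) (\<lambda>s. survival (F l) (X s l))"
  by (intro uniform_pair.intro V_uniform prob_space_axioms)

definition cov :: "nat \<Rightarrow> nat \<Rightarrow> nat \<Rightarrow> real" where
  "cov n j l = expectation (\<lambda>s. score n j (X s) * score n l (X s))"

lemma cov_commute: "cov n j l = cov n l j"
  by (simp add: cov_def mult.commute)

lemma expectation_copy: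
  fixes g :: "(nat \<Rightarrow> real) \<Rightarrow> real"
  assumes "i \<ge> 1" "g \<in> borel_measurable (Rvec m)"
  shows "expectation (\<lambda>s. g (Xs i s)) = expectation (\<lambda>s. g (X s))"
  using integral_distr[OF Xs_measurable[OF assms(1)] assms(2)] integral_distr[OF X assms(2)]
  unfolding Xs_copies[OF assms(1)] by simp

lemma integrable_copy:
  fixes g :: "(nat \<Rightarrow> real) \<Rightarrow> real"
  assumes "i \<ge> 1" "g \<in> borel_measurable (Rvec m)"
  shows "integrable M (\<lambda>s. g (Xs i s)) \<longleftrightarrow> integrable M (\<lambda>s. g (X s) :: real)"
  using integrable_distr_eq[OF Xs_measurable[OF assms(1)] assms(2)] integrable_distr_eq[OF X assms(2)]
  unfolding Xs_copies[OF assms(1)] by simp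

lemma copula_limit:
  assumes j: "j \<in> {1..m}" and l: "l \<in> {1..m}" and "j \<noteq> l" "0 < x" "0 < y"
  shows "((\<lambda>s. s * uniform_pair.joint M (\<lambda>s. survival (F j) (X s j)) (\<lambda>s. survival (F l) (X s l)) (x / s) (y / s))
    \<longlongrightarrow> R j l (ennreal x) (ennreal y)) at_top"
proof -
  interpret uniform_pair M "\<lambda>s. survival (F j) (X s j)" "\<lambda>s. survival (F l) (X s l)" by (rule pair[OF j l])
  have "((\<lambda>s. s * survival_copula M X j l (ennreal x / ennreal s) (ennreal y / ennreal s)) \<longlongrightarrow> R j l (ennreal x) (ennreal y)) at_top"
    using J j l \<open>j \<noteq> l\<close> unfolding cond_J_def by auto
  moreover have "\<forall>\<^sub>F s in at_top. s * survival_copula M X j l (ennreal x / ennreal s) (ennreal y / ennreal s) = s * joint (x / s) (y / s)"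
    using eventually_gt_at_top[of 0]
  proof eventually_elim
    case (elim s)
    have "ennreal v \<le> ennreal z / ennreal s \<longleftrightarrow> v \<le> z / s" if "z > 0" for v z
      using that elim by (simp add: divide_ennreal)
    then show ?case
      using assms(4,5) unfolding survival_copula_def joint_def F_def[symmetric] by simp
  qed
  ultimately show ?thesis by (rule Lim_transform_eventually)
qed

text \<open>The normalisation is that of the covariance of two Hill errors at rate
  \<open>sqrt ktot\<close> with \<open>N n j\<close> common observations. The diagonal is the same
  computation with both variables equal: the tail copula limit is then \<open>min x y\<close>, with
  value 1 at \<open>x = y = 1\<close>.\<close>

lemma cov_tendsto_aux:
  assumes j: "j \<in> {1..m}" and l: "l \<in> {1..m}" and "j \<le> l"
  shows "(\<lambda>n. real (ktot n) * real (N n j) / (real (k n j) * real (k n l)) * cov n j l) \<longlonglongrightarrow>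
    S * c j * (if j = l then 1 else R j l (ennreal (c l / c j)) (ennreal (b l / b j)))"
proof -
  interpret uniform_pair M "\<lambda>s. survival (F j) (X s j)" "\<lambda>s. survival (F l) (X s l)" by (rule pair[OF j l])
  have cj: "c j > 0" "c l > 0" "b j > 0" "b l > 0" using c_range b_range j l by auto
  \<comment> \<open>Dividing by \<open>z\<close> makes \<open>s n * a n j\<close> and
    \<open>s n * a n l\<close> tend to \<open>c l / c j\<close> and \<open>b l / b j\<close>, the
    arguments of \<open>R\<close> in \<open>var_mat\<close>.\<close>
  define z where "z = S * c j"
  have z: "z > 0" using S_pos cj by (simp add: z_def)
  define s where "s n = real (ktot n) * real (N n j) / (real (k n j) * real (k n l)) / z" for n
  define R' where "R' x y = (if j = l then min x y else R j l (ennreal x) (ennreal y))" for x y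
  have "(\<lambda>n. s n * expectation (\<lambda>w. (tail_log 1 (a n j) (survival (F j) (X w j)) - tail_log 0 (a n j) (survival (F j) (X w j))) *
      (tail_log 1 (a n l) (survival (F l) (X w l)) - tail_log 0 (a n l) (survival (F l) (X w l))))) \<longlonglongrightarrow> R' (c l / c j) (b l / b j)"
  proof (rule copula_covariance_tendsto[where R = R' and \<alpha> = "c l / c j" and \<beta> = "b l / b j"])
    fix x y :: real assume xy: "0 < x" "0 < y"
    show "((\<lambda>s. s * joint (x / s) (y / s)) \<longlongrightarrow> R' x y) at_top"
    proof (cases "j = l")
      case True
      have "\<forall>\<^sub>F s in at_top. s * joint (x / s) (y / s) = min x y"
        using eventually_gt_at_top[of "max x y"]
      proof eventually_elim
        case (elim s)
        then have s: "s > 0" using xy by auto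
        have "joint (x / s) (y / s) = prob {w\<in>space M. survival (F j) (X w j) \<le> min x y / s}"
        proof -
          have "min x y / s = min (x / s) (y / s)" using s by (simp add: min_divide_distrib_right)
          then show ?thesis unfolding joint_def by (simp add: True)
        qed
        also have "\<dots> = min x y / s"
          using elim s xy by (intro uniform_rv.V_uniform[OF V_uniform[OF j]]) auto
        finally show ?case using s by simp
      qed
      then show ?thesis unfolding R'_def using True by (simp add: tendsto_eventually)
    next
      case False
      then show ?thesis using copula_limit[OF j l False xy] by (simp add: R'_def)
    qed
  next
    have "filterlim (\<lambda>n. inverse (a n j)) at_top sequentially"
      using k_pos[OF j] k_intermediate[OF j] unfolding a_def
      by (intro filterlim_inverse_at_top) (auto elim: eventually_mono)
    moreover have "(\<lambda>n. real (ktot n) / real (k n l) / z) \<longlonglongrightarrow> S * c l / z"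
      using z by (intro tendsto_divide ktot_ratio l tendsto_const) auto
    moreover have "S * c l / z > 0" using S_pos cj z by simp
    ultimately have "filterlim (\<lambda>n. real (ktot n) / real (k n l) / z * inverse (a n j)) at_top sequentially"
      by (intro filterlim_tendsto_pos_mult_at_top)
    also have "(\<lambda>n. real (ktot n) / real (k n l) / z * inverse (a n j)) = s"
      by (auto simp: s_def a_def)
    finally show "filterlim s at_top sequentially" .
    have "(\<lambda>n. real (ktot n) / real (k n l) / z) \<longlonglongrightarrow> S * c l / z"
      using z by (intro tendsto_divide ktot_ratio l tendsto_const) auto
    also have "S * c l / z = c l / c j" using S_pos by (simp add: z_def)
    finally show "(\<lambda>n. s n * a n j) \<longlonglongrightarrow> c l / c j"
    proof (rule Lim_transform_eventually)
      show "\<forall>\<^sub>F n in sequentially. real (ktot n) / real (k n l) / z = s n * a n j"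
        using k_pos[OF j] by eventually_elim (auto simp: s_def a_def field_simps)
    qed
    have "(\<lambda>n. real (ktot n) / real (k n j) * (real (N n j) / real (N n l)) / z) \<longlonglongrightarrow> S * c j * (b l / b j) / z"
      using z by (intro tendsto_intros ktot_ratio N_ratio j l) auto
    also have "S * c j * (b l / b j) / z = b l / b j" unfolding z_def[symmetric] using z by simp
    finally show "(\<lambda>n. s n * a n l) \<longlonglongrightarrow> b l / b j"
    proof (rule Lim_transform_eventually)
      show "\<forall>\<^sub>F n in sequentially. real (ktot n) / real (k n j) * (real (N n j) / real (N n l)) / z = s n * a n l"
        using k_pos[OF l] by eventually_elim (auto simp: s_def a_def field_simps)
    qed
  qed (use cj in auto)
  then have "(\<lambda>n. z * (s n * cov n j l)) \<longlonglongrightarrow> z * R' (c l / c j) (b l / b j)"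
    unfolding cov_def score_def by (rule tendsto_mult_left)
  moreover have "z * (s n * cov n j l) = real (ktot n) * real (N n j) / (real (k n j) * real (k n l)) * cov n j l" for n
    using z by (simp add: s_def)
  moreover have "R' (c l / c j) (b l / b j) = (if j = l then 1 else R j l (ennreal (c l / c j)) (ennreal (b l / b j)))"
    using cj by (simp add: R'_def)
  ultimately show ?thesis by (simp add: z_def)
qed

text \<open>Two samples share exactly the observations with index up to
  \<open>min (N n j) (N n l)\<close>. Sizes increase with the sample index, so this is the size of
  the sample with the smaller index, which matches \<open>var_mat\<close> above the diagonal; below
  it, the symmetry of \<open>cov\<close> is used.\<close>

lemma cov_tendsto:
  assumes j: "j \<in> {1..m}" and l: "l \<in> {1..m}"
  shows "(\<lambda>n. \<gamma>\<^sup>2 * (real (ktot n) * real (min (N n j) (N n l)) / (real (k n j) * real (k n l)) * cov n j l)) \<longlonglongrightarrow>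
    var_mat m \<gamma> b c R j l"
proof (cases "j \<le> l")
  case True
  have "min (N n j) (N n l) = N n j" for n using N_mono[of j l n] True j l by simp
  then show ?thesis
    using tendsto_mult_left[OF cov_tendsto_aux[OF j l True], of "\<gamma>\<^sup>2"] True
    by (auto simp: var_mat_def Let_def S_def mult_ac)
next
  case False
  have "min (N n j) (N n l) = N n l" for n using N_mono[of l j n] False j l by simp
  then show ?thesis
    using tendsto_mult_left[OF cov_tendsto_aux[OF l j], of "\<gamma>\<^sup>2"] False
    by (auto simp: var_mat_def Let_def S_def mult_ac cov_commute[of _ l j])
qed

end

section \<open>Independent summands and the central limit theorem\<close>

lemma integrable_if_const:
  fixes f :: "'a \<Rightarrow> real"
  shows "integrable M f \<Longrightarrow> integrable M (\<lambda>s. if P then w * f s else 0)"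
  by (cases P) simp_all

context pooled_tail_setting
begin

definition good :: "nat \<Rightarrow> bool" where
  "good n \<longleftrightarrow> (\<forall>j\<in>{1..m}. 0 < k n j \<and> k n j < N n j)"

lemma good_a: "good n \<Longrightarrow> j \<in> {1..m} \<Longrightarrow> 0 < a n j \<and> a n j \<le> 1"
proof -
  assume "good n" "j \<in> {1..m}"
  then have "0 < k n j" "k n j < N n j" by (auto simp: good_def)
  then show ?thesis by (simp add: a_def)
qed

lemma eventually_good: "\<forall>\<^sub>F n in sequentially. good n"
  using all_k_pos unfolding good_def .

lemma N_le: "j \<in> {1..m} \<Longrightarrow> N n j \<le> n"
  using member_le_sum[of j "{1..m}" "N n"] N_sum[of n] by auto

lemma score_product_integrable:
  assumes "good n" "j \<in> {1..m}" "l \<in> {1..m}"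
  shows "integrable M (\<lambda>s. score n j (X s) * score n l (X s))"
proof -
  interpret uniform_pair M "\<lambda>s. survival (F j) (X s j)" "\<lambda>s. survival (F l) (X s l)"
    by (rule pair[OF assms(2,3)])
  have "integrable M (\<lambda>s. tail_log p (a n j) (survival (F j) (X s j)) * tail_log q (a n l) (survival (F l) (X s l)))" for p q
    using good_a[OF assms(1)] assms(2,3) by (intro integrable_tail_log_product) auto
  then show ?thesis
    unfolding score_def left_diff_distrib right_diff_distrib by (simp del: One_nat_def)
qed

lemma score_moments:
  assumes "good n" "j \<in> {1..m}"
  shows "expectation (\<lambda>s. score n j (X s)) = 0"
    and "expectation (\<lambda>s. (score n j (X s))\<^sup>2) = a n j"
    and "integrable M (\<lambda>s. score n j (X s))"
    and "integrable M (\<lambda>s. \<bar>score n j (X s)\<bar> ^ 3)"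
    and "expectation (\<lambda>s. \<bar>score n j (X s)\<bar> ^ 3) \<le> 28 * a n j"
proof -
  interpret uniform_rv M "\<lambda>s. survival (F j) (X s j)" by (rule V_uniform[OF assms(2)])
  have a: "0 < a n j" "a n j \<le> 1" using good_a[OF assms] by auto
  show "expectation (\<lambda>s. score n j (X s)) = 0" "integrable M (\<lambda>s. score n j (X s))"
    unfolding score_def using a by (simp_all add: expectation_tail_log)
  have sq: "(tail_log 1 b x - tail_log 0 b x)\<^sup>2 = tail_log 2 b x - 2 * tail_log 1 b x + tail_log 0 b x" for b x
    by (simp add: tail_log_def power2_diff)
  show "expectation (\<lambda>s. (score n j (X s))\<^sup>2) = a n j"
    unfolding score_def sq using a by (simp add: expectation_tail_log)
  show "integrable M (\<lambda>s. \<bar>score n j (X s)\<bar> ^ 3)" "expectation (\<lambda>s. \<bar>score n j (X s)\<bar> ^ 3) \<le> 28 * a n j"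
    unfolding score_def using score_third_moment[OF a] by auto
qed

text \<open>The linearised Hill error of sample \<open>j\<close> is \<open>\<gamma>\<close> times
  its sum of scores divided by \<open>k n j\<close>; the rate and the coefficient \<open>w j\<close>
  are included here.\<close>

definition weight :: "(nat \<Rightarrow> real) \<Rightarrow> nat \<Rightarrow> nat \<Rightarrow> real" where
  "weight w n j = w j * \<gamma> * (sqrt (real (ktot n)) / real (k n j))"

text \<open>All scores of the \<open>i\<close>-th vector are collected in one term, over those
  samples that are long enough to contain it. Terms with different \<open>i\<close> are independent,
  whereas the scores inside one term need not be.\<close>

definition summand :: "(nat \<Rightarrow> real) \<Rightarrow> nat \<Rightarrow> nat \<Rightarrow> (nat \<Rightarrow> real) \<Rightarrow> real" where
  "summand w n i x = (\<Sum>j=1..m. if i \<le> N n j then weight w n j * score n j x else 0)"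

lemma summand_measurable: "summand w n i \<in> borel_measurable (Rvec m)"
  unfolding summand_def using score_measurable
  by (intro borel_measurable_sum measurable_If borel_measurable_times) auto

lemma sum_summand:
  "(\<Sum>i=1..n. summand w n i (Xs i s)) = (\<Sum>j=1..m. weight w n j * (\<Sum>i=1..N n j. score n j (Xs i s)))"
proof -
  have "(\<Sum>i=1..n. summand w n i (Xs i s)) =
      (\<Sum>j=1..m. \<Sum>i=1..n. if i \<le> N n j then weight w n j * score n j (Xs i s) else 0)"
    unfolding summand_def by (rule sum.swap)
  also have "\<dots> = (\<Sum>j=1..m. \<Sum>i=1..N n j. weight w n j * score n j (Xs i s))"
  proof (rule sum.cong[OF refl])
    fix j assume "j \<in> {1..m}"
    then have "{1..n} \<inter> {i. i \<le> N n j} = {1..N n j}" using N_le[of j n] by auto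
    then show "(\<Sum>i=1..n. if i \<le> N n j then weight w n j * score n j (Xs i s) else 0) =
        (\<Sum>i=1..N n j. weight w n j * score n j (Xs i s))"
      by (simp add: sum.If_cases)
  qed
  finally show ?thesis by (simp add: sum_distrib_left)
qed

lemma summand_square:
  "(summand w n i x)\<^sup>2 = (\<Sum>j=1..m. \<Sum>l=1..m. if i \<le> min (N n j) (N n l)
    then weight w n j * weight w n l * (score n j x * score n l x) else 0)"
  unfolding summand_def power2_eq_square sum_product by (intro sum.cong refl) auto

text \<open>Moments are computed for \<open>X\<close> and transferred by equality in law. The
  second-moment bound is uniform in \<open>i\<close> and gives the negligibility condition; the
  third-moment bound keeps the condition \<open>i \<le> N n j\<close>, so that summation over
  \<open>i\<close> yields the factor \<open>N n j\<close>.\<close>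

lemma summand_moments:
  assumes g: "good n" and i: "i \<ge> 1"
  shows "expectation (\<lambda>s. summand w n i (Xs i s)) = 0"
    and "integrable M (\<lambda>s. (summand w n i (Xs i s))\<^sup>2)"
    and "expectation (\<lambda>s. (summand w n i (Xs i s))\<^sup>2) = (\<Sum>j=1..m. \<Sum>l=1..m.
      if i \<le> min (N n j) (N n l) then weight w n j * weight w n l * cov n j l else 0)"
    and "expectation (\<lambda>s. (summand w n i (Xs i s))\<^sup>2) \<le> real m ^ 2 * (\<Sum>j=1..m. (weight w n j)\<^sup>2 * a n j)"
    and "integrable M (\<lambda>s. \<bar>summand w n i (Xs i s)\<bar> ^ 3)"
    and "expectation (\<lambda>s. \<bar>summand w n i (Xs i s)\<bar> ^ 3) \<le>
      real m ^ 3 * (\<Sum>j=1..m. if i \<le> N n j then \<bar>weight w n j\<bar> ^ 3 * (28 * a n j) else 0)"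
proof -
  note [measurable] = summand_measurable
  note E = expectation_copy[OF i] and I = integrable_copy[OF i]
  have m2: "(\<lambda>x. (summand w n i x)\<^sup>2) \<in> borel_measurable (Rvec m)"
    and m3: "(\<lambda>x. \<bar>summand w n i x\<bar> ^ 3) \<in> borel_measurable (Rvec m)" by measurable
  have "integrable M (\<lambda>s. if i \<le> N n j then weight w n j * score n j (X s) else 0)"
      "expectation (\<lambda>s. if i \<le> N n j then weight w n j * score n j (X s) else 0) = 0"
    if "j \<in> {1..m}" for j
    using score_moments(1,3)[OF g that] by (cases "i \<le> N n j"; simp)+
  then have "expectation (\<lambda>s. summand w n i (X s)) = 0"
    unfolding summand_def by (subst Bochner_Integration.integral_sum) (blast, simp)
  then show "expectation (\<lambda>s. summand w n i (Xs i s)) = 0"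
    by (simp only: E[OF summand_measurable])
  have int2: "integrable M (\<lambda>s. (summand w n i (X s))\<^sup>2)"
    unfolding summand_square
  proof (intro Bochner_Integration.integrable_sum)
    fix j l assume "j \<in> {1..m}" "l \<in> {1..m}"
    then show "integrable M (\<lambda>s. if i \<le> min (N n j) (N n l)
        then weight w n j * weight w n l * (score n j (X s) * score n l (X s)) else 0)"
      by (intro integrable_if_const score_product_integrable[OF g])
  qed
  then show "integrable M (\<lambda>s. (summand w n i (Xs i s))\<^sup>2)"
    by (simp only: I[OF m2])
  have E2: "expectation (\<lambda>s. (summand w n i (Xs i s))\<^sup>2) = expectation (\<lambda>s. (summand w n i (X s))\<^sup>2)"
    by (rule E[OF m2])
  have "expectation (\<lambda>s. (summand w n i (X s))\<^sup>2) = (\<Sum>j=1..m. \<Sum>l=1..m.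
      if i \<le> min (N n j) (N n l) then weight w n j * weight w n l * cov n j l else 0)"
  proof -
    let ?f = "\<lambda>j l s. if i \<le> min (N n j) (N n l) then weight w n j * weight w n l * (score n j (X s) * score n l (X s)) else 0"
    have e: "expectation (\<lambda>s. if i \<le> min (N n j) (N n l) then weight w n j * weight w n l * (score n j (X s) * score n l (X s)) else 0)
      = (if i \<le> min (N n j) (N n l) then weight w n j * weight w n l * cov n j l else 0)" for j l
    proof (cases "i \<le> min (N n j) (N n l)")
      case True
      show ?thesis by (simp only: True if_True) (simp add: cov_def)
    next
      case False
      show ?thesis by (simp only: False if_False) simp
    qed
    have it: "integrable M (\<lambda>s. if i \<le> min (N n j) (N n l) then weight w n j * weight w n l * (score n j (X s) * score n l (X s)) else 0)"
      if "j \<in> {1..m}" "l \<in> {1..m}" for j l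
      by (intro integrable_if_const score_product_integrable[OF g] that)
    have "expectation (\<lambda>s. (summand w n i (X s))\<^sup>2) = (\<Sum>j=1..m. expectation (\<lambda>s. \<Sum>l=1..m. ?f j l s))"
      unfolding summand_square by (intro Bochner_Integration.integral_sum Bochner_Integration.integrable_sum it)
    also have "\<dots> = (\<Sum>j=1..m. \<Sum>l=1..m. expectation (?f j l))"
      by (intro sum.cong refl Bochner_Integration.integral_sum it)
    finally show ?thesis by (simp only: e)
  qed
  then show "expectation (\<lambda>s. (summand w n i (Xs i s))\<^sup>2) = (\<Sum>j=1..m. \<Sum>l=1..m.
      if i \<le> min (N n j) (N n l) then weight w n j * weight w n l * cov n j l else 0)"
    unfolding E2 .
  define t where "t j x = (if i \<le> N n j then weight w n j * score n j x else 0)" for j x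
  have sum_t: "summand w n i x = (\<Sum>j=1..m. t j x)" for x by (simp add: summand_def t_def)
  have t2: "integrable M (\<lambda>s. \<bar>t j (X s)\<bar> ^ 2)" "expectation (\<lambda>s. \<bar>t j (X s)\<bar> ^ 2) \<le> (weight w n j)\<^sup>2 * a n j"
    if "j \<in> {1..m}" for j
  proof -
    have eq: "\<bar>t j x\<bar> ^ 2 = (if i \<le> N n j then (weight w n j)\<^sup>2 * (score n j x)\<^sup>2 else 0)" for x
      by (simp add: t_def power_mult_distrib)
    have int: "integrable M (\<lambda>s. (score n j (X s))\<^sup>2)"
      using score_product_integrable[OF g that that] by (simp add: power2_eq_square)
    show "integrable M (\<lambda>s. \<bar>t j (X s)\<bar> ^ 2)" unfolding eq by (intro integrable_if_const int)
    have "0 \<le> (weight w n j)\<^sup>2 * a n j" using good_a[OF g that] by simp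
    then show "expectation (\<lambda>s. \<bar>t j (X s)\<bar> ^ 2) \<le> (weight w n j)\<^sup>2 * a n j"
      unfolding eq using score_moments(2)[OF g that] by (cases "i \<le> N n j") simp_all
  qed
  have "expectation (\<lambda>s. (summand w n i (X s))\<^sup>2) \<le> expectation (\<lambda>s. real m ^ 2 * (\<Sum>j=1..m. \<bar>t j (X s)\<bar> ^ 2))"
  proof (rule integral_mono[OF int2])
    show "integrable M (\<lambda>s. real m ^ 2 * (\<Sum>j=1..m. \<bar>t j (X s)\<bar> ^ 2))"
      using t2 by (intro Bochner_Integration.integrable_mult_right Bochner_Integration.integrable_sum) auto
    show "(summand w n i (X s))\<^sup>2 \<le> real m ^ 2 * (\<Sum>j=1..m. \<bar>t j (X s)\<bar> ^ 2)" for s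
      using abs_sum_power_le[OF m, of "\<lambda>j. t j (X s)" 2] by (simp add: sum_t)
  qed
  also have "\<dots> = real m ^ 2 * (\<Sum>j=1..m. expectation (\<lambda>s. \<bar>t j (X s)\<bar> ^ 2))"
    using t2 by (simp add: Bochner_Integration.integral_sum)
  also have "\<dots> \<le> real m ^ 2 * (\<Sum>j=1..m. (weight w n j)\<^sup>2 * a n j)"
    using t2 by (intro mult_left_mono sum_mono) auto
  finally show "expectation (\<lambda>s. (summand w n i (Xs i s))\<^sup>2) \<le> real m ^ 2 * (\<Sum>j=1..m. (weight w n j)\<^sup>2 * a n j)"
    unfolding E2 .
  have t3: "integrable M (\<lambda>s. \<bar>t j (X s)\<bar> ^ 3)"
    "expectation (\<lambda>s. \<bar>t j (X s)\<bar> ^ 3) \<le> (if i \<le> N n j then \<bar>weight w n j\<bar> ^ 3 * (28 * a n j) else 0)"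
    if "j \<in> {1..m}" for j
  proof -
    have eq: "\<bar>t j x\<bar> ^ 3 = (if i \<le> N n j then \<bar>weight w n j\<bar> ^ 3 * \<bar>score n j x\<bar> ^ 3 else 0)" for x
      by (simp add: t_def abs_mult power_mult_distrib)
    show "integrable M (\<lambda>s. \<bar>t j (X s)\<bar> ^ 3)"
      unfolding eq by (intro integrable_if_const score_moments(4)[OF g that])
    have "\<bar>weight w n j\<bar> ^ 3 * expectation (\<lambda>s. \<bar>score n j (X s)\<bar> ^ 3) \<le> \<bar>weight w n j\<bar> ^ 3 * (28 * a n j)"
      using score_moments(5)[OF g that] by (intro mult_left_mono) auto
    then show "expectation (\<lambda>s. \<bar>t j (X s)\<bar> ^ 3) \<le> (if i \<le> N n j then \<bar>weight w n j\<bar> ^ 3 * (28 * a n j) else 0)"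
      unfolding eq by (cases "i \<le> N n j") simp_all
  qed
  have bound3: "\<bar>summand w n i (X s)\<bar> ^ 3 \<le> real m ^ 3 * (\<Sum>j=1..m. \<bar>t j (X s)\<bar> ^ 3)" for s
    using abs_sum_power_le[OF m, of "\<lambda>j. t j (X s)" 3] by (simp add: sum_t)
  have intb: "integrable M (\<lambda>s. real m ^ 3 * (\<Sum>j=1..m. \<bar>t j (X s)\<bar> ^ 3))"
    using t3 by (intro Bochner_Integration.integrable_mult_right Bochner_Integration.integrable_sum) auto
  have [measurable]: "X \<in> measurable M (Rvec m)" by (rule X)
  have int3: "integrable M (\<lambda>s. \<bar>summand w n i (X s)\<bar> ^ 3)"
  proof (rule Bochner_Integration.integrable_bound[OF intb])
    show "AE s in M. norm (\<bar>summand w n i (X s)\<bar> ^ 3) \<le> norm (real m ^ 3 * (\<Sum>j=1..m. \<bar>t j (X s)\<bar> ^ 3))"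
      using bound3 by (intro AE_I2) (auto intro: order_trans[OF _ abs_ge_self])
  qed measurable
  then show "integrable M (\<lambda>s. \<bar>summand w n i (Xs i s)\<bar> ^ 3)"
    by (simp only: I[OF m3])
  have "expectation (\<lambda>s. \<bar>summand w n i (Xs i s)\<bar> ^ 3) = expectation (\<lambda>s. \<bar>summand w n i (X s)\<bar> ^ 3)"
    by (rule E[OF m3])
  also have "\<dots> \<le> expectation (\<lambda>s. real m ^ 3 * (\<Sum>j=1..m. \<bar>t j (X s)\<bar> ^ 3))"
    by (rule integral_mono[OF int3 intb bound3])
  also have "\<dots> = real m ^ 3 * (\<Sum>j=1..m. expectation (\<lambda>s. \<bar>t j (X s)\<bar> ^ 3))"
    using t3 by (simp add: Bochner_Integration.integral_sum)
  also have "\<dots> \<le> real m ^ 3 * (\<Sum>j=1..m. if i \<le> N n j then \<bar>weight w n j\<bar> ^ 3 * (28 * a n j) else 0)"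
    using t3 by (intro mult_left_mono sum_mono) auto
  finally show "expectation (\<lambda>s. \<bar>summand w n i (Xs i s)\<bar> ^ 3) \<le>
      real m ^ 3 * (\<Sum>j=1..m. if i \<le> N n j then \<bar>weight w n j\<bar> ^ 3 * (28 * a n j) else 0)" .
qed

lemma sum_if_le: "L \<le> n \<Longrightarrow> (\<Sum>i=1..n. if i \<le> L then x else 0) = real L * x" for L n :: nat
proof -
  assume "L \<le> n"
  then have "{1..n} \<inter> {i. i \<le> L} = {1..L}" by auto
  then show ?thesis by (simp add: sum.If_cases)
qed

lemma variance_sum_tendsto:
  "(\<lambda>n. \<Sum>j=1..m. \<Sum>l=1..m. real (min (N n j) (N n l)) * (weight w n j * weight w n l * cov n j l))
    \<longlonglongrightarrow> quad_form m (var_mat m \<gamma> b c R) w"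
  unfolding quad_form_def
proof (intro tendsto_sum)
  fix j l assume jl: "j \<in> {1..m}" "l \<in> {1..m}"
  have "(\<lambda>n. w j * (\<gamma>\<^sup>2 * (real (ktot n) * real (min (N n j) (N n l)) / (real (k n j) * real (k n l)) * cov n j l)) * w l) \<longlonglongrightarrow>
      w j * var_mat m \<gamma> b c R j l * w l"
    by (intro tendsto_intros cov_tendsto jl)
  moreover have "w j * (\<gamma>\<^sup>2 * (real (ktot n) * real (min (N n j) (N n l)) / (real (k n j) * real (k n l)) * cov n j l)) * w l
    = real (min (N n j) (N n l)) * (weight w n j * weight w n l * cov n j l)" for n
  proof -
    define r where "r = sqrt (real (ktot n))"
    have r: "real (ktot n) = r * r" by (simp add: r_def)
    show ?thesis unfolding weight_def r r_def[symmetric] by (simp add: power2_eq_square mult_ac)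
  qed
  ultimately show "(\<lambda>n. real (min (N n j) (N n l)) * (weight w n j * weight w n l * cov n j l)) \<longlonglongrightarrow>
      w j * var_mat m \<gamma> b c R j l * w l" by simp
qed

lemma sqrt_ktot_ratio:
  assumes "j \<in> {1..m}"
  shows "(\<lambda>n. sqrt (real (ktot n)) / sqrt (real (k n j))) \<longlonglongrightarrow> sqrt (S * c j)"
  using tendsto_real_sqrt[OF ktot_ratio[OF assms]] by (simp add: real_sqrt_divide)

lemma inverse_sqrt_k:
  assumes "j \<in> {1..m}"
  shows "(\<lambda>n. 1 / sqrt (real (k n j))) \<longlonglongrightarrow> 0"
proof -
  have "filterlim (\<lambda>n. sqrt (real (k n j))) at_top sequentially"
    by (intro filterlim_compose[OF sqrt_at_top] filterlim_compose[OF filterlim_real_sequentially] k_inf assms)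
  from tendsto_inverse_0_at_top[OF this] show ?thesis by (simp add: inverse_eq_divide)
qed

text \<open>Empty at indices that are not yet \<open>good\<close>, so that the moment conditions of
  the limit theorem hold for every \<open>n\<close>.\<close>

definition I :: "nat \<Rightarrow> nat set" where
  "I n = (if good n then {1..n} else {})"

lemma summand_char_tendsto:
  "(\<lambda>n. char (distr M borel (\<lambda>s. \<Sum>i=1..n. summand w n i (Xs i s))) t) \<longlonglongrightarrow>
    complex_of_real (exp (- (t\<^sup>2 * quad_form m (var_mat m \<gamma> b c R) w / 2)))"
proof -
  have sub: "i \<ge> 1" "good n" if "i \<in> I n" for i n using that by (auto simp: I_def split: if_splits)
  have "(\<lambda>n. char (distr M borel (\<lambda>s. \<Sum>i\<in>I n. summand w n i (Xs i s))) t) \<longlonglongrightarrow>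
    complex_of_real (exp (- (t\<^sup>2 * quad_form m (var_mat m \<gamma> b c R) w / 2)))"
  proof (rule lyapunov_char_tendsto)
    show "finite (I n)" for n by (simp add: I_def)
    show "indep_vars (\<lambda>_. borel) (\<lambda>i s. summand w n i (Xs i s)) (I n)" for n
      by (rule indep_vars_compose2[OF indep_vars_subset[OF Xs_indep]])
         (rule subsetI, simp only: atLeast_iff, erule sub(1), rule summand_measurable)
    \<comment> \<open>Exchanging the sums counts, for each pair of samples, their common
      observations.\<close>
    show "(\<lambda>n. \<Sum>i\<in>I n. expectation (\<lambda>s. (summand w n i (Xs i s))\<^sup>2)) \<longlonglongrightarrow> quad_form m (var_mat m \<gamma> b c R) w"
    proof (rule Lim_transform_eventually[OF variance_sum_tendsto])
      show "\<forall>\<^sub>F n in sequentially. (\<Sum>j=1..m. \<Sum>l=1..m. real (min (N n j) (N n l)) * (weight w n j * weight w n l * cov n j l))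
        = (\<Sum>i\<in>I n. expectation (\<lambda>s. (summand w n i (Xs i s))\<^sup>2))"
        using eventually_good
      proof eventually_elim
        case (elim n)
        have "(\<Sum>i\<in>I n. expectation (\<lambda>s. (summand w n i (Xs i s))\<^sup>2)) = (\<Sum>i=1..n. \<Sum>j=1..m. \<Sum>l=1..m.
            if i \<le> min (N n j) (N n l) then weight w n j * weight w n l * cov n j l else 0)"
          using elim by (simp add: I_def summand_moments(3) del: One_nat_def min.bounded_iff)
        also have "\<dots> = (\<Sum>j=1..m. \<Sum>i=1..n. \<Sum>l=1..m.
            if i \<le> min (N n j) (N n l) then weight w n j * weight w n l * cov n j l else 0)"
          by (rule sum.swap)
        also have "\<dots> = (\<Sum>j=1..m. \<Sum>l=1..m. \<Sum>i=1..n.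
            if i \<le> min (N n j) (N n l) then weight w n j * weight w n l * cov n j l else 0)"
          by (intro sum.cong refl sum.swap)
        also have "\<dots> = (\<Sum>j=1..m. \<Sum>l=1..m. real (min (N n j) (N n l)) * (weight w n j * weight w n l * cov n j l))"
          using N_le by (intro sum.cong refl sum_if_le) (auto simp: min_le_iff_disj)
        finally show ?case by simp
      qed
    qed
    \<comment> \<open>Sample \<open>j\<close> contributes at most
      \<open>N * \<bar>weight\<bar> ^ 3 * 28 * a\<close>, up to the constant in \<open>m\<close>,
      and \<open>N * a = k\<close>; what remains is the cube of a convergent ratio times
      \<open>1 / sqrt k\<close>.\<close>
    show "(\<lambda>n. \<Sum>i\<in>I n. expectation (\<lambda>s. \<bar>summand w n i (Xs i s)\<bar> ^ 3)) \<longlonglongrightarrow> 0"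
    proof (rule Lim_null_comparison)
      show "\<forall>\<^sub>F n in sequentially. norm (\<Sum>i\<in>I n. expectation (\<lambda>s. \<bar>summand w n i (Xs i s)\<bar> ^ 3)) \<le>
         real m ^ 3 * (\<Sum>j=1..m. \<bar>w j * \<gamma>\<bar> ^ 3 * (sqrt (real (ktot n)) / sqrt (real (k n j))) ^ 3 * (28 * (1 / sqrt (real (k n j)))))"
        using eventually_good
      proof eventually_elim
        case (elim n)
        have "norm (\<Sum>i\<in>I n. expectation (\<lambda>s. \<bar>summand w n i (Xs i s)\<bar> ^ 3)) = (\<Sum>i\<in>I n. expectation (\<lambda>s. \<bar>summand w n i (Xs i s)\<bar> ^ 3))"
          by (simp add: sum_nonneg)
        also have "\<dots> \<le> (\<Sum>i=1..n. real m ^ 3 * (\<Sum>j=1..m. if i \<le> N n j then \<bar>weight w n j\<bar> ^ 3 * (28 * a n j) else 0))"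
          using elim unfolding I_def by (simp only: if_True) (intro sum_mono summand_moments(6), auto)
        also have "\<dots> = real m ^ 3 * (\<Sum>j=1..m. \<Sum>i=1..n. if i \<le> N n j then \<bar>weight w n j\<bar> ^ 3 * (28 * a n j) else 0)"
          unfolding sum_distrib_left[symmetric] by (intro arg_cong[where f = "\<lambda>z. real m ^ 3 * z"] sum.swap)
        also have "\<dots> = real m ^ 3 * (\<Sum>j=1..m. \<bar>w j * \<gamma>\<bar> ^ 3 * (sqrt (real (ktot n)) / sqrt (real (k n j))) ^ 3 * (28 * (1 / sqrt (real (k n j)))))"
        proof (intro arg_cong[where f = "\<lambda>z. real m ^ 3 * z"] sum.cong refl)
          fix j assume j: "j \<in> {1..m}"
          define u where "u = sqrt (real (k n j))"
          have "0 < k n j \<and> k n j < N n j" using elim j unfolding good_def by blast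
          then have kN: "0 < k n j" "0 < N n j" by auto
          then have u: "u > 0" "real (k n j) = u * u" by (simp_all add: u_def)
          have "(\<Sum>i=1..n. if i \<le> N n j then \<bar>weight w n j\<bar> ^ 3 * (28 * a n j) else 0) =
              real (N n j) * (\<bar>weight w n j\<bar> ^ 3 * (28 * a n j))"
            by (rule sum_if_le[OF N_le[OF j]])
          also have "\<dots> = \<bar>weight w n j\<bar> ^ 3 * (28 * real (k n j))" using kN by (simp add: a_def)
          also have "\<dots> = \<bar>w j * \<gamma>\<bar> ^ 3 * (sqrt (real (ktot n)) / u) ^ 3 * (28 * (1 / u))"
          proof -
            have "\<bar>weight w n j\<bar> = \<bar>w j * \<gamma>\<bar> * (sqrt (real (ktot n)) / (u * u))"
              by (simp add: weight_def abs_mult u(2))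
            then have "\<bar>weight w n j\<bar> ^ 3 = \<bar>w j * \<gamma>\<bar> ^ 3 * (sqrt (real (ktot n)) / (u * u)) ^ 3"
              by (simp only: power_mult_distrib)
            moreover have "(r / (u * u)) ^ 3 * (28 * (u * u)) = (r / u) ^ 3 * (28 * (1 / u))" for r
              using u(1) by (simp add: power3_eq_cube field_simps)
            ultimately show ?thesis by (simp only: u(2) mult.assoc)
          qed
          finally show "(\<Sum>i=1..n. if i \<le> N n j then \<bar>weight w n j\<bar> ^ 3 * (28 * a n j) else 0) =
            \<bar>w j * \<gamma>\<bar> ^ 3 * (sqrt (real (ktot n)) / sqrt (real (k n j))) ^ 3 * (28 * (1 / sqrt (real (k n j))))"
            unfolding u_def .
        qed
        finally show ?case .
      qed
      have "(\<lambda>n. real m ^ 3 * (\<Sum>j=1..m. \<bar>w j * \<gamma>\<bar> ^ 3 * (sqrt (real (ktot n)) / sqrt (real (k n j))) ^ 3 * (28 * (1 / sqrt (real (k n j))))))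
        \<longlonglongrightarrow> real m ^ 3 * (\<Sum>j=1..m. \<bar>w j * \<gamma>\<bar> ^ 3 * sqrt (S * c j) ^ 3 * (28 * 0))"
        by (intro tendsto_intros tendsto_sum sqrt_ktot_ratio inverse_sqrt_k)
      then show "(\<lambda>n. real m ^ 3 * (\<Sum>j=1..m. \<bar>w j * \<gamma>\<bar> ^ 3 * (sqrt (real (ktot n)) / sqrt (real (k n j))) ^ 3 * (28 * (1 / sqrt (real (k n j))))))
        \<longlonglongrightarrow> 0" by simp
    qed
    show "\<forall>\<^sub>F n in sequentially. \<forall>i\<in>I n. expectation (\<lambda>s. (summand w n i (Xs i s))\<^sup>2)
        \<le> real m ^ 2 * (\<Sum>j=1..m. (weight w n j)\<^sup>2 * a n j)"
      using summand_moments(4) sub by (intro always_eventually allI ballI) blast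
    have "(\<lambda>n. \<Sum>j=1..m. (w j * \<gamma>)\<^sup>2 * (sqrt (real (ktot n)) / sqrt (real (k n j)))\<^sup>2 * (1 / real (N n j))) \<longlonglongrightarrow>
        (\<Sum>j=1..m. (w j * \<gamma>)\<^sup>2 * (sqrt (S * c j))\<^sup>2 * 0)"
    proof (intro tendsto_sum tendsto_intros sqrt_ktot_ratio)
      fix j assume "j \<in> {1..m}"
      then have "filterlim (\<lambda>n. real (N n j)) at_top sequentially"
        by (intro filterlim_compose[OF filterlim_real_sequentially] N_inf)
      from tendsto_inverse_0_at_top[OF this] show "(\<lambda>n. 1 / real (N n j)) \<longlonglongrightarrow> 0"
        by (simp add: inverse_eq_divide)
    qed
    then have "(\<lambda>n. real m ^ 2 * (\<Sum>j=1..m. (w j * \<gamma>)\<^sup>2 * (sqrt (real (ktot n)) / sqrt (real (k n j)))\<^sup>2 * (1 / real (N n j)))) \<longlonglongrightarrow> real m ^ 2 * 0"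
      by (intro tendsto_mult_left) simp
    then have "(\<lambda>n. real m ^ 2 * (\<Sum>j=1..m. (w j * \<gamma>)\<^sup>2 * (sqrt (real (ktot n)) / sqrt (real (k n j)))\<^sup>2 * (1 / real (N n j)))) \<longlonglongrightarrow> 0"
      by simp
    moreover have "real m ^ 2 * (\<Sum>j=1..m. (w j * \<gamma>)\<^sup>2 * (sqrt (real (ktot n)) / sqrt (real (k n j)))\<^sup>2 * (1 / real (N n j)))
       = real m ^ 2 * (\<Sum>j=1..m. (weight w n j)\<^sup>2 * a n j)" for n
      unfolding weight_def a_def
      by (intro arg_cong[where f = "\<lambda>z. real m ^ 2 * z"] sum.cong refl)
         (simp add: power_mult_distrib power_divide power2_eq_square)
    ultimately show "(\<lambda>n. real m ^ 2 * (\<Sum>j=1..m. (weight w n j)\<^sup>2 * a n j)) \<longlonglongrightarrow> 0"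
      by (simp only:)
  qed (use summand_moments(1,2,5) sub in auto)
  moreover have "\<forall>\<^sub>F n in sequentially. char (distr M borel (\<lambda>s. \<Sum>i\<in>I n. summand w n i (Xs i s))) t
      = char (distr M borel (\<lambda>s. \<Sum>i=1..n. summand w n i (Xs i s))) t"
    using eventually_good by eventually_elim (simp add: I_def)
  ultimately show ?thesis by (rule Lim_transform_eventually)
qed

text \<open>The entries are known only through limits, so positivity is read off the characteristic
  functions: a negative value would make their limit at \<open>t = 1\<close> exceed 1 in
  modulus.\<close>

lemma quad_form_nonneg: "0 \<le> quad_form m (var_mat m \<gamma> b c R) w"
proof (rule ccontr)
  assume "\<not> ?thesis"
  moreover have "norm (complex_of_real (exp (- (1\<^sup>2 * quad_form m (var_mat m \<gamma> b c R) w / 2)))) \<le> 1"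
  proof (rule tendsto_upperbound[OF tendsto_norm[OF summand_char_tendsto[of w 1]]])
    have "(\<lambda>s. \<Sum>i=1..n. summand w n i (Xs i s)) \<in> borel_measurable M" for n
      using Xs_measurable by (intro borel_measurable_sum measurable_compose[OF _ summand_measurable]) auto
    then show "\<forall>\<^sub>F n in sequentially. norm (char (distr M borel (\<lambda>s. \<Sum>i=1..n. summand w n i (Xs i s))) 1) \<le> 1"
      by (intro always_eventually allI real_distribution.cmod_char_le_1 real_distribution_distr)
  qed simp
  ultimately show False by simp
qed

end

section \<open>Limit law of weighted tail index errors\<close>

context pooled_tail_setting
begin

definition H :: "nat \<Rightarrow> 'a \<Rightarrow> nat \<Rightarrow> real" where
  "H n s j = hill (\<lambda>i. Xs i s j) (N n j) (k n j)"

definition threshold :: "nat \<Rightarrow> 'a \<Rightarrow> nat \<Rightarrow> real" where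
  "threshold n s j = order_stat (\<lambda>i. Xs i s j) (N n j) (N n j - k n j)"

definition error :: "nat \<Rightarrow> 'a \<Rightarrow> nat \<Rightarrow> real" where
  "error n s j = sqrt (real (ktot n)) * (H n s j - \<gamma>)"

lemma sqrt_k_factor:
  assumes j: "j \<in> {1..m}"
  shows "\<forall>\<^sub>F n in sequentially. sqrt (real (ktot n)) / sqrt (real (k n j)) * sqrt (real (k n j)) = sqrt (real (ktot n))"
  using k_pos[OF j] by eventually_elim simp

lemma ktot_factor_O_pr:
  assumes j: "j \<in> {1..m}" and Y: "O_pr M (\<lambda>n s. sqrt (real (k n j)) * Y n s)"
  shows "O_pr M (\<lambda>n s. sqrt (real (ktot n)) * Y n s)"
proof -
  have "O_pr M (\<lambda>n s. sqrt (real (ktot n)) / sqrt (real (k n j)) * (sqrt (real (k n j)) * Y n s))"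
    by (intro O_pr_mult O_pr_const[OF sqrt_ktot_ratio[OF j]] Y)
  then show ?thesis
    by (rule O_pr_cong) (intro whp_mono[OF whp_eventually[OF sqrt_k_factor[OF j]]],
      auto simp: mult.assoc[symmetric] simp del: times_divide_eq_left)
qed

lemma error_O_pr: "j \<in> {1..m} \<Longrightarrow> O_pr M (\<lambda>n s. error n s j)"
  unfolding error_def H_def
  by (rule ktot_factor_O_pr, assumption) (rule hill_sample.hill_O_pr[OF hill_sample])

text \<open>The one-sample expansion is multiplied by \<open>sqrt ktot / sqrt k\<close>, which tends
  to \<open>sqrt (S * c j)\<close>. In the stochastic part the exact factor is kept inside
  \<open>weight\<close>; only in the deterministic bias is it replaced by its limit.\<close>

lemma error_expansion:
  assumes j: "j \<in> {1..m}"
  shows "o_pr M (\<lambda>n s. w j * error n s j - (weight w n j * (\<Sum>i=1..N n j. score n j (Xs i s))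
    + w j * (sqrt (S * c j) * (lam j / (1 - \<rho> j)))))"
proof -
  define q where "q n = sqrt (real (ktot n)) / sqrt (real (k n j))" for n
  have q: "q \<longlonglongrightarrow> sqrt (S * c j)" unfolding q_def by (rule sqrt_ktot_ratio[OF j])
  have 1: "o_pr M (\<lambda>n s. (sqrt (real (k n j)) * (H n s j - \<gamma>) -
    (\<gamma> * ((\<Sum>i=1..N n j. score n j (Xs i s)) / sqrt (real (k n j))) + lam j / (1 - \<rho> j))) * (w j * q n))"
    using hill_sample.hill_expansion_explicit[OF hill_sample[OF j]] q
    unfolding H_def score_def a_def by (intro o_pr_O_pr_mult O_pr_const[OF tendsto_mult[OF tendsto_const]])
  have "(\<lambda>n. w j * ((q n - sqrt (S * c j)) * (lam j / (1 - \<rho> j)))) \<longlonglongrightarrow> w j * ((sqrt (S * c j) - sqrt (S * c j)) * (lam j / (1 - \<rho> j)))"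
    by (intro tendsto_mult tendsto_diff q tendsto_const)
  then have "o_pr M (\<lambda>n s. w j * ((q n - sqrt (S * c j)) * (lam j / (1 - \<rho> j))))"
    by (intro o_pr_const) simp
  from o_pr_add[OF 1 this] show ?thesis
  proof (rule o_pr_cong, intro whp_mono[OF whp_eventually[OF k_pos[OF j]]] always_eventually allI ballI impI)
    fix n s assume "0 < k n j \<and> k n j < N n j"
    then have k0: "sqrt (real (k n j)) > 0" by simp
    define u where "u = sqrt (real (k n j))"
    have u: "u > 0" "real (k n j) = u * u" using k0 by (simp_all add: u_def)
    define r where "r = sqrt (real (ktot n))"
    have qu: "q n * u = r" "weight w n j = w j * \<gamma> * q n / u"
      using u by (simp_all add: q_def u_def[symmetric] r_def weight_def)
    have e: "(u * h - (\<gamma> * (z / u) + l)) * (w j * q n) + w j * ((q n - x) * l)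
        = w j * (r * h) - (weight w n j * z + w j * (x * l))" for h z l x
      unfolding qu(1)[symmetric] qu(2) by (simp add: algebra_simps)
    show "(sqrt (real (k n j)) * (H n s j - \<gamma>) -
      (\<gamma> * ((\<Sum>i=1..N n j. score n j (Xs i s)) / sqrt (real (k n j))) + lam j / (1 - \<rho> j))) * (w j * q n)
      + w j * ((q n - sqrt (S * c j)) * (lam j / (1 - \<rho> j))) =
      w j * error n s j - (weight w n j * (\<Sum>i=1..N n j. score n j (Xs i s)) + w j * (sqrt (S * c j) * (lam j / (1 - \<rho> j))))"
      unfolding error_def u_def[symmetric] r_def[symmetric] by (rule e)
  qed
qed

lemma weighted_error_expansion:
  "o_pr M (\<lambda>n s. ((\<Sum>i=1..n. summand w n i (Xs i s)) + inner_vec m w (bias_vec m c lam \<rho>)) - (\<Sum>j=1..m. w j * error n s j))"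
proof -
  have "o_pr M (\<lambda>n s. - (\<Sum>j=1..m. w j * error n s j - (weight w n j * (\<Sum>i=1..N n j. score n j (Xs i s))
    + w j * (sqrt (S * c j) * (lam j / (1 - \<rho> j))))))"
    by (intro o_pr_uminus o_pr_sum error_expansion)
  moreover have "inner_vec m w (bias_vec m c lam \<rho>) = (\<Sum>j=1..m. w j * (sqrt (S * c j) * (lam j / (1 - \<rho> j))))"
    unfolding inner_vec_def bias_vec_def S_def[symmetric] by (simp add: real_sqrt_mult mult.assoc)
  ultimately show ?thesis
    unfolding sum_summand by (simp add: sum_subtractf sum.distrib algebra_simps)
qed

lemma order_stat_Xs_measurable:
  "j \<in> {1..m} \<Longrightarrow> (\<lambda>s. order_stat (\<lambda>i. Xs i s j) L r) \<in> borel_measurable M"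
  using Xs_component by (intro order_stat_measurable) auto

lemma H_measurable: "j \<in> {1..m} \<Longrightarrow> (\<lambda>s. H n s j) \<in> borel_measurable M"
proof -
  assume "j \<in> {1..m}"
  note [measurable] = order_stat_Xs_measurable[OF this]
  show ?thesis unfolding H_def hill_def by measurable
qed

lemma threshold_measurable: "j \<in> {1..m} \<Longrightarrow> (\<lambda>s. threshold n s j) \<in> borel_measurable M"
  unfolding threshold_def by (rule order_stat_Xs_measurable)

text \<open>The characteristic function is computed for the independent sum plus its bias, and
  carried over to \<open>Y\<close> before Levy's theorem is applied. \<open>Y\<close> may be an
  extrapolated quantile error or the linear statistic itself.\<close>

lemma conv_in_dist_normal:
  assumes Y: "\<And>n. Y n \<in> borel_measurable M"
    and o: "o_pr M (\<lambda>n s. Y n s - (\<Sum>j=1..m. w j * error n s j))"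
  shows "conv_in_dist M Y (normal_law (inner_vec m w (bias_vec m c lam \<rho>)) (quad_form m (var_mat m \<gamma> b c R) w))"
  unfolding conv_in_dist_def
proof (rule levy_continuity)
  define \<mu> where "\<mu> = inner_vec m w (bias_vec m c lam \<rho>)"
  define v where "v = quad_form m (var_mat m \<gamma> b c R) w"
  have v: "v \<ge> 0" unfolding v_def by (rule quad_form_nonneg)
  show "real_distribution (distr M borel (Y n))" for n using Y by (rule real_distribution_distr)
  show "real_distribution (normal_law \<mu> v)" using v by (rule real_distribution_normal_law)
  fix t
  define G where "G n s = (\<Sum>i=1..n. summand w n i (Xs i s))" for n s
  have G: "G n \<in> borel_measurable M" for n
    unfolding G_def using Xs_measurable by (intro borel_measurable_sum measurable_compose[OF _ summand_measurable]) auto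
  have "o_pr M (\<lambda>n s. ((G n s + \<mu>) - (\<Sum>j=1..m. w j * error n s j)) - (Y n s - (\<Sum>j=1..m. w j * error n s j)))"
    unfolding G_def \<mu>_def by (intro o_pr_diff weighted_error_expansion o)
  then have "o_pr M (\<lambda>n s. (G n s + \<mu>) - Y n s)" by (simp add: algebra_simps)
  moreover have "(\<lambda>n. char (distr M borel (\<lambda>s. G n s + \<mu>)) t) \<longlonglongrightarrow> char (normal_law \<mu> v) t"
    unfolding char_normal_law[OF v] char_distr_add_const[OF G] unfolding G_def v_def
    by (intro tendsto_mult summand_char_tendsto tendsto_const)
  ultimately show "(\<lambda>n. char (distr M borel (Y n)) t) \<longlonglongrightarrow> char (normal_law \<mu> v) t"
    using G Y by (intro char_tendsto_o_pr[where X = "\<lambda>n s. G n s + \<mu>" and Y = Y]) auto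
qed

end

section \<open>Extrapolation to the extreme level with estimated weights\<close>

locale pooled_quantile_setting = pooled_tail_setting +
  fixes p :: "nat \<Rightarrow> real" and \<omega> :: "nat \<Rightarrow> real" and \<omega>_hat :: "nat \<Rightarrow> 'a \<Rightarrow> nat \<Rightarrow> real"
  assumes p_extreme: "filterlim (\<lambda>n. real (ktot n) / (real n * p n)) at_top sequentially"
    and p_rate: "filterlim (\<lambda>n. sqrt (real (ktot n)) / ln (real (ktot n) / (real n * p n)))
      at_top sequentially"
    and \<omega>_hat_rv: "\<And>n. \<omega>_hat n \<in> measurable M (Rvec m)"
    and \<omega>_hat_sum: "\<And>n. AE s in M. (\<Sum>j=1..m. \<omega>_hat n s j) = 1"
    and \<omega>_hat_conv: "small_op M (\<lambda>n s. L2_set (\<lambda>j. \<omega>_hat n s j - \<omega> j) {1..m})"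
begin

definition ratio :: "nat \<Rightarrow> nat \<Rightarrow> real" where
  "ratio n j = real (k n j) / (real (N n j) * p n)"

definition L :: "nat \<Rightarrow> real" where
  "L n = ln (real (ktot n) / (real n * p n))"

lemma eventually_p: "\<forall>\<^sub>F n in sequentially. 0 < p n \<and> 0 < n \<and> 0 < ktot n"
  using p_extreme[unfolded filterlim_at_top_dense, rule_format, of 0]
proof eventually_elim
  case (elim n)
  then have "0 < real n * p n \<and> 0 < real (ktot n)"
    by (auto simp: zero_less_divide_iff)
  then show ?case by (auto simp: zero_less_mult_iff)
qed

lemma L_top: "filterlim L at_top sequentially"
  unfolding L_def by (rule filterlim_compose[OF ln_at_top p_extreme])

text \<open>The proportions \<open>k j / N j\<close> and \<open>ktot / n\<close> are of the same
  order, because all quotients \<open>k i / k j\<close> and \<open>N i / N j\<close> have positive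
  limits. The extrapolation factor of one sample thus differs from the pooled one by a convergent
  positive factor.\<close>

lemma ratio_asymp:
  assumes j: "j \<in> {1..m}"
  shows "\<exists>z>0. (\<lambda>n. ratio n j / (real (ktot n) / (real n * p n))) \<longlonglongrightarrow> z"
proof -
  define B where "B = (\<Sum>i=1..m. b j / b i)"
  have B: "B > 0" unfolding B_def using m b_range j by (intro sum_pos) auto
  have "(\<lambda>n. inverse (real (ktot n) / real (k n j)) * (\<Sum>i=1..m. real (N n i) / real (N n j))) \<longlonglongrightarrow> inverse (S * c j) * B"
    unfolding B_def using j S_pos c_range[OF j]
    by (intro tendsto_mult tendsto_inverse ktot_ratio tendsto_sum N_ratio) auto
  moreover have "\<forall>\<^sub>F n in sequentially. inverse (real (ktot n) / real (k n j)) * (\<Sum>i=1..m. real (N n i) / real (N n j))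
      = ratio n j / (real (ktot n) / (real n * p n))"
    using eventually_p k_pos[OF j]
  proof eventually_elim
    case (elim n)
    have "(\<Sum>i=1..m. real (N n i) / real (N n j)) = real n / real (N n j)"
    proof -
      have "(\<Sum>i=1..m. real (N n i)) = real n" using arg_cong[OF N_sum[of n], of real] by simp
      then show ?thesis by (simp only: sum_divide_distrib[symmetric])
    qed
    then show ?case using elim by (simp add: ratio_def)
  qed
  ultimately have "(\<lambda>n. ratio n j / (real (ktot n) / (real n * p n))) \<longlonglongrightarrow> inverse (S * c j) * B"
    by (rule Lim_transform_eventually)
  moreover have "inverse (S * c j) * B > 0" using B S_pos c_range[OF j] by simp
  ultimately show ?thesis by blast
qed

text \<open>A convergent positive factor adds a bounded term to a divergent logarithm, so the two
  logarithmic factors are interchangeable in the rates.\<close>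

lemma ln_ratio_asymp:
  assumes j: "j \<in> {1..m}"
  shows "(\<lambda>n. ln (ratio n j) / L n) \<longlonglongrightarrow> 1"
proof -
  obtain z where z: "z > 0" "(\<lambda>n. ratio n j / (real (ktot n) / (real n * p n))) \<longlonglongrightarrow> z"
    using ratio_asymp[OF j] by blast
  have "(\<lambda>n. 1 + ln (ratio n j / (real (ktot n) / (real n * p n))) * inverse (L n)) \<longlonglongrightarrow> 1 + ln z * 0"
    using z by (intro tendsto_intros tendsto_inverse_0_at_top L_top) auto
  moreover have "\<forall>\<^sub>F n in sequentially. 1 + ln (ratio n j / (real (ktot n) / (real n * p n))) * inverse (L n) = ln (ratio n j) / L n"
    using eventually_p k_pos[OF j] L_top[unfolded filterlim_at_top_dense, rule_format, of 0]
  proof eventually_elim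
    case (elim n)
    have "ratio n j > 0" "real (ktot n) / (real n * p n) > 0" using elim by (auto simp: ratio_def)
    then have "ln (ratio n j / (real (ktot n) / (real n * p n))) = ln (ratio n j) - L n"
      unfolding L_def by (rule ln_divide_pos)
    then show ?case using elim by (simp add: field_simps)
  qed
  ultimately show ?thesis by (auto intro: Lim_transform_eventually)
qed

lemma ln_ratio_top: "j \<in> {1..m} \<Longrightarrow> filterlim (\<lambda>n. ln (ratio n j)) at_top sequentially"
proof -
  assume j: "j \<in> {1..m}"
  have "filterlim (\<lambda>n. ln (ratio n j) / L n * L n) at_top sequentially"
    by (rule filterlim_tendsto_pos_mult_at_top[OF ln_ratio_asymp[OF j] zero_less_one L_top])
  moreover have "\<forall>\<^sub>F n in sequentially. ln (ratio n j) / L n * L n = ln (ratio n j)"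
    using L_top[unfolded filterlim_at_top_dense, rule_format, of 0] by eventually_elim simp
  ultimately show ?thesis by (simp cong: filterlim_cong)
qed

lemma rate_ratio_top: "j \<in> {1..m} \<Longrightarrow> filterlim (\<lambda>n. sqrt (real (ktot n)) / ln (ratio n j)) at_top sequentially"
proof -
  assume j: "j \<in> {1..m}"
  have "(\<lambda>n. inverse (ln (ratio n j) / L n)) \<longlonglongrightarrow> inverse 1"
    by (intro tendsto_inverse ln_ratio_asymp j) simp
  then have "filterlim (\<lambda>n. inverse (ln (ratio n j) / L n) * (sqrt (real (ktot n)) / L n)) at_top sequentially"
    by (rule filterlim_tendsto_pos_mult_at_top[OF _ _ p_rate[folded L_def]]) simp
  moreover have "\<forall>\<^sub>F n in sequentially. inverse (ln (ratio n j) / L n) * (sqrt (real (ktot n)) / L n) = sqrt (real (ktot n)) / ln (ratio n j)"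
    using L_top[unfolded filterlim_at_top_dense, rule_format, of 0] by eventually_elim simp
  ultimately show ?thesis by (simp cong: filterlim_cong)
qed

text \<open>The extrapolation factor eventually exceeds 1, so the extreme level lies beyond the
  threshold and within reach of the uniform bounds.\<close>

lemma p_le: "j \<in> {1..m} \<Longrightarrow> \<forall>\<^sub>F n in sequentially. 0 < p n \<and> p n \<le> real (k n j) / real (N n j)"
proof -
  assume j: "j \<in> {1..m}"
  show ?thesis
    using eventually_p k_pos[OF j] ln_ratio_top[OF j, unfolded filterlim_at_top_dense, rule_format, of 0]
  proof eventually_elim
    case (elim n)
    have r: "ratio n j > 0" using elim by (auto simp: ratio_def)
    then have "1 \<le> ratio n j" using elim by simp
    then show ?case using elim by (simp add: ratio_def field_simps)
  qed
qed

lemma \<omega>_hat_component: "j \<in> {1..m} \<Longrightarrow> (\<lambda>s. \<omega>_hat n s j) \<in> borel_measurable M"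
  by (intro component_measurable \<omega>_hat_rv)

lemma \<omega>_hat_diff: 
  assumes j: "j \<in> {1..m}"
  shows "o_pr M (\<lambda>n s. \<omega>_hat n s j - \<omega> j)"
proof (rule o_pr_dominated)
  have "(\<lambda>s. \<Sum>j=1..m. (\<omega>_hat n s j - \<omega> j)\<^sup>2) \<in> borel_measurable M" for n
    using \<omega>_hat_component by (intro borel_measurable_sum borel_measurable_power borel_measurable_diff) auto
  then have "(\<lambda>s. L2_set (\<lambda>j. \<omega>_hat n s j - \<omega> j) {1..m}) \<in> borel_measurable M" for n
    unfolding L2_set_def by (rule measurable_compose) measurable
  then show "o_pr M (\<lambda>n s. L2_set (\<lambda>j. \<omega>_hat n s j - \<omega> j) {1..m})"
    by (rule small_op_imp_o_pr[OF \<omega>_hat_conv])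
  have "\<bar>\<omega>_hat n s j - \<omega> j\<bar> \<le> \<bar>L2_set (\<lambda>j. \<omega>_hat n s j - \<omega> j) {1..m}\<bar>" for n s
    using member_le_L2_set[of "{1..m}" j "\<lambda>j. \<bar>\<omega>_hat n s j - \<omega> j\<bar>"] j
    by (simp add: L2_set_def)
  then show "whp M (\<lambda>n s. \<bar>\<omega>_hat n s j - \<omega> j\<bar> \<le> \<bar>L2_set (\<lambda>j. \<omega>_hat n s j - \<omega> j) {1..m}\<bar>)"
    by (intro whp_AE always_eventually allI AE_I2)
qed

text \<open>The limit weights inherit the constraint: otherwise the estimated weights, which sum to
  1 almost surely, could not converge to \<open>\<omega>\<close>, and an impossible event would hold
  with high probability.\<close>

lemma \<omega>_sum: "(\<Sum>j=1..m. \<omega> j) = 1"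
proof (rule ccontr)
  assume ne: "(\<Sum>j=1..m. \<omega> j) \<noteq> 1"
  define e where "e = \<bar>1 - (\<Sum>j=1..m. \<omega> j)\<bar> / 2"
  have e: "e > 0" using ne by (simp add: e_def)
  have "o_pr M (\<lambda>n s. \<Sum>j=1..m. \<omega>_hat n s j - \<omega> j)" by (intro o_pr_sum \<omega>_hat_diff)
  then have "whp M (\<lambda>n s. \<bar>\<Sum>j=1..m. \<omega>_hat n s j - \<omega> j\<bar> \<le> e)" using e by (simp add: o_pr_def)
  moreover have "whp M (\<lambda>n s. (\<Sum>j=1..m. \<omega>_hat n s j) = 1)" using \<omega>_hat_sum by (intro whp_AE) simp
  ultimately have "whp M (\<lambda>n s. False)"
    by (rule whp_mono'[OF whp_conj]) (use ne in \<open>auto simp: sum_subtractf e_def\<close>)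
  then have "\<forall>\<^sub>F n in sequentially. nearly M (1/2) (\<lambda>s. False)" by (simp add: whp_def)
  then have "nearly M (1/2) (\<lambda>s. False)" using eventually_happens'[OF sequentially_bot] by blast
  then obtain E where "E \<in> sets M" "prob E \<le> 1/2" "space M \<subseteq> E" by (auto simp: nearly_def)
  then have "E = space M" using sets.sets_into_space by blast
  then show False using \<open>prob E \<le> 1/2\<close> by (simp add: prob_space)
qed

definition T :: "nat \<Rightarrow> 'a \<Rightarrow> real" where
  "T n s = (\<Sum>j=1..m. \<omega> j * error n s j)"

lemma T_eq: "T n s = sqrt (real (ktot n)) * (pooled_hill m (\<lambda>i j. Xs i s j) (N n) (k n) \<omega> - \<gamma>)"
proof -
  have "T n s = sqrt (real (ktot n)) * ((\<Sum>j=1..m. \<omega> j * H n s j) - (\<Sum>j=1..m. \<omega> j) * \<gamma>)"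
    unfolding T_def error_def by (simp add: sum_distrib_left sum_distrib_right sum_subtractf algebra_simps)
  then show ?thesis unfolding \<omega>_sum by (simp add: pooled_hill_def H_def)
qed

lemma T_O_pr: "O_pr M T"
  unfolding T_def by (intro O_pr_sum O_pr_mult error_O_pr O_pr_const[OF tendsto_const])

lemma T_measurable: "T n \<in> borel_measurable M"
  unfolding T_def error_def using H_measurable by (intro borel_measurable_sum borel_measurable_times borel_measurable_diff) auto

lemma \<omega>_hat_O_pr: "j \<in> {1..m} \<Longrightarrow> O_pr M (\<lambda>n s. \<omega>_hat n s j)"
proof -
  assume j: "j \<in> {1..m}"
  have "O_pr M (\<lambda>n s. (\<omega>_hat n s j - \<omega> j) + \<omega> j)"
    by (intro O_pr_add o_pr_imp_O_pr \<omega>_hat_diff j O_pr_const[OF tendsto_const])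
  then show ?thesis by simp
qed

text \<open>Log error of the threshold, measured like \<open>q_error\<close> against the power law
  \<open>exp (ell j) * t powr \<gamma>\<close>, here at \<open>t = 1 / a n j\<close> and there at
  \<open>t = 1 / p n\<close>. In the difference of the two the constant \<open>ell j\<close>
  cancels.\<close>

definition thr_error :: "nat \<Rightarrow> 'a \<Rightarrow> nat \<Rightarrow> real" where
  "thr_error n s j = ln (threshold n s j) - ell j + \<gamma> * ln (a n j)"

definition q_error :: "nat \<Rightarrow> nat \<Rightarrow> real" where
  "q_error n j = ln (U j (1 / p n)) - ell j + \<gamma> * ln (p n)"

lemma thr_error_O_pr: "j \<in> {1..m} \<Longrightarrow> O_pr M (\<lambda>n s. sqrt (real (ktot n)) * thr_error n s j)"
  unfolding thr_error_def threshold_def a_def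
  by (rule ktot_factor_O_pr, assumption) (rule hill_sample.threshold_O_pr_explicit[OF hill_sample])

lemma q_error_O_pr: "j \<in> {1..m} \<Longrightarrow> O_pr M (\<lambda>n s. sqrt (real (ktot n)) * q_error n j)"
proof -
  assume j: "j \<in> {1..m}"
  have U: "U j = tail_quantile (F j)" by (simp add: U_def)
  show ?thesis
    unfolding q_error_def U
    by (rule ktot_factor_O_pr[OF j])
       (rule hill_sample.extreme_quantile_bounded_explicit(1)[OF hill_sample[OF j] p_le[OF j]])
qed

lemma U_pos: "j \<in> {1..m} \<Longrightarrow> \<forall>\<^sub>F n in sequentially. U j (1 / p n) > 0"
  using hill_sample.extreme_quantile_bounded_explicit(2)[OF hill_sample p_le] by (simp add: U_def)

lemma threshold_pos: "whp M (\<lambda>n s. \<forall>j\<in>{1..m}. threshold n s j > 0)"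
  unfolding threshold_def by (intro whp_ball hill_sample.threshold_pos[OF hill_sample]) auto

lemma quantile_eq: "j \<in> {1..m} \<Longrightarrow> p n > 0 \<Longrightarrow> quantile (F j) (1 - p n) = U j (1 / p n)"
  using quantile_eq_tail_quantile[of "p n" "F j"] continuous_cdf.F_le_1[OF cdf_component]
  by (simp add: U_def)

lemma regular: "whp M (\<lambda>n s. (\<forall>j\<in>{1..m}. threshold n s j > 0) \<and> (\<Sum>j=1..m. \<omega>_hat n s j) = 1 \<and>
    good n \<and> 0 < p n \<and> 0 < L n \<and> (\<forall>j\<in>{1..m}. 0 < ratio n j \<and> ln (ratio n j) > 0 \<and> U j (1 / p n) > 0) \<and> 0 < ktot n)"
proof -
  have 1: "\<forall>\<^sub>F n in sequentially. \<forall>j\<in>{1..m}. ln (ratio n j) > 0 \<and> U j (1 / p n) > 0"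
    using ln_ratio_top[unfolded filterlim_at_top_dense] U_pos
    by (intro eventually_ball_finite ballI eventually_conj) auto
  have 2: "\<forall>\<^sub>F n in sequentially. good n \<and> 0 < p n \<and> 0 < L n \<and> (\<forall>j\<in>{1..m}. 0 < ratio n j \<and> ln (ratio n j) > 0 \<and> U j (1 / p n) > 0) \<and> 0 < ktot n"
    using 1 eventually_good eventually_p L_top[unfolded filterlim_at_top_dense, rule_format, of 0]
    by eventually_elim (auto simp: ratio_def good_def intro!: divide_pos_pos mult_pos_pos)
  have 3: "whp M (\<lambda>n s. (\<Sum>j=1..m. \<omega>_hat n s j) = 1)" using \<omega>_hat_sum by (intro whp_AE) simp
  show ?thesis by (intro whp_conj threshold_pos 3 whp_eventually[OF 2])
qed

lemma inverse_top_o_pr: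
  "filterlim f at_top sequentially \<Longrightarrow> O_pr M Y \<Longrightarrow> o_pr M (\<lambda>n s. inverse (f n) * Y n s)"
  by (intro o_pr_O_pr_mult o_pr_const tendsto_inverse_0_at_top)

end

context pooled_quantile_setting
begin

lemma ln_ratio_eq:
  assumes "0 < p n" "good n" "j \<in> {1..m}"
  shows "ln (ratio n j) = ln (a n j) - ln (p n)"
proof -
  have "ratio n j = a n j / p n" by (simp add: ratio_def a_def)
  then show ?thesis using good_a[OF assms(2,3)] assms(1) by (simp add: ln_divide_pos)
qed

definition marginal_error :: "nat \<Rightarrow> nat \<Rightarrow> 'a \<Rightarrow> real" where
  "marginal_error j n s = sqrt (real (ktot n)) / ln (real (k n j) / (real (N n j) * p n)) *
    (marginal_quantile_est m (\<lambda>i j. Xs i s j) (N n) (k n) (p n) (\<omega>_hat n s) j / quantile (F j) (1 - p n) - 1)"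

text \<open>The log error of the quantile is the tail index error times
  \<open>ln (ratio n j)\<close> plus \<open>thr_error - q_error\<close>. After multiplication by the
  rate the second part carries \<open>1 / ln (ratio n j)\<close> and disappears. In the first, the
  weights sum to 1, so passing to their limits only multiplies centred errors by
  \<open>\<omega>_hat - \<omega>\<close>.\<close>

lemma marginal_error_expansion:
  assumes j: "j \<in> {1..m}"
  shows "o_pr M (\<lambda>n s. marginal_error j n s - T n s)"
proof (rule o_pr_ratio_of_log[where r = "\<lambda>n. sqrt (real (ktot n))" and d = "\<lambda>n. ln (ratio n j)"
      and Z = "\<lambda>n s. (\<Sum>i=1..m. \<omega>_hat n s i * H n s i) * ln (ratio n j) + ln (threshold n s j) - ln (U j (1 / p n))"])
  show "O_pr M T" by (rule T_O_pr)
  show "filterlim (\<lambda>n. sqrt (real (ktot n)) / ln (ratio n j)) at_top sequentially" by (rule rate_ratio_top[OF j])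
  show "\<forall>\<^sub>F n in sequentially. sqrt (real (ktot n)) > 0 \<and> ln (ratio n j) > 0"
    using eventually_p ln_ratio_top[OF j, unfolded filterlim_at_top_dense, rule_format, of 0]
    by eventually_elim simp
  show "whp M (\<lambda>n s. marginal_error j n s = sqrt (real (ktot n)) / ln (ratio n j) *
      (exp ((\<Sum>i=1..m. \<omega>_hat n s i * H n s i) * ln (ratio n j) + ln (threshold n s j) - ln (U j (1 / p n))) - 1))"
  proof (rule whp_mono'[OF regular], elim conjE)
    fix n s
    assume th: "\<forall>j\<in>{1..m}. threshold n s j > 0" and p: "0 < p n"
      and r: "\<forall>j\<in>{1..m}. 0 < ratio n j \<and> ln (ratio n j) > 0 \<and> U j (1 / p n) > 0"
    have pos: "threshold n s j > 0" "ratio n j > 0" "U j (1 / p n) > 0" using th r j by auto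
    have e1: "marginal_quantile_est m (\<lambda>i j. Xs i s j) (N n) (k n) (p n) (\<omega>_hat n s) j =
        ratio n j powr (\<Sum>i=1..m. \<omega>_hat n s i * H n s i) * threshold n s j"
      by (simp add: marginal_quantile_est_def pooled_hill_def H_def ratio_def threshold_def)
    have e2: "ratio n j powr (\<Sum>i=1..m. \<omega>_hat n s i * H n s i) * threshold n s j / quantile (F j) (1 - p n) =
        exp ((\<Sum>i=1..m. \<omega>_hat n s i * H n s i) * ln (ratio n j) + ln (threshold n s j) - ln (U j (1 / p n)))"
      using pos by (simp add: quantile_eq[OF j p] powr_def exp_add exp_diff)
    show "marginal_error j n s = sqrt (real (ktot n)) / ln (ratio n j) *
      (exp ((\<Sum>i=1..m. \<omega>_hat n s i * H n s i) * ln (ratio n j) + ln (threshold n s j) - ln (U j (1 / p n))) - 1)"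
      unfolding marginal_error_def ratio_def[symmetric] e1 e2 ..
  qed
  have "o_pr M (\<lambda>n s. (\<Sum>i=1..m. (\<omega>_hat n s i - \<omega> i) * error n s i) + inverse (ln (ratio n j)) *
      (sqrt (real (ktot n)) * thr_error n s j - sqrt (real (ktot n)) * q_error n j))"
    by (intro o_pr_add o_pr_sum o_pr_O_pr_mult[OF \<omega>_hat_diff error_O_pr] inverse_top_o_pr ln_ratio_top
        O_pr_diff thr_error_O_pr q_error_O_pr j)
  then show "o_pr M (\<lambda>n s. sqrt (real (ktot n)) / ln (ratio n j) *
      ((\<Sum>i=1..m. \<omega>_hat n s i * H n s i) * ln (ratio n j) + ln (threshold n s j) - ln (U j (1 / p n))) - T n s)"
  proof (rule o_pr_cong, intro whp_mono'[OF regular], elim conjE)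
    fix n s
    assume w: "(\<Sum>j=1..m. \<omega>_hat n s j) = 1" and g: "good n" and p: "0 < p n"
      and r: "\<forall>j\<in>{1..m}. 0 < ratio n j \<and> ln (ratio n j) > 0 \<and> U j (1 / p n) > 0"
    define K where "K = sqrt (real (ktot n))"
    define d where "d = ln (ratio n j)"
    define W where "W = (\<Sum>i=1..m. \<omega>_hat n s i * H n s i)"
    have d: "d \<noteq> 0" "d = ln (a n j) - ln (p n)" using bspec[OF r j] ln_ratio_eq[OF p g j] by (auto simp: d_def)
    have "(\<Sum>i=1..m. (\<omega>_hat n s i - \<omega> i) * error n s i) + T n s = (\<Sum>i=1..m. \<omega>_hat n s i * error n s i)"
      unfolding T_def sum.distrib[symmetric] by (simp add: algebra_simps)
    also have "\<dots> = K * (W - (\<Sum>i=1..m. \<omega>_hat n s i) * \<gamma>)"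
      unfolding error_def K_def W_def by (simp add: sum_distrib_left sum_distrib_right sum_subtractf algebra_simps)
    finally have 1: "(\<Sum>i=1..m. (\<omega>_hat n s i - \<omega> i) * error n s i) = K * (W - \<gamma>) - T n s" using w by simp
    \<comment> \<open>As \<open>ln (ratio n j) = ln (a n j) - ln (p n)\<close>, the two power-law
      terms combine into \<open>\<gamma> * d\<close>, which supplies the centring of the tail
      index.\<close>
    have 2: "thr_error n s j - q_error n j = ln (threshold n s j) - ln (U j (1 / p n)) + \<gamma> * d"
      unfolding thr_error_def q_error_def d(2) by (simp add: algebra_simps)
    have "K / d * (W * d + x) = K * W + inverse d * (K * x)" for x
      using d(1) by (simp add: field_simps)
    from this[of "ln (threshold n s j) - ln (U j (1 / p n))"]
    have 3: "K / d * (W * d + ln (threshold n s j) - ln (U j (1 / p n))) =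
        K * W + inverse d * (K * (ln (threshold n s j) - ln (U j (1 / p n))))" by (simp add: add_diff_eq)
    have 4: "inverse d * (K * thr_error n s j - K * q_error n j) =
        inverse d * (K * (ln (threshold n s j) - ln (U j (1 / p n)))) + K * \<gamma>"
      unfolding right_diff_distrib[symmetric] 2 using d(1) by (simp add: field_simps)
    show "(\<Sum>i=1..m. (\<omega>_hat n s i - \<omega> i) * error n s i) + inverse (ln (ratio n j)) *
      (sqrt (real (ktot n)) * thr_error n s j - sqrt (real (ktot n)) * q_error n j) =
      sqrt (real (ktot n)) / ln (ratio n j) *
      ((\<Sum>i=1..m. \<omega>_hat n s i * H n s i) * ln (ratio n j) + ln (threshold n s j) - ln (U j (1 / p n))) - T n s"
      unfolding K_def[symmetric] d_def[symmetric] W_def[symmetric] 1 3 4 by (simp add: algebra_simps)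
  qed
qed

text \<open>\<open>ell j\<close> is the limit of \<open>ln (U j t) - \<gamma> * ln t\<close>, and
  the logarithm of the quotient of two tail quantiles tends to \<open>ln 1\<close>.\<close>

lemma ell_eq:
  assumes ratio: "\<And>j l. j \<in> {1..m} \<Longrightarrow> l \<in> {1..m} \<Longrightarrow> j \<noteq> l \<Longrightarrow> ((\<lambda>t. U j t / U l t) \<longlongrightarrow> 1) at_top"
    and i: "i \<in> {1..m}" and j: "j \<in> {1..m}"
  shows "ell i = ell j"
proof (cases "i = j")
  case False
  have lim: "((\<lambda>t. ln (U j t) - \<gamma> * ln t) \<longlongrightarrow> ell j) at_top" if j: "j \<in> {1..m}" for j
  proof (rule Lim_transform)
    show "((\<lambda>t. ell j) \<longlongrightarrow> ell j) at_top" by simp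
    have A0: "(A j \<longlongrightarrow> 0) at_top" using C2 j unfolding cond_C2_def by blast
    have bound: "\<forall>\<^sub>F t in at_top. norm (ln (U j t) - \<gamma> * ln t - ell j) \<le> \<bar>A j t\<bar> + \<bar>A j t / \<rho> j\<bar>"
      using hill_sample.expansion[OF hill_sample[OF j] zero_less_one]
    proof eventually_elim
      case (elim t)
      have "\<bar>ln (U j t) - \<gamma> * ln t - ell j - A j t / \<rho> j\<bar> \<le> \<bar>A j t\<bar>"
        using elim[rule_format, of 1] by (simp add: U_def)
      then show ?case unfolding real_norm_def by linarith
    qed
    have "((\<lambda>t. \<bar>A j t\<bar> + \<bar>A j t / \<rho> j\<bar>) \<longlongrightarrow> \<bar>0\<bar> + \<bar>0 / \<rho> j\<bar>) at_top"
      using \<rho>_neg[OF j] by (intro tendsto_intros A0) auto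
    then have "((\<lambda>t. \<bar>A j t\<bar> + \<bar>A j t / \<rho> j\<bar>) \<longlongrightarrow> 0) at_top" by simp
    then show "((\<lambda>t. ln (U j t) - \<gamma> * ln t - ell j) \<longlongrightarrow> 0) at_top"
      by (rule Lim_null_comparison[OF bound])
  qed
  have pos: "\<forall>\<^sub>F t in at_top. U j t > 0" if "j \<in> {1..m}" for j
    using hill_sample.U_pos[OF hill_sample[OF that]] by (simp add: U_def)
  have "((\<lambda>t. (ln (U i t) - \<gamma> * ln t) - (ln (U j t) - \<gamma> * ln t)) \<longlongrightarrow> ell i - ell j) at_top"
    by (intro tendsto_diff lim i j)
  moreover have "\<forall>\<^sub>F t in at_top. (ln (U i t) - \<gamma> * ln t) - (ln (U j t) - \<gamma> * ln t) = ln (U i t / U j t)"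
    using pos[OF i] pos[OF j] by eventually_elim (simp add: ln_divide_pos)
  ultimately have "((\<lambda>t. ln (U i t / U j t)) \<longlongrightarrow> ell i - ell j) at_top"
    by (rule Lim_transform_eventually)
  moreover have "((\<lambda>t. ln (U i t / U j t)) \<longlongrightarrow> ln 1) at_top"
    by (rule tendsto_ln[OF ratio[OF i j False]]) simp
  ultimately have "ell i - ell j = ln 1"
    by (rule tendsto_unique[OF trivial_limit_at_top_linorder])
  then show ?thesis by simp
qed simp

definition pooled_error :: "nat \<Rightarrow> nat \<Rightarrow> 'a \<Rightarrow> real" where
  "pooled_error j n s = sqrt (real (ktot n)) / ln (real (ktot n) / (real n * p n)) *
    (pooled_quantile_est m (\<lambda>i j. Xs i s j) (N n) (k n) (p n) (\<omega>_hat n s) / quantile (F j) (1 - p n) - 1)"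

text \<open>On the log scale the estimator is a weighted mean of marginal log-extrapolations, and
  the factors \<open>ln (ratio n i)\<close> may be exchanged for \<open>L n\<close>. With unequal
  constants \<open>ell i\<close>, their weighted mean would in general miss \<open>ell j\<close> by
  a constant, which the diverging rate would amplify.\<close>

lemma pooled_error_expansion:
  assumes ell: "\<And>i. i \<in> {1..m} \<Longrightarrow> ell i = ell j" and j: "j \<in> {1..m}"
  shows "o_pr M (\<lambda>n s. pooled_error j n s - T n s)"
proof (rule o_pr_ratio_of_log[where r = "\<lambda>n. sqrt (real (ktot n))" and d = L
      and Z = "\<lambda>n s. (\<Sum>i=1..m. \<omega>_hat n s i * (H n s i * ln (ratio n i) + ln (threshold n s i))) - ln (U j (1 / p n))"])
  show "O_pr M T" by (rule T_O_pr)
  show "filterlim (\<lambda>n. sqrt (real (ktot n)) / L n) at_top sequentially" using p_rate by (simp add: L_def)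
  show "\<forall>\<^sub>F n in sequentially. sqrt (real (ktot n)) > 0 \<and> L n > 0"
    using eventually_p L_top[unfolded filterlim_at_top_dense, rule_format, of 0] by eventually_elim simp
  show "whp M (\<lambda>n s. pooled_error j n s = sqrt (real (ktot n)) / L n *
      (exp ((\<Sum>i=1..m. \<omega>_hat n s i * (H n s i * ln (ratio n i) + ln (threshold n s i))) - ln (U j (1 / p n))) - 1))"
  proof (rule whp_mono'[OF regular], elim conjE)
    fix n s
    assume th: "\<forall>j\<in>{1..m}. threshold n s j > 0" and p: "0 < p n"
      and r: "\<forall>j\<in>{1..m}. 0 < ratio n j \<and> ln (ratio n j) > 0 \<and> U j (1 / p n) > 0"
    have "pooled_quantile_est m (\<lambda>i j. Xs i s j) (N n) (k n) (p n) (\<omega>_hat n s) =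
        (\<Prod>i=1..m. (ratio n i powr H n s i * threshold n s i) powr \<omega>_hat n s i)"
      by (simp add: pooled_quantile_est_def H_def ratio_def threshold_def)
    also have "\<dots> = (\<Prod>i=1..m. exp (\<omega>_hat n s i * (H n s i * ln (ratio n i) + ln (threshold n s i))))"
    proof (rule prod.cong[OF refl])
      fix i assume i: "i \<in> {1..m}"
      then have "ratio n i > 0" "threshold n s i > 0" using th r by auto
      then show "(ratio n i powr H n s i * threshold n s i) powr \<omega>_hat n s i =
          exp (\<omega>_hat n s i * (H n s i * ln (ratio n i) + ln (threshold n s i)))"
        by (simp add: powr_def ln_mult)
    qed
    also have "\<dots> = exp (\<Sum>i=1..m. \<omega>_hat n s i * (H n s i * ln (ratio n i) + ln (threshold n s i)))"
      by (simp add: exp_sum)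
    finally have e1: "pooled_quantile_est m (\<lambda>i j. Xs i s j) (N n) (k n) (p n) (\<omega>_hat n s) =
        exp (\<Sum>i=1..m. \<omega>_hat n s i * (H n s i * ln (ratio n i) + ln (threshold n s i)))" .
    have e2: "exp (\<Sum>i=1..m. \<omega>_hat n s i * (H n s i * ln (ratio n i) + ln (threshold n s i))) / quantile (F j) (1 - p n) =
        exp ((\<Sum>i=1..m. \<omega>_hat n s i * (H n s i * ln (ratio n i) + ln (threshold n s i))) - ln (U j (1 / p n)))"
      using r j by (simp add: quantile_eq[OF j p] exp_diff)
    show "pooled_error j n s = sqrt (real (ktot n)) / L n *
      (exp ((\<Sum>i=1..m. \<omega>_hat n s i * (H n s i * ln (ratio n i) + ln (threshold n s i))) - ln (U j (1 / p n))) - 1)"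
      unfolding pooled_error_def L_def[symmetric] e1 e2 ..
  qed
  have lr: "o_pr M (\<lambda>n s. ln (ratio n i) / L n - 1)" if "i \<in> {1..m}" for i
    using tendsto_diff[OF ln_ratio_asymp[OF that] tendsto_const[of 1]] by (intro o_pr_const) simp
  have "o_pr M (\<lambda>n s. (\<Sum>i=1..m. (\<omega>_hat n s i - \<omega> i) * (ln (ratio n i) / L n * error n s i) + (ln (ratio n i) / L n - 1) * (\<omega> i * error n s i))
      + inverse (L n) * ((\<Sum>i=1..m. \<omega>_hat n s i * (sqrt (real (ktot n)) * thr_error n s i)) - sqrt (real (ktot n)) * q_error n j))"
    by (intro o_pr_add o_pr_sum o_pr_O_pr_mult[OF \<omega>_hat_diff] o_pr_O_pr_mult[OF lr] inverse_top_o_pr L_top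
        O_pr_diff O_pr_sum O_pr_mult thr_error_O_pr q_error_O_pr error_O_pr \<omega>_hat_O_pr
        O_pr_const[OF ln_ratio_asymp] O_pr_const[OF tendsto_const] j)
  then show "o_pr M (\<lambda>n s. sqrt (real (ktot n)) / L n *
      ((\<Sum>i=1..m. \<omega>_hat n s i * (H n s i * ln (ratio n i) + ln (threshold n s i))) - ln (U j (1 / p n))) - T n s)"
  proof (rule o_pr_cong, intro whp_mono'[OF regular], elim conjE)
    fix n s
    assume w: "(\<Sum>j=1..m. \<omega>_hat n s j) = 1" and g: "good n" and p: "0 < p n" and L: "0 < L n"
    define K where "K = sqrt (real (ktot n))"
    have 1: "(\<Sum>i=1..m. (\<omega>_hat n s i - \<omega> i) * (ln (ratio n i) / L n * error n s i) + (ln (ratio n i) / L n - 1) * (\<omega> i * error n s i))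
      = (\<Sum>i=1..m. \<omega>_hat n s i * (ln (ratio n i) / L n * error n s i)) - T n s"
    proof -
      have "(x - y) * (q * e) + (q - 1) * (y * e) = x * (q * e) - y * e" for x y q e :: real
        by (simp add: algebra_simps)
      then show ?thesis unfolding T_def sum_subtractf[symmetric] by (simp only:)
    qed
    have "\<omega>_hat n s i * (H n s i * ln (ratio n i) + ln (threshold n s i)) =
        \<omega>_hat n s i * (ln (ratio n i) * (H n s i - \<gamma>)) + \<omega>_hat n s i * thr_error n s i + \<omega>_hat n s i * (ell j - \<gamma> * ln (p n))"
      if i: "i \<in> {1..m}" for i
    proof -
      have e: "ln (a n i) = ln (ratio n i) + ln (p n)" using ln_ratio_eq[OF p g i] by simp
      show ?thesis unfolding thr_error_def e ell[OF i] by (simp add: algebra_simps)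
    qed
    then have "(\<Sum>i=1..m. \<omega>_hat n s i * (H n s i * ln (ratio n i) + ln (threshold n s i))) =
        (\<Sum>i=1..m. \<omega>_hat n s i * (ln (ratio n i) * (H n s i - \<gamma>)) + \<omega>_hat n s i * thr_error n s i + \<omega>_hat n s i * (ell j - \<gamma> * ln (p n)))"
      by (intro sum.cong) auto
    \<comment> \<open>The weights sum to 1, so the common value
      \<open>ell j - \<gamma> * ln (p n)\<close> comes out with coefficient exactly 1.\<close>
    also have "\<dots> = (\<Sum>i=1..m. \<omega>_hat n s i * (ln (ratio n i) * (H n s i - \<gamma>))) + (\<Sum>i=1..m. \<omega>_hat n s i * thr_error n s i) + (ell j - \<gamma> * ln (p n))"
      using w by (simp add: sum.distrib flip: sum_distrib_right)
    finally have 2: "(\<Sum>i=1..m. \<omega>_hat n s i * (H n s i * ln (ratio n i) + ln (threshold n s i))) - ln (U j (1 / p n)) =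
        (\<Sum>i=1..m. \<omega>_hat n s i * (ln (ratio n i) * (H n s i - \<gamma>))) + (\<Sum>i=1..m. \<omega>_hat n s i * thr_error n s i) - q_error n j"
      by (simp add: q_error_def)
    have 3: "(\<Sum>i=1..m. \<omega>_hat n s i * (ln (ratio n i) / L n * error n s i)) =
        K / L n * (\<Sum>i=1..m. \<omega>_hat n s i * (ln (ratio n i) * (H n s i - \<gamma>)))"
      unfolding error_def K_def sum_distrib_left by (intro sum.cong refl) simp
    have 4: "(\<Sum>i=1..m. \<omega>_hat n s i * (K * thr_error n s i)) = K * (\<Sum>i=1..m. \<omega>_hat n s i * thr_error n s i)"
      unfolding sum_distrib_left by (intro sum.cong refl) simp
    show "(\<Sum>i=1..m. (\<omega>_hat n s i - \<omega> i) * (ln (ratio n i) / L n * error n s i) + (ln (ratio n i) / L n - 1) * (\<omega> i * error n s i))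
      + inverse (L n) * ((\<Sum>i=1..m. \<omega>_hat n s i * (sqrt (real (ktot n)) * thr_error n s i)) - sqrt (real (ktot n)) * q_error n j)
      = sqrt (real (ktot n)) / L n *
      ((\<Sum>i=1..m. \<omega>_hat n s i * (H n s i * ln (ratio n i) + ln (threshold n s i))) - ln (U j (1 / p n))) - T n s"
      unfolding K_def[symmetric] 1 2 3 4
      by (simp add: divide_inverse distrib_left right_diff_distrib mult_ac)
  qed
qed

lemma marginal_error_measurable:
  assumes j: "j \<in> {1..m}"
  shows "marginal_error j n \<in> borel_measurable M"
proof -
  note [measurable] = threshold_measurable[OF j]
  have [measurable]: "(\<lambda>s. \<Sum>i=1..m. \<omega>_hat n s i * H n s i) \<in> borel_measurable M"
    using H_measurable \<omega>_hat_component by (intro borel_measurable_sum borel_measurable_times) auto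
  have "marginal_error j n s = sqrt (real (ktot n)) / ln (ratio n j) *
      (ratio n j powr (\<Sum>i=1..m. \<omega>_hat n s i * H n s i) * threshold n s j / quantile (F j) (1 - p n) - 1)" for s
    by (simp add: marginal_error_def marginal_quantile_est_def pooled_hill_def H_def ratio_def threshold_def)
  then have "marginal_error j n = (\<lambda>s. sqrt (real (ktot n)) / ln (ratio n j) *
      (ratio n j powr (\<Sum>i=1..m. \<omega>_hat n s i * H n s i) * threshold n s j / quantile (F j) (1 - p n) - 1))" by auto
  then show ?thesis by (simp only:) measurable
qed

lemma pooled_error_measurable: "pooled_error j n \<in> borel_measurable M"
proof -
  have "(\<lambda>s. (ratio n i powr H n s i * threshold n s i) powr \<omega>_hat n s i) \<in> borel_measurable M" if "i \<in> {1..m}" for i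
  proof -
    note [measurable] = threshold_measurable[OF that] H_measurable[OF that] \<omega>_hat_component[OF that]
    show ?thesis by measurable
  qed
  then have [measurable]: "(\<lambda>s. \<Prod>i=1..m. (ratio n i powr H n s i * threshold n s i) powr \<omega>_hat n s i) \<in> borel_measurable M"
    by (intro borel_measurable_prod) auto
  have "pooled_error j n = (\<lambda>s. sqrt (real (ktot n)) / L n *
      ((\<Prod>i=1..m. (ratio n i powr H n s i * threshold n s i) powr \<omega>_hat n s i) / quantile (F j) (1 - p n) - 1))"
    by (auto simp: pooled_error_def pooled_quantile_est_def H_def ratio_def threshold_def L_def)
  then show ?thesis by (simp only:) measurable
qed

text \<open>\<open>T\<close> itself satisfies the hypothesis of the normal limit, with a difference
  that is identically 0.\<close>

lemma limit_law:
  assumes Y: "\<And>n. Y n \<in> borel_measurable M" and o: "o_pr M (\<lambda>n s. Y n s - T n s)"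
  shows "small_op M (\<lambda>n s. Y n s - T n s) \<and>
    conv_in_dist M Y (normal_law (inner_vec m \<omega> (bias_vec m c lam \<rho>)) (quad_form m (var_mat m \<gamma> b c R) \<omega>)) \<and>
    conv_in_dist M T (normal_law (inner_vec m \<omega> (bias_vec m c lam \<rho>)) (quad_form m (var_mat m \<gamma> b c R) \<omega>))"
  using o o_pr_imp_small_op[OF o] conv_in_dist_normal[of Y \<omega>] conv_in_dist_normal[of T \<omega>] Y T_measurable o_pr_zero
  by (simp add: T_def)

end

theorem theorem2:
  fixes M :: "'a measure"
    and m :: nat
    and X :: "'a \<Rightarrow> nat \<Rightarrow> real"
    and Xs :: "nat \<Rightarrow> 'a \<Rightarrow> nat \<Rightarrow> real"
    and N k :: "nat \<Rightarrow> nat \<Rightarrow> nat"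
    and F U A :: "nat \<Rightarrow> real \<Rightarrow> real"
    and R :: "nat \<Rightarrow> nat \<Rightarrow> ennreal \<Rightarrow> ennreal \<Rightarrow> real"
    and \<gamma> :: real
    and \<rho> b c lam \<omega> :: "nat \<Rightarrow> real"
    and ktot :: "nat \<Rightarrow> nat"
    and p :: "nat \<Rightarrow> real"
    and \<omega>_hat :: "nat \<Rightarrow> 'a \<Rightarrow> nat \<Rightarrow> real"
    and T :: "nat \<Rightarrow> 'a \<Rightarrow> real"
    and L :: "real measure"
  assumes "prob_space M"
    and "m \<ge> 1"
    and X: "X \<in> measurable M (Rvec m)"
    and Xs_indep: "prob_space.indep_vars M (\<lambda>_. Rvec m) Xs {1..}"
    and Xs_copies: "\<And>i. i \<ge> 1 \<Longrightarrow> distr M (Rvec m) (Xs i) = distr M (Rvec m) X"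
    and F_def: "F = marginal_cdf M X"
    and U_def: "U = (\<lambda>j. tail_quantile (F j))"
    and F_cont: "\<And>j. j \<in> {1..m} \<Longrightarrow> continuous_on UNIV (F j)"
    and N_sum: "\<And>n. (\<Sum>j=1..m. N n j) = n"
    and N_inf: "\<And>j. j \<in> {1..m} \<Longrightarrow> filterlim (\<lambda>n. N n j) at_top sequentially"
    and C2: "cond_C2 m U (\<lambda>_. \<gamma>) \<rho> A"
    and J: "cond_J m M X R"
    and \<rho>_neg: "\<And>j. j \<in> {1..m} \<Longrightarrow> \<rho> j < 0"
    and N_mono: "\<And>n j l. 1 \<le> j \<Longrightarrow> j \<le> l \<Longrightarrow> l \<le> m \<Longrightarrow> N n j \<le> N n l"
    and k_inf: "\<And>j. j \<in> {1..m} \<Longrightarrow> filterlim (\<lambda>n. k n j) at_top sequentially"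
    and k_intermediate: "\<And>j. j \<in> {1..m} \<Longrightarrow> (\<lambda>n. real (k n j) / real (N n j)) \<longlonglongrightarrow> 0"
    and b_range: "\<And>j. j \<in> {1..m} \<Longrightarrow> 0 < b j \<and> b j \<le> 1"
    and b_lim: "\<And>j. j \<in> {1..m} \<Longrightarrow> (\<lambda>n. real (N n 1) / real (N n j)) \<longlonglongrightarrow> b j"
    and c_range: "\<And>j. j \<in> {1..m} \<Longrightarrow> 0 < c j"
    and c_lim: "\<And>j. j \<in> {1..m} \<Longrightarrow> (\<lambda>n. real (k n 1) / real (k n j)) \<longlonglongrightarrow> c j"
    and lam_lim: "\<And>j. j \<in> {1..m} \<Longrightarrow>
      (\<lambda>n. sqrt (real (k n j)) * A j (real (N n j) / real (k n j))) \<longlonglongrightarrow> lam j"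
    and ktot_def: "ktot = (\<lambda>n. \<Sum>j=1..m. k n j)"
    and p_lim: "p \<longlonglongrightarrow> 0"
    and p_extreme: "filterlim (\<lambda>n. real (ktot n) / (real n * p n)) at_top sequentially"
    and p_rate: "filterlim (\<lambda>n. sqrt (real (ktot n)) / ln (real (ktot n) / (real n * p n)))
      at_top sequentially"
    and \<omega>_hat_rv: "\<And>n. \<omega>_hat n \<in> measurable M (Rvec m)"
    and \<omega>_hat_sum: "\<And>n. AE s in M. (\<Sum>j=1..m. \<omega>_hat n s j) = 1"
    and \<omega>_hat_conv: "small_op M (\<lambda>n s. L2_set (\<lambda>j. \<omega>_hat n s j - \<omega> j) {1..m})"
    and T_def: "T = (\<lambda>n s. sqrt (real (ktot n)) *
      (pooled_hill m (\<lambda>i j. Xs i s j) (N n) (k n) \<omega> - \<gamma>))"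
    and L_def: "L = normal_law (inner_vec m \<omega> (bias_vec m c lam \<rho>))
      (quad_form m (var_mat m \<gamma> b c R) \<omega>)"
  shows
    "(\<forall>j\<in>{1..m}.
        let Q = (\<lambda>n s. sqrt (real (ktot n)) / ln (real (k n j) / (real (N n j) * p n)) *
          (marginal_quantile_est m (\<lambda>i j. Xs i s j) (N n) (k n) (p n) (\<omega>_hat n s) j
             / quantile (F j) (1 - p n) - 1))
        in small_op M (\<lambda>n s. Q n s - T n s) \<and> conv_in_dist M Q L \<and> conv_in_dist M T L)
     \<and>
     ((\<forall>j\<in>{1..m}. \<forall>l\<in>{1..m}. j \<noteq> l \<longrightarrow> ((\<lambda>t. U j t / U l t) \<longlongrightarrow> 1) at_top) \<longrightarrow>
      (\<forall>j\<in>{1..m}.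
        let Q = (\<lambda>n s. sqrt (real (ktot n)) / ln (real (ktot n) / (real n * p n)) *
          (pooled_quantile_est m (\<lambda>i j. Xs i s j) (N n) (k n) (p n) (\<omega>_hat n s)
             / quantile (F j) (1 - p n) - 1))
        in small_op M (\<lambda>n s. Q n s - T n s) \<and> conv_in_dist M Q L \<and> conv_in_dist M T L))"
proof -
  interpret prob_space M by fact
  interpret Q: pooled_quantile_setting M m X Xs N k F U A R \<gamma> \<rho> b c lam ktot p \<omega> \<omega>_hat
    by (intro pooled_quantile_setting.intro pooled_tail_setting.intro pooled_tail_setting_axioms.intro
        pooled_quantile_setting_axioms.intro prob_space_axioms) (fact assms)+
  \<comment> \<open>The identity rests on the limit weights summing to 1, which lets
    \<open>\<gamma>\<close> move inside the weighted sum.\<close>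
  have T: "T = Q.T"
    unfolding T_def by (intro ext) (simp only: Q.T_eq)
  have marginal: "small_op M (\<lambda>n s. Q.marginal_error j n s - T n s) \<and>
      conv_in_dist M (Q.marginal_error j) L \<and> conv_in_dist M T L" if "j \<in> {1..m}" for j
    unfolding T L_def using that
    by (intro Q.limit_law Q.marginal_error_measurable Q.marginal_error_expansion)
  have pooled: "small_op M (\<lambda>n s. Q.pooled_error j n s - T n s) \<and>
      conv_in_dist M (Q.pooled_error j) L \<and> conv_in_dist M T L"
    if "\<forall>j\<in>{1..m}. \<forall>l\<in>{1..m}. j \<noteq> l \<longrightarrow> ((\<lambda>t. U j t / U l t) \<longlongrightarrow> 1) at_top" "j \<in> {1..m}" for j
    unfolding T L_def using that
    by (intro Q.limit_law Q.pooled_error_measurable Q.pooled_error_expansion Q.ell_eq) auto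
  show ?thesis
    unfolding Let_def using marginal pooled
    unfolding Q.marginal_error_def[abs_def] Q.pooled_error_def[abs_def] by blast
qed

end
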